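(* Let $\mathcal{F}=\{F_\tau,\tau\in\mathcal{T}\}$ with an open Euclidean parameter space $\mathcal{T}$. (i) Suppose the marginal densities $f_\tau$ of $X$ satisfy $$\int\big(f_{\tau+\Delta}^{1/2}-f_\tau^{1/2}-\tfrac12\Delta^t\rho_\tau f_\tau^{1/2}\big)^2\,d\nu=o(\|\Delta\|^2)\quad(\Delta\to0),\qquad\tau\in\mathcal{T},$$ for certain score functions $\rho_\tau$, that $I_\tau\equiv\operatorname{Cov}_\tau(\rho_\tau(X))$ is of full rank, $\mathcal{L}(u_\tau;F_\tau)$ is continuous in $\tau$ in the weak topology, $E_\tau u_\tau^2$ is continuous in $\tau$, $E_\tau\{\overline u_{\tau+\Delta}-\overline u_\tau\}^2\to0$ as $\Delta\to0$, $E_\tau\overline u_\tau^2$ is locally bounded, and $\mu'(\tau)$ exists, where $\mu(\tau)\equiv E_\tau u_\tau$. Then the efficient influence function for the estimation of $S_n(F_\tau)$ is $$\phi_{*,\tau}=\overline u_\tau-\mu(\tau)+\rho_\tau^tI_\tau^{-1}\gamma_\tau,\qquad\gamma_\tau=\mu'(\tau)-E_\tau\overline u_\tau\rho_\tau;$$ that is, an estimator $\widehat S_n$ is asymptotically efficient at $P_\tau$ if and only if $\widehat S_n/n=\mu(\tau)+n^{-1}\sum_{j=1}^n\phi_{*,\tau}(X_j)+o_{P_\tau}(n^{-1/2})$, and moreover $$\phi_{*,\tau}=\psi_{*,\tau}+\overline u_\tau-\mu(\tau)-u_{*,\tau},$$ where $\psi_{*,\tau}$ is the efficient influence function for the estimation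 of $\mu(\tau)$ and $u_{*,\tau}$ is the projection of $\overline u_\tau$ to the tangent space at $F_\tau$. (ii) Suppose the conditions of (i) hold, that $\widehat\tau_n$ is an estimator of $\tau$ satisfying, for every $\tau\in\mathcal{T}$, $$\widehat\tau_n=\tau+\frac1n\sum_{j=1}^n\kappa_\tau(X_j)+o_{P_\tau}(n^{-1/2}),\qquad E_\tau\kappa_\tau(X)\rho_\tau^t(X)=\text{identity matrix},$$ and that for all $\tau\in\mathcal{T}$ and $c>0$, $$\sup_{\|\Delta\|\le c/\sqrt n}\Big|\sum_{j=1}^n\big[\overline u_{\tau+\Delta}(X_j)-\overline u_\tau(X_j)-\{E_\tau\overline u_{\tau+\Delta}(X)-\mu(\tau)\}\big]\Big|=o_{P_\tau}(n^{1/2}).$$ Then, with $\gamma_\tau$ and $\phi_{*,\tau}$ as in (i) and $\kappa_{*,\tau}\equiv I_\tau^{-1}\rho_\tau$, the plug-in estimator $\widehat S_n\equiv\sum_{j=1}^n\overline u_{\widehat\tau_n}(X_j)$ satisfies, under $P_\tau$, $$\frac{\widehat S_n-S_n(F_\tau)}{n^{1/2}}\xrightarrow{D}N(0,\sigma_\tau^2),\qquad\sigma_\tau^2=\operatorname{Var}_\tau(\phi_{*,\tau}(X)-u_\tau)+\operatorname{Var}_\tau\big(\{\kappa_\tau(X)-\kappa_{*,\tau}(X)\}^t\gamma_\tau\big).$$ In particular, this plug-in estimator is asymptotically efficient under $P_\tau$ if and only if $\gamma_\tau^t\kappa_\tau=\gamma_\tau^tI_\tau^{-1}\rho_\tau$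.
   Context: Under $P_\tau$ (expectation $E_\tau\equiv E_{F_\tau}$), $(X,\theta),(X_j,\theta_j)$, $j\ge1$, are i.i.d. with joint distribution $F_\tau$; the $X_j$ are observed, the $\theta_j$ and $\tau$ are unknown, and estimators are functions of $X_1,\dots,X_n$. The marginal distribution of $X$ is $dF_\tau^X=f_\tau\,d\nu$. $u(x,\vartheta;F)$ is a utility function possibly depending on $F$; $S_n(F)\equiv\sum_{j=1}^nu(X_j,\theta_j;F)$, $u_\tau\equiv u(X,\theta;F_\tau)$, $\overline u_\tau(x)\equiv E_\tau[u(X,\theta;F_\tau)|X=x]$, and $\overline u_\tau$ also denotes $\overline u_\tau(X)$. $\mathcal{L}(U;F)$ is the law of $U$ under $P_F$. Influence functions $\kappa_\tau(X)$ have, as usual, mean zero and finite second moments under $P_\tau$. Equalities between functions of $X$ are almost sure under $P_\tau$. The local curves at $F_\tau$ are $t\mapsto F_{\tau+at}$ for fixed vectors $a$, with scores $a^t\rho_\tau$; the tangent space at $F_\tau$ is the linear span of the components of $\rho_\tau(X)$ in $L_2(F_\tau)$. The efficient influence function $\psi_{*,\tau}$ for $\mu(\tau)$ is the element of the tangent space with $\lim_{t\to0+}\{\mu(\tau+at)-\mu(\tau)\}/t=E_\tau\psi_{*,\tau}(X)a^t\rho_\tau(X)$ for all $a$. An estimator $\widetilde S_n$ of $S_n(F)$ is regular at $P_\tau$ if there is a random variable $\xi_0$ such that for every fixed vector $a$ the law of $n^{-1/2}\{\widetilde S_n-S_n(F_{\tau+a/\sqrt n})\}$ under $P_{\tau+a/\sqrt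 n}$ converges weakly to the law of $\xi_0$ (the same for all $a$). It is asymptotically efficient at $P_\tau$ if it is regular at $P_\tau$ and $E\xi_0^2$ equals the sharp lower bound for the variance of the limits $\xi_0$ of all estimators regular at $P_\tau$. *)

theory Defs
  imports "HOL-Probability.Probability"
begin

text \<open>
  A parametric model is a family \<open>F :: real ^ 'd \<Rightarrow> ('x \<times> 't) measure\<close> of joint laws of
  \<open>(X, \<theta>)\<close>; only its values on the parameter space matter. A function \<open>g\<close> of \<open>X\<close> is a function
  on \<open>'x\<close>, and \<open>E\<^sub>\<tau> g(X)\<close> is \<open>\<integral>z. g (fst z) \<partial>F \<tau>\<close>. The utility \<open>u x \<vartheta> M\<close> may depend on the
  joint law \<open>M\<close> itself. The i.i.d. sequence \<open>(X\<^sub>j, \<theta>\<^sub>j)\<close> is realised on the canonical space and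
  indexed from \<open>0\<close>.
\<close>

definition iid :: "'a measure \<Rightarrow> (nat \<Rightarrow> 'a) measure" where
  "iid M = Pi\<^sub>M UNIV (\<lambda>_. M)"

definition obs :: "nat \<Rightarrow> (nat \<Rightarrow> 'x \<times> 't) \<Rightarrow> nat \<Rightarrow> 'x" where
  "obs n \<omega> = (\<lambda>j\<in>{..<n}. fst (\<omega> j))"

definition estimator ::
  "'x measure \<Rightarrow> (nat \<Rightarrow> (nat \<Rightarrow> 'x) \<Rightarrow> 'b::topological_space) \<Rightarrow> bool" where
  "estimator MX S \<longleftrightarrow> (\<forall>n. S n \<in> borel_measurable (Pi\<^sub>M {..<n} (\<lambda>_. MX)))"

text \<open>
  \<open>Y\<^sub>n = o\<^sub>P(r\<^sub>n)\<close> for nonnegative, possibly infinite \<open>Y\<^sub>n\<close>. The outer measure makes this meaningful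
  for suprema over uncountable sets; on measurable events it is the probability itself.
\<close>

definition small_oP :: "'w measure \<Rightarrow> (nat \<Rightarrow> 'w \<Rightarrow> ennreal) \<Rightarrow> (nat \<Rightarrow> real) \<Rightarrow> bool" where
  "small_oP P Y r \<longleftrightarrow>
     (\<forall>\<epsilon>>0. (\<lambda>n. outer_measure_of P {\<omega> \<in> space P. Y n \<omega> > ennreal (\<epsilon> * r n)}) \<longlonglongrightarrow> 0)"

text \<open>The expansion \<open>Z\<^sub>n = c + n\<^sup>-\<^sup>1 \<Sum>\<^sub>j g(X\<^sub>j) + o\<^sub>P(n\<^sup>-\<^sup>1\<^sup>/\<^sup>2)\<close> under i.i.d. sampling from \<open>M\<close>.\<close>

definition asymp_linear ::
  "('x \<times> 't) measure \<Rightarrow> (nat \<Rightarrow> (nat \<Rightarrow> 'x) \<Rightarrow> 'b::real_normed_vector) \<Rightarrow> 'b \<Rightarrow> ('x \<Rightarrow> 'b) \<Rightarrow> bool"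
where
  "asymp_linear M Z c g \<longleftrightarrow>
     small_oP (iid M)
       (\<lambda>n \<omega>. ennreal (norm (Z n (obs n \<omega>) - (c + (\<Sum>j<n. g (fst (\<omega> j))) /\<^sub>R real n))))
       (\<lambda>n. real n powr (- 1 / 2))"

definition influence_fun ::
  "'x measure \<Rightarrow> ('x \<times> 't) measure \<Rightarrow> ('x \<Rightarrow> 'b::euclidean_space) \<Rightarrow> bool" where
  "influence_fun MX M g \<longleftrightarrow>
     g \<in> borel_measurable MX \<and>
     integrable M (\<lambda>z. (norm (g (fst z)))\<^sup>2) \<and>
     (\<integral>z. g (fst z) \<partial>M) = 0"

text \<open>
  \<open>g\<close> is a version of \<open>E[h(X, \<theta>) | X = \<cdot>]\<close>. Values of such a version off the support are used
  below (under other parameters), so the version is a given function rather than a chosen one.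
\<close>

definition cond_exp_given_X ::
  "'x measure \<Rightarrow> ('x \<times> 't) measure \<Rightarrow> ('x \<times> 't \<Rightarrow> real) \<Rightarrow> ('x \<Rightarrow> real) \<Rightarrow> bool" where
  "cond_exp_given_X MX M h g \<longleftrightarrow>
     g \<in> borel_measurable MX \<and>
     (AE z in M. g (fst z) = real_cond_exp M (vimage_algebra (space M) fst MX) h z)"

definition util :: "('x \<Rightarrow> 't \<Rightarrow> ('x \<times> 't) measure \<Rightarrow> real) \<Rightarrow> ('x \<times> 't) measure \<Rightarrow> 'x \<times> 't \<Rightarrow> real"
where
  "util u M z = u (fst z) (snd z) M"

definition util_sum ::
  "('x \<Rightarrow> 't \<Rightarrow> ('x \<times> 't) measure \<Rightarrow> real) \<Rightarrow> ('x \<times> 't) measure \<Rightarrow> nat \<Rightarrow> (nat \<Rightarrow> 'x \<times> 't) \<Rightarrow> real"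
where
  "util_sum u M n \<omega> = (\<Sum>j<n. u (fst (\<omega> j)) (snd (\<omega> j)) M)"

definition mean_util ::
  "('p \<Rightarrow> ('x \<times> 't) measure) \<Rightarrow> ('x \<Rightarrow> 't \<Rightarrow> ('x \<times> 't) measure \<Rightarrow> real) \<Rightarrow> 'p \<Rightarrow> real" where
  "mean_util F u \<tau> = (\<integral>z. util u (F \<tau>) z \<partial>F \<tau>)"

definition cov_matrix :: "'a measure \<Rightarrow> ('a \<Rightarrow> real ^ 'd) \<Rightarrow> real ^ 'd ^ 'd" where
  "cov_matrix M g =
     (\<chi> i j. \<integral>z. (g z $ i - (\<integral>w. g w $ i \<partial>M)) * (g z $ j - (\<integral>w. g w $ j \<partial>M)) \<partial>M)"

definition fisher_info ::
  "('p \<Rightarrow> ('x \<times> 't) measure) \<Rightarrow> ('p \<Rightarrow> 'x \<Rightarrow> real ^ 'd) \<Rightarrow> 'p \<Rightarrow> real ^ 'd ^ 'd" where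
  "fisher_info F \<rho> \<tau> = cov_matrix (F \<tau>) (\<lambda>z. \<rho> \<tau> (fst z))"

text \<open>The integral is an extended nonnegative real, so that differentiability in quadratic mean
  includes its finiteness near \<open>\<Delta> = 0\<close>.\<close>

definition quadratic_mean_diff ::
  "'x measure \<Rightarrow> (real ^ 'd \<Rightarrow> 'x \<Rightarrow> real) \<Rightarrow> ('x \<Rightarrow> real ^ 'd) \<Rightarrow> real ^ 'd \<Rightarrow> bool" where
  "quadratic_mean_diff \<nu> f \<rho> \<tau> \<longleftrightarrow>
     ((\<lambda>\<Delta>. (\<integral>\<^sup>+x. ennreal ((sqrt (f (\<tau> + \<Delta>) x) - sqrt (f \<tau> x)
                  - (1 / 2) * (\<Delta> \<bullet> \<rho> x) * sqrt (f \<tau> x))\<^sup>2) \<partial>\<nu>) / ennreal ((norm \<Delta>)\<^sup>2))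
       \<longlongrightarrow> 0) (at 0)"

definition weakly_continuous_on :: "('p::metric_space) set \<Rightarrow> ('p \<Rightarrow> real measure) \<Rightarrow> bool" where
  "weakly_continuous_on T L \<longleftrightarrow>
     (\<forall>\<tau>\<in>T. \<forall>s. (\<forall>n::nat. s n \<in> T) \<and> s \<longlonglongrightarrow> \<tau> \<longrightarrow> weak_conv_m (\<lambda>n. L (s n)) (L \<tau>))"

text \<open>The tangent space consists of functions of \<open>X\<close>, identified up to almost sure equality.\<close>

definition in_tangent_space ::
  "'x measure \<Rightarrow> ('x \<times> 't) measure \<Rightarrow> ('x \<Rightarrow> real ^ 'd) \<Rightarrow> ('x \<Rightarrow> real) \<Rightarrow> bool" where
  "in_tangent_space MX M \<rho> g \<longleftrightarrow>
     g \<in> borel_measurable MX \<and> (\<exists>b. AE z in M. g (fst z) = b \<bullet> \<rho> (fst z))"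

definition tangent_projection ::
  "'x measure \<Rightarrow> ('x \<times> 't) measure \<Rightarrow> ('x \<Rightarrow> real ^ 'd) \<Rightarrow> ('x \<Rightarrow> real) \<Rightarrow> ('x \<Rightarrow> real) \<Rightarrow> bool" where
  "tangent_projection MX M \<rho> h p \<longleftrightarrow>
     in_tangent_space MX M \<rho> p \<and>
     (\<forall>g. in_tangent_space MX M \<rho> g \<longrightarrow> (\<integral>z. (h (fst z) - p (fst z)) * g (fst z) \<partial>M) = 0)"

definition efficient_influence_fun ::
  "'x measure \<Rightarrow> ('x \<times> 't) measure \<Rightarrow> ('x \<Rightarrow> real ^ 'd) \<Rightarrow> (real ^ 'd \<Rightarrow> real) \<Rightarrow> real ^ 'd
     \<Rightarrow> ('x \<Rightarrow> real) \<Rightarrow> bool" where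
  "efficient_influence_fun MX M \<rho> m \<tau> \<psi> \<longleftrightarrow>
     in_tangent_space MX M \<rho> \<psi> \<and>
     (\<forall>a. ((\<lambda>t. (m (\<tau> + t *\<^sub>R a) - m \<tau>) / t)
            \<longlongrightarrow> (\<integral>z. \<psi> (fst z) * (a \<bullet> \<rho> (fst z)) \<partial>M)) (at_right 0))"

text \<open>
  Regularity at \<open>\<tau>\<close> for estimating the random quantity \<open>S\<^sub>n(F)\<close>; \<open>L\<close> is the law of the limit
  \<open>\<xi>\<^sub>0\<close>. For open parameter spaces \<open>\<tau> + a/\<surd>n\<close> is a parameter for all but finitely many \<open>n\<close>.
\<close>

definition regular_limit ::
  "(real ^ 'd \<Rightarrow> ('x \<times> 't) measure) \<Rightarrow> ('x \<Rightarrow> 't \<Rightarrow> ('x \<times> 't) measure \<Rightarrow> real) \<Rightarrow> real ^ 'd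
     \<Rightarrow> (nat \<Rightarrow> (nat \<Rightarrow> 'x) \<Rightarrow> real) \<Rightarrow> real measure \<Rightarrow> bool" where
  "regular_limit F u \<tau> S L \<longleftrightarrow>
     real_distribution L \<and>
     (\<forall>a. weak_conv_m
        (\<lambda>n. let M = F (\<tau> + a /\<^sub>R sqrt (real n))
             in distr (iid M) borel (\<lambda>\<omega>. (S n (obs n \<omega>) - util_sum u M n \<omega>) / sqrt (real n)))
        L)"

text \<open>The variance as an extended nonnegative real: it is infinite when the second moment is
  (also if the mean does not exist, whatever default value the integral then has).\<close>

definition ext_variance :: "real measure \<Rightarrow> ennreal" where
  "ext_variance L = (\<integral>\<^sup>+x. ennreal ((x - (\<integral>y. y \<partial>L))\<^sup>2) \<partial>L)"

definition variance_bound ::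
  "'x measure \<Rightarrow> (real ^ 'd \<Rightarrow> ('x \<times> 't) measure) \<Rightarrow> ('x \<Rightarrow> 't \<Rightarrow> ('x \<times> 't) measure \<Rightarrow> real)
     \<Rightarrow> real ^ 'd \<Rightarrow> ennreal" where
  "variance_bound MX F u \<tau> = Inf {ext_variance L | S L. estimator MX S \<and> regular_limit F u \<tau> S L}"

definition asymp_efficient ::
  "'x measure \<Rightarrow> (real ^ 'd \<Rightarrow> ('x \<times> 't) measure) \<Rightarrow> ('x \<Rightarrow> 't \<Rightarrow> ('x \<times> 't) measure \<Rightarrow> real)
     \<Rightarrow> real ^ 'd \<Rightarrow> (nat \<Rightarrow> (nat \<Rightarrow> 'x) \<Rightarrow> real) \<Rightarrow> bool" where
  "asymp_efficient MX F u \<tau> S \<longleftrightarrow>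
     estimator MX S \<and>
     (\<exists>L. regular_limit F u \<tau> S L \<and> (\<integral>\<^sup>+x. ennreal (x\<^sup>2) \<partial>L) = variance_bound MX F u \<tau>)"

text \<open>\<open>dm\<close> is the gradient of \<open>\<tau> \<mapsto> mean_util F u \<tau>\<close>.\<close>

definition gamma_vec ::
  "('p \<Rightarrow> ('x \<times> 't) measure) \<Rightarrow> ('p \<Rightarrow> 'x \<Rightarrow> real) \<Rightarrow> ('p \<Rightarrow> 'x \<Rightarrow> real ^ 'd) \<Rightarrow> ('p \<Rightarrow> real ^ 'd)
     \<Rightarrow> 'p \<Rightarrow> real ^ 'd" where
  "gamma_vec F ubar \<rho> dm \<tau> = dm \<tau> - (\<integral>z. ubar \<tau> (fst z) *\<^sub>R \<rho> \<tau> (fst z) \<partial>F \<tau>)"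

definition phi_star ::
  "('p \<Rightarrow> ('x \<times> 't) measure) \<Rightarrow> ('x \<Rightarrow> 't \<Rightarrow> ('x \<times> 't) measure \<Rightarrow> real) \<Rightarrow> ('p \<Rightarrow> 'x \<Rightarrow> real)
     \<Rightarrow> ('p \<Rightarrow> 'x \<Rightarrow> real ^ 'd) \<Rightarrow> ('p \<Rightarrow> real ^ 'd) \<Rightarrow> 'p \<Rightarrow> 'x \<Rightarrow> real" where
  "phi_star F u ubar \<rho> dm \<tau> x =
     ubar \<tau> x - mean_util F u \<tau>
     + \<rho> \<tau> x \<bullet> (matrix_inv (fisher_info F \<rho> \<tau>) *v gamma_vec F ubar \<rho> dm \<tau>)"

definition kappa_star ::
  "('p \<Rightarrow> ('x \<times> 't) measure) \<Rightarrow> ('p \<Rightarrow> 'x \<Rightarrow> real ^ 'd) \<Rightarrow> 'p \<Rightarrow> 'x \<Rightarrow> real ^ 'd" where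
  "kappa_star F \<rho> \<tau> x = matrix_inv (fisher_info F \<rho> \<tau>) *v \<rho> \<tau> x"

definition plug_in ::
  "('p \<Rightarrow> 'x \<Rightarrow> real) \<Rightarrow> (nat \<Rightarrow> (nat \<Rightarrow> 'x) \<Rightarrow> 'p) \<Rightarrow> nat \<Rightarrow> (nat \<Rightarrow> 'x) \<Rightarrow> real" where
  "plug_in ubar \<tau>hat n x = (\<Sum>j<n. ubar (\<tau>hat n x) (x j))"

text \<open>\<open>N(0, v)\<close>, where \<open>v = 0\<close> gives the point mass at \<open>0\<close>.\<close>

definition centered_normal :: "real \<Rightarrow> real measure" where
  "centered_normal v = distr std_normal_distribution borel (\<lambda>x. sqrt v * x)"

end

theory Submission
  imports Defs
begin

text \<open>
  Write \<open>S\<^sub>n - S\<^sub>n(F)\<close> as a function of the observations minus the sum of the residuals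
  \<open>u - ubar\<close>. Given the observations, that sum is asymptotically \<open>N(0, n v)\<close> with \<open>v\<close> the variance of a
  residual; at the level of characteristic functions it only contributes the factor \<open>exp(- t\<^sup>2 v / 2)\<close>.
  For the rest \<open>A\<^sub>n\<close>, a function of the observations centred at \<open>\<Sum> ubar\<close>, a local shift of the
  parameter acts through the likelihood ratio of the observations and through the drift of \<open>ubar\<close>,
  which together produce \<open>\<gamma>\<close>.

  Regularity then determines the limits of \<open>E exp(i t A\<^sub>n)\<close> and, by a first-order expansion of the
  likelihood ratio in the direction \<open>I\<^sup>-\<^sup>1 \<gamma>\<close>, of \<open>E exp(i t A\<^sub>n) Y\<^sub>n\<close>, where \<open>Y\<^sub>n\<close> is the normalised sum
  of \<open>\<rho> \<bullet> I\<^sup>-\<^sup>1 \<gamma>\<close>. Computing the \<open>L\<^sub>2\<close> distance of \<open>exp(i t A\<^sub>n)\<close> from a multiple of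
  \<open>1 + i t Y\<^sub>n\<close> and letting \<open>t\<close> tend to \<open>0\<close> gives both the variance bound \<open>v + \<gamma> \<bullet> I\<^sup>-\<^sup>1 \<gamma>\<close> and, in the case of
  equality, \<open>A\<^sub>n - Y\<^sub>n \<rightarrow> 0\<close> in probability; no convolution theorem is needed.
\<close>

subsection \<open>Independent samples\<close>

text \<open>Neighbouring marginals need not dominate one another and their likelihood ratios need
  not be square integrable, so each ratio is set to 0 beyond a fixed level. Differentiability in
  quadratic mean makes the lost mass o(1/n) per observation, hence o(1) over a sample, and the
  product of the truncated ratios keeps a bounded second moment. That bound does the work of
  contiguity: by Cauchy-Schwarz, what is negligible under the central law stays negligible after
  weighting. Neither an estimator nor its limit law is assumed to have moments, so exp(i t A) takes
  the place of covariances. For fixed t the L2 distance yields a Bessel inequality for the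
  coefficients of exp(i t A) on 1 and Y; only its second-order behaviour at t = 0 is comparable with
  a variance. Normality of an efficient limit is a consequence, not an ingredient. The versions
  \<open>ubar\<close> move together with the sampling law, and their uniform integrability has to be
  borrowed from the utilities, whose laws are the ones with a hypothesis of weak continuity.\<close>

lemma norm_integral_le:
  fixes f :: "'a \<Rightarrow> 'b::{banach, second_countable_topology}"
  assumes g: "integrable M g" and le: "AE x in M. norm (f x) \<le> g x"
  shows "norm (\<integral>x. f x \<partial>M) \<le> (\<integral>x. g x \<partial>M)"
proof (cases "integrable M f")
  case True
  then show ?thesis
    using integral_norm_bound[of M f] integral_mono_AE[OF integrable_norm[OF True] g le] by linarith
next
  \<comment> \<open>The integral is then 0 by convention, and the right-hand side is nonnegative
    because \<open>g\<close> dominates a norm.\<close>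
  case False
  have "0 \<le> (\<integral>x. g x \<partial>M)"
    by (rule integral_nonneg_AE) (use le in eventually_elim, metis norm_ge_zero order_trans)
  then show ?thesis by (simp add: not_integrable_integral_eq[OF False])
qed

text \<open>\<open>z n ^ n = exp (n * Ln (z n))\<close> as soon as \<open>z n\<close> is nonzero,
  and \<open>Ln w / (w - 1)\<close> tends to 1 as w tends to 1, so \<open>n * Ln (z n)\<close> has
  the same limit as \<open>n * (z n - 1)\<close>.\<close>

lemma power_tendsto_exp:
  fixes z :: "nat \<Rightarrow> complex"
  assumes "(\<lambda>n. of_nat n * (z n - 1)) \<longlonglongrightarrow> c"
  shows "(\<lambda>n. z n ^ n) \<longlonglongrightarrow> exp c"
proof -
  have z1: "(\<lambda>n. z n - 1) \<longlonglongrightarrow> 0"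
  proof -
    have "(\<lambda>n. (of_nat n * (z n - 1)) * (1 / of_nat n)) \<longlonglongrightarrow> c * 0"
      by (intro tendsto_mult assms lim_1_over_n)
    then have "(\<lambda>n. (of_nat n * (z n - 1)) * (1 / of_nat n)) \<longlonglongrightarrow> 0" by simp
    then show ?thesis
      by (rule Lim_transform_eventually)
        (use eventually_gt_at_top[of 0] in eventually_elim, auto)
  qed
  then have z: "z \<longlonglongrightarrow> 1" by (simp add: LIM_zero_iff)
  \<comment> \<open>The singularity at 1 is filled in so that
    \<open>(z n - 1) * q (z n) = Ln (z n)\<close> also holds at indices with
    \<open>z n = 1\<close>.\<close>
  define q where "q w = (if w = 1 then 1 else Ln w / (w - 1))" for w :: complex
  have "(\<lambda>w. (Ln w - Ln 1) / (w - 1)) \<midarrow>1\<rightarrow> inverse 1"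
    using has_field_derivative_Ln[of 1] by (simp add: has_field_derivative_iff complex_nonpos_Reals_iff)
  then have "(\<lambda>w. (Ln w - Ln 1) / (w - 1)) \<midarrow>1\<rightarrow> 1" by simp
  then have "q \<midarrow>1\<rightarrow> 1"
    by (rule Lim_transform_eventually) (auto simp: q_def eventually_at_filter)
  then have "isCont q 1" by (simp add: isCont_def q_def)
  then have q: "(\<lambda>n. q (z n)) \<longlonglongrightarrow> 1"
    using isCont_tendsto_compose[OF _ z, of q] by (simp add: q_def)
  have "(\<lambda>n. exp ((of_nat n * (z n - 1)) * q (z n))) \<longlonglongrightarrow> exp (c * 1)"
    by (intro tendsto_intros assms q)
  moreover have "\<forall>\<^sub>F n in sequentially. exp ((of_nat n * (z n - 1)) * q (z n)) = z n ^ n"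
    using tendsto_imp_eventually_ne[OF z one_neq_zero]
  proof eventually_elim
    case (elim n)
    have "(z n - 1) * q (z n) = Ln (z n)" by (auto simp: q_def)
    then have "exp ((of_nat n * (z n - 1)) * q (z n)) = exp (of_nat n * Ln (z n))"
      by (simp add: mult.assoc)
    also have "\<dots> = z n ^ n" using elim by (simp add: exp_of_nat_mult)
    finally show ?case .
  qed
  ultimately show ?thesis by (simp add: tendsto_cong)
qed

lemma measurable_fst_sets: "sets M = sets (MX \<Otimes>\<^sub>M MTh) \<Longrightarrow> fst \<in> measurable M MX"
  using measurable_fst measurable_cong_sets[of M "MX \<Otimes>\<^sub>M MTh" MX MX] by auto

lemma measurable_PiM_map:
  assumes "g \<in> measurable M N"
  shows "(\<lambda>w. \<lambda>j\<in>I. g (w j)) \<in> measurable (Pi\<^sub>M I (\<lambda>_. M)) (Pi\<^sub>M I (\<lambda>_. N))"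
  by (rule measurable_restrict) (rule measurable_compose[OF _ assms], rule measurable_component_singleton)

lemma obs_measurable:
  assumes "sets M = sets (MX \<Otimes>\<^sub>M MTh)"
  shows "obs n \<in> measurable (iid M) (Pi\<^sub>M {..<n} (\<lambda>_. MX))"
proof -
  have [measurable]: "fst \<in> measurable M MX"
    using assms by (rule measurable_fst_sets)
  show ?thesis unfolding obs_def iid_def by measurable
qed

lemma prob_space_iid: "prob_space M \<Longrightarrow> prob_space (iid M)"
  unfolding iid_def by (rule prob_space_PiM)

lemma measurable_iid_component: "(\<lambda>w. w j) \<in> measurable (iid M) M"
  unfolding iid_def by measurable

lemma distr_iid_component: "prob_space M \<Longrightarrow> distr (iid M) M (\<lambda>w. w j) = M"
  unfolding iid_def by (intro distr_PiM_component) auto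

lemma iid_component:
  fixes g :: "_ \<Rightarrow> 'b::{banach, second_countable_topology}"
  assumes "prob_space M" "integrable M g"
  shows "integrable (iid M) (\<lambda>w. g (w j))" "(\<integral>w. g (w j) \<partial>iid M) = (\<integral>z. g z \<partial>M)"
proof -
  have gm: "g \<in> borel_measurable M" using assms by auto
  show "integrable (iid M) (\<lambda>w. g (w j))"
    using integrable_distr_eq[OF measurable_iid_component, of g M j] assms gm by (simp add: distr_iid_component)
  show "(\<integral>w. g (w j) \<partial>iid M) = (\<integral>z. g z \<partial>M)"
    using integral_distr[OF measurable_iid_component, of g M j] assms gm by (simp add: distr_iid_component)
qed

lemma iid_restrict:
  fixes g :: "_ \<Rightarrow> 'b::{banach, second_countable_topology}"
  assumes "prob_space M" "g \<in> borel_measurable (Pi\<^sub>M {..<n} (\<lambda>_. M))"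
  shows "(\<integral>w. g (restrict w {..<n}) \<partial>iid M) = (\<integral>w. g w \<partial>Pi\<^sub>M {..<n} (\<lambda>_. M))"
    and "integrable (iid M) (\<lambda>w. g (restrict w {..<n})) \<longleftrightarrow> integrable (Pi\<^sub>M {..<n} (\<lambda>_. M)) g"
proof -
  interpret M: prob_space M by fact
  interpret product_prob_space "\<lambda>_. M" UNIV by standard
  have *: "distr (iid M) (Pi\<^sub>M {..<n} (\<lambda>_. M)) (\<lambda>w. restrict w {..<n}) = Pi\<^sub>M {..<n} (\<lambda>_. M)"
    unfolding iid_def by (rule distr_PiM_restrict_finite) auto
  have [measurable]: "(\<lambda>w. restrict w {..<n}) \<in> measurable (iid M) (Pi\<^sub>M {..<n} (\<lambda>_. M))"
    unfolding iid_def by measurable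
  show "(\<integral>w. g (restrict w {..<n}) \<partial>iid M) = (\<integral>w. g w \<partial>Pi\<^sub>M {..<n} (\<lambda>_. M))"
    by (rule integral_distr[of "\<lambda>w. restrict w {..<n}" "iid M" "Pi\<^sub>M {..<n} (\<lambda>_. M)" g, unfolded *, symmetric])
      (use assms(2) in measurable)
  show "integrable (iid M) (\<lambda>w. g (restrict w {..<n})) \<longleftrightarrow> integrable (Pi\<^sub>M {..<n} (\<lambda>_. M)) g"
    by (rule integrable_distr_eq[of "\<lambda>w. restrict w {..<n}" "iid M" "Pi\<^sub>M {..<n} (\<lambda>_. M)" g, unfolded *, symmetric])
      (use assms(2) in measurable)
qed

lemma iid_integral_prod:
  fixes k :: "nat \<Rightarrow> 'a \<Rightarrow> 'b::{real_normed_field, banach, second_countable_topology}"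
  assumes "prob_space M" "\<And>j. j < n \<Longrightarrow> integrable M (k j)"
  shows "integrable (iid M) (\<lambda>w. \<Prod>j<n. k j (w j))"
    and "(\<integral>w. (\<Prod>j<n. k j (w j)) \<partial>iid M) = (\<Prod>j<n. \<integral>z. k j z \<partial>M)"
proof -
  interpret M: prob_space M by fact
  interpret product_prob_space "\<lambda>_. M" UNIV by standard
  have m: "(\<lambda>w. \<Prod>j<n. k j (w j)) \<in> borel_measurable (Pi\<^sub>M {..<n} (\<lambda>_. M))"
    using product_integrable_prod[of "{..<n}" k] assms(2) by auto
  have r: "(\<Prod>j<n. k j (restrict w {..<n} j)) = (\<Prod>j<n. k j (w j))" for w
    by (intro prod.cong) auto
  show "integrable (iid M) (\<lambda>w. \<Prod>j<n. k j (w j))"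
    using iid_restrict(2)[OF assms(1) m] product_integrable_prod[of "{..<n}" k] assms(2) by (simp add: r)
  show "(\<integral>w. (\<Prod>j<n. k j (w j)) \<partial>iid M) = (\<Prod>j<n. \<integral>z. k j z \<partial>M)"
    using iid_restrict(1)[OF assms(1) m] product_integral_prod[of "{..<n}" k] assms(2) by (simp add: r)
qed

text \<open>Only the laws of the weights given the first coordinate matter. With two sampling laws this is a
  change of measure; with one law it is the tower property.\<close>

lemma PiM_transfer:
  fixes k1 k2 :: "'x \<times> 't \<Rightarrow> complex" and G :: "('i \<Rightarrow> 'x) \<Rightarrow> complex"
  assumes M1: "prob_space M1" "sets M1 = sets (MX \<Otimes>\<^sub>M MTh)" "integrable M1 k1"
    and M2: "prob_space M2" "sets M2 = sets (MX \<Otimes>\<^sub>M MTh)" "integrable M2 k2"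
    and eq: "\<And>H B. H \<in> borel_measurable MX \<Longrightarrow> (\<And>x. x \<in> space MX \<Longrightarrow> norm (H x) \<le> (B::real)) \<Longrightarrow>
           (\<integral>z. H (fst z) * k1 z \<partial>M1) = (\<integral>z. H (fst z) * k2 z \<partial>M2)"
    and "finite I" "G \<in> borel_measurable (Pi\<^sub>M I (\<lambda>_. MX))"
    and "\<And>x. x \<in> space (Pi\<^sub>M I (\<lambda>_. MX)) \<Longrightarrow> norm (G x) \<le> (B::real)"
  shows "(\<integral>w. G (\<lambda>j\<in>I. fst (w j)) * (\<Prod>j\<in>I. k1 (w j)) \<partial>Pi\<^sub>M I (\<lambda>_. M1)) =
         (\<integral>w. G (\<lambda>j\<in>I. fst (w j)) * (\<Prod>j\<in>I. k2 (w j)) \<partial>Pi\<^sub>M I (\<lambda>_. M2))"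
  using assms(8-)
proof (induction I arbitrary: G B rule: finite_induct)
  case empty
  show ?case unfolding PiM_empty by (simp add: lebesgue_integral_count_space_finite restrict_def)
next
  case (insert i I)
  interpret M1: prob_space M1 by fact
  interpret M2: prob_space M2 by fact
  interpret P1: product_prob_space "\<lambda>_. M1" UNIV by standard
  interpret P2: product_prob_space "\<lambda>_. M2" UNIV by standard
  have fm: "fst \<in> measurable M1 MX" "fst \<in> measurable M2 MX"
    by (rule measurable_fst_sets[OF M1(2)], rule measurable_fst_sets[OF M2(2)])
  have km[measurable]: "k1 \<in> borel_measurable M1" "k2 \<in> borel_measurable M2" using M1(3) M2(3) by (auto dest: borel_measurable_integrable)
  \<comment> \<open>Coordinate \<open>i\<close> is integrated out under \<open>M1\<close>. By
    \<open>eq\<close>, integrating it out under \<open>M2\<close> with weight \<open>k2\<close>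
    gives the same function, so one application of the induction hypothesis to \<open>G'\<close>
    serves both sides.\<close>
  define G' where "G' x = (\<integral>z. G (x(i := fst z)) * k1 z \<partial>M1)" for x
  have upd: "(\<lambda>(x, z). G (x(i := fst z))) \<in> borel_measurable (Pi\<^sub>M I (\<lambda>_. MX) \<Otimes>\<^sub>M N)"
    if that: "fst \<in> measurable N MX" for N :: "('x \<times> 't) measure"
  proof -
    have "(\<lambda>p. (fst p)(i := fst (snd p))) \<in> measurable (Pi\<^sub>M I (\<lambda>_. MX) \<Otimes>\<^sub>M N) (Pi\<^sub>M (insert i I) (\<lambda>_. MX))"
      by (rule measurable_fun_upd[where J=I], simp, rule measurable_fst, rule measurable_compose[OF measurable_snd that])
    from measurable_compose[OF this insert.prems(1)] show ?thesis unfolding case_prod_beta .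
  qed
  have sec: "(\<lambda>y. G (x(i := y))) \<in> borel_measurable MX" if "x \<in> space (Pi\<^sub>M I (\<lambda>_. MX))" for x
  proof -
    have "(\<lambda>y. x(i := y)) \<in> measurable MX (Pi\<^sub>M (insert i I) (\<lambda>_. MX))"
      by (rule measurable_component_update[OF that insert.hyps(2)])
    from measurable_compose[OF this insert.prems(1)] show ?thesis .
  qed
  have bnd: "norm (G (x(i := y))) \<le> B" if "x \<in> space (Pi\<^sub>M I (\<lambda>_. MX))" "y \<in> space MX" for x y
    using that by (intro insert.prems(2)) (auto simp: space_PiM PiE_iff extensional_def)
  have G'2: "G' x = (\<integral>z. G (x(i := fst z)) * k2 z \<partial>M2)" if "x \<in> space (Pi\<^sub>M I (\<lambda>_. MX))" for x
    unfolding G'_def by (rule eq[OF sec[OF that], where B=B]) (use bnd[OF that] in auto)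
  have G'm: "G' \<in> borel_measurable (Pi\<^sub>M I (\<lambda>_. MX))"
  proof -
    have "(\<lambda>(x, z). G (x(i := fst z)) * k1 z) \<in> borel_measurable (Pi\<^sub>M I (\<lambda>_. MX) \<Otimes>\<^sub>M M1)"
      using borel_measurable_times[OF upd[OF fm(1)] measurable_compose[OF measurable_snd km(1)]]
      unfolding case_prod_beta .
    from M1.borel_measurable_lebesgue_integral[OF this] show ?thesis unfolding G'_def .
  qed
  have spf1: "fst z \<in> space MX" if "z \<in> space M1" for z using measurable_space[OF fm(1) that] .
  have spf2: "fst z \<in> space MX" if "z \<in> space M2" for z using measurable_space[OF fm(2) that] .
  \<comment> \<open>The bound grows by the factor E|k1| with every coordinate, which is why the
    induction keeps \<open>B\<close> arbitrary.\<close>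
  have G'b: "norm (G' x) \<le> B * (\<integral>z. norm (k1 z) \<partial>M1)" if x: "x \<in> space (Pi\<^sub>M I (\<lambda>_. MX))" for x
  proof -
    have "norm (G' x) \<le> (\<integral>z. B * norm (k1 z) \<partial>M1)"
      unfolding G'_def
    proof (rule norm_integral_le)
      show "integrable M1 (\<lambda>z. B * norm (k1 z))" using M1(3) by (intro integrable_mult_right integrable_norm)
      show "AE z in M1. norm (G (x(i := fst z)) * k1 z) \<le> B * norm (k1 z)"
        by (rule AE_I2) (use bnd[OF x spf1] in \<open>auto simp: norm_mult intro!: mult_right_mono\<close>)
    qed
    then show ?thesis by simp
  qed
  \<comment> \<open>Fubini for the new coordinate, stated for a generic pair of law and weight
    because it is applied to both.\<close>
  have main: "(\<integral>w. G (\<lambda>j\<in>insert i I. fst (w j)) * (\<Prod>j\<in>insert i I. k (w j)) \<partial>Pi\<^sub>M (insert i I) (\<lambda>_. M)) =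
      (\<integral>w. (\<integral>z. G ((\<lambda>j\<in>I. fst (w j))(i := fst z)) * k z \<partial>M) * (\<Prod>j\<in>I. k (w j)) \<partial>Pi\<^sub>M I (\<lambda>_. M))"
    if pM: "prob_space M" and fM: "fst \<in> measurable M MX" and ik: "integrable M k"
    for M and k :: "'x \<times> 't \<Rightarrow> complex"
  proof -
    interpret M: prob_space M by fact
    interpret P: product_prob_space "\<lambda>_. M" UNIV by standard
    have km[measurable]: "k \<in> borel_measurable M" using ik by auto
    have spM: "fst z \<in> space MX" if "z \<in> space M" for z using measurable_space[OF fM that] .
    have pi: "integrable (Pi\<^sub>M (insert i I) (\<lambda>_. M)) (\<lambda>w. \<Prod>j\<in>insert i I. k (w j))"
      by (rule P.product_integrable_prod[of "insert i I" "\<lambda>_. k"]) (use insert.hyps ik in auto)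
    have om: "(\<lambda>w. \<lambda>j\<in>insert i I. fst (w j)) \<in> measurable (Pi\<^sub>M (insert i I) (\<lambda>_. M)) (Pi\<^sub>M (insert i I) (\<lambda>_. MX))"
      by (rule measurable_PiM_map[OF fM])
    have gm: "(\<lambda>w. G (\<lambda>j\<in>insert i I. fst (w j))) \<in> borel_measurable (Pi\<^sub>M (insert i I) (\<lambda>_. M))"
      using measurable_compose[OF om insert.prems(1)] .
    have int: "integrable (Pi\<^sub>M (insert i I) (\<lambda>_. M))
        (\<lambda>w. G (\<lambda>j\<in>insert i I. fst (w j)) * (\<Prod>j\<in>insert i I. k (w j)))"
    proof (rule Bochner_Integration.integrable_bound[OF integrable_mult_right[OF integrable_norm[OF pi], of B]])
      show "AE w in Pi\<^sub>M (insert i I) (\<lambda>_. M).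
          norm (G (\<lambda>j\<in>insert i I. fst (w j)) * (\<Prod>j\<in>insert i I. k (w j)))
          \<le> norm (B * norm (\<Prod>j\<in>insert i I. k (w j)))"
      proof (rule AE_I2)
        fix w assume "w \<in> space (Pi\<^sub>M (insert i I) (\<lambda>_. M))"
        from insert.prems(2)[OF measurable_space[OF om this]]
        have "norm (G (\<lambda>j\<in>insert i I. fst (w j))) \<le> \<bar>B\<bar>" by linarith
        then show "norm (G (\<lambda>j\<in>insert i I. fst (w j)) * (\<Prod>j\<in>insert i I. k (w j)))
          \<le> norm (B * norm (\<Prod>j\<in>insert i I. k (w j)))"
          unfolding norm_mult real_norm_def abs_mult abs_norm_cancel by (rule mult_right_mono) simp
      qed
    qed (rule borel_measurable_times[OF gm borel_measurable_integrable[OF pi]])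
    have rew: "G (\<lambda>j\<in>insert i I. fst (fun_upd w i z j)) * (\<Prod>j\<in>insert i I. k (fun_upd w i z j)) =
       (G ((\<lambda>j\<in>I. fst (w j))(i := fst z)) * k z) * (\<Prod>j\<in>I. k (w j))" for w z
    proof -
      have "(\<lambda>j\<in>insert i I. fst (fun_upd w i z j)) = (\<lambda>j\<in>I. fst (w j))(i := fst z)"
        by (auto simp: restrict_def fun_eq_iff)
      moreover have "(\<Prod>j\<in>I. k (fun_upd w i z j)) = (\<Prod>j\<in>I. k (w j))"
        using insert.hyps by (intro prod.cong) auto
      ultimately show ?thesis using insert.hyps by simp
    qed
    show ?thesis
      unfolding P.product_integral_insert[OF insert.hyps int] rew by simp
  qed
  have r: "(\<lambda>j\<in>I. fst (w j)) \<in> space (Pi\<^sub>M I (\<lambda>_. MX))" if "w \<in> space (Pi\<^sub>M I (\<lambda>_. M2))" for w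
    using that spf2 by (auto simp: space_PiM PiE_iff)
  have "(\<integral>w. G (\<lambda>j\<in>insert i I. fst (w j)) * (\<Prod>j\<in>insert i I. k1 (w j)) \<partial>Pi\<^sub>M (insert i I) (\<lambda>_. M1)) =
     (\<integral>w. G' (\<lambda>j\<in>I. fst (w j)) * (\<Prod>j\<in>I. k1 (w j)) \<partial>Pi\<^sub>M I (\<lambda>_. M1))"
    unfolding main[OF M1(1) fm(1) M1(3)] by (simp add: G'_def)
  also have "\<dots> = (\<integral>w. G' (\<lambda>j\<in>I. fst (w j)) * (\<Prod>j\<in>I. k2 (w j)) \<partial>Pi\<^sub>M I (\<lambda>_. M2))"
    by (rule insert.IH[OF G'm G'b])
  also have "\<dots> = (\<integral>w. G (\<lambda>j\<in>insert i I. fst (w j)) * (\<Prod>j\<in>insert i I. k2 (w j)) \<partial>Pi\<^sub>M (insert i I) (\<lambda>_. M2))"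
    unfolding main[OF M2(1) fm(2) M2(3)]
    by (intro Bochner_Integration.integral_cong refl) (simp add: G'2[OF r])
  finally show ?case .
qed

lemma iid_transfer:
  fixes k1 k2 :: "'x \<times> 't \<Rightarrow> complex" and G :: "(nat \<Rightarrow> 'x) \<Rightarrow> complex"
  assumes M1: "prob_space M1" "sets M1 = sets (MX \<Otimes>\<^sub>M MTh)" "integrable M1 k1"
    and M2: "prob_space M2" "sets M2 = sets (MX \<Otimes>\<^sub>M MTh)" "integrable M2 k2"
    and eq: "\<And>H B. H \<in> borel_measurable MX \<Longrightarrow> (\<And>x. x \<in> space MX \<Longrightarrow> norm (H x) \<le> (B::real)) \<Longrightarrow>
           (\<integral>z. H (fst z) * k1 z \<partial>M1) = (\<integral>z. H (fst z) * k2 z \<partial>M2)"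
    and G: "G \<in> borel_measurable (Pi\<^sub>M {..<n} (\<lambda>_. MX))"
      "\<And>x. x \<in> space (Pi\<^sub>M {..<n} (\<lambda>_. MX)) \<Longrightarrow> norm (G x) \<le> (B::real)"
  shows "(\<integral>w. G (obs n w) * (\<Prod>j<n. k1 (w j)) \<partial>iid M1) =
         (\<integral>w. G (obs n w) * (\<Prod>j<n. k2 (w j)) \<partial>iid M2)"
proof -
  have *: "(\<integral>w. G (obs n w) * (\<Prod>j<n. k (w j)) \<partial>iid M) =
      (\<integral>w. G (\<lambda>j\<in>{..<n}. fst (w j)) * (\<Prod>j\<in>{..<n}. k (w j)) \<partial>Pi\<^sub>M {..<n} (\<lambda>_. M))"
    if pM: "prob_space M" and s: "sets M = sets (MX \<Otimes>\<^sub>M MTh)" and ik: "integrable M k"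
    for M :: "('x \<times> 't) measure" and k :: "'x \<times> 't \<Rightarrow> complex"
  proof -
    have fM: "fst \<in> measurable M MX" using s by (rule measurable_fst_sets)
    have km: "k \<in> borel_measurable M" using ik by (rule borel_measurable_integrable)
    have om: "(\<lambda>w. \<lambda>j\<in>{..<n}. fst (w j)) \<in> measurable (Pi\<^sub>M {..<n} (\<lambda>_. M)) (Pi\<^sub>M {..<n} (\<lambda>_. MX))"
      by (rule measurable_PiM_map[OF fM])
    have gm: "(\<lambda>w. G (\<lambda>j\<in>{..<n}. fst (w j))) \<in> borel_measurable (Pi\<^sub>M {..<n} (\<lambda>_. M))"
      using measurable_compose[OF om G(1)] .
    have m: "(\<lambda>w. G (\<lambda>j\<in>{..<n}. fst (w j)) * (\<Prod>j\<in>{..<n}. k (w j))) \<in> borel_measurable (Pi\<^sub>M {..<n} (\<lambda>_. M))"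
      by (intro borel_measurable_times gm borel_measurable_prod measurable_compose[OF _ km] measurable_component_singleton)
    have e: "(\<lambda>j\<in>{..<n}. fst (restrict w {..<n} j)) = obs n w"
      "(\<Prod>j<n. k (restrict w {..<n} j)) = (\<Prod>j<n. k (w j))" for w
      by (auto simp: obs_def restrict_def intro!: prod.cong)
    show ?thesis using iid_restrict(1)[OF pM m] unfolding e .
  qed
  show ?thesis
    unfolding *[OF M1] *[OF M2]
  proof (rule PiM_transfer[OF M1 M2 _ finite_lessThan G])
    fix H :: "'x \<Rightarrow> complex" and B :: real
    assume "H \<in> borel_measurable MX" and "\<And>x. x \<in> space MX \<Longrightarrow> norm (H x) \<le> B"
    then show "(\<integral>z. H (fst z) * k1 z \<partial>M1) = (\<integral>z. H (fst z) * k2 z \<partial>M2)" by (rule eq)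
  qed
qed

subsection \<open>Exponentials of sums and products\<close>

lemma integrable_mult_of_squares:
  fixes f g :: "'a \<Rightarrow> real"
  assumes [measurable]: "f \<in> borel_measurable M" "g \<in> borel_measurable M"
    and "integrable M (\<lambda>x. (f x)\<^sup>2)" "integrable M (\<lambda>x. (g x)\<^sup>2)"
  shows "integrable M (\<lambda>x. f x * g x)"
proof (rule Bochner_Integration.integrable_bound)
  show "integrable M (\<lambda>x. (f x)\<^sup>2 + (g x)\<^sup>2)" by (rule Bochner_Integration.integrable_add[OF assms(3,4)])
  have "\<bar>f x * g x\<bar> \<le> (f x)\<^sup>2 + (g x)\<^sup>2" for x
  proof -
    have "2 * (\<bar>f x\<bar> * \<bar>g x\<bar>) \<le> (f x)\<^sup>2 + (g x)\<^sup>2"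
      using sum_squares_bound[of "\<bar>f x\<bar>" "\<bar>g x\<bar>"] by (simp only: power2_abs mult.assoc)
    moreover have "0 \<le> \<bar>f x\<bar> * \<bar>g x\<bar>" by simp
    ultimately show ?thesis unfolding abs_mult by linarith
  qed
  then show "AE x in M. norm (f x * g x) \<le> norm ((f x)\<^sup>2 + (g x)\<^sup>2)" by (auto intro: AE_I2)
qed simp

text \<open>The integral of (s|f| - |g|)^2 is a nonnegative quadratic in s; its value at the
  minimiser C / A is the inequality.\<close>

lemma integral_Cauchy_Schwarz:
  fixes f g :: "'a \<Rightarrow> real"
  assumes [measurable]: "f \<in> borel_measurable M" "g \<in> borel_measurable M"
    and f2: "integrable M (\<lambda>x. (f x)\<^sup>2)" and g2: "integrable M (\<lambda>x. (g x)\<^sup>2)"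
  shows "(\<integral>x. \<bar>f x * g x\<bar> \<partial>M) \<le> sqrt (\<integral>x. (f x)\<^sup>2 \<partial>M) * sqrt (\<integral>x. (g x)\<^sup>2 \<partial>M)"
proof -
  define A B C where "A = (\<integral>x. (f x)\<^sup>2 \<partial>M)" and "B = (\<integral>x. (g x)\<^sup>2 \<partial>M)" and "C = (\<integral>x. \<bar>f x * g x\<bar> \<partial>M)"
  have fg: "integrable M (\<lambda>x. \<bar>f x * g x\<bar>)"
    using integrable_mult_of_squares[OF assms] by simp
  have nn: "A \<ge> 0" "B \<ge> 0" "C \<ge> 0" by (simp_all add: A_def B_def C_def)
  have q: "0 \<le> s\<^sup>2 * A - 2 * s * C + B" for s
  proof -
    have "0 \<le> (\<integral>x. (s * \<bar>f x\<bar> - \<bar>g x\<bar>)\<^sup>2 \<partial>M)" by simp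
    also have "\<dots> = (\<integral>x. s\<^sup>2 * (f x)\<^sup>2 - 2 * s * \<bar>f x * g x\<bar> + (g x)\<^sup>2 \<partial>M)"
      by (intro Bochner_Integration.integral_cong) (auto simp: power2_diff power_mult_distrib abs_mult)
    also have "\<dots> = s\<^sup>2 * A - 2 * s * C + B"
      unfolding A_def B_def C_def using f2 g2 fg by simp
    finally show ?thesis .
  qed
  have "C\<^sup>2 \<le> A * B"
  proof (cases "A = 0")
    case True
    have "C = 0"
    proof (rule ccontr)
      assume "C \<noteq> 0"
      \<comment> \<open>With \<open>A = 0\<close> the quadratic is the affine function B - 2 s C,
        and this s gives it the value -1.\<close>
      with q[of "(B + 1) / (2 * C)"] True show False by simp
    qed
    then show ?thesis using True by simp
  next
    case False
    with nn have "A > 0" by simp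
    then show ?thesis using q[of "C / A"] by (simp add: power2_eq_square field_simps)
  qed
  then have "C \<le> sqrt (A * B)" by (rule real_le_rsqrt)
  then show ?thesis by (simp add: A_def B_def C_def real_sqrt_mult)
qed

lemma (in finite_measure) integral_abs_le_L2:
  fixes f :: "'a \<Rightarrow> real"
  assumes "f \<in> borel_measurable M" "integrable M (\<lambda>x. (f x)\<^sup>2)"
  shows "(\<integral>x. \<bar>f x\<bar> \<partial>M) \<le> sqrt (\<integral>x. (f x)\<^sup>2 \<partial>M) * sqrt (measure M (space M))"
  using integral_Cauchy_Schwarz[OF assms(1) borel_measurable_const[of 1] assms(2)] by simp

lemma iid_L2_pair:
  fixes g h :: "'a \<Rightarrow> real"
  assumes M: "prob_space M"
    and gm: "g \<in> borel_measurable M" and hm: "h \<in> borel_measurable M"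
    and g2: "integrable M (\<lambda>z. (g z)\<^sup>2)" and h2: "integrable M (\<lambda>z. (h z)\<^sup>2)"
  shows "integrable (iid M) (\<lambda>w. g (w i) * h (w j))"
    and "(\<integral>w. g (w i) * h (w j) \<partial>iid M) =
      (if i = j then (\<integral>z. g z * h z \<partial>M) else (\<integral>z. g z \<partial>M) * (\<integral>z. h z \<partial>M))"
proof -
  interpret prob_space M by fact
  have g1: "integrable M g" and h1: "integrable M h"
    by (rule square_integrable_imp_integrable[OF gm g2], rule square_integrable_imp_integrable[OF hm h2])
  have gh: "integrable M (\<lambda>z. g z * h z)" by (rule integrable_mult_of_squares) fact+
  \<comment> \<open>For distinct indices the integrand is a product over n coordinates with
    \<open>g\<close> at i, \<open>h\<close> at j and 1 elsewhere; n only has to exceed both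
    indices.\<close>
  define n where "n = Suc (max i j)"
  define k where "k l = (if l = i then g else if l = j then h else (\<lambda>_. 1))" for l
  have ki: "integrable M (k l)" for l unfolding k_def using g1 h1 by simp
  have p: "(\<Prod>l<n. k l (w l)) = g (w i) * h (w j)" if "i \<noteq> j" for w
  proof -
    have "(\<Prod>l<n. k l (w l)) = (\<Prod>l\<in>{i,j}. k l (w l))"
      by (rule prod.mono_neutral_right) (auto simp: n_def k_def)
    with that show ?thesis by (simp add: k_def)
  qed
  have p': "(\<Prod>l<n. \<integral>z. k l z \<partial>M) = (\<integral>z. g z \<partial>M) * (\<integral>z. h z \<partial>M)" if "i \<noteq> j"
  proof -
    have "(\<Prod>l<n. \<integral>z. k l z \<partial>M) = (\<Prod>l\<in>{i,j}. \<integral>z. k l z \<partial>M)"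
      by (rule prod.mono_neutral_right) (auto simp: n_def k_def prob_space)
    with that show ?thesis by (simp add: k_def)
  qed
  show "integrable (iid M) (\<lambda>w. g (w i) * h (w j))"
    using iid_component(1)[OF M gh, of i] iid_integral_prod(1)[OF M, of n k] ki p
    by (cases "i = j") auto
  show "(\<integral>w. g (w i) * h (w j) \<partial>iid M) =
      (if i = j then (\<integral>z. g z * h z \<partial>M) else (\<integral>z. g z \<partial>M) * (\<integral>z. h z \<partial>M))"
    using iid_component(2)[OF M gh, of i] iid_integral_prod(2)[OF M, of n k] ki p p'
    by (cases "i = j") auto
qed

text \<open>Off-diagonal terms factor into the product of the two means, so it is enough that one of
  the functions is centred.\<close>

lemma iid_L2_sum:
  fixes g h :: "'a \<Rightarrow> real"
  assumes M: "prob_space M"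
    and gm: "g \<in> borel_measurable M" and hm: "h \<in> borel_measurable M"
    and g2: "integrable M (\<lambda>z. (g z)\<^sup>2)" and h2: "integrable M (\<lambda>z. (h z)\<^sup>2)"
  shows "integrable (iid M) (\<lambda>w. (\<Sum>j<n. g (w j)) * (\<Sum>j<n. h (w j)))"
    and "(\<integral>z. g z \<partial>M) = 0 \<Longrightarrow>
      (\<integral>w. (\<Sum>j<n. g (w j)) * (\<Sum>j<n. h (w j)) \<partial>iid M) = real n * (\<integral>z. g z * h z \<partial>M)"
proof -
  note pr = iid_L2_pair[OF assms]
  have e: "(\<Sum>j<n. g (w j)) * (\<Sum>j<n. h (w j)) = (\<Sum>i<n. \<Sum>j<n. g (w i) * h (w j))" for w
    by (simp add: sum_product)
  show "integrable (iid M) (\<lambda>w. (\<Sum>j<n. g (w j)) * (\<Sum>j<n. h (w j)))"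
    unfolding e using pr(1) by (intro Bochner_Integration.integrable_sum)
  assume "(\<integral>z. g z \<partial>M) = 0"
  then have "(\<integral>w. (\<Sum>j<n. g (w j)) * (\<Sum>j<n. h (w j)) \<partial>iid M) =
      (\<Sum>i<n. \<Sum>j<n. if i = j then (\<integral>z. g z * h z \<partial>M) else 0)"
    unfolding e using pr by (simp add: Bochner_Integration.integral_sum Bochner_Integration.integrable_sum cong: if_cong)
  also have "\<dots> = real n * (\<integral>z. g z * h z \<partial>M)" by simp
  finally show "(\<integral>w. (\<Sum>j<n. g (w j)) * (\<Sum>j<n. h (w j)) \<partial>iid M) = real n * (\<integral>z. g z * h z \<partial>M)" .
qed

text \<open>Since log(1 + i x) = i x + x^2 / 2 + O(x^3), the product (1 + i x) exp(- x^2 / 2) agrees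
  with exp(i x) up to third order. For |x| > 1 both terms have modulus at most 1, so x^2 also bounds
  the error up to a constant; the minimum of the two is what a Lindeberg condition can control. The
  modulus bound, from 1 + x^2 \<le> exp(x^2), allows products to be compared factor by
  factor.\<close>

lemma iexp_prod_factor_bound:
  fixes x :: real
  shows "norm (iexp x - (1 + \<i> * x) * exp (- x\<^sup>2 / 2)) \<le> 2 * min (x\<^sup>2) (\<bar>x\<bar> ^ 3)"
    and "norm ((1 + \<i> * x) * exp (- x\<^sup>2 / 2)) \<le> 1"
    and "(norm (1 + \<i> * x))\<^sup>2 = 1 + x\<^sup>2"
proof -
  show n2: "(norm (1 + \<i> * x))\<^sup>2 = 1 + x\<^sup>2" by (simp add: cmod_power2)
  have "1 + x\<^sup>2 \<le> exp (x\<^sup>2)" by (rule exp_ge_add_one_self)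
  then have "(norm (1 + \<i> * x))\<^sup>2 \<le> (exp (x\<^sup>2 / 2))\<^sup>2"
    unfolding n2 by (simp add: power2_eq_square mult_exp_exp)
  then have le: "norm (1 + \<i> * x) \<le> exp (x\<^sup>2 / 2)" by (rule power2_le_imp_le) simp
  have "norm (1 + \<i> * x) * exp (- x\<^sup>2 / 2) \<le> exp (x\<^sup>2 / 2) * exp (- x\<^sup>2 / 2)"
    by (rule mult_right_mono[OF le]) simp
  also have "\<dots> = 1" by (simp add: mult_exp_exp)
  finally show n1: "norm ((1 + \<i> * x) * exp (- x\<^sup>2 / 2)) \<le> 1"
    by (simp add: norm_mult)
  show "norm (iexp x - (1 + \<i> * x) * exp (- x\<^sup>2 / 2)) \<le> 2 * min (x\<^sup>2) (\<bar>x\<bar> ^ 3)"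
  proof (cases "\<bar>x\<bar> \<le> 1")
    case True
    define y where "y = x\<^sup>2 / 2"
    have y: "0 \<le> y" "2 * y \<le> 1"
      using True by (auto simp: y_def abs_square_le_1)
    have e2: "\<bar>exp (- y) - (1 - y)\<bar> \<le> y\<^sup>2"
    proof -
      have "1 - y \<le> exp (- y)" using exp_ge_add_one_self[of "- y"] by simp
      moreover have "exp (- y) \<le> 1 / (1 + y)"
        using exp_ge_add_one_self[of y] y by (simp add: exp_minus field_simps)
      \<comment> \<open>Indeed (1 - y + y^2)(1 + y) = 1 + y^3.\<close>
      moreover have "1 / (1 + y) \<le> 1 - y + y\<^sup>2"
      proof -
        have "1 \<le> (1 - y + y\<^sup>2) * (1 + y)" using y by (simp add: algebra_simps power2_eq_square)
        then show ?thesis using y by (simp add: field_simps)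
      qed
      ultimately show ?thesis by linarith
    qed
    \<comment> \<open>Three errors remain: the Taylor remainder of exp(i x), the cubic cross term i
      x y, and the remainder of exp(- y), of fourth order in x.\<close>
    have "iexp x - (1 + \<i> * x) * exp (- y) =
        (iexp x - (\<Sum>k\<le>2. (\<i> * x)^k / fact k)) + \<i> * x * y - (1 + \<i> * x) * (exp (- y) - (1 - y))"
      by (simp add: numeral_2_eq_2 y_def algebra_simps power2_eq_square)
    also have "norm \<dots> \<le> norm (iexp x - (\<Sum>k\<le>2. (\<i> * x)^k / fact k)) + norm (\<i> * x * y)
        + norm ((1 + \<i> * x) * (exp (- y) - (1 - y)))"
      by (rule order_trans[OF norm_triangle_ineq4]) (intro add_mono norm_triangle_ineq order_refl)
    also have "\<dots> \<le> \<bar>x\<bar>^3 / 6 + \<bar>x\<bar>^3 / 2 + 2 * (\<bar>x\<bar>^3 / 4)"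
    proof (intro add_mono)
      show "norm (iexp x - (\<Sum>k\<le>2. (\<i> * x)^k / fact k)) \<le> \<bar>x\<bar>^3 / 6"
        using iexp_approx1[of x 2] by (simp add: numeral_eq_Suc fact_numeral)
      show "norm (\<i> * x * y) \<le> \<bar>x\<bar>^3 / 2"
        by (simp add: norm_mult y_def power3_eq_cube power2_eq_square abs_mult)
      have "norm (1 + \<i> * x) \<le> 2"
        using norm_triangle_ineq[of 1 "\<i> * x"] True by (simp add: norm_mult)
      moreover have "norm (complex_of_real (exp (- y) - (1 - y))) \<le> \<bar>x\<bar>^3 / 4"
      proof -
        have "y\<^sup>2 = \<bar>x\<bar>^3 * \<bar>x\<bar> / 4" by (simp add: y_def power2_eq_square power3_eq_cube)
        also have "\<dots> \<le> \<bar>x\<bar>^3 * 1 / 4" using True by (intro divide_right_mono mult_left_mono) auto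
        finally show ?thesis using e2 unfolding norm_of_real by linarith
      qed
      ultimately show "norm ((1 + \<i> * x) * (exp (- y) - (1 - y))) \<le> 2 * (\<bar>x\<bar>^3 / 4)"
        using mult_mono[of "norm (1 + \<i> * x)" 2 "norm (complex_of_real (exp (- y) - (1 - y)))" "\<bar>x\<bar>^3 / 4"]
        by (simp add: norm_mult)
    qed
    also have "\<dots> \<le> 2 * \<bar>x\<bar>^3" by simp
    also have "\<bar>x\<bar>^3 = min (x\<^sup>2) (\<bar>x\<bar>^3)"
    proof -
      have "\<bar>x\<bar>^3 \<le> \<bar>x\<bar>^2" using True by (intro power_decreasing) auto
      then show ?thesis by simp
    qed
    finally show ?thesis by (simp add: y_def)
  next
    case False
    have "norm (iexp x - (1 + \<i> * x) * exp (- x\<^sup>2 / 2)) \<le> 1 + 1"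
      by (rule order_trans[OF norm_triangle_ineq4]) (intro add_mono n1, simp)
    also have "\<dots> \<le> 2 * min (x\<^sup>2) (\<bar>x\<bar> ^ 3)"
    proof -
      have "1 \<le> \<bar>x\<bar>^2" by (rule one_le_power) (use False in simp)
      moreover have "1 \<le> \<bar>x\<bar>^3" by (rule one_le_power) (use False in simp)
      ultimately show ?thesis by simp
    qed
    finally show ?thesis .
  qed
qed

lemma abs_exp_minus_diff_le:
  fixes a b :: real
  assumes "0 \<le> a" "0 \<le> b"
  shows "\<bar>exp (- a) - exp (- b)\<bar> \<le> \<bar>a - b\<bar>"
proof -
  have *: "exp (- a) - exp (- b) \<le> b - a" if "0 \<le> a" "a \<le> b" for a b :: real
  proof -
    have "exp (- a) - exp (- b) = exp (- a) * (1 - exp (- (b - a)))"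
      by (simp add: algebra_simps flip: exp_add)
    also have "\<dots> \<le> 1 * (b - a)"
    proof (rule mult_mono)
      have "1 + (a - b) \<le> exp (a - b)" by (rule exp_ge_add_one_self)
      moreover have "exp (- (b - a)) = exp (a - b)" by simp
      ultimately show "1 - exp (- (b - a)) \<le> b - a" by linarith
    qed (use that in auto)
    finally show ?thesis by simp
  qed
  show ?thesis
  proof (cases "a \<le> b")
    case True
    then have "exp (- b) \<le> exp (- a)" by simp
    then show ?thesis using *[of a b] assms True by linarith
  next
    case False
    then have "exp (- a) \<le> exp (- b)" by simp
    then show ?thesis using *[of b a] assms False by linarith
  qed
qed

text \<open>A quantitative comparison in the style of McLeish, with \<open>S\<close> the total
  second moment and \<open>Tl\<close> its Lindeberg tail beyond the level \<open>e\<close>. Passing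
  factor by factor to (1 + i x) exp(- x^2 / 2) costs 2 (e S + Tl). This leaves exp(- Q / 2) with the
  random sum of squares Q; replacing it by exp(- v / 2) costs, by Cauchy-Schwarz, the L2 norm of the
  product, at most sqrt(exp S), times the L2 distance of the two exponentials.\<close>

lemma iexp_sum_prod_bound:
  fixes x :: "'a \<Rightarrow> real" and n :: nat
  assumes M: "prob_space M" and xm: "x \<in> borel_measurable M"
    and x2: "integrable M (\<lambda>z. (x z)\<^sup>2)" and e: "0 < e" and v: "0 \<le> v"
  defines "S \<equiv> real n * (\<integral>z. (x z)\<^sup>2 \<partial>M)"
    and "Tl \<equiv> real n * (\<integral>z. (x z)\<^sup>2 * indicator {z. \<bar>x z\<bar> > e} z \<partial>M)"
  shows "(\<integral>w. norm (iexp (\<Sum>j<n. x (w j)) - complex_of_real (exp (- v / 2)) * (\<Prod>j<n. 1 + \<i> * x (w j))) \<partial>iid M)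
    \<le> 2 * (e * S + Tl) + sqrt (exp S) * sqrt ((2 * Tl + \<bar>S - v\<bar> + e * sqrt S) / 2)"
proof -
  interpret M: prob_space M by fact
  interpret P: prob_space "iid M" by (rule prob_space_iid[OF M])
  note [measurable] = xm
  have cm[measurable]: "(\<lambda>w. x (w j)) \<in> borel_measurable (iid M)" for j
    by (rule measurable_compose[OF measurable_iid_component xm])
  \<comment> \<open>Q need not have a variance, since only second moments of x are given. The
    squares are therefore split at the level \<open>e\<close>: the sum of the small ones has
    variance at most e^2 S, and the large ones have total mean \<open>Tl\<close>.\<close>
  define ww where "ww z = (x z)\<^sup>2 * indicator {z. \<bar>x z\<bar> > e} z" for z
  define y where "y z = (x z)\<^sup>2 * indicator {z. \<bar>x z\<bar> \<le> e} z" for z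
  have wm[measurable]: "ww \<in> borel_measurable M" and ym[measurable]: "y \<in> borel_measurable M"
    unfolding ww_def y_def by measurable
  have wi: "integrable M ww" and yi: "integrable M y"
    unfolding ww_def y_def
    by (rule Bochner_Integration.integrable_bound[OF x2]; simp add: indicator_def AE_I2)+
  have yw: "(x z)\<^sup>2 = y z + ww z" for z by (simp add: y_def ww_def indicator_def)
  have y2: "(y z)\<^sup>2 \<le> e\<^sup>2 * (x z)\<^sup>2" for z
  proof (cases "\<bar>x z\<bar> \<le> e")
    case True
    then have "(x z)\<^sup>2 \<le> e\<^sup>2" using e by (metis abs_le_square_iff abs_of_pos)
    then show ?thesis using True by (simp add: y_def power2_eq_square mult_right_mono)
  qed (simp add: y_def)
  have y2i: "integrable M (\<lambda>z. (y z)\<^sup>2)"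
    by (rule Bochner_Integration.integrable_bound[OF integrable_mult_right[OF x2, of "e\<^sup>2"]])
      (use y2 in \<open>auto intro!: AE_I2\<close>)
  define m where "m = (\<integral>z. y z \<partial>M)"
  have Tl: "Tl = real n * (\<integral>z. ww z \<partial>M)" by (simp add: Tl_def ww_def)
  have nm: "real n * m = S - Tl"
    unfolding S_def Tl m_def yw using yi wi by (simp add: algebra_simps)
  have S0: "0 \<le> S" and T0: "0 \<le> Tl" unfolding S_def Tl_def by simp_all
  define Q where "Q w = (\<Sum>j<n. (x (w j))\<^sup>2)" for w :: "nat \<Rightarrow> 'a"
  define P where "P w = (\<Prod>j<n. 1 + \<i> * x (w j))" for w :: "nat \<Rightarrow> 'a"
  define W where "W w = \<bar>exp (- (Q w / 2)) - exp (- (v / 2))\<bar>" for w :: "nat \<Rightarrow> 'a"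
  have [measurable]: "Q \<in> borel_measurable (iid M)" "P \<in> borel_measurable (iid M)" "W \<in> borel_measurable (iid M)"
    unfolding Q_def P_def W_def by measurable
  have Q0: "0 \<le> Q w" for w unfolding Q_def by (simp add: sum_nonneg)
  have W1: "W w \<le> 1" for w
  proof -
    have "0 < exp (- (Q w / 2))" "exp (- (Q w / 2)) \<le> 1" "0 < exp (- (v / 2))" "exp (- (v / 2)) \<le> 1"
      using Q0[of w] v by auto
    then show ?thesis unfolding W_def by linarith
  qed
  have W0: "0 \<le> W w" for w by (simp add: W_def)
  \<comment> \<open>Because W lies in [0, 1], its square is at most W, so a first moment of |Q - v|
    controls the second moment of W.\<close>
  have WQ: "(W w)\<^sup>2 \<le> \<bar>Q w - v\<bar> / 2" for w
  proof -
    have "(W w)\<^sup>2 \<le> W w"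
      unfolding power2_eq_square using mult_left_le[OF W1 W0] .
    also have "\<dots> \<le> \<bar>Q w / 2 - v / 2\<bar>"
      unfolding W_def by (rule abs_exp_minus_diff_le) (use Q0 v in auto)
    finally show ?thesis by (simp add: diff_divide_distrib[symmetric])
  qed
  have W2i: "integrable (iid M) (\<lambda>w. (W w)\<^sup>2)"
    by (rule P.integrable_const_bound[of _ 1]) (use W0 W1 in \<open>auto intro!: AE_I2 power_le_one\<close>)
  have P2: "(norm (P w))\<^sup>2 = (\<Prod>j<n. 1 + (x (w j))\<^sup>2)" for w
    by (simp only: P_def prod_norm[symmetric] prod_power_distrib iexp_prod_factor_bound(3))
  have x2': "integrable M (\<lambda>z. 1 + (x z)\<^sup>2)" using x2 by simp
  have P2i: "integrable (iid M) (\<lambda>w. (norm (P w))\<^sup>2)"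
    unfolding P2 by (rule iid_integral_prod(1)[OF M, of n "\<lambda>_ z. 1 + (x z)\<^sup>2"]) (rule x2')
  have P2e: "(\<integral>w. (norm (P w))\<^sup>2 \<partial>iid M) \<le> exp S"
  proof -
    have "(\<integral>w. (norm (P w))\<^sup>2 \<partial>iid M) = (1 + (\<integral>z. (x z)\<^sup>2 \<partial>M)) ^ n"
      unfolding P2 using iid_integral_prod(2)[OF M, of n "\<lambda>_ z. 1 + (x z)\<^sup>2"] x2 by (simp add: M.prob_space)
    also have "\<dots> \<le> exp (\<integral>z. (x z)\<^sup>2 \<partial>M) ^ n"
      by (intro power_mono exp_ge_add_one_self) simp
    finally show ?thesis by (simp add: S_def exp_of_nat_mult)
  qed
  have sx: "integrable (iid M) (\<lambda>w. \<Sum>j<n. g (w j))"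
    "(\<integral>w. (\<Sum>j<n. g (w j)) \<partial>iid M) = real n * (\<integral>z. g z \<partial>M)"
    if "integrable M g" for g :: "'a \<Rightarrow> real"
    using iid_component[OF M that] by (simp_all add: Bochner_Integration.integral_sum)
  have Qv: "(\<integral>w. \<bar>Q w - v\<bar> \<partial>iid M) \<le> 2 * Tl + \<bar>S - v\<bar> + e * sqrt S"
  proof -
    define g where "g z = y z - m" for z
    have gm: "g \<in> borel_measurable M" and g0: "(\<integral>z. g z \<partial>M) = 0"
      and g2i: "integrable M (\<lambda>z. (g z)\<^sup>2)"
      unfolding g_def using yi y2i by (auto simp: m_def M.prob_space power2_diff)
    define R where "R w = (\<Sum>j<n. g (w j))" for w :: "nat \<Rightarrow> 'a"
    have Rm: "R \<in> borel_measurable (iid M)"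
      unfolding R_def by (intro borel_measurable_sum measurable_compose[OF measurable_iid_component gm])
    have R2: "integrable (iid M) (\<lambda>w. (R w)\<^sup>2)" "(\<integral>w. (R w)\<^sup>2 \<partial>iid M) = real n * (\<integral>z. (g z)\<^sup>2 \<partial>M)"
      using iid_L2_sum[OF M gm gm g2i g2i, of n] g0 by (simp_all add: R_def power2_eq_square)
    have gv: "real n * (\<integral>z. (g z)\<^sup>2 \<partial>M) \<le> e\<^sup>2 * S"
    proof -
      have "(\<integral>z. (g z)\<^sup>2 \<partial>M) = (\<integral>z. (y z)\<^sup>2 \<partial>M) - m\<^sup>2"
        unfolding g_def using yi y2i by (simp add: power2_diff M.prob_space m_def) (simp add: power2_eq_square)
      also have "\<dots> \<le> (\<integral>z. (y z)\<^sup>2 \<partial>M)" by simp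
      also have "\<dots> \<le> (\<integral>z. e\<^sup>2 * (x z)\<^sup>2 \<partial>M)"
        by (rule integral_mono[OF y2i]) (use x2 y2 in auto)
      finally have "real n * (\<integral>z. (g z)\<^sup>2 \<partial>M) \<le> real n * (e\<^sup>2 * (\<integral>z. (x z)\<^sup>2 \<partial>M))"
        by (intro mult_left_mono) auto
      then show ?thesis by (simp add: S_def algebra_simps)
    qed
    have R1: "integrable (iid M) (\<lambda>w. \<bar>R w\<bar>)"
      using P.square_integrable_imp_integrable[OF Rm R2(1)] by simp
    have "(\<integral>w. \<bar>R w\<bar> \<partial>iid M) \<le> sqrt (\<integral>w. (R w)\<^sup>2 \<partial>iid M)"
      using P.integral_abs_le_L2[OF Rm R2(1)] by (simp add: P.prob_space)
    also have "\<dots> \<le> sqrt (e\<^sup>2 * S)" using gv R2 by simp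
    also have "\<dots> = e * sqrt S" using e by (simp add: real_sqrt_mult)
    finally have R3: "(\<integral>w. \<bar>R w\<bar> \<partial>iid M) \<le> e * sqrt S" .
    \<comment> \<open>Q - v is the centred sum of the small squares, plus the large squares, plus
      the bias S - Tl - v.\<close>
    have pw: "\<bar>Q w - v\<bar> \<le> \<bar>R w\<bar> + (\<Sum>j<n. ww (w j)) + (\<bar>S - v\<bar> + Tl)" for w
    proof -
      have "Q w - v = R w + (\<Sum>j<n. ww (w j)) + (S - Tl - v)"
        unfolding Q_def R_def yw g_def nm[symmetric] by (simp add: sum.distrib sum_subtractf)
      moreover have "0 \<le> (\<Sum>j<n. ww (w j))" by (simp add: sum_nonneg ww_def)
      ultimately show ?thesis using T0 by linarith
    qed
    have i2: "integrable (iid M) (\<lambda>w. \<bar>R w\<bar> + (\<Sum>j<n. ww (w j)))"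
      by (rule Bochner_Integration.integrable_add[OF R1 sx(1)[OF wi]])
    have "(\<integral>w. \<bar>Q w - v\<bar> \<partial>iid M) = norm (\<integral>w. \<bar>Q w - v\<bar> \<partial>iid M)" by simp
    also have "\<dots> \<le> (\<integral>w. \<bar>R w\<bar> + (\<Sum>j<n. ww (w j)) + (\<bar>S - v\<bar> + Tl) \<partial>iid M)"
      by (rule norm_integral_le) (use pw i2 in \<open>auto intro!: AE_I2\<close>)
    also have "\<dots> = (\<integral>w. \<bar>R w\<bar> \<partial>iid M) + Tl + (\<bar>S - v\<bar> + Tl)"
      using R1 sx[OF wi] by (simp add: Tl P.prob_space)
    finally show ?thesis using R3 by linarith
  qed
  have Qi: "integrable (iid M) (\<lambda>w. \<bar>Q w - v\<bar> / 2)"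
    using sx(1)[OF x2] unfolding Q_def by auto
  have W2e: "(\<integral>w. (W w)\<^sup>2 \<partial>iid M) \<le> (2 * Tl + \<bar>S - v\<bar> + e * sqrt S) / 2"
  proof -
    have "(\<integral>w. (W w)\<^sup>2 \<partial>iid M) \<le> (\<integral>w. \<bar>Q w - v\<bar> / 2 \<partial>iid M)"
      by (rule integral_mono[OF W2i Qi WQ])
    then show ?thesis using Qv by simp
  qed
  have PWi: "integrable (iid M) (\<lambda>w. norm (P w) * W w)"
    by (rule integrable_mult_of_squares[OF _ _ P2i W2i]) measurable
  have PW: "(\<integral>w. norm (P w) * W w \<partial>iid M) \<le> sqrt (exp S) * sqrt ((2 * Tl + \<bar>S - v\<bar> + e * sqrt S) / 2)"
  proof -
    have "(\<integral>w. norm (P w) * W w \<partial>iid M) = (\<integral>w. \<bar>norm (P w) * W w\<bar> \<partial>iid M)"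
      using W0 by (simp add: abs_mult)
    also have "\<dots> \<le> sqrt (\<integral>w. (norm (P w))\<^sup>2 \<partial>iid M) * sqrt (\<integral>w. (W w)\<^sup>2 \<partial>iid M)"
      by (rule integral_Cauchy_Schwarz[OF _ _ P2i W2i]) measurable
    also have "\<dots> \<le> sqrt (exp S) * sqrt ((2 * Tl + \<bar>S - v\<bar> + e * sqrt S) / 2)"
      by (intro mult_mono real_sqrt_le_mono P2e W2e) (auto intro: integral_nonneg_AE)
    finally show ?thesis .
  qed
  have pw: "norm (iexp (\<Sum>j<n. x (w j)) - complex_of_real (exp (- v / 2)) * P w)
      \<le> (\<Sum>j<n. 2 * (e * (x (w j))\<^sup>2 + ww (w j))) + norm (P w) * W w" for w
  proof -
    have aux: "2 * a \<le> 2 * (c + d)" if "a \<le> b" "b \<le> c" "0 \<le> d" for a b c d :: real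
      by (rule mult_left_mono) (use that in auto)
    \<comment> \<open>Below the level \<open>e\<close> the cubic bound is used, since |x|^3 \<le> e
      x^2; above it the quadratic one, which is exactly \<open>ww\<close>.\<close>
    have min_le: "2 * min ((x z)\<^sup>2) (\<bar>x z\<bar>^3) \<le> 2 * (e * (x z)\<^sup>2 + ww z)" for z
    proof (cases "\<bar>x z\<bar> \<le> e")
      case True
      then have "\<bar>x z\<bar> * (x z)\<^sup>2 \<le> e * (x z)\<^sup>2" by (intro mult_right_mono) auto
      then have "\<bar>x z\<bar>^3 \<le> e * (x z)\<^sup>2" by (simp add: power3_eq_cube power2_eq_square abs_mult_self_eq flip: mult.assoc)
      from aux[OF min.cobounded2 this] show ?thesis by (simp add: ww_def)
    next
      case False
      then have "ww z = (x z)\<^sup>2" by (simp add: ww_def)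
      with aux[OF min.cobounded1 order_refl, of "e * (x z)\<^sup>2"] e show ?thesis by (simp add: add.commute)
    qed
    \<comment> \<open>The intermediate product: each factor carries its own exp(- x^2 / 2), and
      together they form exp(- Q / 2).\<close>
    define P' where "P' = (\<Prod>j<n. (1 + \<i> * x (w j)) * exp (- (x (w j))\<^sup>2 / 2))"
    have P': "P' = P w * exp (- (Q w / 2))"
      unfolding P'_def P_def Q_def prod.distrib of_real_prod[symmetric] of_real_mult[symmetric]
      by (subst exp_sum[symmetric]) (simp_all add: sum_negf sum_divide_distrib)
    have "iexp (\<Sum>j<n. x (w j)) = (\<Prod>j<n. iexp (x (w j)))"
      by (simp add: exp_sum sum_distrib_left)
    then have "norm (iexp (\<Sum>j<n. x (w j)) - P') \<le>
        (\<Sum>j<n. norm (iexp (x (w j)) - (1 + \<i> * x (w j)) * exp (- (x (w j))\<^sup>2 / 2)))"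
      unfolding P'_def using iexp_prod_factor_bound(2) by (simp only:) (intro norm_prod_diff, auto)
    also have "\<dots> \<le> (\<Sum>j<n. 2 * (e * (x (w j))\<^sup>2 + ww (w j)))"
      by (intro sum_mono order_trans[OF iexp_prod_factor_bound(1) min_le])
    finally have 1: "norm (iexp (\<Sum>j<n. x (w j)) - P') \<le> (\<Sum>j<n. 2 * (e * (x (w j))\<^sup>2 + ww (w j)))" .
    have 2: "norm (P' - complex_of_real (exp (- v / 2)) * P w) = norm (P w) * W w"
    proof -
      have "P' - complex_of_real (exp (- v / 2)) * P w = P w * complex_of_real (exp (- (Q w / 2)) - exp (- (v / 2)))"
        unfolding P' by (simp add: algebra_simps)
      then show ?thesis unfolding W_def by (simp only: norm_mult norm_of_real)
    qed
    show ?thesis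
      using norm_triangle_ineq[of "iexp (\<Sum>j<n. x (w j)) - P'" "P' - complex_of_real (exp (- v / 2)) * P w"] 1 2 by simp
  qed
  have li: "integrable (iid M) (\<lambda>w. \<Sum>j<n. 2 * (e * (x (w j))\<^sup>2 + ww (w j)))"
    "(\<integral>w. (\<Sum>j<n. 2 * (e * (x (w j))\<^sup>2 + ww (w j))) \<partial>iid M) = 2 * (e * S + Tl)"
    using sx[of "\<lambda>z. 2 * (e * (x z)\<^sup>2 + ww z)"] x2 wi by (auto simp: S_def Tl algebra_simps)
  have "(\<integral>w. norm (iexp (\<Sum>j<n. x (w j)) - complex_of_real (exp (- v / 2)) * P w) \<partial>iid M) =
      norm (\<integral>w. norm (iexp (\<Sum>j<n. x (w j)) - complex_of_real (exp (- v / 2)) * P w) \<partial>iid M)" by simp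
  also have "\<dots> \<le> (\<integral>w. (\<Sum>j<n. 2 * (e * (x (w j))\<^sup>2 + ww (w j))) + norm (P w) * W w \<partial>iid M)"
    by (rule norm_integral_le[OF Bochner_Integration.integrable_add[OF li(1) PWi]])
      (use pw in \<open>auto intro!: AE_I2\<close>)
  also have "\<dots> = 2 * (e * S + Tl) + (\<integral>w. norm (P w) * W w \<partial>iid M)"
    using Bochner_Integration.integral_add[OF li(1) PWi] li(2) by simp
  finally show ?thesis using PW unfolding P_def by linarith
qed

lemma lindeberg_iexp_prod:
  fixes M :: "nat \<Rightarrow> 'a measure" and D :: "nat \<Rightarrow> 'a \<Rightarrow> real"
  assumes M: "\<And>n. prob_space (M n)" and Dm: "\<And>n. D n \<in> borel_measurable (M n)"
    and D2: "\<And>n. integrable (M n) (\<lambda>z. (D n z)\<^sup>2)"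
    and s: "(\<lambda>n. \<integral>z. (D n z)\<^sup>2 \<partial>M n) \<longlonglongrightarrow> v"
    and lind: "(\<lambda>n. \<integral>z. (D n z)\<^sup>2 * indicator {z. (D n z)\<^sup>2 > sqrt (real n)} z \<partial>M n) \<longlonglongrightarrow> 0"
  shows "(\<lambda>n. \<integral>w. norm (iexp (\<Sum>j<n. D n (w j) / sqrt n)
      - complex_of_real (exp (- v / 2)) * (\<Prod>j<n. 1 + \<i> * (D n (w j) / sqrt n))) \<partial>iid (M n)) \<longlonglongrightarrow> 0"
proof (rule tendsto_sandwich[OF always_eventually eventually_sequentiallyI[of 1] tendsto_const])
  have v: "0 \<le> v" by (rule LIMSEQ_le_const[OF s]) auto
  \<comment> \<open>The truncation level n^(-1/4): |D / sqrt n| > n^(-1/4) says D^2 > sqrt n, the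
    event in \<open>lind\<close>, and the level itself tends to 0, which removes the terms not
    covered by the tail.\<close>
  define c where "c n = inverse (sqrt (sqrt (real n)))" for n :: nat
  define s t where "s n = (\<integral>z. (D n z)\<^sup>2 \<partial>M n)"
    and "t n = (\<integral>z. (D n z)\<^sup>2 * indicator {z. (D n z)\<^sup>2 > sqrt (real n)} z \<partial>M n)" for n
  define b where "b n = 2 * (c n * s n + t n) + sqrt (exp (s n)) * sqrt ((2 * t n + \<bar>s n - v\<bar> + c n * sqrt (s n)) / 2)" for n
  have c0: "c \<longlonglongrightarrow> 0" unfolding c_def
    by (intro tendsto_inverse_0_at_top filterlim_compose[OF sqrt_at_top] filterlim_real_sequentially)
  have "s \<longlonglongrightarrow> v" "t \<longlonglongrightarrow> 0" using assms by (auto simp: s_def[abs_def] t_def[abs_def])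
  then have "b \<longlonglongrightarrow> 2 * (0 * v + 0) + sqrt (exp v) * sqrt ((2 * 0 + \<bar>v - v\<bar> + 0 * sqrt v) / 2)"
    unfolding b_def by (intro tendsto_intros c0) auto
  then show "b \<longlonglongrightarrow> 0" by simp
  fix n :: nat assume n: "1 \<le> n"
  define x where "x z = D n z / sqrt n" for z
  have xm: "x \<in> borel_measurable (M n)" unfolding x_def using Dm by measurable
  have x2: "(x z)\<^sup>2 = (D n z)\<^sup>2 / n" for z by (simp add: x_def power_divide)
  have x2i: "integrable (M n) (\<lambda>z. (x z)\<^sup>2)" unfolding x2 using D2 by simp
  have cn: "0 < c n" using n by (simp add: c_def)
  have ind: "\<bar>x z\<bar> > c n \<longleftrightarrow> (D n z)\<^sup>2 > sqrt (real n)" for z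
  proof -
    have "\<bar>x z\<bar> > c n \<longleftrightarrow> (x z)\<^sup>2 > (c n)\<^sup>2"
      using cn by (metis abs_le_square_iff abs_of_pos not_le)
    also have "(c n)\<^sup>2 = inverse (sqrt (real n))" by (simp add: c_def power_inverse)
    also have "(x z)\<^sup>2 > inverse (sqrt (real n)) \<longleftrightarrow> (D n z)\<^sup>2 > sqrt (real n)"
      using n unfolding x2 by (simp add: field_simps) (metis (no_types) real_div_sqrt of_nat_0_le_iff divide_less_eq mult.commute less_divide_eq real_sqrt_gt_0_iff of_nat_0_less_iff less_eq_Suc_le One_nat_def)
    finally show ?thesis .
  qed
  have S: "real n * (\<integral>z. (x z)\<^sup>2 \<partial>M n) = s n" using n by (simp add: x2 s_def)
  have Tl: "real n * (\<integral>z. (x z)\<^sup>2 * indicator {z. \<bar>x z\<bar> > c n} z \<partial>M n) = t n"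
    using n unfolding ind by (simp add: x2 t_def)
  show "(\<integral>w. norm (iexp (\<Sum>j<n. D n (w j) / sqrt n)
      - complex_of_real (exp (- v / 2)) * (\<Prod>j<n. 1 + \<i> * (D n (w j) / sqrt n))) \<partial>iid (M n)) \<le> b n"
    using iexp_sum_prod_bound[OF M xm x2i cn v, of n, unfolded S Tl, folded b_def] unfolding x_def .
qed simp

subsection \<open>Negligible sequences and weak convergence\<close>

text \<open>The rate is divided out, and the outer measure is kept so that this agrees with
  \<open>small_oP\<close> before any measurability is known.\<close>

definition oP1 :: "'w measure \<Rightarrow> (nat \<Rightarrow> 'w \<Rightarrow> real) \<Rightarrow> bool" where
  "oP1 P W \<longleftrightarrow> (\<forall>\<epsilon>>0. (\<lambda>n. outer_measure_of P {w \<in> space P. \<epsilon> < \<bar>W n w\<bar>}) \<longlonglongrightarrow> 0)"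

lemma null_of_norm_le:
  fixes g :: "nat \<Rightarrow> real"
  assumes "\<And>n. norm (f n) \<le> g n" "g \<longlonglongrightarrow> 0"
  shows "f \<longlonglongrightarrow> 0"
  using Lim_null_comparison[OF always_eventually assms(2), of f] assms(1) by auto

text \<open>Positivity of the rate is asked only for n > 0 because \<open>0 powr a\<close> is
  0.\<close>

lemma small_oP_iff_oP1:
  assumes "\<And>n. 0 < n \<Longrightarrow> 0 < r n"
  shows "small_oP P (\<lambda>n w. ennreal \<bar>Y n w\<bar>) r \<longleftrightarrow> oP1 P (\<lambda>n w. Y n w / r n)"
proof -
  have "(\<lambda>n. outer_measure_of P {w \<in> space P. ennreal \<bar>Y n w\<bar> > ennreal (\<epsilon> * r n)}) \<longlonglongrightarrow> 0 \<longleftrightarrow>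
     (\<lambda>n. outer_measure_of P {w \<in> space P. \<epsilon> < \<bar>Y n w / r n\<bar>}) \<longlonglongrightarrow> 0" if "0 < \<epsilon>" for \<epsilon>
  proof (rule tendsto_cong, rule eventually_mono[OF eventually_gt_at_top[of 0]])
    fix n :: nat assume "0 < n"
    then have r: "0 < r n" by (rule assms)
    have "ennreal \<bar>Y n w\<bar> > ennreal (\<epsilon> * r n) \<longleftrightarrow> \<epsilon> < \<bar>Y n w / r n\<bar>" for w
      using r that by (simp add: ennreal_less_iff abs_divide field_simps)
    then show "outer_measure_of P {w \<in> space P. ennreal \<bar>Y n w\<bar> > ennreal (\<epsilon> * r n)} =
      outer_measure_of P {w \<in> space P. \<epsilon> < \<bar>Y n w / r n\<bar>}" by simp
  qed
  then show ?thesis unfolding small_oP_def oP1_def by auto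
qed

lemma outer_measure_of_Un_le:
  assumes "A \<subseteq> space M" "B \<subseteq> space M"
  shows "outer_measure_of M (A \<union> B) \<le> outer_measure_of M A + outer_measure_of M B"
proof -
  obtain E where E: "E \<in> sets M" "A \<subseteq> E" "outer_measure_of M A = emeasure M E"
    using outer_measure_of_attain[OF assms(1)] by auto
  obtain D where D: "D \<in> sets M" "B \<subseteq> D" "outer_measure_of M B = emeasure M D"
    using outer_measure_of_attain[OF assms(2)] by auto
  have "outer_measure_of M (A \<union> B) \<le> outer_measure_of M (E \<union> D)"
    using E D by (intro outer_measure_of_mono) auto
  also have "\<dots> \<le> emeasure M E + emeasure M D"
    using E D emeasure_subadditive by simp
  finally show ?thesis using E D by simp
qed

lemma oP1_cover:
  assumes "\<And>\<epsilon>. 0 < \<epsilon> \<Longrightarrow> \<exists>A. (\<forall>n. A n \<subseteq> space P) \<and> (\<lambda>n. outer_measure_of P (A n)) \<longlonglongrightarrow> 0 \<and>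
      (\<forall>\<^sub>F n in sequentially. \<forall>w\<in>space P - A n. \<bar>W n w\<bar> \<le> \<epsilon>)"
  shows "oP1 P W"
  unfolding oP1_def
proof safe
  fix \<epsilon> :: real assume "0 < \<epsilon>"
  from assms[OF this] obtain A where A: "\<And>n. A n \<subseteq> space P" "(\<lambda>n. outer_measure_of P (A n)) \<longlonglongrightarrow> 0"
      "\<forall>\<^sub>F n in sequentially. \<forall>w\<in>space P - A n. \<bar>W n w\<bar> \<le> \<epsilon>" by auto
  show "(\<lambda>n. outer_measure_of P {w \<in> space P. \<epsilon> < \<bar>W n w\<bar>}) \<longlonglongrightarrow> 0"
  proof (rule tendsto_sandwich[OF _ _ tendsto_const A(2)])
    show "\<forall>\<^sub>F n in sequentially. outer_measure_of P {w \<in> space P. \<epsilon> < \<bar>W n w\<bar>} \<le> outer_measure_of P (A n)"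
      using A(3) by eventually_elim (intro outer_measure_of_mono, force)
  qed simp
qed

text \<open>Exceptional sets that are merely small, one family for each \<delta>, suffice. Tightness
  supplies sets of this kind: their mass is at most \<delta> but need not tend to 0.\<close>

lemma oP1_tight_cover:
  assumes "\<And>\<epsilon> \<delta>. 0 < \<epsilon> \<Longrightarrow> 0 < \<delta> \<Longrightarrow> \<exists>A. (\<forall>n. A n \<subseteq> space P) \<and>
      (\<forall>\<^sub>F n in sequentially. outer_measure_of P (A n) \<le> ennreal \<delta>) \<and>
      (\<forall>\<^sub>F n in sequentially. \<forall>w\<in>space P - A n. \<bar>W n w\<bar> \<le> \<epsilon>)"
  shows "oP1 P W"
  unfolding oP1_def
proof (intro allI impI order_tendstoI)
  fix \<epsilon> :: real and x :: ennreal assume \<epsilon>: "0 < \<epsilon>" and x: "0 < x"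
  obtain y where y: "0 < y" "y < x" using dense[OF x] by auto
  then have "y < \<top>" by (metis less_top_ennreal order_less_trans top.not_eq_extremum)
  then obtain \<delta> where d: "y = ennreal \<delta>" "0 < \<delta>"
    using y(1) by (cases y) auto
  obtain A where A: "\<And>n. A n \<subseteq> space P" "\<forall>\<^sub>F n in sequentially. outer_measure_of P (A n) \<le> ennreal \<delta>"
      "\<forall>\<^sub>F n in sequentially. \<forall>w\<in>space P - A n. \<bar>W n w\<bar> \<le> \<epsilon>"
    using assms[OF \<epsilon> d(2)] by blast
  from A(2,3) show "\<forall>\<^sub>F n in sequentially. outer_measure_of P {w \<in> space P. \<epsilon> < \<bar>W n w\<bar>} < x"
  proof eventually_elim
    case (elim n)
    have "outer_measure_of P {w \<in> space P. \<epsilon> < \<bar>W n w\<bar>} \<le> outer_measure_of P (A n)"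
      by (rule outer_measure_of_mono) (use elim(2) in force)
    also have "\<dots> < x" using elim(1) y(2) d(1) by simp
    finally show ?case .
  qed
qed simp

lemma oP1_add:
  assumes W: "oP1 P W" and V: "oP1 P V"
  shows "oP1 P (\<lambda>n w. W n w + V n w)"
proof (rule oP1_cover)
  fix \<epsilon> :: real assume e: "0 < \<epsilon>"
  define A where "A n = {w \<in> space P. \<epsilon> / 2 < \<bar>W n w\<bar>}" for n
  define B where "B n = {w \<in> space P. \<epsilon> / 2 < \<bar>V n w\<bar>}" for n
  have e2: "0 < \<epsilon> / 2" using e by simp
  have AB: "(\<lambda>n. outer_measure_of P (A n) + outer_measure_of P (B n)) \<longlonglongrightarrow> 0 + 0"
    unfolding A_def B_def
    by (rule tendsto_add[OF W[unfolded oP1_def, rule_format, OF e2] V[unfolded oP1_def, rule_format, OF e2]])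
  have "outer_measure_of P (A n \<union> B n) \<le> outer_measure_of P (A n) + outer_measure_of P (B n)" for n
    by (rule outer_measure_of_Un_le) (auto simp: A_def B_def)
  then have "(\<lambda>n. outer_measure_of P (A n \<union> B n)) \<longlonglongrightarrow> 0"
    by (intro tendsto_sandwich[OF always_eventually always_eventually tendsto_const AB[simplified]]) auto
  moreover have "\<bar>W n w + V n w\<bar> \<le> \<epsilon>" if "w \<in> space P - (A n \<union> B n)" for n w
    using that abs_triangle_ineq[of "W n w" "V n w"] by (auto simp: A_def B_def)
  moreover have "A n \<union> B n \<subseteq> space P" for n by (auto simp: A_def B_def)
  ultimately show "\<exists>A. (\<forall>n. A n \<subseteq> space P) \<and> (\<lambda>n. outer_measure_of P (A n)) \<longlonglongrightarrow> 0 \<and>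
      (\<forall>\<^sub>F n in sequentially. \<forall>w\<in>space P - A n. \<bar>W n w + V n w\<bar> \<le> \<epsilon>)"
    by (intro exI[of _ "\<lambda>n. A n \<union> B n"]) (auto intro!: always_eventually)
qed

lemma oP1_mono:
  assumes V: "oP1 P V" and le: "\<forall>\<^sub>F n in sequentially. \<forall>w\<in>space P. \<bar>W n w\<bar> \<le> \<bar>V n w\<bar>"
  shows "oP1 P W"
proof (rule oP1_cover)
  fix \<epsilon> :: real assume e: "0 < \<epsilon>"
  then show "\<exists>A. (\<forall>n. A n \<subseteq> space P) \<and> (\<lambda>n. outer_measure_of P (A n)) \<longlonglongrightarrow> 0 \<and>
      (\<forall>\<^sub>F n in sequentially. \<forall>w\<in>space P - A n. \<bar>W n w\<bar> \<le> \<epsilon>)"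
    using V le
    by (intro exI[of _ "\<lambda>n. {w \<in> space P. \<epsilon> < \<bar>V n w\<bar>}"])
      (auto simp: oP1_def elim!: eventually_mono intro: order_trans)
qed

lemma oP1_cong:
  assumes "oP1 P V" and "\<forall>\<^sub>F n in sequentially. \<forall>w\<in>space P. W n w = V n w"
  shows "oP1 P W"
  using assms(1) by (rule oP1_mono) (use assms(2) in eventually_elim, simp)

lemma oP1_measurable_iff:
  assumes "prob_space P" "\<And>n. W n \<in> borel_measurable P"
  shows "oP1 P W \<longleftrightarrow> (\<forall>\<epsilon>>0. (\<lambda>n. measure P {w \<in> space P. \<epsilon> < \<bar>W n w\<bar>}) \<longlonglongrightarrow> 0)"
proof -
  interpret prob_space P by fact
  note [measurable] = assms(2)
  have "outer_measure_of P {w \<in> space P. \<epsilon> < \<bar>W n w\<bar>} = ennreal (measure P {w \<in> space P. \<epsilon> < \<bar>W n w\<bar>})" for n \<epsilon>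
    by (subst outer_measure_of_eq) (auto simp: emeasure_eq_measure)
  then show ?thesis unfolding oP1_def
    by (simp add: ennreal_tendsto_0_iff)
qed

lemma oP1_of_L2:
  assumes P: "prob_space P" and Wm: "\<And>n. W n \<in> borel_measurable P"
    and W2: "\<And>n. integrable P (\<lambda>w. (W n w)\<^sup>2)" and lim: "(\<lambda>n. \<integral>w. (W n w)\<^sup>2 \<partial>P) \<longlonglongrightarrow> 0"
  shows "oP1 P W"
  unfolding oP1_measurable_iff[OF P Wm]
proof safe
  interpret prob_space P by fact
  note [measurable] = Wm
  fix \<epsilon> :: real assume e: "0 < \<epsilon>"
  have "measure P {w \<in> space P. \<epsilon> < \<bar>W n w\<bar>} \<le> (\<integral>w. (W n w)\<^sup>2 \<partial>P) / \<epsilon>\<^sup>2" for n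
  proof -
    have "measure P {w \<in> space P. \<epsilon> < \<bar>W n w\<bar>} \<le> measure P {w \<in> space P. \<epsilon> \<le> \<bar>W n w\<bar>}"
      by (rule finite_measure_mono) auto
    also have "\<dots> \<le> (\<integral>w. (W n w)\<^sup>2 \<partial>P) / \<epsilon>\<^sup>2"
      by (rule second_moment_method[OF Wm W2 e])
    finally show ?thesis .
  qed
  moreover have "(\<lambda>n. (\<integral>w. (W n w)\<^sup>2 \<partial>P) / \<epsilon>\<^sup>2) \<longlonglongrightarrow> 0"
    using tendsto_divide[OF lim tendsto_const, of "\<epsilon>\<^sup>2"] e by simp
  ultimately show "(\<lambda>n. measure P {w \<in> space P. \<epsilon> < \<bar>W n w\<bar>}) \<longlonglongrightarrow> 0"
    by (intro null_of_norm_le[where f = "\<lambda>n. measure P {w \<in> space P. \<epsilon> < \<bar>W n w\<bar>}"]) auto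
qed

section \<open>Weak convergence, characteristic functions and negligibility\<close>

lemma weak_conv_m_cong_eventually:
  assumes "\<forall>\<^sub>F n in sequentially. N n = N' n"
  shows "weak_conv_m N L \<longleftrightarrow> weak_conv_m N' L"
proof -
  have "(\<lambda>n. cdf (N n) x) \<longlonglongrightarrow> l \<longleftrightarrow> (\<lambda>n. cdf (N' n) x) \<longlonglongrightarrow> l" for x l
    by (rule tendsto_cong) (use assms in eventually_elim, simp)
  then show ?thesis by (simp add: weak_conv_m_def weak_conv_def)
qed

lemma weak_conv_m_iff_char:
  assumes N: "\<And>n. real_distribution (N n)" and L: "real_distribution L"
  shows "weak_conv_m N L \<longleftrightarrow> (\<forall>t. (\<lambda>n. char (N n) t) \<longlonglongrightarrow> char L t)"
  using levy_continuity1[OF N L] levy_continuity[OF N L] by auto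

lemma norm_iexp_diff_le: "norm (iexp x - iexp y) \<le> \<bar>x - y\<bar>" "norm (iexp x - 1) \<le> \<bar>x\<bar>" "norm (iexp x - 1) \<le> 2"
proof -
  show 1: "norm (iexp x - 1) \<le> \<bar>x\<bar>" for x using iexp_approx1[of x 0] by simp
  have "iexp x - iexp y = iexp y * (iexp (x - y) - 1)"
    by (simp add: algebra_simps flip: exp_add)
  then show "norm (iexp x - iexp y) \<le> \<bar>x - y\<bar>" using 1[of "x - y"] by (simp add: norm_mult)
  show "norm (iexp x - 1) \<le> 2" using norm_triangle_ineq4[of "iexp x" 1] by simp
qed

text \<open>A criterion by bounded quantities, so no moments of W are involved. In the backward
  direction the characteristic functions converge to 1, the laws converge weakly to the point mass
  at 0, and a continuous test function dominating the tail indicator finishes.\<close>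

lemma oP1_iff_iexp:
  assumes P: "prob_space P" and Wm: "\<And>n. W n \<in> borel_measurable P"
  shows "oP1 P W \<longleftrightarrow> (\<forall>t. (\<lambda>n. \<integral>w. norm (iexp (t * W n w) - 1) \<partial>P) \<longlonglongrightarrow> 0)"
proof
  interpret prob_space P by fact
  note [measurable] = Wm
  have int: "integrable P (\<lambda>w. norm (iexp (t * W n w) - 1))" for t n
    by (rule integrable_const_bound[of _ 2])
      (rule AE_I2, simp only: real_norm_def abs_norm_cancel, rule norm_iexp_diff_le(3), measurable)
  show "\<forall>t. (\<lambda>n. \<integral>w. norm (iexp (t * W n w) - 1) \<partial>P) \<longlonglongrightarrow> 0" if W: "oP1 P W"
  proof
    fix t
    show "(\<lambda>n. \<integral>w. norm (iexp (t * W n w) - 1) \<partial>P) \<longlonglongrightarrow> 0"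
    proof (rule LIMSEQ_I)
      fix e :: real assume e: "0 < e"
      obtain c where c: "\<bar>t\<bar> \<le> c" "0 < c"
        using reals_Archimedean2[of "\<bar>t\<bar>"] by (meson abs_ge_zero le_less_trans less_imp_le)
      define d where "d = e / (2 * c)"
      have d: "0 < d" using e c by (simp add: d_def)
      have "\<bar>t\<bar> * d \<le> c * d" using c d by (intro mult_right_mono) auto
      also have "c * d = e / 2" using c by (simp add: d_def)
      finally have td: "\<bar>t\<bar> * d \<le> e / 2" .
      have le: "(\<integral>w. norm (iexp (t * W n w) - 1) \<partial>P) \<le> \<bar>t\<bar> * d + 2 * measure P {w \<in> space P. d < \<bar>W n w\<bar>}" for n
      proof -
        have "(\<integral>w. norm (iexp (t * W n w) - 1) \<partial>P) \<le>
            (\<integral>w. \<bar>t\<bar> * d + 2 * indicator {w \<in> space P. d < \<bar>W n w\<bar>} w \<partial>P)"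
        proof (rule integral_mono[OF int])
          fix w assume "w \<in> space P"
          show "norm (iexp (t * W n w) - 1) \<le> \<bar>t\<bar> * d + 2 * indicator {w \<in> space P. d < \<bar>W n w\<bar>} w"
          proof (cases "d < \<bar>W n w\<bar>")
            case True
            have "0 \<le> \<bar>t\<bar> * d" using d by simp
            with True \<open>w \<in> space P\<close> norm_iexp_diff_le(3)[of "t * W n w"] show ?thesis
              by (simp add: indicator_def)
          next
            case False
            then have "\<bar>t * W n w\<bar> \<le> \<bar>t\<bar> * d" unfolding abs_mult by (intro mult_left_mono) auto
            with False norm_iexp_diff_le(2)[of "t * W n w"] show ?thesis
              by (simp add: indicator_def)
          qed
        qed (intro Bochner_Integration.integrable_add integrable_const integrable_mult_right
            integrable_real_indicator, auto simp: emeasure_eq_measure)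
        also have "\<dots> = \<bar>t\<bar> * d + 2 * measure P {w \<in> space P. d < \<bar>W n w\<bar>}"
          by (subst Bochner_Integration.integral_add)
            (auto simp: prob_space emeasure_eq_measure intro!: integrable_real_indicator)
        finally show ?thesis .
      qed
      have "(\<lambda>n. measure P {w \<in> space P. d < \<bar>W n w\<bar>}) \<longlonglongrightarrow> 0"
        using W d unfolding oP1_measurable_iff[OF P Wm] by auto
      from LIMSEQ_D[OF this, of "e / 4"] e obtain N where
        N: "\<And>n. n \<ge> N \<Longrightarrow> measure P {w \<in> space P. d < \<bar>W n w\<bar>} < e / 4" by auto
      show "\<exists>N. \<forall>n\<ge>N. norm ((\<integral>w. norm (iexp (t * W n w) - 1) \<partial>P) - 0) < e"
      proof (intro exI[of _ N] allI impI)
        fix n assume "N \<le> n"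
        then show "norm ((\<integral>w. norm (iexp (t * W n w) - 1) \<partial>P) - 0) < e"
          using le[of n] N[of n] td by simp
      qed
    qed
  qed
  show "oP1 P W" if lim: "\<forall>t. (\<lambda>n. \<integral>w. norm (iexp (t * W n w) - 1) \<partial>P) \<longlonglongrightarrow> 0"
    unfolding oP1_measurable_iff[OF P Wm]
  proof safe
    fix \<epsilon> :: real assume e: "0 < \<epsilon>"
    define N where "N n = distr P borel (W n)" for n
    have N: "real_distribution (N n)" for n unfolding N_def by (rule real_distribution_distr) simp
    interpret Z: prob_space "return borel (0::real)" by (rule prob_space_return) simp
    have L: "real_distribution (return borel (0::real))" by standard auto
    have "(\<lambda>n. char (N n) t) \<longlonglongrightarrow> char (return borel 0) t" for t
    proof -
      have "char (N n) t - 1 = (\<integral>w. iexp (t * W n w) - 1 \<partial>P)" for n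
      proof -
        have "integrable P (\<lambda>w. iexp (t * W n w))" by (rule integrable_iexp) auto
        then show ?thesis unfolding N_def char_def by (simp add: integral_distr prob_space)
      qed
      then have "norm (char (N n) t - 1) \<le> (\<integral>w. norm (iexp (t * W n w) - 1) \<partial>P)" for n
        by simp
      then have "(\<lambda>n. char (N n) t - 1) \<longlonglongrightarrow> 0"
        by (rule null_of_norm_le[OF _ lim[rule_format, of t]])
      moreover have "char (return borel 0) t = 1"
        unfolding char_def by (subst integral_return) auto
      ultimately show ?thesis by (simp add: LIM_zero_iff)
    qed
    then have wc: "weak_conv_m N (return borel 0)" by (rule levy_continuity[OF N L])
    \<comment> \<open>Bounded and continuous, 0 at 0 and equal to 1 where |x| > \<epsilon>, so its
      integral dominates the tail probability.\<close>
    define f :: "real \<Rightarrow> real" where "f x = min 1 (\<bar>x\<bar> / \<epsilon>)" for x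
    have "(\<lambda>n. integral\<^sup>L (N n) f) \<longlonglongrightarrow> integral\<^sup>L (return borel 0) f"
    proof (rule weak_conv_imp_integral_bdd_continuous_conv[OF N L wc])
      show "isCont f x" for x unfolding f_def using e by (intro continuous_intros) auto
      show "norm (f x) \<le> 1" for x using e by (auto simp: f_def)
    qed
    moreover have [measurable]: "f \<in> borel_measurable borel" unfolding f_def by measurable
    moreover have "integral\<^sup>L (return borel 0) f = 0" by (subst integral_return) (auto simp: f_def)
    moreover have "integral\<^sup>L (N n) f = (\<integral>w. f (W n w) \<partial>P)" for n
      unfolding N_def by (rule integral_distr) auto
    ultimately have f0: "(\<lambda>n. \<integral>w. f (W n w) \<partial>P) \<longlonglongrightarrow> 0" by simp
    have "measure P {w \<in> space P. \<epsilon> < \<bar>W n w\<bar>} \<le> (\<integral>w. f (W n w) \<partial>P)" for n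
    proof -
      have "measure P {w \<in> space P. \<epsilon> < \<bar>W n w\<bar>} = (\<integral>w. indicator {w \<in> space P. \<epsilon> < \<bar>W n w\<bar>} w \<partial>P)"
        by simp
      also have "\<dots> \<le> (\<integral>w. f (W n w) \<partial>P)"
      proof (rule integral_mono)
        show "integrable P (\<lambda>w. f (W n w))"
          by (rule integrable_const_bound[of _ 1]) (use e in \<open>auto simp: f_def\<close>)
        show "integrable P (indicat_real {w \<in> space P. \<epsilon> < \<bar>W n w\<bar>})"
          by (intro integrable_real_indicator) (auto simp: emeasure_eq_measure)
      qed (use e in \<open>auto simp: f_def indicator_def field_simps\<close>)
      finally show ?thesis .
    qed
    then show "(\<lambda>n. measure P {w \<in> space P. \<epsilon> < \<bar>W n w\<bar>}) \<longlonglongrightarrow> 0"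
      by (intro null_of_norm_le[OF _ f0]) simp
  qed
qed

text \<open>The substitute for contiguity. |exp(i t (A - B)) - 1| is bounded by 2, so its
  convergence in mean is also convergence in mean square, and Cauchy-Schwarz pairs it with weights
  of bounded second moment.\<close>

lemma oP1_iexp_weighted:
  assumes P: "prob_space P" and Am: "\<And>n. A n \<in> borel_measurable P" and Bm: "\<And>n. B n \<in> borel_measurable P"
    and Lm: "\<And>n. L n \<in> borel_measurable P" and L2: "\<And>n. integrable P (\<lambda>w. (L n w)\<^sup>2)"
    and C: "\<And>n. (\<integral>w. (L n w)\<^sup>2 \<partial>P) \<le> C"
    and AB: "oP1 P (\<lambda>n w. A n w - B n w)"
  shows "(\<lambda>n. (\<integral>w. iexp (t * A n w) * complex_of_real (L n w) \<partial>P)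
      - (\<integral>w. iexp (t * B n w) * complex_of_real (L n w) \<partial>P)) \<longlonglongrightarrow> 0"
proof -
  interpret prob_space P by fact
  note [measurable] = Am Bm Lm
  define d where "d n w = norm (iexp (t * (A n w - B n w)) - 1)" for n w
  have dm[measurable]: "d n \<in> borel_measurable P" for n unfolding d_def by measurable
  have d0: "0 \<le> d n w" "d n w \<le> 2" for n w
    unfolding d_def by (rule norm_ge_zero, rule norm_iexp_diff_le(3))
  have di: "integrable P (d n)" for n by (rule integrable_const_bound[of _ 2]) (use d0 in auto)
  have d2i: "integrable P (\<lambda>w. (d n w)\<^sup>2)" for n
    by (rule integrable_const_bound[of _ 4]) (use d0 power_mono[of _ 2 2] in \<open>force intro!: AE_I2\<close>, measurable)
  have dlim: "(\<lambda>n. \<integral>w. d n w \<partial>P) \<longlonglongrightarrow> 0"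
    using AB unfolding d_def by (subst (asm) oP1_iff_iexp[OF P]) auto
  have d2: "(\<integral>w. (d n w)\<^sup>2 \<partial>P) \<le> 2 * (\<integral>w. d n w \<partial>P)" for n
  proof -
    have "(\<integral>w. (d n w)\<^sup>2 \<partial>P) \<le> (\<integral>w. 2 * d n w \<partial>P)"
      by (rule integral_mono[OF d2i]) (use di d0 in \<open>auto simp: power2_eq_square intro!: mult_right_mono\<close>)
    then show ?thesis by simp
  qed
  have Li: "integrable P (L n)" for n by (rule square_integrable_imp_integrable[OF Lm L2])
  have iL: "integrable P (\<lambda>w. iexp (t * X w) * complex_of_real (L n w))"
    if [measurable]: "X \<in> borel_measurable P" for X n
    by (rule Bochner_Integration.integrable_bound[OF Li[of n]]) (auto simp: norm_mult)
  have le: "norm ((\<integral>w. iexp (t * A n w) * complex_of_real (L n w) \<partial>P)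
      - (\<integral>w. iexp (t * B n w) * complex_of_real (L n w) \<partial>P)) \<le> sqrt (2 * (\<integral>w. d n w \<partial>P)) * sqrt C" for n
  proof -
    have "(\<integral>w. iexp (t * A n w) * complex_of_real (L n w) \<partial>P)
      - (\<integral>w. iexp (t * B n w) * complex_of_real (L n w) \<partial>P) =
      (\<integral>w. iexp (t * A n w) * complex_of_real (L n w) - iexp (t * B n w) * complex_of_real (L n w) \<partial>P)"
      by (rule Bochner_Integration.integral_diff[symmetric, OF iL[OF Am] iL[OF Bm]])
    also have "norm \<dots> \<le> (\<integral>w. \<bar>d n w * L n w\<bar> \<partial>P)"
    proof (rule norm_integral_le)
      show "integrable P (\<lambda>w. \<bar>d n w * L n w\<bar>)"
        using integrable_mult_of_squares[OF dm Lm d2i L2] by simp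
      have "norm (iexp (t * A n w) * complex_of_real (L n w) - iexp (t * B n w) * complex_of_real (L n w))
          = \<bar>d n w * L n w\<bar>" for w
      proof -
        have "iexp (t * A n w) * complex_of_real (L n w) - iexp (t * B n w) * complex_of_real (L n w) =
          iexp (t * B n w) * ((iexp (t * (A n w - B n w)) - 1) * complex_of_real (L n w))"
          by (simp add: algebra_simps flip: exp_add)
        then show ?thesis by (simp add: norm_mult d_def abs_mult)
      qed
      then show "AE w in P. norm (iexp (t * A n w) * complex_of_real (L n w) - iexp (t * B n w) * complex_of_real (L n w))
          \<le> \<bar>d n w * L n w\<bar>" by simp
    qed
    also have "\<dots> \<le> sqrt (\<integral>w. (d n w)\<^sup>2 \<partial>P) * sqrt (\<integral>w. (L n w)\<^sup>2 \<partial>P)"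
      by (rule integral_Cauchy_Schwarz[OF dm Lm d2i L2])
    also have "\<dots> \<le> sqrt (2 * (\<integral>w. d n w \<partial>P)) * sqrt C"
      by (intro mult_mono real_sqrt_le_mono d2 C) (auto intro!: integral_nonneg_AE simp: d0)
    finally show ?thesis .
  qed
  have "(\<lambda>n. sqrt (2 * (\<integral>w. d n w \<partial>P)) * sqrt C) \<longlonglongrightarrow> sqrt (2 * 0) * sqrt C"
    by (intro tendsto_intros dlim)
  then show ?thesis by (intro null_of_norm_le[OF le]) simp
qed

text \<open>Weak convergence gives convergence of the truncated second moments E min(X^2, k).
  Together with convergence of the full second moments, the excess over k converges to that of the
  limit, which is small for large k. The underlying spaces may change with n.\<close>

lemma weak_conv_uniformly_square_integrable:
  fixes X :: "nat \<Rightarrow> 'a \<Rightarrow> real"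
  assumes P: "\<And>n. prob_space (P n)" and Q: "prob_space Q"
    and Xm: "\<And>n. X n \<in> borel_measurable (P n)" and Ym: "Y \<in> borel_measurable Q"
    and X2: "\<And>n. integrable (P n) (\<lambda>w. (X n w)\<^sup>2)" and Y2: "integrable Q (\<lambda>w. (Y w)\<^sup>2)"
    and wc: "weak_conv_m (\<lambda>n. distr (P n) borel (X n)) (distr Q borel Y)"
    and lim: "(\<lambda>n. \<integral>w. (X n w)\<^sup>2 \<partial>P n) \<longlonglongrightarrow> (\<integral>w. (Y w)\<^sup>2 \<partial>Q)"
    and K: "filterlim K at_top sequentially"
  shows "(\<lambda>n. \<integral>w. (X n w)\<^sup>2 * indicator {w. K n < (X n w)\<^sup>2} w \<partial>P n) \<longlonglongrightarrow> 0"
proof (rule LIMSEQ_I)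
  interpret P: prob_space "P n" for n by fact
  interpret Q: prob_space Q by fact
  note [measurable] = Xm Ym
  fix e :: real assume e: "0 < e"
  have N: "real_distribution (distr (P n) borel (X n))" for n by (rule P.real_distribution_distr) simp
  have L: "real_distribution (distr Q borel Y)" by (rule Q.real_distribution_distr) simp
  have tail: "(\<lambda>k. \<integral>w. (Y w)\<^sup>2 - min ((Y w)\<^sup>2) (real k) \<partial>Q) \<longlonglongrightarrow> (\<integral>w. 0 \<partial>Q)"
  proof (rule integral_dominated_convergence[where w = "\<lambda>w. (Y w)\<^sup>2"])
    show "AE w in Q. (\<lambda>k. (Y w)\<^sup>2 - min ((Y w)\<^sup>2) (real k)) \<longlonglongrightarrow> 0"
    proof (rule AE_I2)
      fix w
      have "\<forall>\<^sub>F k in sequentially. (Y w)\<^sup>2 - min ((Y w)\<^sup>2) (real k) = 0"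
        using eventually_ge_at_top[of "nat \<lceil>(Y w)\<^sup>2\<rceil>"] by eventually_elim linarith
      then show "(\<lambda>k. (Y w)\<^sup>2 - min ((Y w)\<^sup>2) (real k)) \<longlonglongrightarrow> 0"
        by (rule tendsto_eventually)
    qed
  qed (use Y2 in \<open>auto simp: min_def\<close>)
  then obtain k where k: "(\<integral>w. (Y w)\<^sup>2 - min ((Y w)\<^sup>2) (real k) \<partial>Q) < e / 2"
    using LIMSEQ_D[OF tail, of "e / 2"] e by fastforce
  have Yk: "integrable Q (\<lambda>w. min ((Y w)\<^sup>2) (real k))"
    by (rule Q.integrable_const_bound[of _ "real k"]) auto
  have Xk: "integrable (P n) (\<lambda>w. min ((X n w)\<^sup>2) (real k))" for n
    by (rule P.integrable_const_bound[of _ "real k"]) auto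
  have "(\<lambda>n. \<integral>x. min (x\<^sup>2) (real k) \<partial>distr (P n) borel (X n)) \<longlonglongrightarrow> (\<integral>x. min (x\<^sup>2) (real k) \<partial>distr Q borel Y)"
    by (rule weak_conv_imp_integral_bdd_continuous_conv[OF N L wc, where B = "real k"])
      (auto intro!: continuous_intros)
  then have "(\<lambda>n. \<integral>w. min ((X n w)\<^sup>2) (real k) \<partial>P n) \<longlonglongrightarrow> (\<integral>w. min ((Y w)\<^sup>2) (real k) \<partial>Q)"
    by (simp add: integral_distr)
  from tendsto_diff[OF lim this]
  have "(\<lambda>n. \<integral>w. (X n w)\<^sup>2 - min ((X n w)\<^sup>2) (real k) \<partial>P n) \<longlonglongrightarrow> (\<integral>w. (Y w)\<^sup>2 - min ((Y w)\<^sup>2) (real k) \<partial>Q)"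
    using X2 Y2 Xk Yk by simp
  from order_tendstoD(2)[OF this k]
  have "\<forall>\<^sub>F n in sequentially. (\<integral>w. (X n w)\<^sup>2 - min ((X n w)\<^sup>2) (real k) \<partial>P n) < e / 2" .
  moreover have "\<forall>\<^sub>F n in sequentially. 2 * real k \<le> K n"
    using K by (simp add: filterlim_at_top)
  ultimately have "\<forall>\<^sub>F n in sequentially. norm ((\<integral>w. (X n w)\<^sup>2 * indicator {w. K n < (X n w)\<^sup>2} w \<partial>P n) - 0) < e"
  proof eventually_elim
    case (elim n)
    \<comment> \<open>Where X^2 > K \<ge> 2 k, the excess X^2 - k is at least half of X^2; this
      accounts for the factor 2.\<close>
    have "(\<integral>w. (X n w)\<^sup>2 * indicator {w. K n < (X n w)\<^sup>2} w \<partial>P n) \<le>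
       (\<integral>w. 2 * ((X n w)\<^sup>2 - min ((X n w)\<^sup>2) (real k)) \<partial>P n)"
    proof (rule integral_mono)
      show "integrable (P n) (\<lambda>w. (X n w)\<^sup>2 * indicator {w. K n < (X n w)\<^sup>2} w)"
        by (rule Bochner_Integration.integrable_bound[OF X2[of n]]) (auto simp: indicator_def)
    qed (use X2 Xk elim in \<open>auto simp: indicator_def min_def\<close>)
    also have "\<dots> = 2 * (\<integral>w. (X n w)\<^sup>2 - min ((X n w)\<^sup>2) (real k) \<partial>P n)"
      by (rule integral_mult_right_zero)
    also have "\<dots> < e" using elim by simp
    finally show ?case by (simp add: integral_nonneg_AE)
  qed
  then show "\<exists>N. \<forall>n\<ge>N. norm ((\<integral>w. (X n w)\<^sup>2 * indicator {w. K n < (X n w)\<^sup>2} w \<partial>P n) - 0) < e"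
    by (simp add: eventually_sequentially)
qed

lemma centered_normal:
  assumes "0 \<le> v"
  shows "real_distribution (centered_normal v)"
    and "char (centered_normal v) t = exp (- (t\<^sup>2 * v) / 2)"
    and "integrable (centered_normal v) (\<lambda>x. x\<^sup>2)" "(\<integral>x. x\<^sup>2 \<partial>centered_normal v) = v"
proof -
  interpret Z: real_distribution std_normal_distribution by (rule real_dist_normal_dist)
  have [measurable]: "(\<lambda>x. sqrt v * x) \<in> measurable std_normal_distribution borel" by simp
  show "real_distribution (centered_normal v)"
    unfolding centered_normal_def by (rule Z.real_distribution_distr) simp
  have "char (centered_normal v) t = char std_normal_distribution (t * sqrt v)"
    unfolding centered_normal_def char_def by (subst integral_distr) (auto simp: mult.assoc)
  also have "\<dots> = exp (- (t\<^sup>2 * v) / 2)"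
    unfolding char_std_normal_distribution using assms by (simp add: power_mult_distrib)
  finally show "char (centered_normal v) t = exp (- (t\<^sup>2 * v) / 2)" .
  have i2: "integrable std_normal_distribution (\<lambda>x. x\<^sup>2)" by (rule integrable_std_normal_distribution_moment)
  have m2: "(\<integral>x. x\<^sup>2 \<partial>std_normal_distribution) = 1"
    using std_normal_distribution_even_moments[of 1] by (simp add: has_bochner_integral_iff)
  have [simp]: "(\<lambda>x::real. x\<^sup>2) \<in> borel_measurable borel" by simp
  show "integrable (centered_normal v) (\<lambda>x. x\<^sup>2)"
    unfolding centered_normal_def using i2 by (subst integrable_distr_eq) (auto simp: power_mult_distrib)
  show "(\<integral>x. x\<^sup>2 \<partial>centered_normal v) = v"
    unfolding centered_normal_def using assms m2 by (subst integral_distr) (auto simp: power_mult_distrib)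
qed

subsection \<open>Truncated likelihood ratios\<close>

text \<open>To be read with s and s' as roots of the two densities, g as the remainder of the
  quadratic mean expansion and w as half the score. Where the base density vanishes, s' = g. Where
  the ratio exceeds 4, s' > 2 s: if |w| \<le> 1/2 the remainder must account for the growth, with s'
  \<le> 4 g, and otherwise s' \<le> 2 (g + w s) and the score is in its tail.\<close>

lemma lr_complement_bound:
  fixes s s' g w :: real
  assumes s: "0 \<le> s" "0 \<le> s'" and eq: "s' = s + g + w * s" and nh: "\<not> (s'\<^sup>2 \<le> 4 * s\<^sup>2 \<and> 0 < s\<^sup>2)"
  shows "s'\<^sup>2 \<le> 16 * g\<^sup>2 + 8 * w\<^sup>2 * s\<^sup>2 * of_bool (1 / 2 < \<bar>w\<bar>)"
proof (cases "s = 0")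
  case True
  then show ?thesis using eq by simp
next
  case False
  then have s0: "0 < s" using s by simp
  then have "(2 * s)\<^sup>2 < s'\<^sup>2" using nh by (simp add: power_mult_distrib)
  then have s2: "2 * s < s'" by (rule power2_less_imp_less) (use s in simp)
  show ?thesis
  proof (cases "\<bar>w\<bar> \<le> 1 / 2")
    case True
    then have "w * s \<le> 1 / 2 * s" using s by (intro mult_right_mono) auto
    then have "s' \<le> 4 * g" using eq s2 by linarith
    then have "s'\<^sup>2 \<le> (4 * g)\<^sup>2" using s by (intro power_mono) auto
    then show ?thesis using True by (simp add: power_mult_distrib)
  next
    case False
    have "s' \<le> 2 * (g + w * s)" using eq s2 unfolding distrib_left by linarith
    then have "s'\<^sup>2 \<le> (2 * (g + w * s))\<^sup>2" using s by (intro power_mono) auto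
    also have "\<dots> \<le> 8 * g\<^sup>2 + 8 * (w * s)\<^sup>2"
      using sum_squares_bound[of g "w * s"] by (simp add: power2_eq_square algebra_simps)
    also have "\<dots> \<le> 16 * g\<^sup>2 + 8 * (w * s)\<^sup>2" by simp
    also have "\<dots> = 16 * g\<^sup>2 + 8 * w\<^sup>2 * s\<^sup>2 * of_bool (1 / 2 < \<bar>w\<bar>)"
      using False by (simp add: power_mult_distrib)
    finally show ?thesis .
  qed
qed

text \<open>With y = s' / s - 1 the ratio is 1 + 2 y + y^2, and y = w + d where d s = g, so r - 1 -
  2 w = 2 d + y^2. The truncation gives |y| \<le> 1, which keeps y^4 under control.\<close>

lemma lr_expansion_bound:
  fixes s s' g w \<eta> :: real
  assumes s: "0 \<le> s" "0 \<le> s'" and eq: "s' = s + g + w * s" and \<eta>: "0 < \<eta>" "\<eta> \<le> 1 / 2"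
  defines "r \<equiv> (if s'\<^sup>2 \<le> 4 * s\<^sup>2 \<and> 0 < s\<^sup>2 then s'\<^sup>2 / s\<^sup>2 else 0)"
  shows "(r - 1 - 2 * w)\<^sup>2 * s\<^sup>2 \<le> 20 * g\<^sup>2 + 8 * \<eta>\<^sup>2 * w\<^sup>2 * s\<^sup>2 + 16 * w\<^sup>2 * s\<^sup>2 * of_bool (\<eta> < \<bar>w\<bar>)"
proof (cases "s = 0")
  case True
  then show ?thesis by simp
next
  case False
  then have s0: "0 < s" using s by simp
  show ?thesis
  proof (cases "s'\<^sup>2 \<le> 4 * s\<^sup>2 \<and> 0 < s\<^sup>2")
    case True
    have "s'\<^sup>2 \<le> (2 * s)\<^sup>2" using True by (simp add: power_mult_distrib)
    then have s2: "s' \<le> 2 * s" by (rule power2_le_imp_le) (use s in simp)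
    define y where "y = s' / s - 1"
    define d where "d = y - w"
    have y: "\<bar>y\<bar> \<le> 1" using s s0 s2 by (auto simp: y_def abs_le_iff field_simps)
    have g: "g = d * s" using eq s0 by (simp add: d_def y_def field_simps)
    have r: "r - 1 - 2 * w = 2 * d + y\<^sup>2"
      using True s0 by (simp add: r_def d_def y_def power2_eq_square field_simps)
    have y2: "y\<^sup>2 \<le> 1" using y by (simp add: abs_square_le_1)
    have yw: "y\<^sup>2 \<le> 2 * d\<^sup>2 + 2 * w\<^sup>2"
    proof -
      have "y\<^sup>2 = (d + w)\<^sup>2" by (simp add: d_def)
      then show ?thesis using sum_squares_bound[of d w] by (simp add: power2_sum)
    qed
    \<comment> \<open>In the tail of w, y^4 \<le> y^2 is enough. Otherwise the bound on y^2 is used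
      twice and |w| \<le> \<eta> \<le> 1 supplies the factor \<eta>^2. Below, 2 (2 d)^2 + 2 y^4
      yields the constant 20 = 8 + 12.\<close>
    have y4: "(y\<^sup>2)\<^sup>2 \<le> 6 * d\<^sup>2 + 4 * \<eta>\<^sup>2 * w\<^sup>2 + 2 * w\<^sup>2 * of_bool (\<eta> < \<bar>w\<bar>)"
    proof (cases "\<eta> < \<bar>w\<bar>")
      case True
      have "(y\<^sup>2)\<^sup>2 \<le> y\<^sup>2 * 1" unfolding power2_eq_square[of "y\<^sup>2"] using y2 by (intro mult_left_mono) auto
      moreover have "0 \<le> d\<^sup>2" "0 \<le> 4 * \<eta>\<^sup>2 * w\<^sup>2" by simp_all
      moreover have "of_bool (\<eta> < \<bar>w\<bar>) = (1::real)" using True by simp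
      ultimately show ?thesis using yw by (simp only:)
    next
      case False
      have w2: "w\<^sup>2 \<le> \<eta>\<^sup>2" using False \<eta> by (metis abs_le_square_iff abs_of_pos not_le)
      have e2: "\<eta>\<^sup>2 \<le> 1" using \<eta> by (intro power_le_one) auto
      have "(y\<^sup>2)\<^sup>2 \<le> y\<^sup>2 * (2 * d\<^sup>2 + 2 * w\<^sup>2)"
        unfolding power2_eq_square[of "y\<^sup>2"] using yw by (intro mult_left_mono) auto
      also have "\<dots> = y\<^sup>2 * (2 * d\<^sup>2) + y\<^sup>2 * (2 * w\<^sup>2)" by (simp add: algebra_simps)
      also have "\<dots> \<le> 1 * (2 * d\<^sup>2) + (2 * d\<^sup>2 + 2 * w\<^sup>2) * (2 * w\<^sup>2)"
        using y2 yw by (intro add_mono mult_right_mono) auto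
      also have "(2 * d\<^sup>2 + 2 * w\<^sup>2) * (2 * w\<^sup>2) = d\<^sup>2 * (4 * w\<^sup>2) + w\<^sup>2 * (4 * w\<^sup>2)" by (simp add: algebra_simps)
      also have "\<dots> \<le> d\<^sup>2 * 4 + \<eta>\<^sup>2 * (4 * w\<^sup>2)"
        using w2 e2 by (intro add_mono mult_left_mono mult_right_mono) auto
      finally show ?thesis using False by simp
    qed
    have "(2 * d + y\<^sup>2)\<^sup>2 \<le> 2 * (2 * d)\<^sup>2 + 2 * (y\<^sup>2)\<^sup>2"
      using sum_squares_bound[of "2 * d" "y\<^sup>2"] by (simp add: power2_sum)
    moreover have "(2 * d)\<^sup>2 = 4 * d\<^sup>2" by (simp add: power_mult_distrib)
    moreover have "0 \<le> w\<^sup>2 * of_bool (\<eta> < \<bar>w\<bar>)" by simp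
    ultimately have "(r - 1 - 2 * w)\<^sup>2 \<le> 20 * d\<^sup>2 + 8 * \<eta>\<^sup>2 * w\<^sup>2 + 16 * w\<^sup>2 * of_bool (\<eta> < \<bar>w\<bar>)"
      unfolding r using y4 unfolding mult.assoc by linarith
    then have "(r - 1 - 2 * w)\<^sup>2 * s\<^sup>2 \<le> (20 * d\<^sup>2 + 8 * \<eta>\<^sup>2 * w\<^sup>2 + 16 * w\<^sup>2 * of_bool (\<eta> < \<bar>w\<bar>)) * s\<^sup>2"
      by (intro mult_right_mono) auto
    then show ?thesis by (simp add: g power_mult_distrib algebra_simps)
  next
    \<comment> \<open>The ratio is cut off here, so (1 + 2 w)^2 s^2 has to be bounded. For |w| \<le>
      1/2, s' > 2 s forces s \<le> 2 g; for larger |w|, |1 + 2 w| \<le> 4 |w|, which is where the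
      constant 16 comes from.\<close>
    case nh: False
    then have r: "r = 0" unfolding r_def by (rule if_not_P)
    have "(2 * s)\<^sup>2 < s'\<^sup>2" using nh s0 by (simp add: power_mult_distrib)
    then have s2: "2 * s < s'" by (rule power2_less_imp_less) (use s in simp)
    have nn: "0 \<le> \<eta>\<^sup>2 * w\<^sup>2 * s\<^sup>2" "0 \<le> g\<^sup>2" by simp_all
    show ?thesis
    proof (cases "\<bar>w\<bar> \<le> 1 / 2")
      case True
      then have "w * s \<le> 1 / 2 * s" using s by (intro mult_right_mono) auto
      then have g: "s \<le> 2 * g" using eq s2 by linarith
      have "\<bar>1 + 2 * w\<bar> * s \<le> 2 * (2 * g)" using True g s by (intro mult_mono) auto
      then have "(\<bar>1 + 2 * w\<bar> * s)\<^sup>2 \<le> (2 * (2 * g))\<^sup>2" using s by (intro power_mono) auto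
      also have "(\<bar>1 + 2 * w\<bar> * s)\<^sup>2 = (r - 1 - 2 * w)\<^sup>2 * s\<^sup>2"
        unfolding r power_mult_distrib power2_abs by (simp add: power2_eq_square algebra_simps)
      also have "(2 * (2 * g))\<^sup>2 = 16 * g\<^sup>2" by (simp add: power_mult_distrib)
      finally have "(r - 1 - 2 * w)\<^sup>2 * s\<^sup>2 \<le> 16 * g\<^sup>2" .
      moreover have "0 \<le> 16 * w\<^sup>2 * s\<^sup>2 * of_bool (\<eta> < \<bar>w\<bar>)" by simp
      moreover have "0 \<le> 8 * \<eta>\<^sup>2 * w\<^sup>2 * s\<^sup>2" by simp
      ultimately show ?thesis using nn by linarith
    next
      case False
      have "\<bar>- 1 - 2 * w\<bar> \<le> 4 * \<bar>w\<bar>" using False by linarith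
      then have "(\<bar>- 1 - 2 * w\<bar>)\<^sup>2 \<le> (4 * \<bar>w\<bar>)\<^sup>2" by (intro power_mono) auto
      then have "(r - 1 - 2 * w)\<^sup>2 * s\<^sup>2 \<le> 16 * w\<^sup>2 * s\<^sup>2" by (intro mult_right_mono) (auto simp: r power_mult_distrib)
      moreover have "of_bool (\<eta> < \<bar>w\<bar>) = (1::real)" using False \<eta> by simp
      moreover have "0 \<le> 8 * \<eta>\<^sup>2 * w\<^sup>2 * s\<^sup>2" by simp
      ultimately show ?thesis using nn by (simp only: mult_1_right)
    qed
  qed
qed

text \<open>In the lemmas the parameter \<open>\<tau>\<close> is written \<open>p\<close> and a shift \<open>\<Delta>\<close> of it \<open>h\<close>.\<close>

locale dqm_model =
  fixes MX :: "'x measure" and MTh :: "'t measure" and \<nu> :: "'x measure"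
    and T :: "(real ^ 'd) set" and F :: "real ^ 'd \<Rightarrow> ('x \<times> 't) measure"
    and f :: "real ^ 'd \<Rightarrow> 'x \<Rightarrow> real" and \<rho> :: "real ^ 'd \<Rightarrow> 'x \<Rightarrow> real ^ 'd"
  assumes openT: "open T"
    and F_prob: "\<And>p. p \<in> T \<Longrightarrow> prob_space (F p)"
    and sets_F: "\<And>p. p \<in> T \<Longrightarrow> sets (F p) = sets (MX \<Otimes>\<^sub>M MTh)"
    and sets_\<nu>: "sets \<nu> = sets MX"
    and f_meas: "\<And>p. p \<in> T \<Longrightarrow> f p \<in> borel_measurable MX"
    and f_nonneg: "\<And>p x. p \<in> T \<Longrightarrow> x \<in> space MX \<Longrightarrow> 0 \<le> f p x"
    and F_marginal: "\<And>p. p \<in> T \<Longrightarrow> distr (F p) MX fst = density \<nu> (\<lambda>x. ennreal (f p x))"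
    and \<rho>_meas: "\<And>p. p \<in> T \<Longrightarrow> \<rho> p \<in> borel_measurable MX"
    and dqm: "\<And>p. p \<in> T \<Longrightarrow> quadratic_mean_diff \<nu> f (\<rho> p) p"
begin

lemma fst_F: "p \<in> T \<Longrightarrow> fst \<in> measurable (F p) MX"
  by (rule measurable_fst_sets[OF sets_F])

lemma comp_F: "p \<in> T \<Longrightarrow> g \<in> measurable MX N \<Longrightarrow> (\<lambda>z. g (fst z)) \<in> measurable (F p) N"
  by (rule measurable_compose[OF fst_F])

lemma fst_space: "p \<in> T \<Longrightarrow> z \<in> space (F p) \<Longrightarrow> fst z \<in> space MX"
  by (rule measurable_space[OF fst_F])

lemma space_\<nu>: "space \<nu> = space MX"
  by (rule sets_eq_imp_space_eq[OF sets_\<nu>])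

lemma meas_\<nu>: "measurable \<nu> N = measurable MX N"
  by (rule measurable_cong_sets[OF sets_\<nu> refl])

lemma nn_integral_F:
  assumes p: "p \<in> T" and g: "g \<in> borel_measurable MX"
  shows "(\<integral>\<^sup>+z. g (fst z) \<partial>F p) = (\<integral>\<^sup>+x. ennreal (f p x) * g x \<partial>\<nu>)"
proof -
  have "(\<integral>\<^sup>+z. g (fst z) \<partial>F p) = (\<integral>\<^sup>+x. g x \<partial>distr (F p) MX fst)"
    using g by (subst nn_integral_distr[OF fst_F[OF p]]) auto
  also have "\<dots> = (\<integral>\<^sup>+x. ennreal (f p x) * g x \<partial>\<nu>)"
    unfolding F_marginal[OF p] using f_meas[OF p] g by (subst nn_integral_density) (auto simp: meas_\<nu>)
  finally show ?thesis .
qed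

lemma integral_F:
  fixes g :: "'x \<Rightarrow> 'b::{banach, second_countable_topology}"
  assumes p: "p \<in> T" and g: "g \<in> borel_measurable MX"
  shows "(\<integral>z. g (fst z) \<partial>F p) = (\<integral>x. f p x *\<^sub>R g x \<partial>\<nu>)"
proof -
  have "(\<integral>z. g (fst z) \<partial>F p) = (\<integral>x. g x \<partial>distr (F p) MX fst)"
    using g by (subst integral_distr[OF fst_F[OF p]]) auto
  also have "\<dots> = (\<integral>x. f p x *\<^sub>R g x \<partial>\<nu>)"
    unfolding F_marginal[OF p] using f_meas[OF p] g f_nonneg[OF p]
    by (subst integral_density) (auto simp: meas_\<nu> space_\<nu> intro!: AE_I2)
  finally show ?thesis .
qed

text \<open>The likelihood ratio is set to \<open>0\<close> where it exceeds \<open>4\<close>: this costs only \<open>o(\<parallel>h\<parallel>\<^sup>2)\<close> of mass, and the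
  truncated ratio is square integrable.\<close>

definition lr_set :: "real ^ 'd \<Rightarrow> real ^ 'd \<Rightarrow> 'x set" where
  "lr_set p h = {x \<in> space MX. f (p + h) x \<le> 4 * f p x \<and> 0 < f p x}"

definition lr :: "real ^ 'd \<Rightarrow> real ^ 'd \<Rightarrow> 'x \<Rightarrow> real" where
  "lr p h x = (if x \<in> lr_set p h then f (p + h) x / f p x else 0)"

lemma lr_set_sets: "p \<in> T \<Longrightarrow> p + h \<in> T \<Longrightarrow> lr_set p h \<in> sets MX"
  using f_meas[of p] f_meas[of "p + h"] unfolding lr_set_def by measurable

lemma lr_meas:
  assumes "p \<in> T" "p + h \<in> T"
  shows "lr p h \<in> borel_measurable MX"
proof -
  note [measurable] = f_meas[OF assms(1)] f_meas[OF assms(2)] lr_set_sets[OF assms]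
  show ?thesis unfolding lr_def[abs_def] by measurable
qed

lemma lr_bounds:
  assumes "p \<in> T" "p + h \<in> T"
  shows "0 \<le> lr p h x" "lr p h x \<le> 4"
  using f_nonneg[OF assms(1), of x] f_nonneg[OF assms(2), of x]
  by (auto simp: lr_def lr_set_def field_simps)

text \<open>On \<open>lr_set\<close> the density of the shifted law is exactly the ratio times the
  base density. The indicator on the left is the price for laws that need not dominate one
  another.\<close>

lemma lr_change:
  fixes H :: "'x \<Rightarrow> 'b::{real_normed_field, banach, second_countable_topology}"
  assumes p: "p \<in> T" "p + h \<in> T" and H: "H \<in> borel_measurable MX"
  shows "(\<integral>z. H (fst z) * of_real (indicator (lr_set p h) (fst z)) \<partial>F (p + h)) =
         (\<integral>z. H (fst z) * of_real (lr p h (fst z)) \<partial>F p)"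
proof -
  note [measurable] = H lr_meas[OF p] lr_set_sets[OF p]
  have "(\<integral>z. H (fst z) * of_real (indicator (lr_set p h) (fst z)) \<partial>F (p + h)) =
      (\<integral>x. f (p + h) x *\<^sub>R (H x * of_real (indicator (lr_set p h) x)) \<partial>\<nu>)"
    by (rule integral_F[OF p(2)]) measurable
  also have "\<dots> = (\<integral>x. f p x *\<^sub>R (H x * of_real (lr p h x)) \<partial>\<nu>)"
    by (rule Bochner_Integration.integral_cong[OF refl])
      (auto simp: lr_def lr_set_def indicator_def scaleR_conv_of_real)
  also have "\<dots> = (\<integral>z. H (fst z) * of_real (lr p h (fst z)) \<partial>F p)"
    by (rule integral_F[OF p(1), symmetric]) measurable
  finally show ?thesis .
qed

section \<open>Consequences of differentiability in quadratic mean\<close>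

definition dqm_rem :: "real ^ 'd \<Rightarrow> real ^ 'd \<Rightarrow> 'x \<Rightarrow> real" where
  "dqm_rem p h x = sqrt (f (p + h) x) - sqrt (f p x) - (1 / 2) * (h \<bullet> \<rho> p x) * sqrt (f p x)"

lemma dqm_rem_meas: "p \<in> T \<Longrightarrow> p + h \<in> T \<Longrightarrow> dqm_rem p h \<in> borel_measurable MX"
  using f_meas[of p] f_meas[of "p + h"] \<rho>_meas[of p] unfolding dqm_rem_def[abs_def] by measurable

text \<open>The limit as an \<epsilon>-\<delta> bound that includes h = 0, a point excluded by the
  limit, and puts p + h into the open parameter space.\<close>

lemma dqm_small:
  assumes p: "p \<in> T" and \<epsilon>: "0 < \<epsilon>"
  shows "\<exists>\<delta>>0. \<forall>h. norm h < \<delta> \<longrightarrow> p + h \<in> T \<and>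
    (\<integral>\<^sup>+x. ennreal ((dqm_rem p h x)\<^sup>2) \<partial>\<nu>) \<le> ennreal (\<epsilon> * (norm h)\<^sup>2)"
proof -
  obtain d1 where d1: "0 < d1" "ball p d1 \<subseteq> T" using openT p by (meson open_contains_ball)
  have "\<forall>\<^sub>F h in at 0. (\<integral>\<^sup>+x. ennreal ((dqm_rem p h x)\<^sup>2) \<partial>\<nu>) / ennreal ((norm h)\<^sup>2) < ennreal \<epsilon>"
    using dqm[OF p] \<epsilon> unfolding quadratic_mean_diff_def dqm_rem_def
    by (intro order_tendstoD(2)) auto
  then obtain d2 where d2: "0 < d2" "\<And>h. h \<noteq> 0 \<Longrightarrow> norm h < d2 \<Longrightarrow>
      (\<integral>\<^sup>+x. ennreal ((dqm_rem p h x)\<^sup>2) \<partial>\<nu>) / ennreal ((norm h)\<^sup>2) < ennreal \<epsilon>"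
    unfolding eventually_at by (auto simp: dist_norm)
  show ?thesis
  proof (intro exI[of _ "min d1 d2"] conjI allI impI)
    show "0 < min d1 d2" using d1 d2 by simp
    fix h :: "real ^ 'd" assume D: "norm h < min d1 d2"
    then show "p + h \<in> T" using d1 by (auto simp: subset_iff dist_norm)
    show "(\<integral>\<^sup>+x. ennreal ((dqm_rem p h x)\<^sup>2) \<partial>\<nu>) \<le> ennreal (\<epsilon> * (norm h)\<^sup>2)"
    proof (cases "h = 0")
      case True
      then show ?thesis by (simp add: dqm_rem_def)
    next
      case False
      define I where "I = (\<integral>\<^sup>+x. ennreal ((dqm_rem p h x)\<^sup>2) \<partial>\<nu>)"
      have n0: "0 < (norm h)\<^sup>2" using False by simp
      have "I / ennreal ((norm h)\<^sup>2) \<le> ennreal \<epsilon>" using d2(2)[OF False] D by (simp add: I_def less_imp_le)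
      then have "I / ennreal ((norm h)\<^sup>2) * ennreal ((norm h)\<^sup>2) \<le> ennreal \<epsilon> * ennreal ((norm h)\<^sup>2)"
        by (rule mult_right_mono) simp
      moreover have "I / ennreal ((norm h)\<^sup>2) * ennreal ((norm h)\<^sup>2) = I"
        using n0 unfolding ennreal_divide_times by (subst ennreal_divide_self) auto
      ultimately show ?thesis using \<epsilon> by (simp add: I_def ennreal_mult'')
    qed
  qed
qed

lemma nn_integral_f: "p \<in> T \<Longrightarrow> (\<integral>\<^sup>+x. ennreal (f p x) \<partial>\<nu>) = 1"
  using nn_integral_F[of p "\<lambda>_. 1"] prob_space.emeasure_space_1[OF F_prob] by simp

text \<open>Up to the remainder, (h . \<rho>) sqrt f is twice a difference of root densities, and
  those have L2 norm 1. A single multiple h = c a inside the neighbourhood of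
  \<open>dqm_small\<close> therefore bounds the integral.\<close>

lemma score_direction_L2:
  assumes p: "p \<in> T"
  shows "(\<integral>\<^sup>+z. ennreal ((a \<bullet> \<rho> p (fst z))\<^sup>2) \<partial>F p) < \<infinity>"
proof -
  obtain \<delta> where \<delta>: "0 < \<delta>" "\<And>h. norm h < \<delta> \<Longrightarrow> p + h \<in> T \<and>
      (\<integral>\<^sup>+x. ennreal ((dqm_rem p h x)\<^sup>2) \<partial>\<nu>) \<le> ennreal (1 * (norm h)\<^sup>2)"
    using dqm_small[OF p, of 1] by auto
  define c where "c = \<delta> / (2 * (norm a + 1))"
  have c: "0 < c" using \<delta> by (simp add: c_def add_nonneg_pos)
  define h where "h = c *\<^sub>R a"
  have "norm h < \<delta>"
  proof -
    have "c * norm a \<le> c * (norm a + 1)" using c by simp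
    also have "\<dots> = \<delta> / 2" unfolding c_def by (simp add: field_simps add_nonneg_eq_0_iff)
    finally show ?thesis using \<delta> c by (simp add: h_def)
  qed
  note D = \<delta>(2)[OF this]
  have [measurable]: "f p \<in> borel_measurable \<nu>" "f (p + h) \<in> borel_measurable \<nu>"
      "dqm_rem p h \<in> borel_measurable \<nu>" "\<rho> p \<in> borel_measurable MX"
    using f_meas[OF p] f_meas[of "p + h"] dqm_rem_meas[OF p] D \<rho>_meas[OF p] by (auto simp: meas_\<nu>)
  have pw: "c\<^sup>2 * (a \<bullet> \<rho> p x)\<^sup>2 * f p x \<le> 8 * (dqm_rem p h x)\<^sup>2 + 16 * f (p + h) x + 16 * f p x"
    if "x \<in> space MX" for x
  proof -
    define s s' where "s = sqrt (f p x)" and "s' = sqrt (f (p + h) x)"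
    have sq: "f p x = s\<^sup>2" "f (p + h) x = s'\<^sup>2"
      using f_nonneg[OF p that] f_nonneg[OF conjunct1[OF D] that] by (simp_all add: s_def s'_def)
    have "c * (a \<bullet> \<rho> p x) * s = 2 * (s' - s - dqm_rem p h x)"
      by (simp add: dqm_rem_def h_def s_def s'_def)
    then have "(c * (a \<bullet> \<rho> p x) * s)\<^sup>2 = 4 * (s' - s - dqm_rem p h x)\<^sup>2"
      by (simp only: power_mult_distrib) simp
    also have "\<dots> \<le> 8 * (dqm_rem p h x)\<^sup>2 + 16 * s'\<^sup>2 + 16 * s\<^sup>2"
    proof -
      define R where "R = dqm_rem p h x"
      \<comment> \<open>The right side of the bound minus the left is 4 (s' - s + R)^2 + 8 (s' +
        s)^2.\<close>
      have "0 \<le> (s' - s + R)\<^sup>2" "0 \<le> (s' + s)\<^sup>2" by simp_all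
      then have "4 * (s' - s - R)\<^sup>2 \<le> 8 * R\<^sup>2 + 16 * s'\<^sup>2 + 16 * s\<^sup>2"
        by (simp add: power2_eq_square algebra_simps)
      then show ?thesis by (simp add: R_def)
    qed
    finally show ?thesis by (simp add: sq power_mult_distrib)
  qed
  have "ennreal (c\<^sup>2) * (\<integral>\<^sup>+z. ennreal ((a \<bullet> \<rho> p (fst z))\<^sup>2) \<partial>F p) =
      (\<integral>\<^sup>+z. ennreal (c\<^sup>2) * ennreal ((a \<bullet> \<rho> p (fst z))\<^sup>2) \<partial>F p)"
    by (rule nn_integral_cmult[symmetric]) (rule comp_F[OF p], measurable)
  also have "\<dots> = (\<integral>\<^sup>+x. ennreal (f p x) * (ennreal (c\<^sup>2) * ennreal ((a \<bullet> \<rho> p x)\<^sup>2)) \<partial>\<nu>)"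
    by (rule nn_integral_F[OF p]) measurable
  also have "\<dots> = (\<integral>\<^sup>+x. ennreal (c\<^sup>2 * (a \<bullet> \<rho> p x)\<^sup>2 * f p x) \<partial>\<nu>)"
    by (rule nn_integral_cong) (use f_nonneg[OF p] in \<open>auto simp: space_\<nu> ennreal_mult' ennreal_mult mult_ac\<close>)
  also have "\<dots> \<le> (\<integral>\<^sup>+x. ennreal (8 * (dqm_rem p h x)\<^sup>2 + 16 * f (p + h) x + 16 * f p x) \<partial>\<nu>)"
    by (rule nn_integral_mono) (use pw in \<open>auto simp: space_\<nu> intro!: ennreal_leI\<close>)
  also have "\<dots> = (\<integral>\<^sup>+x. 8 * ennreal ((dqm_rem p h x)\<^sup>2) + 16 * ennreal (f (p + h) x) + 16 * ennreal (f p x) \<partial>\<nu>)"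
    by (rule nn_integral_cong)
      (use f_nonneg[OF p] f_nonneg[OF conjunct1[OF D]] in \<open>auto simp: space_\<nu> ennreal_plus ennreal_mult'\<close>)
  also have "\<dots> = 8 * (\<integral>\<^sup>+x. ennreal ((dqm_rem p h x)\<^sup>2) \<partial>\<nu>) + 16 * 1 + 16 * 1"
    using D by (simp add: nn_integral_add nn_integral_cmult nn_integral_f p)
  also have "\<dots> < \<infinity>"
  proof -
    have "(\<integral>\<^sup>+x. ennreal ((dqm_rem p h x)\<^sup>2) \<partial>\<nu>) < \<top>"
      using D ennreal_less_top le_less_trans by blast
    then show ?thesis by (simp add: ennreal_mult_less_top)
  qed
  finally show ?thesis using c by (auto simp: ennreal_mult_less_top)
qed

lemma score_L2:
  assumes p: "p \<in> T"
  shows "integrable (F p) (\<lambda>z. (norm (\<rho> p (fst z)))\<^sup>2)" "integrable (F p) (\<lambda>z. (a \<bullet> \<rho> p (fst z))\<^sup>2)"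
proof -
  note [measurable] = \<rho>_meas[OF p]
  have "(\<lambda>z. \<rho> p (fst z)) \<in> borel_measurable (F p)" by (rule comp_F[OF p]) measurable
  note [measurable] = this
  show i: "integrable (F p) (\<lambda>z. (a \<bullet> \<rho> p (fst z))\<^sup>2)" for a
    using score_direction_L2[OF p, of a] by (intro integrableI_nonneg) auto
  have "(norm (\<rho> p (fst z)))\<^sup>2 = (\<Sum>b\<in>Basis. (b \<bullet> \<rho> p (fst z))\<^sup>2)" for z :: "'x \<times> 't"
    by (subst euclidean_inner[of "\<rho> p (fst z)" "\<rho> p (fst z)", folded power2_norm_eq_inner])
      (simp add: power2_eq_square inner_commute)
  then show "integrable (F p) (\<lambda>z. (norm (\<rho> p (fst z)))\<^sup>2)"
    by (simp only:) (intro Bochner_Integration.integrable_sum i)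
qed

text \<open>The score is square integrable, so its tail beyond \<open>\<eta> / \<parallel>h\<parallel>\<close> is \<open>o(1)\<close>.\<close>

lemma score_tail:
  assumes p: "p \<in> T" and \<epsilon>: "0 < \<epsilon>" and \<eta>: "0 < \<eta>"
  shows "\<exists>\<delta>>0. \<forall>h. norm h < \<delta> \<longrightarrow>
    (\<integral>\<^sup>+x. ennreal ((h \<bullet> \<rho> p x)\<^sup>2 * f p x * of_bool (\<eta> < \<bar>h \<bullet> \<rho> p x\<bar>)) \<partial>\<nu>) \<le> ennreal (\<epsilon> * (norm h)\<^sup>2)"
proof -
  note [measurable] = \<rho>_meas[OF p] f_meas[OF p]
  have rm[measurable]: "(\<lambda>z. \<rho> p (fst z)) \<in> borel_measurable (F p)" by (rule comp_F[OF p]) measurable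
  have tl: "(\<lambda>k. \<integral>z. (norm (\<rho> p (fst z)))\<^sup>2 * of_bool (real k < norm (\<rho> p (fst z))) \<partial>F p) \<longlonglongrightarrow> (\<integral>z. 0 \<partial>F p)"
  proof (rule integral_dominated_convergence[OF _ _ score_L2(1)[OF p]])
    show "AE z in F p. (\<lambda>k. (norm (\<rho> p (fst z)))\<^sup>2 * of_bool (real k < norm (\<rho> p (fst z)))) \<longlonglongrightarrow> 0"
    proof (rule AE_I2)
      fix z
      have "\<forall>\<^sub>F k in sequentially. (norm (\<rho> p (fst z)))\<^sup>2 * of_bool (real k < norm (\<rho> p (fst z))) = 0"
        using eventually_ge_at_top[of "nat \<lceil>norm (\<rho> p (fst z))\<rceil>"] 
      proof eventually_elim
        case (elim k)
        then have "\<not> real k < norm (\<rho> p (fst z))" by linarith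
        then show ?case by simp
      qed
      then show "(\<lambda>k. (norm (\<rho> p (fst z)))\<^sup>2 * of_bool (real k < norm (\<rho> p (fst z)))) \<longlonglongrightarrow> 0"
        by (rule tendsto_eventually)
    qed
  qed (auto simp: of_bool_def)
  obtain k where k: "(\<integral>z. (norm (\<rho> p (fst z)))\<^sup>2 * of_bool (real k < norm (\<rho> p (fst z))) \<partial>F p) < \<epsilon>"
    using LIMSEQ_D[OF tl \<epsilon>] by fastforce
  have nk: "(\<integral>\<^sup>+z. ennreal ((norm (\<rho> p (fst z)))\<^sup>2 * of_bool (real k < norm (\<rho> p (fst z)))) \<partial>F p) \<le> ennreal \<epsilon>"
  proof (subst nn_integral_eq_integral)
    show "integrable (F p) (\<lambda>z. (norm (\<rho> p (fst z)))\<^sup>2 * of_bool (real k < norm (\<rho> p (fst z))))"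
      by (rule Bochner_Integration.integrable_bound[OF score_L2(1)[OF p]]) (auto simp: of_bool_def)
  qed (use k in \<open>auto intro: ennreal_leI\<close>)
  show ?thesis
  \<comment> \<open>For such h, |h . \<rho>| > \<eta> forces the norm of \<rho> beyond k by
    Cauchy-Schwarz, so the tail of h . \<rho> is contained in the norm tail chosen above.\<close>
  proof (intro exI[of _ "\<eta> / (real k + 1)"] conjI allI impI)
    show "0 < \<eta> / (real k + 1)" using \<eta> by simp
    fix h :: "real ^ 'd" assume D: "norm h < \<eta> / (real k + 1)"
    have pw: "(h \<bullet> \<rho> p x)\<^sup>2 * of_bool (\<eta> < \<bar>h \<bullet> \<rho> p x\<bar>) \<le>
        (norm h)\<^sup>2 * ((norm (\<rho> p x))\<^sup>2 * of_bool (real k < norm (\<rho> p x)))" for x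
    proof (cases "\<eta> < \<bar>h \<bullet> \<rho> p x\<bar>")
      case True
      have cs: "\<bar>h \<bullet> \<rho> p x\<bar> \<le> norm h * norm (\<rho> p x)" by (rule Cauchy_Schwarz_ineq2)
      have "real k < norm (\<rho> p x)"
      proof (rule ccontr)
        assume "\<not> real k < norm (\<rho> p x)"
        then have "norm h * norm (\<rho> p x) \<le> \<eta> / (real k + 1) * (real k + 1)"
          using D \<eta> by (intro mult_mono) auto
        then show False using True cs by simp
      qed
      moreover have "(\<bar>h \<bullet> \<rho> p x\<bar>)\<^sup>2 \<le> (norm h * norm (\<rho> p x))\<^sup>2" by (rule power_mono[OF cs]) simp
      ultimately show ?thesis using True by (simp add: power_mult_distrib)
    qed simp
    have "(\<integral>\<^sup>+x. ennreal ((h \<bullet> \<rho> p x)\<^sup>2 * f p x * of_bool (\<eta> < \<bar>h \<bullet> \<rho> p x\<bar>)) \<partial>\<nu>) \<le>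
      (\<integral>\<^sup>+x. ennreal (f p x) * (ennreal ((norm h)\<^sup>2) * ennreal ((norm (\<rho> p x))\<^sup>2 * of_bool (real k < norm (\<rho> p x)))) \<partial>\<nu>)"
    proof (rule nn_integral_mono)
      fix x assume "x \<in> space \<nu>"
      then have f0: "0 \<le> f p x" using f_nonneg[OF p] by (simp add: space_\<nu>)
      have "(h \<bullet> \<rho> p x)\<^sup>2 * f p x * of_bool (\<eta> < \<bar>h \<bullet> \<rho> p x\<bar>) =
        f p x * ((h \<bullet> \<rho> p x)\<^sup>2 * of_bool (\<eta> < \<bar>h \<bullet> \<rho> p x\<bar>))" by simp
      also have "\<dots> \<le> f p x * ((norm h)\<^sup>2 * ((norm (\<rho> p x))\<^sup>2 * of_bool (real k < norm (\<rho> p x))))"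
        by (rule mult_left_mono[OF pw f0])
      finally show "ennreal ((h \<bullet> \<rho> p x)\<^sup>2 * f p x * of_bool (\<eta> < \<bar>h \<bullet> \<rho> p x\<bar>)) \<le>
        ennreal (f p x) * (ennreal ((norm h)\<^sup>2) * ennreal ((norm (\<rho> p x))\<^sup>2 * of_bool (real k < norm (\<rho> p x))))"
        using f0 by (simp add: ennreal_leI flip: ennreal_mult)
    qed
    also have "\<dots> = (\<integral>\<^sup>+z. ennreal ((norm h)\<^sup>2) * ennreal ((norm (\<rho> p (fst z)))\<^sup>2 * of_bool (real k < norm (\<rho> p (fst z)))) \<partial>F p)"
      by (rule nn_integral_F[OF p, symmetric]) measurable
    also have "\<dots> = ennreal ((norm h)\<^sup>2) * (\<integral>\<^sup>+z. ennreal ((norm (\<rho> p (fst z)))\<^sup>2 * of_bool (real k < norm (\<rho> p (fst z)))) \<partial>F p)"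
      by (rule nn_integral_cmult) measurable
    also have "\<dots> \<le> ennreal ((norm h)\<^sup>2) * ennreal \<epsilon>" by (rule mult_left_mono[OF nk]) simp
    also have "\<dots> = ennreal (\<epsilon> * (norm h)\<^sup>2)" using \<epsilon> by (simp add: ennreal_mult mult.commute)
    finally show "(\<integral>\<^sup>+x. ennreal ((h \<bullet> \<rho> p x)\<^sup>2 * f p x * of_bool (\<eta> < \<bar>h \<bullet> \<rho> p x\<bar>)) \<partial>\<nu>) \<le> ennreal (\<epsilon> * (norm h)\<^sup>2)" .
  qed
qed

text \<open>\<open>lr_complement_bound\<close> with w = h . \<rho> / 2 bounds the density off
  \<open>lr_set\<close> by the squared remainder and the score tail beyond 1, both of which are
  o(|h|^2) after integration.\<close>

lemma lr_mass:
  assumes p: "p \<in> T" and \<epsilon>: "0 < \<epsilon>"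
  shows "\<exists>\<delta>>0. \<forall>h. norm h < \<delta> \<longrightarrow> p + h \<in> T \<and>
    measure (F (p + h)) {z \<in> space (F (p + h)). fst z \<notin> lr_set p h} \<le> \<epsilon> * (norm h)\<^sup>2"
proof -
  \<comment> \<open>The coefficients 16 and 2 of the pointwise bound turn these into \<epsilon>/2 +
    \<epsilon>/2.\<close>
  have "0 < \<epsilon> / 32" "0 < \<epsilon> / 4" using \<epsilon> by auto
  obtain d1 where d1: "0 < d1" "\<And>h. norm h < d1 \<Longrightarrow> p + h \<in> T \<and>
      (\<integral>\<^sup>+x. ennreal ((dqm_rem p h x)\<^sup>2) \<partial>\<nu>) \<le> ennreal (\<epsilon> / 32 * (norm h)\<^sup>2)"
    using dqm_small[OF p \<open>0 < \<epsilon> / 32\<close>] by auto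
  obtain d2 where d2: "0 < d2" "\<And>h. norm h < d2 \<Longrightarrow>
      (\<integral>\<^sup>+x. ennreal ((h \<bullet> \<rho> p x)\<^sup>2 * f p x * of_bool (1 < \<bar>h \<bullet> \<rho> p x\<bar>)) \<partial>\<nu>) \<le> ennreal (\<epsilon> / 4 * (norm h)\<^sup>2)"
    using score_tail[OF p \<open>0 < \<epsilon> / 4\<close>, of 1] by auto
  show ?thesis
  proof (intro exI[of _ "min d1 d2"] conjI allI impI)
    show "0 < min d1 d2" using d1 d2 by simp
    fix h :: "real ^ 'd" assume D: "norm h < min d1 d2"
    then show p': "p + h \<in> T" using d1(2) by simp
    interpret prob_space "F (p + h)" by (rule F_prob[OF p'])
    note [measurable] = \<rho>_meas[OF p] f_meas[OF p] f_meas[OF p'] lr_set_sets[OF p p'] dqm_rem_meas[OF p p']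
    have ms: "{z \<in> space (F (p + h)). fst z \<notin> lr_set p h} \<in> sets (F (p + h))"
      using comp_F[OF p', of "\<lambda>x. x \<in> lr_set p h" "count_space UNIV"] by measurable
    have pw: "f (p + h) x * of_bool (x \<notin> lr_set p h) \<le>
        16 * (dqm_rem p h x)\<^sup>2 + 2 * ((h \<bullet> \<rho> p x)\<^sup>2 * f p x * of_bool (1 < \<bar>h \<bullet> \<rho> p x\<bar>))"
      if x: "x \<in> space MX" for x
    proof (cases "x \<in> lr_set p h")
      case True
      then show ?thesis using f_nonneg[OF p x] by simp
    next
      case False
      define s s' where "s = sqrt (f p x)" and "s' = sqrt (f (p + h) x)"
      have sq: "f p x = s\<^sup>2" "f (p + h) x = s'\<^sup>2" and nn: "0 \<le> s" "0 \<le> s'"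
        using f_nonneg[OF p x] f_nonneg[OF p' x] by (simp_all add: s_def s'_def)
      have "s' = s + dqm_rem p h x + (h \<bullet> \<rho> p x / 2) * s"
        by (simp add: dqm_rem_def s_def s'_def)
      from lr_complement_bound[OF nn this] False x show ?thesis
        by (simp add: lr_set_def sq power_divide)
    qed
    have "emeasure (F (p + h)) {z \<in> space (F (p + h)). fst z \<notin> lr_set p h} =
        (\<integral>\<^sup>+z. indicator {z \<in> space (F (p + h)). fst z \<notin> lr_set p h} z \<partial>F (p + h))"
      using ms by simp
    also have "\<dots> = (\<integral>\<^sup>+z. ennreal (of_bool (fst z \<notin> lr_set p h)) \<partial>F (p + h))"
      by (rule nn_integral_cong) (auto simp: indicator_def)
    also have "\<dots> = (\<integral>\<^sup>+x. ennreal (f (p + h) x) * ennreal (of_bool (x \<notin> lr_set p h)) \<partial>\<nu>)"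
      by (rule nn_integral_F[OF p']) measurable
    also have "\<dots> \<le> (\<integral>\<^sup>+x. 16 * ennreal ((dqm_rem p h x)\<^sup>2) +
        2 * ennreal ((h \<bullet> \<rho> p x)\<^sup>2 * f p x * of_bool (1 < \<bar>h \<bullet> \<rho> p x\<bar>)) \<partial>\<nu>)"
    proof (rule nn_integral_mono)
      fix x assume "x \<in> space \<nu>"
      then have x: "x \<in> space MX" by (simp add: space_\<nu>)
      have "ennreal (f (p + h) x) * ennreal (of_bool (x \<notin> lr_set p h)) = ennreal (f (p + h) x * of_bool (x \<notin> lr_set p h))"
        using f_nonneg[OF p' x] by (simp add: ennreal_mult)
      also have "\<dots> \<le> ennreal (16 * (dqm_rem p h x)\<^sup>2 + 2 * ((h \<bullet> \<rho> p x)\<^sup>2 * f p x * of_bool (1 < \<bar>h \<bullet> \<rho> p x\<bar>)))"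
        by (rule ennreal_leI[OF pw[OF x]])
      also have "\<dots> = 16 * ennreal ((dqm_rem p h x)\<^sup>2) + 2 * ennreal ((h \<bullet> \<rho> p x)\<^sup>2 * f p x * of_bool (1 < \<bar>h \<bullet> \<rho> p x\<bar>))"
        using f_nonneg[OF p x] by (subst ennreal_plus) (auto simp: ennreal_mult')
      finally show "ennreal (f (p + h) x) * ennreal (of_bool (x \<notin> lr_set p h)) \<le> 16 * ennreal ((dqm_rem p h x)\<^sup>2) +
        2 * ennreal ((h \<bullet> \<rho> p x)\<^sup>2 * f p x * of_bool (1 < \<bar>h \<bullet> \<rho> p x\<bar>))" .
    qed
    also have "\<dots> = 16 * (\<integral>\<^sup>+x. ennreal ((dqm_rem p h x)\<^sup>2) \<partial>\<nu>) +
        2 * (\<integral>\<^sup>+x. ennreal ((h \<bullet> \<rho> p x)\<^sup>2 * f p x * of_bool (1 < \<bar>h \<bullet> \<rho> p x\<bar>)) \<partial>\<nu>)"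
      by (simp add: nn_integral_add nn_integral_cmult meas_\<nu>)
    also have "\<dots> \<le> 16 * ennreal (\<epsilon> / 32 * (norm h)\<^sup>2) + 2 * ennreal (\<epsilon> / 4 * (norm h)\<^sup>2)"
      using d1(2)[of h] d2(2)[of h] D by (intro add_mono mult_left_mono) auto
    also have "\<dots> = ennreal (\<epsilon> * (norm h)\<^sup>2)"
    proof -
      define n where "n = (norm h)\<^sup>2"
      have n: "0 \<le> n" by (simp add: n_def)
      have "16 * ennreal (\<epsilon> / 32 * n) = ennreal (16 * (\<epsilon> / 32 * n))"
        "2 * ennreal (\<epsilon> / 4 * n) = ennreal (2 * (\<epsilon> / 4 * n))"
        by (subst ennreal_mult', simp, simp)+
      then have "16 * ennreal (\<epsilon> / 32 * n) + 2 * ennreal (\<epsilon> / 4 * n) =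
        ennreal (16 * (\<epsilon> / 32 * n) + 2 * (\<epsilon> / 4 * n))"
        using \<epsilon> n by (simp only:) (subst ennreal_plus, auto)
      also have "16 * (\<epsilon> / 32 * n) + 2 * (\<epsilon> / 4 * n) = \<epsilon> * n" by simp
      finally show ?thesis by (simp only: n_def)
    qed
    finally show "measure (F (p + h)) {z \<in> space (F (p + h)). fst z \<notin> lr_set p h} \<le> \<epsilon> * (norm h)\<^sup>2"
      using \<epsilon> by (simp add: emeasure_eq_measure)
  qed
qed

text \<open>Not only the root density but the truncated ratio itself is differentiable in mean
  square, with the score as derivative. Boundedness of the truncated ratio is what makes the
  quadratic terms harmless.\<close>

lemma lr_L2:
  assumes p: "p \<in> T" and \<epsilon>: "0 < \<epsilon>"
  shows "\<exists>\<delta>>0. \<forall>h. norm h < \<delta> \<longrightarrow> p + h \<in> T \<and>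
    (\<integral>z. (lr p h (fst z) - 1 - h \<bullet> \<rho> p (fst z))\<^sup>2 \<partial>F p) \<le> \<epsilon> * (norm h)\<^sup>2"
proof -
  define B where "B = (\<integral>z. (norm (\<rho> p (fst z)))\<^sup>2 \<partial>F p)"
  have B0: "0 \<le> B" by (simp add: B_def)
  \<comment> \<open>The term \<eta>^2 |h . \<rho>|^2 of the expansion is not o(|h|^2) by itself;
    \<eta> is fixed in advance so small that it uses only a quarter of \<epsilon>.\<close>
  obtain \<eta> where \<eta>: "0 < \<eta>" "\<eta> \<le> 1 / 2" "2 * \<eta>\<^sup>2 * B \<le> \<epsilon> / 4"
  proof
    define c where "c = B + 1"
    have c: "0 < c" "B \<le> c" using B0 by (auto simp: c_def)
    define \<eta> where "\<eta> = min (1 / 2) (\<epsilon> / (4 * c))"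
    show \<eta>: "0 < \<eta>" "\<eta> \<le> 1 / 2"
      using \<epsilon> c unfolding \<eta>_def by (simp, intro min.cobounded1)
    have "2 * \<eta>\<^sup>2 * B = (2 * \<eta>) * (\<eta> * B)" by (simp add: power2_eq_square)
    also have "\<dots> \<le> 1 * (\<eta> * c)" using \<eta> B0 c by (intro mult_mono) auto
    also have "\<dots> \<le> \<epsilon> / (4 * c) * c" 
    proof -
      have "\<eta> \<le> \<epsilon> / (4 * c)" unfolding \<eta>_def by (rule min.cobounded2)
      then have "\<eta> * c \<le> \<epsilon> / (4 * c) * c" by (rule mult_right_mono) (use c in simp)
      then show ?thesis by (simp only: mult_1)
    qed
    also have "\<dots> = \<epsilon> / 4" using c by simp
    finally show "2 * \<eta>\<^sup>2 * B \<le> \<epsilon> / 4" .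
  qed
  \<comment> \<open>With the coefficients 20 and 4 these two contribute another quarter of
    \<epsilon> each.\<close>
  have e1: "0 < \<epsilon> / 80" "0 < \<epsilon> / 16" "0 < 2 * \<eta>" using \<epsilon> \<eta> by auto
  obtain d1 where d1: "0 < d1" "\<And>h. norm h < d1 \<Longrightarrow> p + h \<in> T \<and>
      (\<integral>\<^sup>+x. ennreal ((dqm_rem p h x)\<^sup>2) \<partial>\<nu>) \<le> ennreal (\<epsilon> / 80 * (norm h)\<^sup>2)"
    using dqm_small[OF p e1(1)] by auto
  obtain d2 where d2: "0 < d2" "\<And>h. norm h < d2 \<Longrightarrow>
      (\<integral>\<^sup>+x. ennreal ((h \<bullet> \<rho> p x)\<^sup>2 * f p x * of_bool (2 * \<eta> < \<bar>h \<bullet> \<rho> p x\<bar>)) \<partial>\<nu>) \<le> ennreal (\<epsilon> / 16 * (norm h)\<^sup>2)"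
    using score_tail[OF p e1(2,3)] by auto
  show ?thesis
  proof (intro exI[of _ "min d1 d2"] conjI allI impI)
    show "0 < min d1 d2" using d1 d2 by simp
    fix h :: "real ^ 'd" assume D: "norm h < min d1 d2"
    then show p': "p + h \<in> T" using d1(2) by simp
    interpret prob_space "F p" by (rule F_prob[OF p])
    note [measurable] = \<rho>_meas[OF p] f_meas[OF p] f_meas[OF p'] lr_meas[OF p p'] dqm_rem_meas[OF p p']
    have pw: "f p x * (lr p h x - 1 - h \<bullet> \<rho> p x)\<^sup>2 \<le>
        20 * (dqm_rem p h x)\<^sup>2 + (2 * \<eta>\<^sup>2 * (norm h)\<^sup>2) * (f p x * (norm (\<rho> p x))\<^sup>2) +
        4 * ((h \<bullet> \<rho> p x)\<^sup>2 * f p x * of_bool (2 * \<eta> < \<bar>h \<bullet> \<rho> p x\<bar>))"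
      if x: "x \<in> space MX" for x
    proof -
      define s s' where "s = sqrt (f p x)" and "s' = sqrt (f (p + h) x)"
      have sq: "f p x = s\<^sup>2" "f (p + h) x = s'\<^sup>2" and nn: "0 \<le> s" "0 \<le> s'"
        using f_nonneg[OF p x] f_nonneg[OF p' x] by (simp_all add: s_def s'_def)
      define w where "w = h \<bullet> \<rho> p x / 2"
      have eq: "s' = s + dqm_rem p h x + w * s"
        by (simp add: dqm_rem_def s_def s'_def w_def)
      have lr: "lr p h x = (if s'\<^sup>2 \<le> 4 * s\<^sup>2 \<and> 0 < s\<^sup>2 then s'\<^sup>2 / s\<^sup>2 else 0)"
        using x by (simp add: lr_def lr_set_def sq)
      have cs: "(h \<bullet> \<rho> p x)\<^sup>2 \<le> (norm h)\<^sup>2 * (norm (\<rho> p x))\<^sup>2"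
        using Cauchy_Schwarz_ineq[of h "\<rho> p x"] by (simp add: power2_norm_eq_inner)
      have w4: "4 * w\<^sup>2 = (h \<bullet> \<rho> p x)\<^sup>2" and w2: "2 * w = h \<bullet> \<rho> p x" and wi: "\<eta> < \<bar>w\<bar> \<longleftrightarrow> 2 * \<eta> < \<bar>h \<bullet> \<rho> p x\<bar>"
        by (auto simp: w_def power_divide)
      have main: "(lr p h x - 1 - 2 * w)\<^sup>2 * s\<^sup>2 \<le> 20 * (dqm_rem p h x)\<^sup>2 + 8 * \<eta>\<^sup>2 * w\<^sup>2 * s\<^sup>2 + 16 * w\<^sup>2 * s\<^sup>2 * of_bool (\<eta> < \<bar>w\<bar>)"
        unfolding lr by (rule lr_expansion_bound[OF nn eq \<eta>(1,2)])
      have E1: "8 * \<eta>\<^sup>2 * w\<^sup>2 * s\<^sup>2 \<le> (2 * \<eta>\<^sup>2 * (norm h)\<^sup>2) * (s\<^sup>2 * (norm (\<rho> p x))\<^sup>2)"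
      proof -
        have "8 * \<eta>\<^sup>2 * w\<^sup>2 * s\<^sup>2 = 2 * \<eta>\<^sup>2 * s\<^sup>2 * (h \<bullet> \<rho> p x)\<^sup>2" unfolding w4[symmetric] by simp
        also have "\<dots> \<le> 2 * \<eta>\<^sup>2 * s\<^sup>2 * ((norm h)\<^sup>2 * (norm (\<rho> p x))\<^sup>2)" by (rule mult_left_mono[OF cs]) simp
        also have "\<dots> = (2 * \<eta>\<^sup>2 * (norm h)\<^sup>2) * (s\<^sup>2 * (norm (\<rho> p x))\<^sup>2)" by simp
        finally show ?thesis .
      qed
      have E2: "16 * w\<^sup>2 * s\<^sup>2 * of_bool (\<eta> < \<bar>w\<bar>) =
          4 * ((h \<bullet> \<rho> p x)\<^sup>2 * s\<^sup>2 * of_bool (2 * \<eta> < \<bar>h \<bullet> \<rho> p x\<bar>))"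
        unfolding wi w4[symmetric] by simp
      have "(lr p h x - 1 - 2 * w)\<^sup>2 * s\<^sup>2 \<le> 20 * (dqm_rem p h x)\<^sup>2 +
          (2 * \<eta>\<^sup>2 * (norm h)\<^sup>2) * (s\<^sup>2 * (norm (\<rho> p x))\<^sup>2) +
          4 * ((h \<bullet> \<rho> p x)\<^sup>2 * s\<^sup>2 * of_bool (2 * \<eta> < \<bar>h \<bullet> \<rho> p x\<bar>))"
        by (rule order_trans[OF main]) (intro add_mono E1 order_refl, simp only: E2)
      then show ?thesis
        unfolding w2 sq by (subst mult.commute[of "s\<^sup>2" "(lr p h x - 1 - h \<bullet> \<rho> p x)\<^sup>2"])
    qed
    have lrm: "(\<lambda>z. lr p h (fst z)) \<in> borel_measurable (F p)" "(\<lambda>z. \<rho> p (fst z)) \<in> borel_measurable (F p)"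
      by (rule comp_F[OF p lr_meas[OF p p']], rule comp_F[OF p \<rho>_meas[OF p]])
    note [measurable] = lrm
    have "(\<integral>\<^sup>+z. ennreal ((lr p h (fst z) - 1 - h \<bullet> \<rho> p (fst z))\<^sup>2) \<partial>F p) =
      (\<integral>\<^sup>+x. ennreal (f p x) * ennreal ((lr p h x - 1 - h \<bullet> \<rho> p x)\<^sup>2) \<partial>\<nu>)"
      by (rule nn_integral_F[OF p]) measurable
    also have "\<dots> \<le> (\<integral>\<^sup>+x. 20 * ennreal ((dqm_rem p h x)\<^sup>2) +
        ennreal (2 * \<eta>\<^sup>2 * (norm h)\<^sup>2) * (ennreal (f p x) * ennreal ((norm (\<rho> p x))\<^sup>2)) +
        4 * ennreal ((h \<bullet> \<rho> p x)\<^sup>2 * f p x * of_bool (2 * \<eta> < \<bar>h \<bullet> \<rho> p x\<bar>)) \<partial>\<nu>)"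
    proof (rule nn_integral_mono)
      fix x assume "x \<in> space \<nu>"
      then have x: "x \<in> space MX" by (simp add: space_\<nu>)
      have "ennreal (f p x) * ennreal ((lr p h x - 1 - h \<bullet> \<rho> p x)\<^sup>2) = ennreal (f p x * (lr p h x - 1 - h \<bullet> \<rho> p x)\<^sup>2)"
        using f_nonneg[OF p x] by (simp add: ennreal_mult)
      also have "\<dots> \<le> ennreal (20 * (dqm_rem p h x)\<^sup>2 + (2 * \<eta>\<^sup>2 * (norm h)\<^sup>2) * (f p x * (norm (\<rho> p x))\<^sup>2) +
        4 * ((h \<bullet> \<rho> p x)\<^sup>2 * f p x * of_bool (2 * \<eta> < \<bar>h \<bullet> \<rho> p x\<bar>)))"
        by (rule ennreal_leI[OF pw[OF x]])
      also have "\<dots> = 20 * ennreal ((dqm_rem p h x)\<^sup>2) +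
        ennreal (2 * \<eta>\<^sup>2 * (norm h)\<^sup>2) * (ennreal (f p x) * ennreal ((norm (\<rho> p x))\<^sup>2)) +
        4 * ennreal ((h \<bullet> \<rho> p x)\<^sup>2 * f p x * of_bool (2 * \<eta> < \<bar>h \<bullet> \<rho> p x\<bar>))"
        using f_nonneg[OF p x] by (simp add: ennreal_plus ennreal_mult ennreal_mult')
      finally show "ennreal (f p x) * ennreal ((lr p h x - 1 - h \<bullet> \<rho> p x)\<^sup>2) \<le> 20 * ennreal ((dqm_rem p h x)\<^sup>2) +
        ennreal (2 * \<eta>\<^sup>2 * (norm h)\<^sup>2) * (ennreal (f p x) * ennreal ((norm (\<rho> p x))\<^sup>2)) +
        4 * ennreal ((h \<bullet> \<rho> p x)\<^sup>2 * f p x * of_bool (2 * \<eta> < \<bar>h \<bullet> \<rho> p x\<bar>))" .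
    qed
    also have "\<dots> = 20 * (\<integral>\<^sup>+x. ennreal ((dqm_rem p h x)\<^sup>2) \<partial>\<nu>) +
        ennreal (2 * \<eta>\<^sup>2 * (norm h)\<^sup>2) * (\<integral>\<^sup>+x. ennreal (f p x) * ennreal ((norm (\<rho> p x))\<^sup>2) \<partial>\<nu>) +
        4 * (\<integral>\<^sup>+x. ennreal ((h \<bullet> \<rho> p x)\<^sup>2 * f p x * of_bool (2 * \<eta> < \<bar>h \<bullet> \<rho> p x\<bar>)) \<partial>\<nu>)"
      by (simp add: nn_integral_add nn_integral_cmult meas_\<nu>)
    also have "(\<integral>\<^sup>+x. ennreal (f p x) * ennreal ((norm (\<rho> p x))\<^sup>2) \<partial>\<nu>) = ennreal B"
      unfolding B_def using nn_integral_F[OF p, of "\<lambda>x. ennreal ((norm (\<rho> p x))\<^sup>2)"]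
        nn_integral_eq_integral[OF score_L2(1)[OF p]] by simp
    also have "20 * (\<integral>\<^sup>+x. ennreal ((dqm_rem p h x)\<^sup>2) \<partial>\<nu>) + ennreal (2 * \<eta>\<^sup>2 * (norm h)\<^sup>2) * ennreal B +
        4 * (\<integral>\<^sup>+x. ennreal ((h \<bullet> \<rho> p x)\<^sup>2 * f p x * of_bool (2 * \<eta> < \<bar>h \<bullet> \<rho> p x\<bar>)) \<partial>\<nu>) \<le>
      20 * ennreal (\<epsilon> / 80 * (norm h)\<^sup>2) + ennreal (2 * \<eta>\<^sup>2 * (norm h)\<^sup>2) * ennreal B + 4 * ennreal (\<epsilon> / 16 * (norm h)\<^sup>2)"
      using d1(2)[of h] d2(2)[of h] D by (intro add_mono mult_left_mono) auto
    also have "\<dots> = ennreal (20 * (\<epsilon> / 80 * (norm h)\<^sup>2) + (2 * \<eta>\<^sup>2 * B) * (norm h)\<^sup>2 + 4 * (\<epsilon> / 16 * (norm h)\<^sup>2))"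
    proof -
      have aux: "20 * ennreal a + ennreal pp * ennreal B + 4 * ennreal b = ennreal (20 * a + pp * B + 4 * b)"
        if "0 \<le> a" "0 \<le> b" "0 \<le> pp" for a b pp
        using that B0 by (simp add: ennreal_plus ennreal_mult ennreal_mult')
      have "2 * \<eta>\<^sup>2 * (norm h)\<^sup>2 * B = 2 * \<eta>\<^sup>2 * B * (norm h)\<^sup>2" by simp
      then show ?thesis using \<epsilon> by (subst aux) (auto simp: mult_ac)
    qed
    also have "\<dots> \<le> ennreal (\<epsilon> * (norm h)\<^sup>2)"
    proof (rule ennreal_leI)
      have "(2 * \<eta>\<^sup>2 * B) * (norm h)\<^sup>2 \<le> \<epsilon> / 4 * (norm h)\<^sup>2" using \<eta>(3) by (rule mult_right_mono) simp
      moreover have "0 \<le> \<epsilon> * (norm h)\<^sup>2" using \<epsilon> by simp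
      ultimately show "20 * (\<epsilon> / 80 * (norm h)\<^sup>2) + (2 * \<eta>\<^sup>2 * B) * (norm h)\<^sup>2 + 4 * (\<epsilon> / 16 * (norm h)\<^sup>2) \<le> \<epsilon> * (norm h)\<^sup>2"
        by linarith
    qed
    finally have le: "(\<integral>\<^sup>+z. ennreal ((lr p h (fst z) - 1 - h \<bullet> \<rho> p (fst z))\<^sup>2) \<partial>F p) \<le> ennreal (\<epsilon> * (norm h)\<^sup>2)" .
    show "(\<integral>z. (lr p h (fst z) - 1 - h \<bullet> \<rho> p (fst z))\<^sup>2 \<partial>F p) \<le> \<epsilon> * (norm h)\<^sup>2"
      by (rule integral_real_bounded) (use \<epsilon> le in auto)
  qed
qed

end

subsection \<open>Local sequences\<close>

lemma integral_square_add_le: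
  fixes f g :: "'a \<Rightarrow> real"
  assumes "f \<in> borel_measurable M" "g \<in> borel_measurable M"
    and f: "integrable M (\<lambda>x. (f x)\<^sup>2)" and g: "integrable M (\<lambda>x. (g x)\<^sup>2)"
  shows "integrable M (\<lambda>x. (f x + g x)\<^sup>2)"
    and "(\<integral>x. (f x + g x)\<^sup>2 \<partial>M) \<le> 2 * (\<integral>x. (f x)\<^sup>2 \<partial>M) + 2 * (\<integral>x. (g x)\<^sup>2 \<partial>M)"
proof -
  have fg: "integrable M (\<lambda>x. f x * g x)" by (rule integrable_mult_of_squares) fact+
  show i: "integrable M (\<lambda>x. (f x + g x)\<^sup>2)"
    unfolding power2_sum using f g fg by (simp add: mult.assoc)
  have "(\<integral>x. (f x + g x)\<^sup>2 \<partial>M) \<le> (\<integral>x. 2 * (f x)\<^sup>2 + 2 * (g x)\<^sup>2 \<partial>M)"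
  proof (rule integral_mono[OF i])
    show "integrable M (\<lambda>x. 2 * (f x)\<^sup>2 + 2 * (g x)\<^sup>2)" using f g by simp
    show "(f x + g x)\<^sup>2 \<le> 2 * (f x)\<^sup>2 + 2 * (g x)\<^sup>2" for x
      using sum_squares_bound[of "f x" "g x"] by (simp add: power2_sum)
  qed
  also have "\<dots> = 2 * (\<integral>x. (f x)\<^sup>2 \<partial>M) + 2 * (\<integral>x. (g x)\<^sup>2 \<partial>M)" using f g by simp
  finally show "(\<integral>x. (f x + g x)\<^sup>2 \<partial>M) \<le> 2 * (\<integral>x. (f x)\<^sup>2 \<partial>M) + 2 * (\<integral>x. (g x)\<^sup>2 \<partial>M)" .
qed

definition L2_tendsto :: "'a measure \<Rightarrow> (nat \<Rightarrow> 'a \<Rightarrow> real) \<Rightarrow> ('a \<Rightarrow> real) \<Rightarrow> bool" where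
  "L2_tendsto M X X0 \<longleftrightarrow> (\<forall>n. X n \<in> borel_measurable M \<and> integrable M (\<lambda>z. (X n z)\<^sup>2)) \<and>
     X0 \<in> borel_measurable M \<and> integrable M (\<lambda>z. (X0 z)\<^sup>2) \<and> (\<lambda>n. \<integral>z. (X n z - X0 z)\<^sup>2 \<partial>M) \<longlonglongrightarrow> 0"

lemma L2_tendsto_mult:
  assumes X: "L2_tendsto M X X0" and Y: "L2_tendsto M Y Y0"
  shows "(\<lambda>n. \<integral>z. X n z * Y n z \<partial>M) \<longlonglongrightarrow> (\<integral>z. X0 z * Y0 z \<partial>M)"
proof -
  have m: "X n \<in> borel_measurable M" "X0 \<in> borel_measurable M" "Y n \<in> borel_measurable M" "Y0 \<in> borel_measurable M" for n
    using X Y by (auto simp: L2_tendsto_def)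
  note [measurable] = m
  have i: "integrable M (\<lambda>z. (X n z)\<^sup>2)" "integrable M (\<lambda>z. (X0 z)\<^sup>2)" "integrable M (\<lambda>z. (Y n z)\<^sup>2)" "integrable M (\<lambda>z. (Y0 z)\<^sup>2)" for n
    using X Y by (auto simp: L2_tendsto_def)
  define x y where "x n z = X n z - X0 z" and "y n z = Y n z - Y0 z" for n z
  have xm[measurable]: "x n \<in> borel_measurable M" "y n \<in> borel_measurable M" for n unfolding x_def y_def by measurable
  have xi: "integrable M (\<lambda>z. (x n z)\<^sup>2)" "integrable M (\<lambda>z. (y n z)\<^sup>2)" for n
    using integral_square_add_le(1)[of "X n" M "\<lambda>z. - X0 z"] integral_square_add_le(1)[of "Y n" M "\<lambda>z. - Y0 z"] i
    by (simp_all add: x_def y_def)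
  have lim: "(\<lambda>n. \<integral>z. (x n z)\<^sup>2 \<partial>M) \<longlonglongrightarrow> 0" "(\<lambda>n. \<integral>z. (y n z)\<^sup>2 \<partial>M) \<longlonglongrightarrow> 0"
    using X Y by (auto simp: L2_tendsto_def x_def y_def)
  note ip = integrable_mult_of_squares[OF xm(1) xm(2) xi(1) xi(2)]
    integrable_mult_of_squares[OF m(2) xm(2) i(2) xi(2)] integrable_mult_of_squares[OF xm(1) m(4) xi(1) i(4)]
    integrable_mult_of_squares[OF m(2) m(4) i(2) i(4)]
  have eq: "(\<integral>z. X n z * Y n z \<partial>M) - (\<integral>z. X0 z * Y0 z \<partial>M) =
     (\<integral>z. x n z * y n z \<partial>M) + (\<integral>z. X0 z * y n z \<partial>M) + (\<integral>z. x n z * Y0 z \<partial>M)" for n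
  proof -
    have "X n z * Y n z = x n z * y n z + X0 z * y n z + x n z * Y0 z + X0 z * Y0 z" for z
      by (simp add: x_def y_def algebra_simps)
    then have "(\<integral>z. X n z * Y n z \<partial>M) = (\<integral>z. x n z * y n z \<partial>M) + (\<integral>z. X0 z * y n z \<partial>M) + (\<integral>z. x n z * Y0 z \<partial>M)
        + (\<integral>z. X0 z * Y0 z \<partial>M)"
      using ip by simp
    then show ?thesis by simp
  qed
  have cs: "\<bar>\<integral>z. f z * g z \<partial>M\<bar> \<le> sqrt (\<integral>z. (f z)\<^sup>2 \<partial>M) * sqrt (\<integral>z. (g z)\<^sup>2 \<partial>M)"
    if "f \<in> borel_measurable M" "g \<in> borel_measurable M" "integrable M (\<lambda>z. (f z)\<^sup>2)" "integrable M (\<lambda>z. (g z)\<^sup>2)" for f g :: "'a \<Rightarrow> real"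
    using order_trans[OF integral_abs_bound integral_Cauchy_Schwarz[OF that]] .
  have z: "(\<lambda>n. sqrt (A n) * sqrt (B n)) \<longlonglongrightarrow> 0" if "A \<longlonglongrightarrow> a" "B \<longlonglongrightarrow> b" "a = 0 \<or> b = 0" for A B :: "nat \<Rightarrow> real" and a b
    using tendsto_mult[OF tendsto_real_sqrt[OF that(1)] tendsto_real_sqrt[OF that(2)]] that(3) by auto
  have "(\<lambda>n. \<integral>z. x n z * y n z \<partial>M) \<longlonglongrightarrow> 0"
    by (rule null_of_norm_le[OF _ z[OF lim]]) (use cs[OF xm xi] in auto)
  moreover have "(\<lambda>n. \<integral>z. X0 z * y n z \<partial>M) \<longlonglongrightarrow> 0"
    by (rule null_of_norm_le[OF _ z[OF tendsto_const lim(2)]]) (use cs[OF m(2) xm(2) i(2) xi(2)] in auto)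
  moreover have "(\<lambda>n. \<integral>z. x n z * Y0 z \<partial>M) \<longlonglongrightarrow> 0"
    by (rule null_of_norm_le[OF _ z[OF lim(1) tendsto_const]]) (use cs[OF xm(1) m(4) xi(1) i(4)] in auto)
  ultimately have "(\<lambda>n. (\<integral>z. X n z * Y n z \<partial>M) - (\<integral>z. X0 z * Y0 z \<partial>M)) \<longlonglongrightarrow> 0 + 0 + 0"
    unfolding eq by (intro tendsto_add)
  then show ?thesis by (simp add: LIM_zero_iff)
qed

lemma L2_tendsto_const:
  "X \<in> borel_measurable M \<Longrightarrow> integrable M (\<lambda>z. (X z)\<^sup>2) \<Longrightarrow> L2_tendsto M (\<lambda>_. X) X"
  by (simp add: L2_tendsto_def)

context dqm_model
begin

text \<open>Shifts of order 1/sqrt n with a limiting direction. Convergence of sqrt n h instead of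
  equality with a leaves room to alter finitely many shifts and to interpolate between subsequences,
  while every p + h n is required to be a parameter.\<close>

definition local_seq :: "real ^ 'd \<Rightarrow> (nat \<Rightarrow> real ^ 'd) \<Rightarrow> real ^ 'd \<Rightarrow> bool" where
  "local_seq p h a \<longleftrightarrow> p \<in> T \<and> (\<forall>n. p + h n \<in> T) \<and> (\<lambda>n. sqrt (real n) *\<^sub>R h n) \<longlonglongrightarrow> a"

lemma local_seqD:
  assumes "local_seq p h a"
  shows "p \<in> T" "p + h n \<in> T" "(\<lambda>n. sqrt (real n) *\<^sub>R h n) \<longlonglongrightarrow> a" "h \<longlonglongrightarrow> 0"
    "(\<lambda>n. real n * (norm (h n))\<^sup>2) \<longlonglongrightarrow> (norm a)\<^sup>2"
proof -
  show "p \<in> T" "p + h n \<in> T" and l: "(\<lambda>n. sqrt (real n) *\<^sub>R h n) \<longlonglongrightarrow> a" using assms by (auto simp: local_seq_def)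
  have "(\<lambda>n. inverse (sqrt (real n))) \<longlonglongrightarrow> 0"
    by (intro tendsto_inverse_0_at_top filterlim_compose[OF sqrt_at_top] filterlim_real_sequentially)
  from tendsto_scaleR[OF this l] have "(\<lambda>n. inverse (sqrt (real n)) *\<^sub>R sqrt (real n) *\<^sub>R h n) \<longlonglongrightarrow> 0" by simp
  then show "h \<longlonglongrightarrow> 0"
    by (rule Lim_transform_eventually) (use eventually_gt_at_top[of 0] in eventually_elim, simp)
  have "(\<lambda>n. (norm (sqrt (real n) *\<^sub>R h n))\<^sup>2) \<longlonglongrightarrow> (norm a)\<^sup>2" by (intro tendsto_intros l)
  then show "(\<lambda>n. real n * (norm (h n))\<^sup>2) \<longlonglongrightarrow> (norm a)\<^sup>2" by (simp add: power_mult_distrib)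
qed

lemma local_seq_exists:
  assumes p: "p \<in> T"
  obtains h where "local_seq p h a" "\<forall>\<^sub>F n in sequentially. h n = a /\<^sub>R sqrt (real n)"
proof
  \<comment> \<open>Where p + a/sqrt n is not a parameter the shift 0 is taken; since T is open this
    concerns finitely many n.\<close>
  define h where "h n = (if p + a /\<^sub>R sqrt (real n) \<in> T then a /\<^sub>R sqrt (real n) else 0)" for n
  have "(\<lambda>n. inverse (sqrt (real n)) *\<^sub>R a) \<longlonglongrightarrow> 0 *\<^sub>R a"
    by (intro tendsto_scaleR tendsto_const tendsto_inverse_0_at_top filterlim_compose[OF sqrt_at_top] filterlim_real_sequentially)
  from tendsto_add[OF tendsto_const this]
  have "(\<lambda>n. p + inverse (sqrt (real n)) *\<^sub>R a) \<longlonglongrightarrow> p" by simp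
  from topological_tendstoD[OF this openT p]
  show ev: "\<forall>\<^sub>F n in sequentially. h n = a /\<^sub>R sqrt (real n)"
    by eventually_elim (simp add: h_def)
  have "\<forall>\<^sub>F n in sequentially. sqrt (real n) *\<^sub>R h n = a"
    using ev eventually_gt_at_top[of 0] by eventually_elim simp
  then show "local_seq p h a"
    using p by (auto simp: local_seq_def h_def tendsto_eventually)
qed

text \<open>n |h n|^2 converges and is therefore bounded, so o(|h|^2) per observation becomes o(1)
  per sample.\<close>

lemma local_seq_scaled_null:
  assumes ls: "local_seq p h a" and nn: "\<And>n. 0 \<le> g (h n)"
    and g: "\<And>\<epsilon>. 0 < \<epsilon> \<Longrightarrow> \<exists>\<delta>>0. \<forall>D. norm D < \<delta> \<longrightarrow> g D \<le> \<epsilon> * (norm D)\<^sup>2"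
  shows "(\<lambda>n. real n * g (h n)) \<longlonglongrightarrow> 0"
proof (rule LIMSEQ_I)
  fix e :: real assume e: "0 < e"
  define c where "c = (norm a)\<^sup>2 + 1"
  have c: "0 < c" by (simp add: c_def add_nonneg_pos)
  have "0 < e / (2 * c)" using e c by simp
  from g[OF this] obtain \<delta> where \<delta>: "0 < \<delta>" "\<And>D. norm D < \<delta> \<Longrightarrow> g D \<le> e / (2 * c) * (norm D)\<^sup>2" by auto
  have "\<forall>\<^sub>F n in sequentially. norm (h n) < \<delta>"
    using tendsto_norm_zero[OF local_seqD(4)[OF ls]] \<delta>(1) by (rule order_tendstoD)
  moreover have "\<forall>\<^sub>F n in sequentially. real n * (norm (h n))\<^sup>2 < c"
    using local_seqD(5)[OF ls] by (rule order_tendstoD) (simp add: c_def)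
  ultimately have "\<forall>\<^sub>F n in sequentially. norm (real n * g (h n) - 0) < e"
  proof eventually_elim
    case (elim n)
    have "real n * g (h n) \<le> real n * (e / (2 * c) * (norm (h n))\<^sup>2)" using \<delta>(2)[OF elim(1)] by (intro mult_left_mono) auto
    also have "\<dots> = e / (2 * c) * (real n * (norm (h n))\<^sup>2)" by simp
    also have "\<dots> \<le> e / (2 * c) * c" using elim e c by (intro mult_left_mono) auto
    also have "\<dots> = e / 2" using c by simp
    finally show ?case using e nn[of n] by simp
  qed
  then show "\<exists>N. \<forall>n\<ge>N. norm (real n * g (h n) - 0) < e" by (simp add: eventually_sequentially)
qed

text \<open>The mass of the shifted law that the truncation discards; along local sequences it is
  o(1/n).\<close>

definition excess :: "real ^ 'd \<Rightarrow> real ^ 'd \<Rightarrow> real" where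
  "excess p h = measure (F (p + h)) {z \<in> space (F (p + h)). fst z \<notin> lr_set p h}"

lemma excess_null:
  assumes ls: "local_seq p h a"
  shows "(\<lambda>n. real n * excess p (h n)) \<longlonglongrightarrow> 0"
proof (rule local_seq_scaled_null[OF ls])
  show "0 \<le> excess p (h n)" for n by (simp add: excess_def)
  show "\<exists>\<delta>>0. \<forall>D. norm D < \<delta> \<longrightarrow> excess p D \<le> \<epsilon> * (norm D)\<^sup>2" if "0 < \<epsilon>" for \<epsilon>
    using lr_mass[OF local_seqD(1)[OF ls] that] unfolding excess_def by blast
qed

lemma lr_F:
  assumes "p \<in> T" "p + h \<in> T"
  shows "(\<lambda>z. lr p h (fst z)) \<in> borel_measurable (F p)" "integrable (F p) (\<lambda>z. lr p h (fst z))"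
    "integrable (F p) (\<lambda>z. (lr p h (fst z))\<^sup>2)"
proof -
  interpret prob_space "F p" by (rule F_prob[OF assms(1)])
  show m: "(\<lambda>z. lr p h (fst z)) \<in> borel_measurable (F p)" by (rule comp_F[OF assms(1) lr_meas[OF assms]])
  show "integrable (F p) (\<lambda>z. lr p h (fst z))"
    by (rule integrable_const_bound[of _ 4]) (use lr_bounds[OF assms] m in auto)
  show "integrable (F p) (\<lambda>z. (lr p h (fst z))\<^sup>2)"
  proof (rule integrable_const_bound[of _ 16])
    have "(lr p h x)\<^sup>2 \<le> 16" for x
      using power_mono[OF lr_bounds(2)[OF assms, of x] lr_bounds(1)[OF assms, of x], of 2] by simp
    then show "AE z in F p. norm ((lr p h (fst z))\<^sup>2) \<le> 16" by simp
  qed (use m in measurable)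
qed

lemma lr_integral:
  assumes p: "p \<in> T" "p + h \<in> T"
  shows "(\<integral>z. lr p h (fst z) \<partial>F p) = 1 - excess p h"
proof -
  interpret prob_space "F (p + h)" by (rule F_prob[OF p(2)])
  have hm: "(\<lambda>x. x \<in> lr_set p h) \<in> measurable MX (count_space UNIV)"
    using lr_set_sets[OF p] by measurable
  have ms: "{z \<in> space (F (p + h)). fst z \<in> lr_set p h} \<in> sets (F (p + h))"
    using comp_F[OF p(2) hm] by measurable
  have "(\<integral>z. lr p h (fst z) \<partial>F p) = (\<integral>z. indicator (lr_set p h) (fst z) \<partial>F (p + h))"
    using lr_change[OF p, of "\<lambda>_. 1::real"] by simp
  also have "\<dots> = (\<integral>z. indicator {z \<in> space (F (p + h)). fst z \<in> lr_set p h} z \<partial>F (p + h))"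
    by (rule Bochner_Integration.integral_cong) (auto simp: indicator_def)
  also have "\<dots> = measure (F (p + h)) {z \<in> space (F (p + h)). fst z \<in> lr_set p h}"
    using ms by simp
  also have "\<dots> = 1 - measure (F (p + h)) (space (F (p + h)) - {z \<in> space (F (p + h)). fst z \<in> lr_set p h})"
    using prob_compl[OF ms] by simp
  also have "space (F (p + h)) - {z \<in> space (F (p + h)). fst z \<in> lr_set p h} =
    {z \<in> space (F (p + h)). fst z \<notin> lr_set p h}" by auto
  finally show ?thesis by (simp add: excess_def)
qed

lemma score_F:
  assumes "p \<in> T"
  shows "(\<lambda>z. \<rho> p (fst z)) \<in> borel_measurable (F p)" "(\<lambda>z. a \<bullet> \<rho> p (fst z)) \<in> borel_measurable (F p)"
    "integrable (F p) (\<lambda>z. a \<bullet> \<rho> p (fst z))"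
proof -
  interpret prob_space "F p" by (rule F_prob[OF assms(1)])
  show m: "(\<lambda>z. \<rho> p (fst z)) \<in> borel_measurable (F p)" by (rule comp_F[OF assms \<rho>_meas[OF assms]])
  then show m': "(\<lambda>z. a \<bullet> \<rho> p (fst z)) \<in> borel_measurable (F p)" by measurable
  show "integrable (F p) (\<lambda>z. a \<bullet> \<rho> p (fst z))"
    by (rule square_integrable_imp_integrable[OF m' score_L2(2)[OF assms]])
qed

text \<open>Two errors: the remainder of \<open>lr_L2\<close> in the actual direction h n, and the
  change of direction from sqrt n h n to a, which costs |sqrt n h n - a|^2 times the second moment
  of the score.\<close>

lemma lr_L2_tendsto:
  assumes ls: "local_seq p h a"
  shows "L2_tendsto (F p) (\<lambda>n z. sqrt (real n) * (lr p (h n) (fst z) - 1)) (\<lambda>z. a \<bullet> \<rho> p (fst z))"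
proof -
  note p = local_seqD(1)[OF ls] and pn = local_seqD(2)[OF ls]
  interpret prob_space "F p" by (rule F_prob[OF p])
  note lm[measurable] = lr_F(1)[OF p pn] and sm[measurable] = score_F(1,2)[OF p]
  note li = lr_F(2,3)[OF p pn]
  have l1: "integrable (F p) (\<lambda>z. (lr p (h n) (fst z) - 1)\<^sup>2)" for n
    using li[of n] by (simp add: power2_diff)
  have xi: "integrable (F p) (\<lambda>z. (sqrt (real n) * (lr p (h n) (fst z) - 1))\<^sup>2)" for n
    using l1[of n] by (simp add: power_mult_distrib)
  define R where "R n z = lr p (h n) (fst z) - 1 - h n \<bullet> \<rho> p (fst z)" for n and z :: "'x \<times> 't"
  have Rm[measurable]: "R n \<in> borel_measurable (F p)" for n unfolding R_def by measurable
  have R2: "integrable (F p) (\<lambda>z. (R n z)\<^sup>2)" for n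
    using integral_square_add_le(1)[OF _ _ l1[of n], of "\<lambda>z. - (h n \<bullet> \<rho> p (fst z))"] score_L2(2)[OF p]
    by (simp add: R_def)
  have Rn: "(\<lambda>n. real n * (\<integral>z. (R n z)\<^sup>2 \<partial>F p)) \<longlonglongrightarrow> 0"
    unfolding R_def
  proof (rule local_seq_scaled_null[OF ls, of "\<lambda>D. \<integral>z. (lr p D (fst z) - 1 - D \<bullet> \<rho> p (fst z))\<^sup>2 \<partial>F p"])
    show "\<exists>\<delta>>0. \<forall>D. norm D < \<delta> \<longrightarrow>
        (\<integral>z. (lr p D (fst z) - 1 - D \<bullet> \<rho> p (fst z))\<^sup>2 \<partial>F p) \<le> \<epsilon> * (norm D)\<^sup>2" if "0 < \<epsilon>" for \<epsilon>
      using lr_L2[OF p that] by blast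
  qed simp
  define B where "B = (\<integral>z. (norm (\<rho> p (fst z)))\<^sup>2 \<partial>F p)"
  have le: "(\<integral>z. (sqrt (real n) * (lr p (h n) (fst z) - 1) - a \<bullet> \<rho> p (fst z))\<^sup>2 \<partial>F p)
      \<le> 2 * (real n * (\<integral>z. (R n z)\<^sup>2 \<partial>F p)) + 2 * ((norm (sqrt (real n) *\<^sub>R h n - a))\<^sup>2 * B)" for n
  proof -
    define b where "b = sqrt (real n) *\<^sub>R h n - a"
    have "(\<integral>z. (sqrt (real n) * (lr p (h n) (fst z) - 1) - a \<bullet> \<rho> p (fst z))\<^sup>2 \<partial>F p) =
        (\<integral>z. (sqrt (real n) * R n z + b \<bullet> \<rho> p (fst z))\<^sup>2 \<partial>F p)"
      by (rule Bochner_Integration.integral_cong) (auto simp: R_def b_def algebra_simps inner_diff_left)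
    also have "\<dots> \<le> 2 * (\<integral>z. (sqrt (real n) * R n z)\<^sup>2 \<partial>F p) + 2 * (\<integral>z. (b \<bullet> \<rho> p (fst z))\<^sup>2 \<partial>F p)"
      by (rule integral_square_add_le(2)) (use R2 score_L2(2)[OF p] in \<open>auto simp: power_mult_distrib\<close>)
    also have "(\<integral>z. (sqrt (real n) * R n z)\<^sup>2 \<partial>F p) = real n * (\<integral>z. (R n z)\<^sup>2 \<partial>F p)"
      by (simp add: power_mult_distrib)
    also have "(\<integral>z. (b \<bullet> \<rho> p (fst z))\<^sup>2 \<partial>F p) \<le> (\<integral>z. (norm b)\<^sup>2 * (norm (\<rho> p (fst z)))\<^sup>2 \<partial>F p)"
    proof (rule integral_mono[OF score_L2(2)[OF p]])
      show "(b \<bullet> \<rho> p (fst z))\<^sup>2 \<le> (norm b)\<^sup>2 * (norm (\<rho> p (fst z)))\<^sup>2" for z :: "'x \<times> 't"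
        using Cauchy_Schwarz_ineq[of b "\<rho> p (fst z)"] by (simp add: power2_norm_eq_inner)
    qed (use score_L2(1)[OF p] in simp)
    also have "\<dots> = (norm b)\<^sup>2 * B" by (simp add: B_def)
    finally show ?thesis by (simp add: b_def)
  qed
  define G where "G n = 2 * (real n * (\<integral>z. (R n z)\<^sup>2 \<partial>F p)) + 2 * ((norm (sqrt (real n) *\<^sub>R h n - a))\<^sup>2 * B)" for n
  have "G \<longlonglongrightarrow> 2 * 0 + 2 * ((norm (a - a))\<^sup>2 * B)"
    unfolding G_def by (intro tendsto_intros Rn local_seqD(3)[OF ls])
  then have G: "G \<longlonglongrightarrow> 0" by simp
  have "norm (\<integral>z. (sqrt (real n) * (lr p (h n) (fst z) - 1) - a \<bullet> \<rho> p (fst z))\<^sup>2 \<partial>F p) \<le> G n" for n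
    using le[of n] unfolding G_def[symmetric] real_norm_def by (subst abs_of_nonneg) simp_all
  then have "(\<lambda>n. \<integral>z. (sqrt (real n) * (lr p (h n) (fst z) - 1) - a \<bullet> \<rho> p (fst z))\<^sup>2 \<partial>F p) \<longlonglongrightarrow> 0"
    by (rule null_of_norm_le[OF _ G])
  then show ?thesis
    unfolding L2_tendsto_def using xi score_L2(2)[OF p] sm(2) lm by auto
qed

text \<open>The truncated ratio integrates to 1 - excess, so sqrt n (E lr - 1) tends to 0; by L2
  convergence its limit is also the mean of the score.\<close>

lemma score_mean:
  assumes p: "p \<in> T"
  shows "(\<integral>z. a \<bullet> \<rho> p (fst z) \<partial>F p) = 0"
proof -
  interpret prob_space "F p" by (rule F_prob[OF p])
  obtain h where ls: "local_seq p h a" using local_seq_exists[OF p] by metis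
  note pn = local_seqD(2)[OF ls]
  have 1: "L2_tendsto (F p) (\<lambda>_ _. 1) (\<lambda>_. 1)" by (rule L2_tendsto_const) auto
  have "(\<integral>z. sqrt (real n) * (lr p (h n) (fst z) - 1) \<partial>F p) = - (sqrt (real n) * excess p (h n))" for n
    using lr_F(2)[OF p pn[of n]] lr_integral[OF p pn[of n]] by (simp add: prob_space)
  then have "(\<lambda>n. - (sqrt (real n) * excess p (h n))) \<longlonglongrightarrow> (\<integral>z. a \<bullet> \<rho> p (fst z) \<partial>F p)"
    using L2_tendsto_mult[OF lr_L2_tendsto[OF ls] 1] by simp
  moreover have "(\<lambda>n. - (sqrt (real n) * excess p (h n))) \<longlonglongrightarrow> 0"
  proof (rule null_of_norm_le[OF _ excess_null[OF ls]])
    fix n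
    have "sqrt (real n) \<le> real n" by (cases "n = 0") (auto intro: real_le_lsqrt simp: power2_eq_square)
    then show "norm (- (sqrt (real n) * excess p (h n))) \<le> real n * excess p (h n)"
      by (simp add: excess_def mult_right_mono abs_mult)
  qed
  ultimately show ?thesis by (rule LIMSEQ_unique)
qed

end

subsection \<open>Utilities and their conditional expectations\<close>

locale utility_model = dqm_model MX MTh \<nu> T F f \<rho>
  for MX :: "'x measure" and MTh :: "'t measure" and \<nu> :: "'x measure"
    and T :: "(real ^ 'd) set" and F :: "real ^ 'd \<Rightarrow> ('x \<times> 't) measure"
    and f :: "real ^ 'd \<Rightarrow> 'x \<Rightarrow> real" and \<rho> :: "real ^ 'd \<Rightarrow> 'x \<Rightarrow> real ^ 'd" +
  fixes u :: "'x \<Rightarrow> 't \<Rightarrow> ('x \<times> 't) measure \<Rightarrow> real"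
    and ubar :: "real ^ 'd \<Rightarrow> 'x \<Rightarrow> real"
    and dm :: "real ^ 'd \<Rightarrow> real ^ 'd"
  assumes u_meas: "\<And>p. p \<in> T \<Longrightarrow> util u (F p) \<in> borel_measurable (MX \<Otimes>\<^sub>M MTh)"
    and ubar_ce: "\<And>p. p \<in> T \<Longrightarrow> cond_exp_given_X MX (F p) (util u (F p)) (ubar p)"
    and info_rank: "\<And>p. p \<in> T \<Longrightarrow> rank (fisher_info F \<rho> p) = CARD('d)"
    and u_weak: "weakly_continuous_on T (\<lambda>p. distr (F p) borel (util u (F p)))"
    and u_sq: "\<And>p. p \<in> T \<Longrightarrow> integrable (F p) (\<lambda>z. (util u (F p) z)\<^sup>2)"
    and u_sq_cont: "continuous_on T (\<lambda>p. \<integral>z. (util u (F p) z)\<^sup>2 \<partial>F p)"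
    and ubar_cont: "\<And>p. p \<in> T \<Longrightarrow>
          ((\<lambda>h. \<integral>\<^sup>+z. ennreal ((ubar (p + h) (fst z) - ubar p (fst z))\<^sup>2) \<partial>F p) \<longlongrightarrow> 0) (at 0)"
    and ubar_finite: "\<And>p. p \<in> T \<Longrightarrow> (\<integral>\<^sup>+z. ennreal ((ubar p (fst z))\<^sup>2) \<partial>F p) < \<infinity>"
    and mean_deriv: "\<And>p. p \<in> T \<Longrightarrow> GDERIV (mean_util F u) p :> dm p"
begin

abbreviation gam :: "real ^ 'd \<Rightarrow> real ^ 'd" where
  "gam \<equiv> gamma_vec F ubar \<rho> dm"

lemma u_F: "p \<in> T \<Longrightarrow> util u (F p) \<in> borel_measurable (F p)"
  using u_meas[of p] by (simp only: measurable_cong_sets[OF sets_F refl])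

lemma ubar_MX: "p \<in> T \<Longrightarrow> ubar p \<in> borel_measurable MX"
  using ubar_ce by (auto simp: cond_exp_given_X_def)

lemma ubar_F: "p \<in> T \<Longrightarrow> p' \<in> T \<Longrightarrow> (\<lambda>z. ubar p' (fst z)) \<in> borel_measurable (F p)"
  by (rule comp_F[OF _ ubar_MX])

lemma ubar_sq: "p \<in> T \<Longrightarrow> integrable (F p) (\<lambda>z. (ubar p (fst z))\<^sup>2)"
  by (rule integrableI_nonneg[OF borel_measurable_power[OF ubar_F] AE_I2 ubar_finite]) simp_all

lemma ubar_orth:
  assumes p: "p \<in> T" and H: "H \<in> borel_measurable MX" and H2: "integrable (F p) (\<lambda>z. (H (fst z))\<^sup>2)"
  shows "(\<integral>z. H (fst z) * util u (F p) z \<partial>F p) = (\<integral>z. H (fst z) * ubar p (fst z) \<partial>F p)"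
    "integrable (F p) (\<lambda>z. H (fst z) * util u (F p) z)"
    "integrable (F p) (\<lambda>z. H (fst z) * ubar p (fst z))"
proof -
  define G where "G = vimage_algebra (space (F p)) fst MX"
  interpret prob_space "F p" by (rule F_prob[OF p])
  have sp: "fst \<in> space (F p) \<rightarrow> space MX" using fst_space[OF p] by auto
  have sub: "subalgebra (F p) G"
    unfolding subalgebra_def G_def sets_vimage_algebra2[OF sp]
    using measurable_sets[OF fst_F[OF p]] by auto
  interpret G: sigma_finite_subalgebra "F p" G
    by (rule finite_measure_subalgebra_is_sigma_finite) (standard, rule sub)
  have HG: "(\<lambda>z. H (fst z)) \<in> borel_measurable G"
    unfolding G_def by (rule measurable_compose[OF measurable_vimage_algebra1[OF sp] H])
  have HF: "(\<lambda>z. H (fst z)) \<in> borel_measurable (F p)" by (rule comp_F[OF p H])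
  show Hu: "integrable (F p) (\<lambda>z. H (fst z) * util u (F p) z)"
    by (rule integrable_mult_of_squares[OF HF u_F[OF p] H2 u_sq[OF p]])
  show "integrable (F p) (\<lambda>z. H (fst z) * ubar p (fst z))"
    by (rule integrable_mult_of_squares[OF HF ubar_F[OF p p] H2 ubar_sq[OF p]])
  have ae: "AE z in F p. ubar p (fst z) = real_cond_exp (F p) G (util u (F p)) z"
    using ubar_ce[OF p] by (auto simp: cond_exp_given_X_def G_def)
  have "(\<integral>z. H (fst z) * ubar p (fst z) \<partial>F p) = (\<integral>z. H (fst z) * real_cond_exp (F p) G (util u (F p)) z \<partial>F p)"
    by (rule integral_cong_AE) (use ae HF ubar_F[OF p p] in auto)
  also have "\<dots> = (\<integral>z. H (fst z) * util u (F p) z \<partial>F p)"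
    by (rule G.real_cond_exp_intg(2)[OF Hu HG u_F[OF p]])
  finally show "(\<integral>z. H (fst z) * util u (F p) z \<partial>F p) = (\<integral>z. H (fst z) * ubar p (fst z) \<partial>F p)" by simp
qed

lemma ubar_mean:
  assumes p: "p \<in> T"
  shows "(\<integral>z. ubar p (fst z) \<partial>F p) = mean_util F u p"
proof -
  interpret prob_space "F p" by (rule F_prob[OF p])
  have "integrable (F p) (\<lambda>z. 1\<^sup>2 :: real)" by simp
  from ubar_orth(1)[OF p _ this] show ?thesis unfolding mean_util_def by simp
qed

section \<open>Residuals, moving versions of \<open>ubar\<close> and uniform integrability\<close>

definition resid :: "real ^ 'd \<Rightarrow> 'x \<times> 't \<Rightarrow> real" where
  "resid p z = util u (F p) z - ubar p (fst z)"

definition resid_var :: "real ^ 'd \<Rightarrow> real" where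
  "resid_var p = (\<integral>z. (resid p z)\<^sup>2 \<partial>F p)"

lemma resid_F:
  assumes p: "p \<in> T"
  shows "resid p \<in> borel_measurable (F p)" "integrable (F p) (\<lambda>z. (resid p z)\<^sup>2)" "integrable (F p) (resid p)"
    "resid_var p = (\<integral>z. (util u (F p) z)\<^sup>2 \<partial>F p) - (\<integral>z. (ubar p (fst z))\<^sup>2 \<partial>F p)"
proof -
  interpret prob_space "F p" by (rule F_prob[OF p])
  have [measurable]: "util u (F p) \<in> borel_measurable (F p)" "(\<lambda>z. ubar p (fst z)) \<in> borel_measurable (F p)"
    using u_F[OF p] ubar_F[OF p p] by auto
  show m: "resid p \<in> borel_measurable (F p)" unfolding resid_def[abs_def] by measurable
  show i: "integrable (F p) (\<lambda>z. (resid p z)\<^sup>2)"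
    using integral_square_add_le(1)[of "util u (F p)" "F p" "\<lambda>z. - ubar p (fst z)"] u_sq[OF p] ubar_sq[OF p]
    by (simp add: resid_def)
  show "integrable (F p) (resid p)" by (rule square_integrable_imp_integrable[OF m i])
  note o = ubar_orth[OF p ubar_MX[OF p] ubar_sq[OF p]]
  have "(\<integral>z. (resid p z)\<^sup>2 \<partial>F p) = (\<integral>z. (util u (F p) z)\<^sup>2 - 2 * (ubar p (fst z) * util u (F p) z) + (ubar p (fst z))\<^sup>2 \<partial>F p)"
    by (rule Bochner_Integration.integral_cong) (auto simp: resid_def power2_diff)
  also have "\<dots> = (\<integral>z. (util u (F p) z)\<^sup>2 \<partial>F p) - (\<integral>z. (ubar p (fst z))\<^sup>2 \<partial>F p)"
    using o u_sq[OF p] ubar_sq[OF p] by (simp add: power2_eq_square)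
  finally show "resid_var p = (\<integral>z. (util u (F p) z)\<^sup>2 \<partial>F p) - (\<integral>z. (ubar p (fst z))\<^sup>2 \<partial>F p)"
    by (simp add: resid_var_def)
qed

lemma resid_var_nonneg: "0 \<le> resid_var p"
  by (simp add: resid_var_def)

lemma resid_orth:
  assumes p: "p \<in> T" and H: "H \<in> borel_measurable MX" and H2: "integrable (F p) (\<lambda>z. (H (fst z))\<^sup>2)"
  shows "(\<integral>z. H (fst z) * resid p z \<partial>F p) = 0" "integrable (F p) (\<lambda>z. H (fst z) * resid p z)"
  using ubar_orth[OF assms] by (simp_all add: resid_def right_diff_distrib)

text \<open>Conditional Jensen on an event determined by X. By orthogonality the integral of ubar^2
  over the event equals that of ubar u, which is at most half the sum of the integrals of ubar^2 and
  u^2. The localisation is what transfers tails from the utility to \<open>ubar\<close>.\<close>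

lemma ubar_sq_le:
  assumes p: "p \<in> T" and A: "A \<in> sets MX"
  shows "(\<integral>z. (ubar p (fst z))\<^sup>2 * indicator A (fst z) \<partial>F p) \<le> (\<integral>z. (util u (F p) z)\<^sup>2 * indicator A (fst z) \<partial>F p)"
proof -
  note [measurable] = u_F[OF p] ubar_F[OF p p] ubar_MX[OF p] A
  have [measurable]: "(\<lambda>z. indicator A (fst z) :: real) \<in> borel_measurable (F p)" by (rule comp_F[OF p]) measurable
  define H where "H x = ubar p x * indicator A x" for x
  have Hm: "H \<in> borel_measurable MX" unfolding H_def by measurable
  have HF: "(\<lambda>z. H (fst z)) \<in> borel_measurable (F p)" by (rule comp_F[OF p Hm])
  have H2: "(H (fst z))\<^sup>2 = (ubar p (fst z))\<^sup>2 * indicator A (fst z)" for z :: "'x \<times> 't"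
    by (simp add: H_def indicator_def)
  have i1: "integrable (F p) (\<lambda>z. (H (fst z))\<^sup>2)"
    by (rule Bochner_Integration.integrable_bound[OF ubar_sq[OF p]]) (use HF in \<open>auto simp: H_def indicator_def\<close>)
  have i2: "integrable (F p) (\<lambda>z. (util u (F p) z)\<^sup>2 * indicator A (fst z))"
    by (rule Bochner_Integration.integrable_bound[OF u_sq[OF p]]) (measurable, auto simp: indicator_def)
  have "(\<integral>z. (H (fst z))\<^sup>2 \<partial>F p) = (\<integral>z. H (fst z) * ubar p (fst z) \<partial>F p)"
    by (rule Bochner_Integration.integral_cong) (auto simp: H_def indicator_def power2_eq_square)
  also have "\<dots> = (\<integral>z. H (fst z) * util u (F p) z \<partial>F p)" by (rule ubar_orth(1)[OF p Hm i1, symmetric])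
  also have "\<dots> \<le> (\<integral>z. ((H (fst z))\<^sup>2 + (util u (F p) z)\<^sup>2 * indicator A (fst z)) / 2 \<partial>F p)"
  proof (rule integral_mono[OF ubar_orth(2)[OF p Hm i1]])
    show "H (fst z) * util u (F p) z \<le> ((H (fst z))\<^sup>2 + (util u (F p) z)\<^sup>2 * indicator A (fst z)) / 2" for z
      using sum_squares_bound[of "H (fst z)" "util u (F p) z"] by (cases "fst z \<in> A") (simp_all add: H_def)
  qed (use i1 i2 in simp)
  also have "\<dots> = ((\<integral>z. (H (fst z))\<^sup>2 \<partial>F p) + (\<integral>z. (util u (F p) z)\<^sup>2 * indicator A (fst z) \<partial>F p)) / 2"
    using i1 i2 by simp
  finally show ?thesis unfolding H2 by simp
qed

text \<open>Along these sequences the shifted versions of \<open>ubar\<close> are square integrable under \<open>F p\<close>; in the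
  model this holds only for small shifts.\<close>

definition good_seq :: "real ^ 'd \<Rightarrow> (nat \<Rightarrow> real ^ 'd) \<Rightarrow> real ^ 'd \<Rightarrow> bool" where
  "good_seq p h a \<longleftrightarrow> local_seq p h a \<and>
     (\<forall>n. (\<integral>\<^sup>+z. ennreal ((ubar (p + h n) (fst z) - ubar p (fst z))\<^sup>2) \<partial>F p) < \<infinity>)"

lemma ubar_cont_0:
  assumes p: "p \<in> T" and \<epsilon>: "0 < \<epsilon>"
  shows "\<exists>\<delta>>0. \<forall>D. norm D < \<delta> \<longrightarrow> (\<integral>\<^sup>+z. ennreal ((ubar (p + D) (fst z) - ubar p (fst z))\<^sup>2) \<partial>F p) < ennreal \<epsilon>"
proof -
  have "\<forall>\<^sub>F D in at 0. (\<integral>\<^sup>+z. ennreal ((ubar (p + D) (fst z) - ubar p (fst z))\<^sup>2) \<partial>F p) < ennreal \<epsilon>"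
    using ubar_cont[OF p] \<epsilon> by (intro order_tendstoD(2)) auto
  then obtain d where d: "0 < d" "\<And>D. D \<noteq> 0 \<Longrightarrow> norm D < d \<Longrightarrow>
      (\<integral>\<^sup>+z. ennreal ((ubar (p + D) (fst z) - ubar p (fst z))\<^sup>2) \<partial>F p) < ennreal \<epsilon>"
    unfolding eventually_at by (auto simp: dist_norm)
  show ?thesis
  proof (intro exI[of _ d] conjI allI impI d(1))
    fix D :: "real ^ 'd" assume "norm D < d"
    then show "(\<integral>\<^sup>+z. ennreal ((ubar (p + D) (fst z) - ubar p (fst z))\<^sup>2) \<partial>F p) < ennreal \<epsilon>"
      using d(2)[of D] \<epsilon> by (cases "D = 0") auto
  qed
qed

lemma good_seq_of_local_seq:
  assumes ls: "local_seq p h' a"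
  obtains h where "good_seq p h a" "\<forall>\<^sub>F n in sequentially. h n = h' n"
proof
  define I where "I D = (\<integral>\<^sup>+z. ennreal ((ubar (p + D) (fst z) - ubar p (fst z))\<^sup>2) \<partial>F p)" for D
  \<comment> \<open>A shift with an infinite integral is replaced by 0; continuity of
    \<open>ubar\<close> at p leaves only finitely many of these.\<close>
  define h where "h n = (if I (h' n) < \<infinity> then h' n else 0)" for n
  note p = local_seqD(1)[OF ls]
  obtain d where d: "0 < d" "\<And>D. norm D < d \<Longrightarrow> I D < ennreal 1"
    using ubar_cont_0[OF p, of 1] by (auto simp: I_def)
  have "\<forall>\<^sub>F n in sequentially. norm (h' n) < d"
    using tendsto_norm_zero[OF local_seqD(4)[OF ls]] d(1) by (rule order_tendstoD)
  then show ev: "\<forall>\<^sub>F n in sequentially. h n = h' n"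
  proof eventually_elim
    case (elim n)
    have "I (h' n) < \<infinity>" using d(2)[OF elim] by (rule less_le_trans) simp
    then show ?case by (simp add: h_def)
  qed
  have "(\<lambda>n. sqrt (real n) *\<^sub>R h n) \<longlonglongrightarrow> a"
    using local_seqD(3)[OF ls] by (rule Lim_transform_eventually) (use ev in eventually_elim, simp)
  moreover have "p + h n \<in> T" for n using p local_seqD(2)[OF ls, of n] by (simp add: h_def)
  moreover have "I (h n) < \<infinity>" for n
  proof (cases "I (h' n) < \<infinity>")
    case False
    then have "h n = 0" unfolding h_def by (rule if_not_P)
    then show ?thesis by (simp add: I_def)
  qed (simp add: h_def)
  ultimately show "good_seq p h a"
    using p by (auto simp: good_seq_def local_seq_def I_def)
qed

lemma good_seqD: "good_seq p h a \<Longrightarrow> local_seq p h a"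
  by (simp add: good_seq_def)

lemma ubar_L2_tendsto:
  assumes gs: "good_seq p h a"
  shows "L2_tendsto (F p) (\<lambda>n z. ubar (p + h n) (fst z)) (\<lambda>z. ubar p (fst z))"
proof -
  note ls = good_seqD[OF gs]
  note p = local_seqD(1)[OF ls] and pn = local_seqD(2)[OF ls]
  note [measurable] = ubar_F[OF p p] ubar_F[OF p pn]
  have di: "integrable (F p) (\<lambda>z. (ubar (p + h n) (fst z) - ubar p (fst z))\<^sup>2)" for n
    using gs by (intro integrableI_nonneg) (auto simp: good_seq_def)
  have i: "integrable (F p) (\<lambda>z. (ubar (p + h n) (fst z))\<^sup>2)" for n
    using integral_square_add_le(1)[OF _ _ di[of n] ubar_sq[OF p]] by simp
  have "(\<lambda>n. \<integral>z. (ubar (p + h n) (fst z) - ubar p (fst z))\<^sup>2 \<partial>F p) \<longlonglongrightarrow> 0"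
  proof (rule LIMSEQ_I)
    fix e :: real assume e: "0 < e"
    obtain d where d: "0 < d" "\<And>D. norm D < d \<Longrightarrow> (\<integral>\<^sup>+z. ennreal ((ubar (p + D) (fst z) - ubar p (fst z))\<^sup>2) \<partial>F p) < ennreal e"
      using ubar_cont_0[OF p e] by auto
    have "\<forall>\<^sub>F n in sequentially. norm (h n) < d"
      using tendsto_norm_zero[OF local_seqD(4)[OF ls]] d(1) by (rule order_tendstoD)
    then have "\<forall>\<^sub>F n in sequentially. norm ((\<integral>z. (ubar (p + h n) (fst z) - ubar p (fst z))\<^sup>2 \<partial>F p) - 0) < e"
    proof eventually_elim
      case (elim n)
      have "ennreal (\<integral>z. (ubar (p + h n) (fst z) - ubar p (fst z))\<^sup>2 \<partial>F p) < ennreal e"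
        using d(2)[OF elim] by (subst (asm) nn_integral_eq_integral[OF di]) auto
      then show ?case using e by (simp add: ennreal_less_iff)
    qed
    then show "\<exists>N. \<forall>n\<ge>N. norm ((\<integral>z. (ubar (p + h n) (fst z) - ubar p (fst z))\<^sup>2 \<partial>F p) - 0) < e"
      by (simp add: eventually_sequentially)
  qed
  then show ?thesis
    unfolding L2_tendsto_def using ubar_F[OF p p] ubar_F[OF p pn] i ubar_sq[OF p] by blast
qed

lemma seq_tendsto:
  assumes ls: "local_seq p h a"
  shows "(\<lambda>n. p + h n) \<longlonglongrightarrow> p"
  using tendsto_add[OF tendsto_const local_seqD(4)[OF ls]] by simp

lemma u_sq_tendsto:
  assumes ls: "local_seq p h a"
  shows "(\<lambda>n. \<integral>z. (util u (F (p + h n)) z)\<^sup>2 \<partial>F (p + h n)) \<longlonglongrightarrow> (\<integral>z. (util u (F p) z)\<^sup>2 \<partial>F p)"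
  by (rule continuous_on_tendsto_compose[OF u_sq_cont seq_tendsto[OF ls] local_seqD(1)[OF ls] always_eventually])
    (rule allI, rule local_seqD(2)[OF ls])

lemma u_tail:
  assumes ls: "local_seq p h a" and K: "filterlim K at_top sequentially"
  shows "(\<lambda>n. \<integral>z. (util u (F (p + h n)) z)\<^sup>2 * indicator {z. K n < (util u (F (p + h n)) z)\<^sup>2} z \<partial>F (p + h n)) \<longlonglongrightarrow> 0"
proof (rule weak_conv_uniformly_square_integrable[OF F_prob[OF local_seqD(2)[OF ls]] F_prob[OF local_seqD(1)[OF ls]]
      u_F[OF local_seqD(2)[OF ls]] u_F[OF local_seqD(1)[OF ls]] u_sq[OF local_seqD(2)[OF ls]] u_sq[OF local_seqD(1)[OF ls]]
      _ u_sq_tendsto[OF ls] K])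
  show "weak_conv_m (\<lambda>n. distr (F (p + h n)) borel (util u (F (p + h n)))) (distr (F p) borel (util u (F p)))"
    using u_weak[unfolded weakly_continuous_on_def, rule_format, OF local_seqD(1)[OF ls], of "\<lambda>n. p + h n"]
      local_seqD(2)[OF ls] seq_tendsto[OF ls] by simp
qed

text \<open>No weak limit of \<open>ubar\<close> under the moving laws is at hand. The event A =
  {ubar^2 > K} depends on X alone, so the integral of ubar^2 over it is at most that of u^2; there
  u^2 is split at a lower level L, giving the tail of u^2 plus L P(A), and P(A) \<le> E u^2 /
  K.\<close>

lemma ubar_tail:
  assumes ls: "local_seq p h a" and K: "filterlim K at_top sequentially"
  shows "(\<lambda>n. \<integral>z. (ubar (p + h n) (fst z))\<^sup>2 * indicator {z. K n < (ubar (p + h n) (fst z))\<^sup>2} z \<partial>F (p + h n)) \<longlonglongrightarrow> 0"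
proof -
  note p = local_seqD(1)[OF ls] and pn = local_seqD(2)[OF ls]
  define M where "M n = F (p + h n)" for n
  define U where "U n = util u (M n)" for n
  define V where "V n z = ubar (p + h n) (fst z)" for n and z :: "'x \<times> 't"
  interpret M: prob_space "M n" for n unfolding M_def by (rule F_prob[OF pn])
  have m: "U n \<in> borel_measurable (M n)" "V n \<in> borel_measurable (M n)" for n
    unfolding U_def V_def[abs_def] M_def using u_F[OF pn] ubar_F[OF pn pn] by auto
  note [measurable] = m
  have U2: "integrable (M n) (\<lambda>z. (U n z)\<^sup>2)" and V2: "integrable (M n) (\<lambda>z. (V n z)\<^sup>2)" for n
    unfolding U_def V_def M_def using u_sq[OF pn] ubar_sq[OF pn] by auto
  define s where "s n = (\<integral>z. (U n z)\<^sup>2 \<partial>M n)" for n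
  have s: "s \<longlonglongrightarrow> (\<integral>z. (util u (F p) z)\<^sup>2 \<partial>F p)"
    unfolding s_def U_def M_def by (rule u_sq_tendsto[OF ls])
  \<comment> \<open>The square root makes both L tend to infinity and L / K tend to 0.\<close>
  define L where "L n = sqrt (max 0 (K n))" for n
  have L: "filterlim L at_top sequentially"
    unfolding L_def by (intro filterlim_compose[OF sqrt_at_top] filterlim_at_top_mono[OF K]) auto
  define t where "t n = (\<integral>z. (U n z)\<^sup>2 * indicator {z. L n < (U n z)\<^sup>2} z \<partial>M n)" for n
  have t: "t \<longlonglongrightarrow> 0" unfolding t_def U_def M_def by (rule u_tail[OF ls L])
  have le: "(\<integral>z. (V n z)\<^sup>2 * indicator {z. K n < (V n z)\<^sup>2} z \<partial>M n) \<le> t n + s n / L n" if Ln: "0 < L n" for n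
  proof -
    have Kn: "0 < K n" "L n * L n = K n"
      using Ln by (auto simp: L_def max_def split: if_splits)
    define A where "A = {x \<in> space MX. K n < (ubar (p + h n) x)\<^sup>2}"
    have A: "A \<in> sets MX" unfolding A_def using ubar_MX[OF pn[of n]] by measurable
    have iA: "indicator {z. K n < (V n z)\<^sup>2} z = (indicator A (fst z) :: real)" if "z \<in> space (M n)" for z
      using that fst_space[OF pn[of n]] by (auto simp: A_def V_def M_def indicator_def)
    have [measurable]: "{z \<in> space (M n). K n < (V n z)\<^sup>2} \<in> sets (M n)" by measurable
    have pK: "measure (M n) {z \<in> space (M n). K n < (V n z)\<^sup>2} \<le> s n / K n"
    proof -
      have "K n * measure (M n) {z \<in> space (M n). K n < (V n z)\<^sup>2} =
          (\<integral>z. K n * indicator {z \<in> space (M n). K n < (V n z)\<^sup>2} z \<partial>M n)" by simp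
      also have "\<dots> \<le> (\<integral>z. (V n z)\<^sup>2 \<partial>M n)"
      proof (rule integral_mono[OF _ V2])
          show "integrable (M n) (\<lambda>z. K n * indicator {z \<in> space (M n). K n < (V n z)\<^sup>2} z)"
            by (intro integrable_mult_right integrable_real_indicator) (auto simp: M.emeasure_eq_measure)
        qed (use Kn in \<open>auto simp: indicator_def\<close>)
      also have "\<dots> \<le> s n"
      proof -
        have "(\<integral>z. (V n z)\<^sup>2 \<partial>M n) = (\<integral>z. (V n z)\<^sup>2 * indicator (space MX) (fst z) \<partial>M n)"
          by (rule Bochner_Integration.integral_cong) (use fst_space[OF pn[of n]] in \<open>auto simp: M_def\<close>)
        also have "\<dots> \<le> (\<integral>z. (U n z)\<^sup>2 * indicator (space MX) (fst z) \<partial>M n)"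
          unfolding V_def U_def M_def by (rule ubar_sq_le[OF pn]) auto
        also have "\<dots> = s n" unfolding s_def
          by (rule Bochner_Integration.integral_cong) (use fst_space[OF pn[of n]] in \<open>auto simp: M_def\<close>)
        finally show ?thesis .
      qed
      finally show ?thesis using Kn by (simp add: field_simps)
    qed
    have i1: "integrable (M n) (\<lambda>z. (U n z)\<^sup>2 * indicator {z. L n < (U n z)\<^sup>2} z)"
      by (rule Bochner_Integration.integrable_bound[OF U2[of n]]) (auto simp: indicator_def)
    have i2: "integrable (M n) (\<lambda>z. L n * indicator {z \<in> space (M n). K n < (V n z)\<^sup>2} z)"
      by (intro integrable_mult_right integrable_real_indicator) (auto simp: M.emeasure_eq_measure)
    have "(\<integral>z. (V n z)\<^sup>2 * indicator {z. K n < (V n z)\<^sup>2} z \<partial>M n) = (\<integral>z. (V n z)\<^sup>2 * indicator A (fst z) \<partial>M n)"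
      by (rule Bochner_Integration.integral_cong) (use iA in auto)
    also have "\<dots> \<le> (\<integral>z. (U n z)\<^sup>2 * indicator A (fst z) \<partial>M n)"
      unfolding V_def U_def M_def by (rule ubar_sq_le[OF pn A])
    also have "\<dots> = (\<integral>z. (U n z)\<^sup>2 * indicator {z. K n < (V n z)\<^sup>2} z \<partial>M n)"
      by (rule Bochner_Integration.integral_cong) (use iA in auto)
    also have "\<dots> \<le> (\<integral>z. (U n z)\<^sup>2 * indicator {z. L n < (U n z)\<^sup>2} z + L n * indicator {z \<in> space (M n). K n < (V n z)\<^sup>2} z \<partial>M n)"
    proof (rule integral_mono)
      show "integrable (M n) (\<lambda>z. (U n z)\<^sup>2 * indicator {z. K n < (V n z)\<^sup>2} z)"
        by (rule Bochner_Integration.integrable_bound[OF U2[of n]]) (auto simp: indicator_def)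
      show "integrable (M n) (\<lambda>z. (U n z)\<^sup>2 * indicator {z. L n < (U n z)\<^sup>2} z + L n * indicator {z \<in> space (M n). K n < (V n z)\<^sup>2} z)"
        by (rule Bochner_Integration.integrable_add[OF i1 i2])
    qed (use Ln in \<open>auto simp: indicator_def not_less\<close>)
    also have "\<dots> = t n + L n * measure (M n) {z \<in> space (M n). K n < (V n z)\<^sup>2}"
      by (subst Bochner_Integration.integral_add[OF i1 i2]) (simp add: t_def)
    also have "L n * measure (M n) {z \<in> space (M n). K n < (V n z)\<^sup>2} \<le> L n * (s n / K n)"
      using pK Ln by (intro mult_left_mono) auto
    also have "L n * (s n / K n) = s n / L n" using Ln Kn(2)[symmetric] by simp
    finally show ?thesis by simp
  qed
  have "(\<lambda>n. s n * inverse (L n)) \<longlonglongrightarrow> (\<integral>z. (util u (F p) z)\<^sup>2 \<partial>F p) * 0"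
    by (intro tendsto_mult s tendsto_inverse_0_at_top L)
  from tendsto_add[OF t this] have b: "(\<lambda>n. t n + s n / L n) \<longlonglongrightarrow> 0" by (simp add: divide_inverse)
  have "\<forall>\<^sub>F n in sequentially. 0 < L n" using L by (simp add: filterlim_at_top_dense)
  then have ev: "\<forall>\<^sub>F n in sequentially. norm (\<integral>z. (V n z)\<^sup>2 * indicator {z. K n < (V n z)\<^sup>2} z \<partial>M n) \<le> t n + s n / L n"
  proof eventually_elim
    case (elim n)
    have "0 \<le> (\<integral>z. (V n z)\<^sup>2 * indicator {z. K n < (V n z)\<^sup>2} z \<partial>M n)" by simp
    then show ?case using le[OF elim] by simp
  qed
  show ?thesis
    using Lim_null_comparison[OF ev b] unfolding V_def M_def .
qed

end

lemma square_tail_tendsto: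
  fixes X :: "'a \<Rightarrow> real"
  assumes [measurable]: "X \<in> borel_measurable M" and X2: "integrable M (\<lambda>z. (X z)\<^sup>2)"
    and K: "filterlim K at_top sequentially"
  shows "(\<lambda>n. \<integral>z. (X z)\<^sup>2 * indicator {z. K n < (X z)\<^sup>2} z \<partial>M) \<longlonglongrightarrow> 0"
proof -
  have "(\<lambda>n. \<integral>z. (X z)\<^sup>2 * indicator {z. K n < (X z)\<^sup>2} z \<partial>M) \<longlonglongrightarrow> (\<integral>z. 0 \<partial>M)"
  proof (rule integral_dominated_convergence[OF _ _ X2])
    show "AE z in M. (\<lambda>n. (X z)\<^sup>2 * indicator {z. K n < (X z)\<^sup>2} z) \<longlonglongrightarrow> 0"
    proof (rule AE_I2)
      fix z
      have "\<forall>\<^sub>F n in sequentially. (X z)\<^sup>2 \<le> K n" using K by (simp add: filterlim_at_top)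
      then have "\<forall>\<^sub>F n in sequentially. (X z)\<^sup>2 * indicator {z. K n < (X z)\<^sup>2} z = 0"
        by eventually_elim (simp add: indicator_def)
      then show "(\<lambda>n. (X z)\<^sup>2 * indicator {z. K n < (X z)\<^sup>2} z) \<longlonglongrightarrow> 0" by (rule tendsto_eventually)
    qed
  qed (simp, measurable, auto simp: indicator_def)
  then show ?thesis by simp
qed

context dqm_model
begin

lemma outside_indicator:
  assumes p: "p \<in> T" "p + h \<in> T"
  shows "(\<lambda>z. indicator (lr_set p h) (fst z) :: real) \<in> borel_measurable (F (p + h))"
    "integrable (F (p + h)) (\<lambda>z. 1 - indicator (lr_set p h) (fst z) :: real)"
    "(\<integral>z. 1 - indicator (lr_set p h) (fst z) \<partial>F (p + h)) = excess p h"
proof -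
  interpret prob_space "F (p + h)" by (rule F_prob[OF p(2)])
  show m: "(\<lambda>z. indicator (lr_set p h) (fst z) :: real) \<in> borel_measurable (F (p + h))"
    by (rule comp_F[OF p(2) borel_measurable_indicator[OF lr_set_sets[OF p]]])
  show "integrable (F (p + h)) (\<lambda>z. 1 - indicator (lr_set p h) (fst z) :: real)"
    by (rule integrable_const_bound[of _ 1]) (use m in \<open>auto simp: indicator_def\<close>)
  have "(\<integral>z. 1 - indicator (lr_set p h) (fst z) \<partial>F (p + h)) =
     (\<integral>z. indicator {z \<in> space (F (p + h)). fst z \<notin> lr_set p h} z \<partial>F (p + h))"
    by (rule Bochner_Integration.integral_cong) (auto simp: indicator_def)
  also have "\<dots> = measure (F (p + h)) ({z \<in> space (F (p + h)). fst z \<notin> lr_set p h} \<inter> space (F (p + h)))"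
    by (rule Bochner_Integration.integral_indicator)
  also have "{z \<in> space (F (p + h)). fst z \<notin> lr_set p h} \<inter> space (F (p + h)) =
     {z \<in> space (F (p + h)). fst z \<notin> lr_set p h}" by auto
  finally show "(\<integral>z. 1 - indicator (lr_set p h) (fst z) \<partial>F (p + h)) = excess p h" by (simp add: excess_def)
qed

lemma lr_minus_1_sq:
  assumes "p \<in> T" "p + h \<in> T"
  shows "(lr p h x - 1)\<^sup>2 \<le> 9"
proof -
  have "\<bar>lr p h x - 1\<bar> \<le> 3" using lr_bounds[OF assms, of x] by linarith
  then have "(\<bar>lr p h x - 1\<bar>)\<^sup>2 \<le> 3\<^sup>2" by (rule power_mono) simp
  then show ?thesis by simp
qed

lemma lr_second_moment:
  assumes ls: "local_seq p h a"
  shows "(\<lambda>n. real n * (\<integral>z. (lr p (h n) (fst z) - 1)\<^sup>2 \<partial>F p)) \<longlonglongrightarrow> (\<integral>z. (a \<bullet> \<rho> p (fst z))\<^sup>2 \<partial>F p)"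
proof -
  have "(\<lambda>n. \<integral>z. (sqrt (real n) * (lr p (h n) (fst z) - 1)) * (sqrt (real n) * (lr p (h n) (fst z) - 1)) \<partial>F p)
      \<longlonglongrightarrow> (\<integral>z. (a \<bullet> \<rho> p (fst z)) * (a \<bullet> \<rho> p (fst z)) \<partial>F p)"
    by (rule L2_tendsto_mult[OF lr_L2_tendsto[OF ls] lr_L2_tendsto[OF ls]])
  moreover have "(sqrt (real n) * x) * (sqrt (real n) * x) = real n * x\<^sup>2" for n x
    by (simp add: power2_eq_square algebra_simps)
  ultimately show ?thesis by (simp add: power2_eq_square[symmetric])
qed

end

context utility_model
begin

text \<open>Split at ubar^2 > n: above, the tail vanishes; below, the integral is at most n times
  the excess, and n is just the level that the excess still absorbs.\<close>

lemma ubar_outside_null: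
  assumes ls: "local_seq p h a"
  shows "(\<lambda>n. \<integral>z. (ubar (p + h n) (fst z))\<^sup>2 * (1 - indicator (lr_set p (h n)) (fst z)) \<partial>F (p + h n)) \<longlonglongrightarrow> 0"
proof -
  note p = local_seqD(1)[OF ls] and pn = local_seqD(2)[OF ls]
  define M where "M n = F (p + h n)" for n
  define V where "V n z = ubar (p + h n) (fst z)" for n and z :: "'x \<times> 't"
  define hh where "hh n z = (indicator (lr_set p (h n)) (fst z) :: real)" for n and z :: "'x \<times> 't"
  interpret M: prob_space "M n" for n unfolding M_def by (rule F_prob[OF pn])
  have Vm: "V n \<in> borel_measurable (M n)" for n
    unfolding V_def[abs_def] M_def by (rule ubar_F[OF pn pn])
  have hm: "hh n \<in> borel_measurable (M n)" for n
    unfolding hh_def[abs_def] M_def by (rule comp_F[OF pn borel_measurable_indicator[OF lr_set_sets[OF p pn]]])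
  note [measurable] = Vm hm
  have V2: "integrable (M n) (\<lambda>z. (V n z)\<^sup>2)" for n unfolding V_def M_def by (rule ubar_sq[OF pn])
  define t where "t n = (\<integral>z. (V n z)\<^sup>2 * indicator {z. real n < (V n z)\<^sup>2} z \<partial>M n)" for n
  have t: "t \<longlonglongrightarrow> 0" unfolding t_def V_def M_def by (rule ubar_tail[OF ls filterlim_real_sequentially])
  have h01: "0 \<le> hh n z" "hh n z \<le> 1" for n z by (simp_all add: hh_def indicator_def)
  have hi: "integrable (M n) (\<lambda>z. 1 - hh n z)" and ex: "(\<integral>z. 1 - hh n z \<partial>M n) = excess p (h n)" for n
    unfolding hh_def M_def by (rule outside_indicator[OF p pn])+
  have "norm (\<integral>z. (V n z)\<^sup>2 * (1 - hh n z) \<partial>M n) \<le> t n + real n * excess p (h n)" for n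
  proof -
    have i1: "integrable (M n) (\<lambda>z. (V n z)\<^sup>2 * indicator {z. real n < (V n z)\<^sup>2} z)"
      by (rule Bochner_Integration.integrable_bound[OF V2[of n]]) (measurable, auto simp: indicator_def)
    have "norm (\<integral>z. (V n z)\<^sup>2 * (1 - hh n z) \<partial>M n) \<le>
        (\<integral>z. (V n z)\<^sup>2 * indicator {z. real n < (V n z)\<^sup>2} z + real n * (1 - hh n z) \<partial>M n)"
    proof (rule norm_integral_le)
      show "integrable (M n) (\<lambda>z. (V n z)\<^sup>2 * indicator {z. real n < (V n z)\<^sup>2} z + real n * (1 - hh n z))"
        by (intro Bochner_Integration.integrable_add i1 integrable_mult_right hi)
      have "norm ((V n z)\<^sup>2 * (1 - hh n z)) \<le> (V n z)\<^sup>2 * indicator {z. real n < (V n z)\<^sup>2} z + real n * (1 - hh n z)" for z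
      proof (cases "real n < (V n z)\<^sup>2")
        case True
        have "(V n z)\<^sup>2 * (1 - hh n z) \<le> (V n z)\<^sup>2 * 1" using h01[of n z] by (intro mult_left_mono) auto
        moreover have "0 \<le> real n * (1 - hh n z)" using h01[of n z] by simp
        ultimately have "(V n z)\<^sup>2 * (1 - hh n z) \<le> (V n z)\<^sup>2 + real n * (1 - hh n z)" by linarith
        then show ?thesis using True h01[of n z] by (simp add: indicator_def)
      next
        case False
        have "(V n z)\<^sup>2 * (1 - hh n z) \<le> real n * (1 - hh n z)" using False h01[of n z] by (intro mult_right_mono) auto
        then show ?thesis using False h01[of n z] by (simp add: indicator_def)
      qed
      then show "AE z in M n. norm ((V n z)\<^sup>2 * (1 - hh n z)) \<le>
          (V n z)\<^sup>2 * indicator {z. real n < (V n z)\<^sup>2} z + real n * (1 - hh n z)" by simp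
    qed
    also have "\<dots> = t n + real n * excess p (h n)"
      by (subst Bochner_Integration.integral_add[OF i1 integrable_mult_right[OF hi]]) (simp add: t_def ex)
    finally show ?thesis .
  qed
  from null_of_norm_le[OF this] tendsto_add[OF t excess_null[OF ls]] show ?thesis
    unfolding V_def M_def hh_def by simp
qed

text \<open>Function and law both move. On \<open>lr_set\<close> the law is moved back to F p, where
  E V^2 lr = E V^2 + E V (V r) with r = lr - 1; the versions V converge in L2 and V r tends to 0 in
  L2. The complement is \<open>ubar_outside_null\<close>.\<close>

lemma ubar_sq_tendsto:
  assumes gs: "good_seq p h a"
  shows "(\<lambda>n. \<integral>z. (ubar (p + h n) (fst z))\<^sup>2 \<partial>F (p + h n)) \<longlonglongrightarrow> (\<integral>z. (ubar p (fst z))\<^sup>2 \<partial>F p)"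
proof -
  note ls = good_seqD[OF gs]
  note p = local_seqD(1)[OF ls] and pn = local_seqD(2)[OF ls]
  interpret prob_space "F p" by (rule F_prob[OF p])
  define V where "V n z = ubar (p + h n) (fst z)" for n and z :: "'x \<times> 't"
  define V0 where "V0 z = ubar p (fst z)" for z :: "'x \<times> 't"
  define r where "r n z = lr p (h n) (fst z) - 1" for n and z :: "'x \<times> 't"
  have VL: "L2_tendsto (F p) V V0" using ubar_L2_tendsto[OF gs] unfolding V_def V0_def .
  have m[measurable]: "V n \<in> borel_measurable (F p)" "V0 \<in> borel_measurable (F p)" "r n \<in> borel_measurable (F p)" for n
    using VL lr_F(1)[OF p pn] by (auto simp: L2_tendsto_def r_def[abs_def])
  have i: "integrable (F p) (\<lambda>z. (V n z)\<^sup>2)" "integrable (F p) (\<lambda>z. (V0 z)\<^sup>2)" for n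
    using VL by (auto simp: L2_tendsto_def)
  have r9: "(r n z)\<^sup>2 \<le> 9" for n z unfolding r_def by (rule lr_minus_1_sq[OF p pn])
  have ir: "integrable (F p) (\<lambda>z. (r n z)\<^sup>2)" for n
    by (rule integrable_const_bound[of _ 9]) (use r9 in auto)
  have iW: "integrable (F p) (\<lambda>z. (X z * r n z)\<^sup>2)"
    "(\<integral>z. (X z * r n z)\<^sup>2 \<partial>F p) \<le> 9 * (\<integral>z. (X z)\<^sup>2 \<partial>F p)"
    if [measurable]: "X \<in> borel_measurable (F p)" and X2: "integrable (F p) (\<lambda>z. (X z)\<^sup>2)" for X n
  proof -
    have b: "(X z * r n z)\<^sup>2 \<le> 9 * (X z)\<^sup>2" for z
      unfolding power_mult_distrib using mult_left_mono[OF r9[of n z], of "(X z)\<^sup>2"] by simp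
    show iX: "integrable (F p) (\<lambda>z. (X z * r n z)\<^sup>2)"
      by (rule Bochner_Integration.integrable_bound[OF integrable_mult_right[OF X2, of 9]])
        (measurable, use b in simp)
    have "(\<integral>z. (X z * r n z)\<^sup>2 \<partial>F p) \<le> (\<integral>z. 9 * (X z)\<^sup>2 \<partial>F p)"
      by (rule integral_mono[OF iX]) (use X2 b in auto)
    then show "(\<integral>z. (X z * r n z)\<^sup>2 \<partial>F p) \<le> 9 * (\<integral>z. (X z)\<^sup>2 \<partial>F p)" by simp
  qed
  define d where "d n = (\<integral>z. (V n z - V0 z)\<^sup>2 \<partial>F p)" for n
  have d: "d \<longlonglongrightarrow> 0" using VL by (simp add: d_def[abs_def] L2_tendsto_def)
  have id: "integrable (F p) (\<lambda>z. (V n z - V0 z)\<^sup>2)" for n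
    using integral_square_add_le(1)[of "V n" "F p" "\<lambda>z. - V0 z"] i by simp
  define t where "t n = (\<integral>z. (V0 z)\<^sup>2 * indicator {z. sqrt (real n) < (V0 z)\<^sup>2} z \<partial>F p)" for n
  have t: "t \<longlonglongrightarrow> 0" unfolding t_def
    by (rule square_tail_tendsto[OF m(2) i(2) filterlim_compose[OF sqrt_at_top filterlim_real_sequentially]])
  define q where "q n = sqrt (real n) * (\<integral>z. (r n z)\<^sup>2 \<partial>F p)" for n
  have q: "q \<longlonglongrightarrow> 0"
  proof -
    have "(\<lambda>n. inverse (sqrt (real n))) \<longlonglongrightarrow> 0"
      by (intro tendsto_inverse_0_at_top filterlim_compose[OF sqrt_at_top] filterlim_real_sequentially)
    from tendsto_mult[OF this lr_second_moment[OF ls]]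
    have "(\<lambda>n. inverse (sqrt (real n)) * (real n * (\<integral>z. (r n z)\<^sup>2 \<partial>F p))) \<longlonglongrightarrow> 0" by (simp add: r_def)
    moreover have "inverse (sqrt (real n)) * (real n * x) = sqrt (real n) * x" for n x
      by (cases "n = 0") (auto simp: field_simps)
    ultimately show ?thesis by (simp add: q_def[abs_def])
  qed
  \<comment> \<open>Split at V0^2 > sqrt n. Below, sqrt n E r^2 tends to 0 because E r^2 is O(1/n);
    above, r^2 \<le> 9 and the tail of the fixed function V0 vanishes.\<close>
  have V0r: "(\<integral>z. (V0 z * r n z)\<^sup>2 \<partial>F p) \<le> q n + 9 * t n" for n
  proof -
    have it: "integrable (F p) (\<lambda>z. (V0 z)\<^sup>2 * indicator {z. sqrt (real n) < (V0 z)\<^sup>2} z)"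
      by (rule Bochner_Integration.integrable_bound[OF i(2)]) (measurable, auto simp: indicator_def)
    have "(\<integral>z. (V0 z * r n z)\<^sup>2 \<partial>F p) \<le>
       (\<integral>z. sqrt (real n) * (r n z)\<^sup>2 + 9 * ((V0 z)\<^sup>2 * indicator {z. sqrt (real n) < (V0 z)\<^sup>2} z) \<partial>F p)"
    proof (rule integral_mono[OF iW(1)[OF m(2) i(2)]])
      show "integrable (F p) (\<lambda>z. sqrt (real n) * (r n z)\<^sup>2 + 9 * ((V0 z)\<^sup>2 * indicator {z. sqrt (real n) < (V0 z)\<^sup>2} z))"
        by (intro Bochner_Integration.integrable_add integrable_mult_right ir it)
      show "(V0 z * r n z)\<^sup>2 \<le> sqrt (real n) * (r n z)\<^sup>2 + 9 * ((V0 z)\<^sup>2 * indicator {z. sqrt (real n) < (V0 z)\<^sup>2} z)" for z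
      proof (cases "sqrt (real n) < (V0 z)\<^sup>2")
        case True
        have "(V0 z)\<^sup>2 * (r n z)\<^sup>2 \<le> (V0 z)\<^sup>2 * 9" by (rule mult_left_mono[OF r9]) simp
        moreover have "0 \<le> sqrt (real n) * (r n z)\<^sup>2" by simp
        ultimately have "(V0 z)\<^sup>2 * (r n z)\<^sup>2 \<le> sqrt (real n) * (r n z)\<^sup>2 + 9 * (V0 z)\<^sup>2" by linarith
        then show ?thesis using True by (simp add: power_mult_distrib)
      next
        case False
        then have "(V0 z)\<^sup>2 * (r n z)\<^sup>2 \<le> sqrt (real n) * (r n z)\<^sup>2" by (intro mult_right_mono) auto
        then show ?thesis using False by (simp add: power_mult_distrib)
      qed
    qed
    also have "\<dots> = q n + 9 * t n"
      by (subst Bochner_Integration.integral_add[OF integrable_mult_right[OF ir] integrable_mult_right[OF it]])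
        (simp add: q_def t_def)
    finally show ?thesis .
  qed
  define W where "W n z = V n z * r n z" for n z
  have Wb: "norm (\<integral>z. (W n z - 0)\<^sup>2 \<partial>F p) \<le> 2 * (9 * d n) + 2 * (q n + 9 * t n)" for n
  proof -
    have dm: "(\<lambda>z. V n z - V0 z) \<in> borel_measurable (F p)" by measurable
    have "(\<integral>z. (W n z)\<^sup>2 \<partial>F p) = (\<integral>z. ((V n z - V0 z) * r n z + V0 z * r n z)\<^sup>2 \<partial>F p)"
      by (simp add: W_def algebra_simps)
    also have "\<dots> \<le> 2 * (\<integral>z. ((V n z - V0 z) * r n z)\<^sup>2 \<partial>F p) + 2 * (\<integral>z. (V0 z * r n z)\<^sup>2 \<partial>F p)"
      by (rule integral_square_add_le(2)[OF _ _ iW(1)[OF dm id] iW(1)[OF m(2) i(2)]]) measurable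
    also have "\<dots> \<le> 2 * (9 * d n) + 2 * (q n + 9 * t n)"
      unfolding d_def by (intro add_mono mult_left_mono iW(2)[OF dm id] V0r[unfolded d_def]) simp_all
    finally show ?thesis by simp
  qed
  have "(\<lambda>n. 2 * (9 * d n) + 2 * (q n + 9 * t n)) \<longlonglongrightarrow> 2 * (9 * 0) + 2 * (0 + 9 * 0)"
    by (intro tendsto_intros d q t)
  then have bn: "(\<lambda>n. 2 * (9 * d n) + 2 * (q n + 9 * t n)) \<longlonglongrightarrow> 0" by simp
  have WL: "L2_tendsto (F p) W (\<lambda>_. 0)"
    unfolding L2_tendsto_def using null_of_norm_le[OF Wb bn] iW(1)[OF m(1) i(1)] by (simp add: W_def[abs_def])
  have VW: "(\<lambda>n. \<integral>z. V n z * W n z \<partial>F p) \<longlonglongrightarrow> 0" using L2_tendsto_mult[OF VL WL] by simp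
  have VV: "(\<lambda>n. \<integral>z. (V n z)\<^sup>2 \<partial>F p) \<longlonglongrightarrow> (\<integral>z. (V0 z)\<^sup>2 \<partial>F p)"
    using L2_tendsto_mult[OF VL VL] by (simp add: power2_eq_square)
  have eq: "(\<integral>z. (ubar (p + h n) (fst z))\<^sup>2 \<partial>F (p + h n)) =
     (\<integral>z. (V n z)\<^sup>2 \<partial>F p) + (\<integral>z. V n z * W n z \<partial>F p) +
     (\<integral>z. (ubar (p + h n) (fst z))\<^sup>2 * (1 - indicator (lr_set p (h n)) (fst z)) \<partial>F (p + h n))" for n
  proof -
    have hm: "(\<lambda>z. indicator (lr_set p (h n)) (fst z) :: real) \<in> borel_measurable (F (p + h n))"
      by (rule comp_F[OF pn borel_measurable_indicator[OF lr_set_sets[OF p pn]]])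
    note [measurable] = hm ubar_F[OF pn pn]
    have i1: "integrable (F (p + h n)) (\<lambda>z. (ubar (p + h n) (fst z))\<^sup>2 * indicator (lr_set p (h n)) (fst z))"
      by (rule Bochner_Integration.integrable_bound[OF ubar_sq[OF pn[of n]]]) (measurable, auto simp: indicator_def)
    have "(\<integral>z. (ubar (p + h n) (fst z))\<^sup>2 * indicator (lr_set p (h n)) (fst z) \<partial>F (p + h n)) =
       (\<integral>z. (ubar (p + h n) (fst z))\<^sup>2 * lr p (h n) (fst z) \<partial>F p)"
      using lr_change[OF p pn[of n], of "\<lambda>x. (ubar (p + h n) x)\<^sup>2"] ubar_MX[OF pn[of n]] by simp
    also have "\<dots> = (\<integral>z. (V n z)\<^sup>2 + V n z * W n z \<partial>F p)"
      by (rule Bochner_Integration.integral_cong) (auto simp: V_def W_def r_def power2_eq_square algebra_simps)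
    also have "\<dots> = (\<integral>z. (V n z)\<^sup>2 \<partial>F p) + (\<integral>z. V n z * W n z \<partial>F p)"
      using i(1) integrable_mult_of_squares[OF m(1) _ i(1), of "W n" n] iW(1)[OF m(1) i(1)] m
      by (subst Bochner_Integration.integral_add) (auto simp: W_def[abs_def])
    finally have "(\<integral>z. (ubar (p + h n) (fst z))\<^sup>2 * indicator (lr_set p (h n)) (fst z) \<partial>F (p + h n)) =
       (\<integral>z. (V n z)\<^sup>2 \<partial>F p) + (\<integral>z. V n z * W n z \<partial>F p)" .
    moreover have "(\<integral>z. (ubar (p + h n) (fst z))\<^sup>2 * (1 - indicator (lr_set p (h n)) (fst z)) \<partial>F (p + h n)) =
       (\<integral>z. (ubar (p + h n) (fst z))\<^sup>2 \<partial>F (p + h n)) -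
       (\<integral>z. (ubar (p + h n) (fst z))\<^sup>2 * indicator (lr_set p (h n)) (fst z) \<partial>F (p + h n))"
      unfolding right_diff_distrib mult_1_right by (rule Bochner_Integration.integral_diff[OF ubar_sq[OF pn] i1])
    ultimately show ?thesis by simp
  qed
  have "(\<lambda>n. \<integral>z. (ubar (p + h n) (fst z))\<^sup>2 \<partial>F (p + h n)) \<longlonglongrightarrow> (\<integral>z. (V0 z)\<^sup>2 \<partial>F p) + 0 + 0"
    unfolding eq by (intro tendsto_add VV VW ubar_outside_null[OF ls])
  then show ?thesis by (simp add: V0_def)
qed

lemma resid_var_tendsto:
  assumes gs: "good_seq p h a"
  shows "(\<lambda>n. resid_var (p + h n)) \<longlonglongrightarrow> resid_var p"
proof -
  note ls = good_seqD[OF gs]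
  show ?thesis
    unfolding resid_F(4)[OF local_seqD(1)[OF ls]] resid_F(4)[OF local_seqD(2)[OF ls]]
    by (intro tendsto_diff u_sq_tendsto[OF ls] ubar_sq_tendsto[OF gs])
qed

lemma resid_tail:
  assumes ls: "local_seq p h a" and K: "filterlim K at_top sequentially"
  shows "(\<lambda>n. \<integral>z. (resid (p + h n) z)\<^sup>2 * indicator {z. K n < (resid (p + h n) z)\<^sup>2} z \<partial>F (p + h n)) \<longlonglongrightarrow> 0"
proof -
  note p = local_seqD(1)[OF ls] and pn = local_seqD(2)[OF ls]
  define M where "M n = F (p + h n)" for n
  define U where "U n = util u (M n)" for n
  define V where "V n z = ubar (p + h n) (fst z)" for n and z :: "'x \<times> 't"
  have m: "U n \<in> borel_measurable (M n)" "V n \<in> borel_measurable (M n)" for n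
    unfolding U_def V_def[abs_def] M_def by (rule u_F[OF pn], rule ubar_F[OF pn pn])
  note [measurable] = m
  have U2: "integrable (M n) (\<lambda>z. (U n z)\<^sup>2)" and V2: "integrable (M n) (\<lambda>z. (V n z)\<^sup>2)" for n
    unfolding U_def V_def M_def by (rule u_sq[OF pn], rule ubar_sq[OF pn])
  \<comment> \<open>(U - V)^2 is at most four times the larger of U^2 and V^2, so beyond K one of
    these exceeds K / 4.\<close>
  define K' where "K' n = K n / 4" for n
  have K': "filterlim K' at_top sequentially"
    unfolding filterlim_at_top
  proof
    fix Z :: real
    have "\<forall>\<^sub>F n in sequentially. 4 * Z \<le> K n" using K by (simp add: filterlim_at_top)
    then show "\<forall>\<^sub>F n in sequentially. Z \<le> K' n" by eventually_elim (simp add: K'_def)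
  qed
  define s where "s n = (\<integral>z. (U n z)\<^sup>2 * indicator {z. K' n < (U n z)\<^sup>2} z \<partial>M n)" for n
  define t where "t n = (\<integral>z. (V n z)\<^sup>2 * indicator {z. K' n < (V n z)\<^sup>2} z \<partial>M n)" for n
  have s: "s \<longlonglongrightarrow> 0" unfolding s_def U_def M_def by (rule u_tail[OF ls K'])
  have t: "t \<longlonglongrightarrow> 0" unfolding t_def V_def M_def by (rule ubar_tail[OF ls K'])
  have iU: "integrable (M n) (\<lambda>z. (U n z)\<^sup>2 * indicator {z. K' n < (U n z)\<^sup>2} z)" for n
    by (rule Bochner_Integration.integrable_bound[OF U2[of n]]) (measurable, auto simp: indicator_def)
  have it: "integrable (M n) (\<lambda>z. (V n z)\<^sup>2 * indicator {z. K' n < (V n z)\<^sup>2} z)" for n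
    by (rule Bochner_Integration.integrable_bound[OF V2[of n]]) (measurable, auto simp: indicator_def)
  have le: "norm (\<integral>z. (U n z - V n z)\<^sup>2 * indicator {z. K n < (U n z - V n z)\<^sup>2} z \<partial>M n) \<le> 4 * s n + 4 * t n" for n
  proof -
    have pw: "norm ((U n z - V n z)\<^sup>2 * indicator {z. K n < (U n z - V n z)\<^sup>2} z) \<le>
        4 * ((U n z)\<^sup>2 * indicator {z. K' n < (U n z)\<^sup>2} z) + 4 * ((V n z)\<^sup>2 * indicator {z. K' n < (V n z)\<^sup>2} z)" for z
    proof (cases "K n < (U n z - V n z)\<^sup>2")
      case True
      have b: "(U n z - V n z)\<^sup>2 \<le> 2 * (U n z)\<^sup>2 + 2 * (V n z)\<^sup>2"
        using sum_squares_bound[of "U n z" "- V n z"] by (simp add: power2_diff)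
      have nn: "0 \<le> 4 * ((U n z)\<^sup>2 * indicator {z. K' n < (U n z)\<^sup>2} z)" "0 \<le> 4 * ((V n z)\<^sup>2 * indicator {z. K' n < (V n z)\<^sup>2} z)"
        by simp_all
      show ?thesis
      proof (cases "(V n z)\<^sup>2 \<le> (U n z)\<^sup>2")
        case ge: True
        have 1: "(U n z - V n z)\<^sup>2 \<le> 4 * (U n z)\<^sup>2" using b ge by linarith
        then have "K' n < (U n z)\<^sup>2" using True by (simp add: K'_def)
        moreover have "(U n z - V n z)\<^sup>2 \<le> 4 * (U n z)\<^sup>2 + 4 * (V n z)\<^sup>2" by (rule add_increasing2[OF _ 1]) simp
        ultimately show ?thesis using 1 True by (simp add: indicator_def)
      next
        case lt: False
        have 1: "(U n z - V n z)\<^sup>2 \<le> 4 * (V n z)\<^sup>2" using b lt by linarith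
        then have "K' n < (V n z)\<^sup>2" using True by (simp add: K'_def)
        moreover have "(U n z - V n z)\<^sup>2 \<le> 4 * (U n z)\<^sup>2 + 4 * (V n z)\<^sup>2" by (rule add_increasing[OF _ 1]) simp
        ultimately show ?thesis using 1 True by (simp add: indicator_def)
      qed
    qed (simp add: indicator_def)
    have "norm (\<integral>z. (U n z - V n z)\<^sup>2 * indicator {z. K n < (U n z - V n z)\<^sup>2} z \<partial>M n) \<le>
      (\<integral>z. 4 * ((U n z)\<^sup>2 * indicator {z. K' n < (U n z)\<^sup>2} z) + 4 * ((V n z)\<^sup>2 * indicator {z. K' n < (V n z)\<^sup>2} z) \<partial>M n)"
      by (rule norm_integral_le[OF Bochner_Integration.integrable_add[OF integrable_mult_right[OF iU] integrable_mult_right[OF it]] AE_I2[OF pw]])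
    also have "\<dots> = 4 * s n + 4 * t n"
      by (subst Bochner_Integration.integral_add[OF integrable_mult_right[OF iU] integrable_mult_right[OF it]])
        (simp add: s_def t_def)
    finally show ?thesis .
  qed
  have "(\<lambda>n. 4 * s n + 4 * t n) \<longlonglongrightarrow> 4 * 0 + 4 * 0" by (intro tendsto_intros s t)
  then have "(\<lambda>n. 4 * s n + 4 * t n) \<longlonglongrightarrow> 0" by simp
  from null_of_norm_le[OF le this] show ?thesis
    unfolding resid_def U_def V_def M_def .
qed

lemma inner_gamma_vec:
  assumes p: "p \<in> T"
  shows "a \<bullet> gam p = a \<bullet> dm p - (\<integral>z. ubar p (fst z) * (a \<bullet> \<rho> p (fst z)) \<partial>F p)"
proof -
  note [measurable] = ubar_F[OF p p] score_F(1)[OF p]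
  have i: "integrable (F p) (\<lambda>z. ubar p (fst z) *\<^sub>R \<rho> p (fst z))"
  proof (rule Bochner_Integration.integrable_bound)
    show "integrable (F p) (\<lambda>z. \<bar>ubar p (fst z)\<bar> * norm (\<rho> p (fst z)))"
      by (rule integrable_mult_of_squares) (use ubar_sq[OF p] score_L2(1)[OF p] in \<open>auto\<close>)
  qed auto
  have "a \<bullet> (\<integral>z. ubar p (fst z) *\<^sub>R \<rho> p (fst z) \<partial>F p) = (\<integral>z. a \<bullet> (ubar p (fst z) *\<^sub>R \<rho> p (fst z)) \<partial>F p)"
    by (rule integral_inner_right[symmetric]) (use i in auto)
  then show ?thesis by (simp add: gamma_vec_def inner_diff_right)
qed

text \<open>The origin of \<gamma>. Under the shifted law the mean of the shifted version is
  \<open>mean_util\<close> at p + h, which contributes a . dm. Returning to F p removes the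
  covariance of \<open>ubar\<close> with the score, contributed by the likelihood ratio.\<close>

lemma mean_shift:
  assumes gs: "good_seq p h a"
  shows "(\<lambda>n. sqrt (real n) * ((\<integral>z. ubar (p + h n) (fst z) \<partial>F p) - mean_util F u p)) \<longlonglongrightarrow> a \<bullet> gam p"
proof -
  note ls = good_seqD[OF gs]
  note p = local_seqD(1)[OF ls] and pn = local_seqD(2)[OF ls]
  interpret prob_space "F p" by (rule F_prob[OF p])
  define m where "m = mean_util F u"
  have D: "(m has_derivative (\<lambda>hh. hh \<bullet> dm p)) (at p)" using mean_deriv[OF p] by (simp add: gderiv_def m_def)
  have 1: "(\<lambda>n. sqrt (real n) * (m (p + h n) - m p)) \<longlonglongrightarrow> a \<bullet> dm p"
  proof -
    have l0: "(\<lambda>hh. norm (m (p + hh) - m p - hh \<bullet> dm p) / norm hh) \<midarrow>0\<rightarrow> 0"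
      using D unfolding has_derivative_at by auto
    \<comment> \<open>The quotient with value 0 at 0 is continuous there, so indices with h n = 0 do
      no harm.\<close>
    define g where "g hh = (if hh = 0 then 0 else norm (m (p + hh) - m p - hh \<bullet> dm p) / norm hh)" for hh
    have "g \<midarrow>0\<rightarrow> 0" using l0 by (rule Lim_transform_eventually) (auto simp: g_def eventually_at_filter)
    then have "isCont g 0" by (simp add: isCont_def g_def)
    from isCont_tendsto_compose[OF this local_seqD(4)[OF ls]] have gl: "(\<lambda>n. g (h n)) \<longlonglongrightarrow> 0" by (simp add: g_def)
    have "(\<lambda>n. g (h n) * norm (sqrt (real n) *\<^sub>R h n)) \<longlonglongrightarrow> 0 * norm a"
      by (intro tendsto_intros gl local_seqD(3)[OF ls])
    then have gl2: "(\<lambda>n. g (h n) * norm (sqrt (real n) *\<^sub>R h n)) \<longlonglongrightarrow> 0" by simp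
    have "norm (sqrt (real n) * (m (p + h n) - m p) - (sqrt (real n) *\<^sub>R h n) \<bullet> dm p) \<le> g (h n) * norm (sqrt (real n) *\<^sub>R h n)" for n
    proof -
      have "sqrt (real n) * (m (p + h n) - m p) - (sqrt (real n) *\<^sub>R h n) \<bullet> dm p =
          sqrt (real n) * (m (p + h n) - m p - h n \<bullet> dm p)" by (simp add: algebra_simps)
      also have "norm \<dots> = sqrt (real n) * norm (m (p + h n) - m p - h n \<bullet> dm p)" by (simp add: abs_mult)
      also have "norm (m (p + h n) - m p - h n \<bullet> dm p) = g (h n) * norm (h n)" by (simp add: g_def)
      finally show ?thesis by simp
    qed
    from null_of_norm_le[OF this gl2]
    have "(\<lambda>n. sqrt (real n) * (m (p + h n) - m p) - (sqrt (real n) *\<^sub>R h n) \<bullet> dm p) \<longlonglongrightarrow> 0" .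
    from tendsto_add[OF this tendsto_inner[OF local_seqD(3)[OF ls] tendsto_const, of "dm p"]] show ?thesis by simp
  qed
  have 2: "(\<lambda>n. \<integral>z. ubar (p + h n) (fst z) * (sqrt (real n) * (lr p (h n) (fst z) - 1)) \<partial>F p) \<longlonglongrightarrow>
      (\<integral>z. ubar p (fst z) * (a \<bullet> \<rho> p (fst z)) \<partial>F p)"
    by (rule L2_tendsto_mult[OF ubar_L2_tendsto[OF gs] lr_L2_tendsto[OF ls]])
  define ou where "ou n = (\<integral>z. ubar (p + h n) (fst z) * (1 - indicator (lr_set p (h n)) (fst z)) \<partial>F (p + h n))" for n
  define s where "s n = (\<integral>z. (ubar (p + h n) (fst z))\<^sup>2 \<partial>F (p + h n))" for n
  have hm: "(\<lambda>z. 1 - indicator (lr_set p (h n)) (fst z) :: real) \<in> borel_measurable (F (p + h n))" for n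
    by (intro borel_measurable_diff borel_measurable_const comp_F[OF pn borel_measurable_indicator[OF lr_set_sets[OF p pn]]])
  have hsq: "(1 - indicator (lr_set p (h n)) (fst z) :: real)\<^sup>2 = 1 - indicator (lr_set p (h n)) (fst z)" for n and z :: "'x \<times> 't"
    by (simp add: indicator_def)
  note hi = outside_indicator(2)[OF p pn] and ex = outside_indicator(3)[OF p pn]
  \<comment> \<open>The lost mass is o(1/n), and Cauchy-Schwarz takes its root; this is precisely
    enough to survive the factor sqrt n.\<close>
  have ob: "norm (sqrt (real n) * ou n) \<le> sqrt (s n) * sqrt (real n * excess p (h n))" for n
  proof -
    have "\<bar>ou n\<bar> \<le> (\<integral>z. \<bar>ubar (p + h n) (fst z) * (1 - indicator (lr_set p (h n)) (fst z))\<bar> \<partial>F (p + h n))"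
      unfolding ou_def by (rule integral_abs_bound)
    also have "\<dots> \<le> sqrt (s n) * sqrt (\<integral>z. (1 - indicator (lr_set p (h n)) (fst z))\<^sup>2 \<partial>F (p + h n))"
      unfolding s_def by (rule integral_Cauchy_Schwarz[OF ubar_F[OF pn pn] hm ubar_sq[OF pn]]) (unfold hsq, rule hi)
    also have "\<dots> = sqrt (s n) * sqrt (excess p (h n))" unfolding hsq ex ..
    finally have "sqrt (real n) * \<bar>ou n\<bar> \<le> sqrt (real n) * (sqrt (s n) * sqrt (excess p (h n)))" by (rule mult_left_mono) simp
    then show ?thesis by (simp add: abs_mult real_sqrt_mult mult_ac)
  qed
  have "(\<lambda>n. sqrt (s n) * sqrt (real n * excess p (h n))) \<longlonglongrightarrow> sqrt (\<integral>z. (ubar p (fst z))\<^sup>2 \<partial>F p) * sqrt 0"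
    by (intro tendsto_intros excess_null[OF ls] ubar_sq_tendsto[OF gs, folded s_def])
  then have "(\<lambda>n. sqrt (s n) * sqrt (real n * excess p (h n))) \<longlonglongrightarrow> 0" by simp
  from null_of_norm_le[OF ob this] have 3: "(\<lambda>n. sqrt (real n) * ou n) \<longlonglongrightarrow> 0" .
  have eq: "sqrt (real n) * ((\<integral>z. ubar (p + h n) (fst z) \<partial>F p) - mean_util F u p) =
     sqrt (real n) * (m (p + h n) - m p) -
     (\<integral>z. ubar (p + h n) (fst z) * (sqrt (real n) * (lr p (h n) (fst z) - 1)) \<partial>F p) - sqrt (real n) * ou n" for n
  proof -
    interpret Mn: prob_space "F (p + h n)" by (rule F_prob[OF pn])
    have ui: "integrable (F (p + h n)) (\<lambda>z. ubar (p + h n) (fst z))"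
      by (rule Mn.square_integrable_imp_integrable[OF ubar_F[OF pn pn] ubar_sq[OF pn]])
    have uhi: "integrable (F (p + h n)) (\<lambda>z. ubar (p + h n) (fst z) * (1 - indicator (lr_set p (h n)) (fst z)))"
      by (rule integrable_mult_of_squares[OF ubar_F[OF pn pn] hm ubar_sq[OF pn]]) (unfold hsq, rule hi)
    have u0m: "(\<lambda>z. ubar (p + h n) (fst z)) \<in> borel_measurable (F p)" and u0i: "integrable (F p) (\<lambda>z. (ubar (p + h n) (fst z))\<^sup>2)"
      using ubar_L2_tendsto[OF gs] by (auto simp: L2_tendsto_def)
    have u01: "integrable (F p) (\<lambda>z. ubar (p + h n) (fst z))"
      by (rule square_integrable_imp_integrable[OF u0m u0i])
    have url: "integrable (F p) (\<lambda>z. ubar (p + h n) (fst z) * lr p (h n) (fst z))"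
      by (rule integrable_mult_of_squares[OF u0m lr_F(1)[OF p pn] u0i lr_F(3)[OF p pn]])
    have "m (p + h n) - ou n = (\<integral>z. ubar (p + h n) (fst z) - ubar (p + h n) (fst z) * (1 - indicator (lr_set p (h n)) (fst z)) \<partial>F (p + h n))"
      unfolding m_def ubar_mean[OF pn, symmetric] ou_def by (rule Bochner_Integration.integral_diff[OF ui uhi, symmetric])
    also have "\<dots> = (\<integral>z. ubar (p + h n) (fst z) * of_real (indicator (lr_set p (h n)) (fst z)) \<partial>F (p + h n))"
      by (simp add: algebra_simps)
    also have "\<dots> = (\<integral>z. ubar (p + h n) (fst z) * lr p (h n) (fst z) \<partial>F p)"
      using lr_change[OF p pn ubar_MX[OF pn[of n]]] by simp
    finally have a: "(\<integral>z. ubar (p + h n) (fst z) * lr p (h n) (fst z) \<partial>F p) = m (p + h n) - ou n" by simp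
    have "(\<integral>z. ubar (p + h n) (fst z) * (sqrt (real n) * (lr p (h n) (fst z) - 1)) \<partial>F p) =
       (\<integral>z. sqrt (real n) * (ubar (p + h n) (fst z) * lr p (h n) (fst z) - ubar (p + h n) (fst z)) \<partial>F p)"
      by (simp add: algebra_simps)
    also have "\<dots> = sqrt (real n) * ((m (p + h n) - ou n) - (\<integral>z. ubar (p + h n) (fst z) \<partial>F p))"
      unfolding a[symmetric] using url u01 by simp
    finally show ?thesis by (simp add: m_def algebra_simps)
  qed
  have "(\<lambda>n. sqrt (real n) * ((\<integral>z. ubar (p + h n) (fst z) \<partial>F p) - mean_util F u p)) \<longlonglongrightarrow>
    a \<bullet> dm p - (\<integral>z. ubar p (fst z) * (a \<bullet> \<rho> p (fst z)) \<partial>F p) - 0"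
    unfolding eq by (intro tendsto_diff 1 2 3)
  then show ?thesis by (simp add: inner_gamma_vec[OF p])
qed

end

subsection \<open>Likelihood ratios of samples\<close>

lemma power_tendsto_exp_real:
  fixes z :: "nat \<Rightarrow> real"
  assumes "(\<lambda>n. real n * (z n - 1)) \<longlonglongrightarrow> c"
  shows "(\<lambda>n. z n ^ n) \<longlonglongrightarrow> exp c"
proof -
  have "(\<lambda>n. complex_of_real (real n * (z n - 1))) \<longlonglongrightarrow> complex_of_real c" by (intro tendsto_of_real assms)
  then have "(\<lambda>n. of_nat n * (complex_of_real (z n) - 1)) \<longlonglongrightarrow> complex_of_real c" by simp
  from power_tendsto_exp[OF this] have "(\<lambda>n. complex_of_real (z n ^ n)) \<longlonglongrightarrow> complex_of_real (exp c)"
    by (simp add: exp_of_real)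
  then show ?thesis by (simp only: tendsto_of_real_iff)
qed

lemma iexp_approx_first:
  "norm (iexp x - 1 - \<i> * x) \<le> x\<^sup>2 / 2" "norm (iexp x - 1 - \<i> * x) \<le> 2 * \<bar>x\<bar>"
  "norm (iexp x - 1 - \<i> * x + x\<^sup>2 / 2) \<le> \<bar>x\<bar> ^ 3 / 6"
proof -
  show "norm (iexp x - 1 - \<i> * x) \<le> x\<^sup>2 / 2"
    using iexp_approx1[of x 1] by (simp add: diff_diff_eq numeral_2_eq_2[symmetric])
  show "norm (iexp x - 1 - \<i> * x) \<le> 2 * \<bar>x\<bar>"
    using iexp_approx2[of x 1] by (simp add: diff_diff_eq)
  have "iexp x - 1 - \<i> * x + x\<^sup>2 / 2 = iexp x - (\<Sum>k\<le>2. (\<i> * x)^k / fact k)"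
    by (simp add: numeral_2_eq_2 algebra_simps power2_eq_square)
  moreover have "norm (iexp x - (\<Sum>k\<le>2. (\<i> * x)^k / fact k)) \<le> \<bar>x\<bar> ^ 3 / 6"
    using iexp_approx1[of x 2] by (simp add: numeral_eq_Suc fact_numeral)
  ultimately show "norm (iexp x - 1 - \<i> * x + x\<^sup>2 / 2) \<le> \<bar>x\<bar> ^ 3 / 6" by (simp only:)
qed

lemma inverse_sqrt_tendsto_0: "(\<lambda>n. c * inverse (sqrt (real n))) \<longlonglongrightarrow> (0::real)"
proof -
  have "(\<lambda>n. c * inverse (sqrt (real n))) \<longlonglongrightarrow> c * 0"
    by (intro tendsto_mult tendsto_const tendsto_inverse_0_at_top filterlim_compose[OF sqrt_at_top] filterlim_real_sequentially)
  then show ?thesis by simp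
qed

text \<open>The third-order bound is used only pointwise, at fixed z; domination by X^2 comes from
  the second-order bound, so two moments suffice.\<close>

lemma iexp_second_order_integral:
  fixes X :: "'a \<Rightarrow> real"
  assumes [measurable]: "X \<in> borel_measurable M" and X2: "integrable M (\<lambda>z. (X z)\<^sup>2)"
  shows "(\<lambda>n. \<integral>z. of_nat n * (iexp (X z / sqrt n) - 1 - \<i> * (X z / sqrt n)) \<partial>M) \<longlonglongrightarrow>
    complex_of_real (- (\<integral>z. (X z)\<^sup>2 \<partial>M) / 2)"
proof -
  have "(\<lambda>n. \<integral>z. of_nat n * (iexp (X z / sqrt n) - 1 - \<i> * (X z / sqrt n)) \<partial>M) \<longlonglongrightarrow>
    (\<integral>z. complex_of_real (- ((X z)\<^sup>2 / 2)) \<partial>M)"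
  proof (rule integral_dominated_convergence[OF _ _ X2])
    show "AE z in M. norm (of_nat n * (iexp (X z / sqrt n) - 1 - \<i> * (X z / sqrt n))) \<le> (X z)\<^sup>2" for n
    proof (rule AE_I2)
      fix z
      have "real n * norm (iexp (X z / sqrt n) - 1 - \<i> * (X z / sqrt n)) \<le> real n * ((X z / sqrt n)\<^sup>2 / 2)"
        by (rule mult_left_mono[OF iexp_approx_first(1)]) simp
      also have "\<dots> \<le> (X z)\<^sup>2" by (cases "n = 0") (auto simp: power_divide)
      finally show "norm (of_nat n * (iexp (X z / sqrt n) - 1 - \<i> * (X z / sqrt n))) \<le> (X z)\<^sup>2"
        unfolding norm_mult norm_of_nat .
    qed
    show "AE z in M. (\<lambda>n. of_nat n * (iexp (X z / sqrt n) - 1 - \<i> * (X z / sqrt n))) \<longlonglongrightarrow> complex_of_real (- ((X z)\<^sup>2 / 2))"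
    proof (rule AE_I2)
      fix z
      have b: "norm (of_nat n * (iexp (X z / sqrt n) - 1 - \<i> * (X z / sqrt n)) - complex_of_real (- ((X z)\<^sup>2 / 2)))
          \<le> \<bar>X z\<bar>^3 / 6 * inverse (sqrt (real n))" if n: "1 \<le> n" for n :: nat
      proof -
        define x where "x = X z / sqrt n"
        have x2: "complex_of_real ((X z)\<^sup>2 / 2) = of_nat n * (complex_of_real (x\<^sup>2) / 2)"
        proof -
          have "(X z)\<^sup>2 / 2 = real n * (x\<^sup>2 / 2)" using n by (simp add: x_def power_divide)
          then show ?thesis by (simp only: of_real_mult of_real_divide of_real_of_nat_eq of_real_numeral)
        qed
        have "of_nat n * (iexp x - 1 - \<i> * x) - complex_of_real (- ((X z)\<^sup>2 / 2)) =
          of_nat n * (iexp x - 1 - \<i> * x + x\<^sup>2 / 2)" unfolding of_real_minus x2 by (simp add: algebra_simps)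
        also have "norm \<dots> \<le> real n * (\<bar>x\<bar>^3 / 6)"
          unfolding norm_mult norm_of_nat by (rule mult_left_mono[OF iexp_approx_first(3)]) simp
        also have "\<dots> = \<bar>X z\<bar>^3 / 6 * inverse (sqrt (real n))"
          using n by (simp add: x_def power_divide abs_divide power3_eq_cube field_simps)
        finally show ?thesis by (simp add: x_def)
      qed
      have "(\<lambda>n. of_nat n * (iexp (X z / sqrt n) - 1 - \<i> * (X z / sqrt n)) - complex_of_real (- ((X z)\<^sup>2 / 2))) \<longlonglongrightarrow> 0"
        by (rule Lim_null_comparison[OF eventually_sequentiallyI[of 1, OF b] inverse_sqrt_tendsto_0])
      then show "(\<lambda>n. of_nat n * (iexp (X z / sqrt n) - 1 - \<i> * (X z / sqrt n))) \<longlonglongrightarrow> complex_of_real (- ((X z)\<^sup>2 / 2))"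
        by (rule LIM_zero_cancel)
    qed
  qed measurable
  also have "(\<integral>z. complex_of_real (- ((X z)\<^sup>2 / 2)) \<partial>M) = complex_of_real (\<integral>z. - ((X z)\<^sup>2 / 2) \<partial>M)"
    by (rule integral_complex_of_real)
  finally show ?thesis by simp
qed

lemma iexp_first_order_L2:
  fixes X :: "'a \<Rightarrow> real"
  assumes [measurable]: "X \<in> borel_measurable M" and X2: "integrable M (\<lambda>z. (X z)\<^sup>2)"
  shows "L2_tendsto M (\<lambda>n z. norm (sqrt n * (iexp (X z / sqrt n) - 1) - \<i> * X z)) (\<lambda>_. 0)"
proof -
  define N where "N n z = norm (sqrt n * (iexp (X z / sqrt n) - 1) - \<i> * X z)" for n :: nat and z
  have Nm[measurable]: "N n \<in> borel_measurable M" for n unfolding N_def by measurable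
  have b: "N n z \<le> 2 * \<bar>X z\<bar>" "N n z \<le> (X z)\<^sup>2 / 2 * inverse (sqrt (real n))" if n: "1 \<le> n" for n z
  proof -
    define x where "x = X z / sqrt n"
    have "sqrt n * (iexp x - 1) - \<i> * X z = sqrt n * (iexp x - 1 - \<i> * x)"
      using n by (simp add: x_def algebra_simps)
    then have e: "N n z = sqrt n * norm (iexp x - 1 - \<i> * x)"
      unfolding N_def x_def[symmetric] by (simp only: norm_mult norm_of_real) simp
    have "N n z \<le> sqrt n * (2 * \<bar>x\<bar>)" unfolding e by (rule mult_left_mono[OF iexp_approx_first(2)]) simp
    then show "N n z \<le> 2 * \<bar>X z\<bar>" using n by (simp add: x_def abs_divide)
    have "N n z \<le> sqrt n * (x\<^sup>2 / 2)" unfolding e by (rule mult_left_mono[OF iexp_approx_first(1)]) simp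
    also have "\<dots> = (X z)\<^sup>2 / 2 * inverse (sqrt (real n))" using n by (simp add: x_def power2_eq_square field_simps)
    finally show "N n z \<le> (X z)\<^sup>2 / 2 * inverse (sqrt (real n))" .
  qed
  \<comment> \<open>At n = 0 the factor sqrt n vanishes and only the term i X survives, so the
    common domination has to be checked separately.\<close>
  have N0: "N 0 z = \<bar>X z\<bar>" for z by (simp add: N_def norm_mult)
  have N4: "(N n z)\<^sup>2 \<le> 4 * (X z)\<^sup>2" for n z
  proof -
    have "N n z \<le> 2 * \<bar>X z\<bar>" using b(1)[of n z] N0[of z] by (cases "n = 0") auto
    then have "(N n z)\<^sup>2 \<le> (2 * \<bar>X z\<bar>)\<^sup>2" by (rule power_mono) (simp add: N_def)
    then show ?thesis by (simp add: power_mult_distrib)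
  qed
  have X4: "integrable M (\<lambda>z. 4 * (X z)\<^sup>2)" using X2 by simp
  have N2: "integrable M (\<lambda>z. (N n z)\<^sup>2)" for n
    by (rule Bochner_Integration.integrable_bound[OF X4]) (measurable, use N4 in simp)
  have "(\<lambda>n. \<integral>z. (N n z)\<^sup>2 \<partial>M) \<longlonglongrightarrow> (\<integral>z. 0 \<partial>M)"
  proof (rule integral_dominated_convergence[OF _ _ X4])
    show "AE z in M. norm ((N n z)\<^sup>2) \<le> 4 * (X z)\<^sup>2" for n using N4 by simp
    show "AE z in M. (\<lambda>n. (N n z)\<^sup>2) \<longlonglongrightarrow> 0"
    proof (rule AE_I2)
      fix z
      have "(\<lambda>n. N n z) \<longlonglongrightarrow> 0"
      proof (rule Lim_null_comparison[OF eventually_sequentiallyI[of 1] inverse_sqrt_tendsto_0])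
        show "norm (N n z) \<le> (X z)\<^sup>2 / 2 * inverse (sqrt (real n))" if "1 \<le> n" for n
          using b(2)[OF that, of z] by (simp add: N_def)
      qed
      from tendsto_power[OF this, of 2] show "(\<lambda>n. (N n z)\<^sup>2) \<longlonglongrightarrow> 0" by simp
    qed
  qed measurable
  then show ?thesis
    unfolding L2_tendsto_def N_def[symmetric] using N2 Nm by simp
qed

lemma iid_prod_times:
  fixes r g :: "'a \<Rightarrow> real"
  assumes M: "prob_space M" and r: "integrable M r" and rg: "integrable M (\<lambda>z. r z * g z)" and k: "k < n"
  shows "(\<integral>w. (\<Prod>j<n. r (w j)) * g (w k) \<partial>iid M) = (\<integral>z. r z * g z \<partial>M) * (\<integral>z. r z \<partial>M) ^ (n - 1)"
proof -
  define s where "s j = (if j = k then (\<lambda>z. r z * g z) else r)" for j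
  have si: "integrable M (s j)" for j using r rg by (simp add: s_def)
  have 1: "(\<Prod>j<n. s j (w j)) = (\<Prod>j<n. r (w j)) * g (w k)" for w
    using k by (subst (1 2) prod.remove[of _ k]) (auto simp: s_def intro!: prod.cong)
  have 2: "(\<Prod>j<n. \<integral>z. s j z \<partial>M) = (\<integral>z. r z * g z \<partial>M) * (\<integral>z. r z \<partial>M) ^ (n - 1)"
  proof -
    have "(\<Prod>j\<in>{..<n} - {k}. \<integral>z. s j z \<partial>M) = (\<Prod>j\<in>{..<n} - {k}. \<integral>z. r z \<partial>M)"
      by (rule prod.cong) (auto simp: s_def)
    then show ?thesis using k by (subst prod.remove[of _ k]) (auto simp: s_def)
  qed
  show ?thesis using iid_integral_prod(2)[OF M, of n s] si unfolding 1 2 by simp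
qed

context dqm_model
begin

lemma obs_compose:
  assumes "p \<in> T" "G \<in> measurable (Pi\<^sub>M {..<n} (\<lambda>_. MX)) N"
  shows "(\<lambda>w. G (obs n w)) \<in> measurable (iid (F p)) N"
  by (rule measurable_compose[OF obs_measurable[OF sets_F[OF assms(1)]] assms(2)])

lemma obs_space:
  assumes "p \<in> T" "w \<in> space (iid (F p))"
  shows "obs n w \<in> space (Pi\<^sub>M {..<n} (\<lambda>_. MX))"
  by (rule measurable_space[OF obs_measurable[OF sets_F[OF assms(1)]] assms(2)])

lemma iid_comp_F: "p \<in> T \<Longrightarrow> g \<in> borel_measurable (F p) \<Longrightarrow> (\<lambda>w. g (w j)) \<in> borel_measurable (iid (F p))"
  by (rule measurable_compose[OF measurable_iid_component])

definition lrprod :: "real ^ 'd \<Rightarrow> real ^ 'd \<Rightarrow> nat \<Rightarrow> (nat \<Rightarrow> 'x \<times> 't) \<Rightarrow> real" where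
  "lrprod p h n w = (\<Prod>j<n. lr p h (fst (w j)))"

lemma lrprod_meas:
  assumes "p \<in> T" "p + h \<in> T"
  shows "lrprod p h n \<in> borel_measurable (iid (F p))"
  unfolding lrprod_def[abs_def] by (intro borel_measurable_prod iid_comp_F[OF assms(1) lr_F(1)[OF assms]])

lemma lrprod_moments:
  assumes p: "p \<in> T" "p + h \<in> T"
  shows "integrable (iid (F p)) (lrprod p h n)" "(\<integral>w. lrprod p h n w \<partial>iid (F p)) = (1 - excess p h) ^ n"
    "integrable (iid (F p)) (\<lambda>w. (lrprod p h n w)\<^sup>2)"
    "(\<integral>w. (lrprod p h n w)\<^sup>2 \<partial>iid (F p)) = (\<integral>z. (lr p h (fst z))\<^sup>2 \<partial>F p) ^ n"
  using iid_integral_prod[OF F_prob[OF p(1)], of n "\<lambda>_ z. lr p h (fst z)"] lr_F(2)[OF p] lr_integral[OF p]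
    iid_integral_prod[OF F_prob[OF p(1)], of n "\<lambda>_ z. (lr p h (fst z))\<^sup>2"] lr_F(3)[OF p]
  by (simp_all add: lrprod_def[abs_def] prod_power_distrib)

text \<open>The second moment is an nth power, and E lr^2 - 1 = E (lr - 1)^2 - 2 excess; multiplied
  by n this tends to the second moment of the score in direction a.\<close>

lemma lrprod_sq_tendsto:
  assumes ls: "local_seq p h a"
  shows "(\<lambda>n. \<integral>w. (lrprod p (h n) n w)\<^sup>2 \<partial>iid (F p)) \<longlonglongrightarrow> exp (\<integral>z. (a \<bullet> \<rho> p (fst z))\<^sup>2 \<partial>F p)"
  unfolding lrprod_moments(4)[OF local_seqD(1,2)[OF ls]]
proof (rule power_tendsto_exp_real)
  note p = local_seqD(1)[OF ls] and pn = local_seqD(2)[OF ls]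
  interpret prob_space "F p" by (rule F_prob[OF p])
  have d: "(\<integral>z. (lr p (h n) (fst z))\<^sup>2 \<partial>F p) - 1 = (\<integral>z. (lr p (h n) (fst z) - 1)\<^sup>2 \<partial>F p) - 2 * excess p (h n)" for n
    using lr_F(2,3)[OF p pn[of n]] lr_integral[OF p pn[of n]] by (simp add: power2_diff prob_space)
  have e: "real n * ((\<integral>z. (lr p (h n) (fst z))\<^sup>2 \<partial>F p) - 1) =
      real n * (\<integral>z. (lr p (h n) (fst z) - 1)\<^sup>2 \<partial>F p) - 2 * (real n * excess p (h n))" for n
    unfolding d by (simp add: right_diff_distrib)
  have "(\<lambda>n. real n * ((\<integral>z. (lr p (h n) (fst z))\<^sup>2 \<partial>F p) - 1)) \<longlonglongrightarrow>
      (\<integral>z. (a \<bullet> \<rho> p (fst z))\<^sup>2 \<partial>F p) - 2 * 0"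
    unfolding e by (intro tendsto_diff tendsto_mult tendsto_const excess_null[OF ls] lr_second_moment[OF ls])
  then show "(\<lambda>n. real n * ((\<integral>z. (lr p (h n) (fst z))\<^sup>2 \<partial>F p) - 1)) \<longlonglongrightarrow> (\<integral>z. (a \<bullet> \<rho> p (fst z))\<^sup>2 \<partial>F p)" by simp
qed

text \<open>The exponent n - 1 occurs when one factor is paired with its own score, as in
  \<open>iid_prod_times\<close>.\<close>

lemma lrprod_mean_tendsto:
  assumes ls: "local_seq p h a"
  shows "(\<lambda>n. (1 - excess p (h n)) ^ n) \<longlonglongrightarrow> 1" "(\<lambda>n. (1 - excess p (h n)) ^ (n - 1)) \<longlonglongrightarrow> 1"
proof -
  have "(\<lambda>n. real n * ((1 - excess p (h n)) - 1)) \<longlonglongrightarrow> 0" using tendsto_minus[OF excess_null[OF ls]] by simp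
  from power_tendsto_exp_real[OF this] show 1: "(\<lambda>n. (1 - excess p (h n)) ^ n) \<longlonglongrightarrow> 1" by simp
  have e: "0 \<le> excess p (h n)" "excess p (h n) \<le> 1" for n
    unfolding excess_def using prob_space.prob_le_1[OF F_prob[OF local_seqD(2)[OF ls]]] by auto
  show "(\<lambda>n. (1 - excess p (h n)) ^ (n - 1)) \<longlonglongrightarrow> 1"
  proof (rule tendsto_sandwich[OF always_eventually always_eventually 1 tendsto_const])
    show "\<forall>n. (1 - excess p (h n)) ^ n \<le> (1 - excess p (h n)) ^ (n - 1)"
      using e by (intro allI power_decreasing) auto
    show "\<forall>n. (1 - excess p (h n)) ^ (n - 1) \<le> 1" using e by (intro allI power_le_one) auto
  qed
qed

definition scoresum :: "real ^ 'd \<Rightarrow> real ^ 'd \<Rightarrow> nat \<Rightarrow> (nat \<Rightarrow> 'x \<times> 't) \<Rightarrow> real" where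
  "scoresum p a n w = (\<Sum>j<n. a \<bullet> \<rho> p (fst (w j))) / sqrt (real n)"

lemma scoresum_facts:
  assumes p: "p \<in> T"
  shows "scoresum p a n \<in> borel_measurable (iid (F p))" "integrable (iid (F p)) (\<lambda>w. (scoresum p a n w)\<^sup>2)"
    "integrable (iid (F p)) (scoresum p a n)" "(\<integral>w. scoresum p a n w \<partial>iid (F p)) = 0"
    "0 < n \<Longrightarrow> (\<integral>w. (scoresum p a n w)\<^sup>2 \<partial>iid (F p)) = (\<integral>z. (a \<bullet> \<rho> p (fst z))\<^sup>2 \<partial>F p)"
proof -
  interpret P: prob_space "iid (F p)" by (rule prob_space_iid[OF F_prob[OF p]])
  note L = iid_L2_sum[OF F_prob[OF p] score_F(2)[OF p, of a] score_F(2)[OF p, of a]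
      score_L2(2)[OF p, of a] score_L2(2)[OF p, of a]]
  show m: "scoresum p a n \<in> borel_measurable (iid (F p))"
    unfolding scoresum_def[abs_def]
    by (intro borel_measurable_divide borel_measurable_sum borel_measurable_const iid_comp_F[OF p score_F(2)[OF p]])
  show i2: "integrable (iid (F p)) (\<lambda>w. (scoresum p a n w)\<^sup>2)"
    using L(1) by (simp add: scoresum_def power_divide power2_eq_square)
  show "integrable (iid (F p)) (scoresum p a n)" by (rule P.square_integrable_imp_integrable[OF m i2])
  show "(\<integral>w. scoresum p a n w \<partial>iid (F p)) = 0"
    using iid_component[OF F_prob[OF p] score_F(3)[OF p]] score_mean[OF p]
    by (simp add: scoresum_def Bochner_Integration.integral_sum)
  show "(\<integral>w. (scoresum p a n w)\<^sup>2 \<partial>iid (F p)) = (\<integral>z. (a \<bullet> \<rho> p (fst z))\<^sup>2 \<partial>F p)" if "0 < n"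
    using L(2)[OF score_mean[OF p]] that by (simp add: scoresum_def power_divide power2_eq_square)
qed

text \<open>First-order expansion of the likelihood ratio, with an error that is quadratic in the direction
  (replace \<open>a\<close> by \<open>s a\<close>). It takes the place of the full local asymptotic normality expansion.\<close>

lemma lrprod_expansion:
  assumes ls: "local_seq p h a"
  defines "m \<equiv> \<integral>z. (a \<bullet> \<rho> p (fst z))\<^sup>2 \<partial>F p"
  shows "integrable (iid (F p)) (\<lambda>w. (lrprod p (h n) n w - 1 - scoresum p a n w)\<^sup>2)"
    and "(\<lambda>n. \<integral>w. (lrprod p (h n) n w - 1 - scoresum p a n w)\<^sup>2 \<partial>iid (F p)) \<longlonglongrightarrow> exp m - 1 - m"
proof -
  note p = local_seqD(1)[OF ls] and pn = local_seqD(2)[OF ls]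
  interpret prob_space "F p" by (rule F_prob[OF p])
  interpret P: prob_space "iid (F p)" by (rule prob_space_iid[OF F_prob[OF p]])
  define L where "L n = lrprod p (h n) n" for n
  define Y where "Y n = scoresum p a n" for n
  note Lf = lrprod_moments[OF p pn, folded L_def] and Lm = lrprod_meas[OF p pn, folded L_def]
  note Yf = scoresum_facts[OF p, where a = a, folded Y_def]
  have LYi: "integrable (iid (F p)) (\<lambda>w. L n w * Y n w)" for n
    unfolding L_def Y_def
    by (rule integrable_mult_of_squares[OF lrprod_meas[OF p pn] scoresum_facts(1)[OF p] lrprod_moments(3)[OF p pn] scoresum_facts(2)[OF p]])
  have Li: "integrable (iid (F p)) (L n)" "integrable (iid (F p)) (\<lambda>w. (L n w)\<^sup>2)"
    "(\<integral>w. L n w \<partial>iid (F p)) = (1 - excess p (h n)) ^ n" for n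
    unfolding L_def by (rule lrprod_moments[OF p pn])+
  have ex: "(L n w - 1 - Y n w)\<^sup>2 = (L n w)\<^sup>2 - 2 * L n w - 2 * (L n w * Y n w) + 1 + 2 * Y n w + (Y n w)\<^sup>2" for n w
    by (simp add: power2_eq_square algebra_simps)
  show "integrable (iid (F p)) (\<lambda>w. (lrprod p (h n) n w - 1 - scoresum p a n w)\<^sup>2)"
    unfolding L_def[symmetric] Y_def[symmetric] ex using Li Yf LYi by simp
  have rgi: "integrable (F p) (\<lambda>z. lr p (h n) (fst z) * (a \<bullet> \<rho> p (fst z)))" for n
    by (rule integrable_mult_of_squares[OF lr_F(1)[OF p pn] score_F(2)[OF p] lr_F(3)[OF p pn] score_L2(2)[OF p]])
  \<comment> \<open>All n summands of the score sum contribute equally, and n / sqrt n = sqrt n.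
    Subtracting 1 from the paired ratio changes nothing because the score is centred.\<close>
  have LY: "(\<integral>w. L n w * Y n w \<partial>iid (F p)) =
      (\<integral>z. (sqrt (real n) * (lr p (h n) (fst z) - 1)) * (a \<bullet> \<rho> p (fst z)) \<partial>F p) * (1 - excess p (h n)) ^ (n - 1)" for n
  proof -
    have gi: "integrable (iid (F p)) (\<lambda>w. L n w * (a \<bullet> \<rho> p (fst (w k))))" for k
    proof (rule integrable_mult_of_squares[OF _ _ Li(2)])
      show "L n \<in> borel_measurable (iid (F p))" unfolding L_def by (rule lrprod_meas[OF p pn])
      show "(\<lambda>w. a \<bullet> \<rho> p (fst (w k))) \<in> borel_measurable (iid (F p))" by (rule iid_comp_F[OF p score_F(2)[OF p]])
      show "integrable (iid (F p)) (\<lambda>w. (a \<bullet> \<rho> p (fst (w k)))\<^sup>2)"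
        by (rule iid_component(1)[OF F_prob[OF p] score_L2(2)[OF p]])
    qed
    have "(\<integral>w. L n w * Y n w \<partial>iid (F p)) = (\<integral>w. (\<Sum>k<n. L n w * (a \<bullet> \<rho> p (fst (w k)))) / sqrt (real n) \<partial>iid (F p))"
      by (simp add: Y_def scoresum_def sum_distrib_left)
    also have "\<dots> = (\<Sum>k<n. \<integral>w. L n w * (a \<bullet> \<rho> p (fst (w k))) \<partial>iid (F p)) / sqrt (real n)"
      using gi by (simp add: Bochner_Integration.integral_sum)
    also have "(\<Sum>k<n. \<integral>w. L n w * (a \<bullet> \<rho> p (fst (w k))) \<partial>iid (F p)) =
        (\<Sum>k<n. (\<integral>z. lr p (h n) (fst z) * (a \<bullet> \<rho> p (fst z)) \<partial>F p) * (1 - excess p (h n)) ^ (n - 1))"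
      using iid_prod_times[OF F_prob[OF p] lr_F(2)[OF p pn] rgi]
      by (intro sum.cong refl) (simp add: L_def lrprod_def lr_integral[OF p pn])
    also have "(\<integral>z. lr p (h n) (fst z) * (a \<bullet> \<rho> p (fst z)) \<partial>F p) =
        (\<integral>z. (lr p (h n) (fst z) - 1) * (a \<bullet> \<rho> p (fst z)) \<partial>F p)"
      using rgi score_F(3)[OF p] score_mean[OF p] by (simp add: left_diff_distrib)
    finally have "(\<integral>w. L n w * Y n w \<partial>iid (F p)) =
        (real n / sqrt (real n)) * ((\<integral>z. (lr p (h n) (fst z) - 1) * (a \<bullet> \<rho> p (fst z)) \<partial>F p) * (1 - excess p (h n)) ^ (n - 1))"
      by simp
    then show ?thesis by (simp add: real_div_sqrt mult.assoc)
  qed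
  have m: "(\<integral>z. (a \<bullet> \<rho> p (fst z)) * (a \<bullet> \<rho> p (fst z)) \<partial>F p) = m" by (simp add: m_def power2_eq_square)
  have LYlim: "(\<lambda>n. \<integral>w. L n w * Y n w \<partial>iid (F p)) \<longlonglongrightarrow> m * 1"
    unfolding LY m[symmetric]
    by (intro tendsto_mult lrprod_mean_tendsto(2)[OF ls]
        L2_tendsto_mult[OF lr_L2_tendsto[OF ls] L2_tendsto_const[OF score_F(2)[OF p] score_L2(2)[OF p]]])
  have Y2lim: "(\<lambda>n. \<integral>w. (Y n w)\<^sup>2 \<partial>iid (F p)) \<longlonglongrightarrow> m"
    by (rule tendsto_eventually, rule eventually_mono[OF eventually_gt_at_top[of 0]]) (simp add: Yf m_def)
  have int: "(\<integral>w. (L n w - 1 - Y n w)\<^sup>2 \<partial>iid (F p)) =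
     (\<integral>w. (L n w)\<^sup>2 \<partial>iid (F p)) - 2 * (1 - excess p (h n)) ^ n - 2 * (\<integral>w. L n w * Y n w \<partial>iid (F p)) + 1 + 2 * 0
       + (\<integral>w. (Y n w)\<^sup>2 \<partial>iid (F p))" for n
    unfolding ex Li(3)[symmetric] using Li(1,2)[of n] Yf(2,3,4)[of n] LYi[of n] by (simp add: P.prob_space)
  \<comment> \<open>E L^2 tends to exp m, while E L Y and E Y^2 both tend to m; what remains is exp
    m - 1 - m, which is O(m^2) for small m.\<close>
  have "(\<lambda>n. \<integral>w. (L n w - 1 - Y n w)\<^sup>2 \<partial>iid (F p)) \<longlonglongrightarrow> exp m - 2 * 1 - 2 * (m * 1) + 1 + 2 * 0 + m"
    unfolding int
    by (intro tendsto_add tendsto_diff tendsto_mult tendsto_const LYlim Y2lim lrprod_mean_tendsto(1)[OF ls]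
        lrprod_sq_tendsto[OF ls, folded L_def m_def])
  then show "(\<lambda>n. \<integral>w. (lrprod p (h n) n w - 1 - scoresum p a n w)\<^sup>2 \<partial>iid (F p)) \<longlonglongrightarrow> exp m - 1 - m"
    by (simp add: L_def Y_def)
qed

text \<open>\<open>iid_transfer\<close> is exact when the shifted sample is restricted to all
  observations in \<open>lr_set\<close>. For |G| \<le> 1, dropping the restriction costs at most the
  expected number of observations outside.\<close>

lemma change_of_measure:
  fixes G :: "(nat \<Rightarrow> 'x) \<Rightarrow> complex"
  assumes p: "p \<in> T" "p + h \<in> T"
    and G: "G \<in> borel_measurable (Pi\<^sub>M {..<n} (\<lambda>_. MX))" "\<And>x. x \<in> space (Pi\<^sub>M {..<n} (\<lambda>_. MX)) \<Longrightarrow> norm (G x) \<le> 1"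
  shows "norm ((\<integral>w. G (obs n w) \<partial>iid (F (p + h))) -
      (\<integral>w. G (obs n w) * complex_of_real (lrprod p h n w) \<partial>iid (F p))) \<le> real n * excess p h"
proof -
  define hh where "hh z = (indicator (lr_set p h) (fst z) :: real)" for z :: "'x \<times> 't"
  interpret M: prob_space "F (p + h)" by (rule F_prob[OF p(2)])
  interpret P: prob_space "iid (F (p + h))" by (rule prob_space_iid[OF F_prob[OF p(2)]])
  note hf = outside_indicator[OF p, folded hh_def]
  have h01: "0 \<le> hh z" "hh z \<le> 1" for z by (simp_all add: hh_def indicator_def)
  have hi: "integrable (F (p + h)) (\<lambda>z. complex_of_real (hh z))"
    by (rule M.integrable_const_bound[of _ 1]) (use hf(1) h01 in auto)
  have ri: "integrable (F p) (\<lambda>z. complex_of_real (lr p h (fst z)))"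
    using lr_F(2)[OF p] by simp
  have tr: "(\<integral>w. G (obs n w) * (\<Prod>j<n. complex_of_real (hh (w j))) \<partial>iid (F (p + h))) =
     (\<integral>w. G (obs n w) * (\<Prod>j<n. complex_of_real (lr p h (fst (w j)))) \<partial>iid (F p))"
  proof (rule iid_transfer[OF F_prob[OF p(2)] sets_F[OF p(2)] hi F_prob[OF p(1)] sets_F[OF p(1)] ri _ G])
    show "(\<integral>z. H (fst z) * complex_of_real (hh z) \<partial>F (p + h)) = (\<integral>z. H (fst z) * complex_of_real (lr p h (fst z)) \<partial>F p)"
      if "H \<in> borel_measurable MX" for H :: "'x \<Rightarrow> complex"
      unfolding hh_def by (rule lr_change[OF p that])
  qed
  have Gm: "(\<lambda>w. G (obs n w)) \<in> borel_measurable (iid (F (p + h)))" by (rule obs_compose[OF p(2) G(1)])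
  have Gb: "norm (G (obs n w)) \<le> 1" if "w \<in> space (iid (F (p + h)))" for w
    by (rule G(2)[OF obs_space[OF p(2) that]])
  have Gi: "integrable (iid (F (p + h))) (\<lambda>w. G (obs n w))"
    by (rule P.integrable_const_bound[of _ 1]) (use Gm Gb in auto)
  have hm: "(\<lambda>w. complex_of_real (hh (w j))) \<in> borel_measurable (iid (F (p + h)))" for j
    by (rule iid_comp_F[OF p(2) measurable_compose[OF hf(1) borel_measurable_of_real]])
  have pb: "norm (\<Prod>j<n. complex_of_real (hh (w j))) \<le> 1" for w
    unfolding prod_norm[symmetric] by (rule prod_le_1) (use h01 in auto)
  have GPi: "integrable (iid (F (p + h))) (\<lambda>w. G (obs n w) * (\<Prod>j<n. complex_of_real (hh (w j))))"
  proof (rule P.integrable_const_bound[of _ 1])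
    show "AE w in iid (F (p + h)). norm (G (obs n w) * (\<Prod>j<n. complex_of_real (hh (w j)))) \<le> 1"
      by (rule AE_I2) (use mult_mono[OF Gb pb] in \<open>simp add: norm_mult\<close>)
    show "(\<lambda>w. G (obs n w) * (\<Prod>j<n. complex_of_real (hh (w j)))) \<in> borel_measurable (iid (F (p + h)))"
      by (intro borel_measurable_times Gm borel_measurable_prod hm)
  qed
  have "(\<integral>w. G (obs n w) \<partial>iid (F (p + h))) - (\<integral>w. G (obs n w) * complex_of_real (lrprod p h n w) \<partial>iid (F p)) =
     (\<integral>w. G (obs n w) \<partial>iid (F (p + h))) - (\<integral>w. G (obs n w) * (\<Prod>j<n. complex_of_real (hh (w j))) \<partial>iid (F (p + h)))"
    unfolding tr lrprod_def of_real_prod ..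
  also have "\<dots> = (\<integral>w. G (obs n w) - G (obs n w) * (\<Prod>j<n. complex_of_real (hh (w j))) \<partial>iid (F (p + h)))"
    by (rule Bochner_Integration.integral_diff[OF Gi GPi, symmetric])
  also have "norm \<dots> \<le> (\<integral>w. (\<Sum>j<n. 1 - hh (w j)) \<partial>iid (F (p + h)))"
  proof (rule norm_integral_le)
    show "integrable (iid (F (p + h))) (\<lambda>w. \<Sum>j<n. 1 - hh (w j))"
      by (intro Bochner_Integration.integrable_sum iid_component(1)[OF F_prob[OF p(2)] hf(2)])
    show "AE w in iid (F (p + h)). norm (G (obs n w) - G (obs n w) * (\<Prod>j<n. complex_of_real (hh (w j)))) \<le> (\<Sum>j<n. 1 - hh (w j))"
    proof (rule AE_I2)
      fix w assume ww: "w \<in> space (iid (F (p + h)))"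
      have "norm (G (obs n w) - G (obs n w) * (\<Prod>j<n. complex_of_real (hh (w j)))) =
        norm (G (obs n w)) * norm ((\<Prod>j<n. 1) - (\<Prod>j<n. complex_of_real (hh (w j))))"
        by (simp add: norm_mult[symmetric] right_diff_distrib)
      also have "\<dots> \<le> 1 * (\<Sum>j<n. norm (1 - complex_of_real (hh (w j))))"
        using h01 by (intro mult_mono norm_prod_diff Gb[OF ww]) (auto simp: sum_nonneg)
      also have "\<dots> = (\<Sum>j<n. 1 - hh (w j))"
      proof -
        have "norm (1 - complex_of_real (hh z)) = 1 - hh z" for z
        proof -
          have "norm (1 - complex_of_real (hh z)) = norm (complex_of_real (1 - hh z))" by simp
          also have "\<dots> = 1 - hh z" using h01[of z] unfolding norm_of_real by simp
          finally show ?thesis .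
        qed
        then show ?thesis by simp
      qed
      finally show "norm (G (obs n w) - G (obs n w) * (\<Prod>j<n. complex_of_real (hh (w j)))) \<le> (\<Sum>j<n. 1 - hh (w j))" .
    qed
  qed
  also have "\<dots> = real n * excess p h"
    using iid_component[OF F_prob[OF p(2)] hf(2)] hf(3) by (simp add: Bochner_Integration.integral_sum)
  finally show ?thesis .
qed

text \<open>A central limit theorem under the weighted law, in the role of Le Cam's third lemma: the
  weight shifts the limit by the covariance of g with the score. Independence turns the integral
  into an nth power, so \<open>power_tendsto_exp\<close> reduces it to a single observation.\<close>

lemma iexp_sum_lrprod_tendsto:
  fixes g :: "'x \<Rightarrow> real"
  assumes ls: "local_seq p h a" and g: "g \<in> borel_measurable MX"
    and g2: "integrable (F p) (\<lambda>z. (g (fst z))\<^sup>2)" and g0: "(\<integral>z. g (fst z) \<partial>F p) = 0"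
  shows "(\<lambda>n. \<integral>w. iexp ((\<Sum>j<n. g (fst (w j))) / sqrt (real n)) * complex_of_real (lrprod p (h n) n w) \<partial>iid (F p))
    \<longlonglongrightarrow> exp (complex_of_real (- (\<integral>z. (g (fst z))\<^sup>2 \<partial>F p) / 2) + \<i> * (\<integral>z. g (fst z) * (a \<bullet> \<rho> p (fst z)) \<partial>F p))"
proof -
  note p = local_seqD(1)[OF ls] and pn = local_seqD(2)[OF ls]
  interpret prob_space "F p" by (rule F_prob[OF p])
  define X where "X z = g (fst z)" for z :: "'x \<times> 't"
  define r where "r n z = lr p (h n) (fst z)" for n and z :: "'x \<times> 't"
  define Z where "Z z = a \<bullet> \<rho> p (fst z)" for z :: "'x \<times> 't"
  define e where "e n z = iexp (X z / sqrt (real n))" for n :: nat and z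
  have Xm[measurable]: "X \<in> borel_measurable (F p)" unfolding X_def[abs_def] by (rule comp_F[OF p g])
  have X2: "integrable (F p) (\<lambda>z. (X z)\<^sup>2)" using g2 by (simp add: X_def)
  have X1: "integrable (F p) X" by (rule square_integrable_imp_integrable[OF Xm X2])
  have rm[measurable]: "r n \<in> borel_measurable (F p)" for n unfolding r_def[abs_def] by (rule lr_F(1)[OF p pn])
  have ri: "integrable (F p) (r n)" for n unfolding r_def[abs_def] by (rule lr_F(2)[OF p pn])
  have em[measurable]: "e n \<in> borel_measurable (F p)" for n unfolding e_def by measurable
  have e1: "norm (e n z) = 1" for n z by (simp add: e_def)
  have eri: "integrable (F p) (\<lambda>z. e n z * complex_of_real (r n z))" for n
    by (rule Bochner_Integration.integrable_bound[OF ri[of n]]) (measurable, simp add: norm_mult e1)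
  have rL: "L2_tendsto (F p) (\<lambda>n z. sqrt (real n) * (r n z - 1)) Z"
    using lr_L2_tendsto[OF ls] unfolding r_def Z_def .
  have Zf: "Z \<in> borel_measurable (F p)" "integrable (F p) (\<lambda>z. (Z z)\<^sup>2)" using rL by (auto simp: L2_tendsto_def)
  have prod: "(\<integral>w. iexp ((\<Sum>j<n. g (fst (w j))) / sqrt (real n)) * complex_of_real (lrprod p (h n) n w) \<partial>iid (F p)) =
      (\<integral>z. e n z * complex_of_real (r n z) \<partial>F p) ^ n" for n
  proof -
    have "iexp ((\<Sum>j<n. g (fst (w j))) / sqrt (real n)) * complex_of_real (lrprod p (h n) n w) =
        (\<Prod>j<n. e n (w j) * complex_of_real (r n (w j)))" for w :: "nat \<Rightarrow> 'x \<times> 't"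
    proof -
      have "iexp ((\<Sum>j<n. g (fst (w j))) / sqrt (real n)) = (\<Prod>j<n. e n (w j))"
        unfolding e_def X_def exp_sum[symmetric, OF finite_lessThan] by (simp add: sum_divide_distrib sum_distrib_left)
      then show ?thesis by (simp add: prod.distrib lrprod_def r_def)
    qed
    then show ?thesis
      using iid_integral_prod(2)[OF F_prob[OF p], of n "\<lambda>_ z. e n z * complex_of_real (r n z)"] eri by simp
  qed
  define U where "U n z = of_nat n * (e n z - 1 - \<i> * (X z / sqrt (real n)))" for n z
  define V where "V n z = sqrt (real n) * (e n z - 1) - \<i> * X z" for n z
  have U: "(\<lambda>n. \<integral>z. U n z \<partial>F p) \<longlonglongrightarrow> complex_of_real (- (\<integral>z. (X z)\<^sup>2 \<partial>F p) / 2)"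
    unfolding U_def e_def by (rule iexp_second_order_integral[OF Xm X2])
  have VL: "L2_tendsto (F p) (\<lambda>n z. norm (V n z)) (\<lambda>_. 0)"
    unfolding V_def e_def by (rule iexp_first_order_L2[OF Xm X2])
  have Vm[measurable]: "V n \<in> borel_measurable (F p)" for n unfolding V_def by measurable
  have Vr: "(\<lambda>n. \<integral>z. V n z * complex_of_real (sqrt (real n) * (r n z - 1)) \<partial>F p) \<longlonglongrightarrow> 0"
  proof -
    \<comment> \<open>The estimate passes through the absolute value of V times the ratio, so L2
      convergence is first carried over to absolute values by the reverse triangle
      inequality.\<close>
    have aL: "L2_tendsto (F p) (\<lambda>n z. \<bar>sqrt (real n) * (r n z - 1)\<bar>) (\<lambda>z. \<bar>Z z\<bar>)"
    proof -
      have le: "(\<integral>z. (\<bar>sqrt (real n) * (r n z - 1)\<bar> - \<bar>Z z\<bar>)\<^sup>2 \<partial>F p) \<le> (\<integral>z. (sqrt (real n) * (r n z - 1) - Z z)\<^sup>2 \<partial>F p)" for n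
      proof (rule integral_mono)
        have i: "integrable (F p) (\<lambda>z. (sqrt (real n) * (r n z - 1))\<^sup>2)" using rL by (auto simp: L2_tendsto_def)
        have m: "(\<lambda>z. sqrt (real n) * (r n z - 1)) \<in> borel_measurable (F p)" by measurable
        show "integrable (F p) (\<lambda>z. (sqrt (real n) * (r n z - 1) - Z z)\<^sup>2)"
          using integral_square_add_le(1)[OF m borel_measurable_uminus[OF Zf(1)] i] Zf(2) by simp
        have "integrable (F p) (\<lambda>z. (\<bar>sqrt (real n) * (r n z - 1)\<bar> + - \<bar>Z z\<bar>)\<^sup>2)"
          by (rule integral_square_add_le(1)) (use m Zf i in \<open>simp_all add: power_mult_distrib\<close>)
        then show "integrable (F p) (\<lambda>z. (\<bar>sqrt (real n) * (r n z - 1)\<bar> - \<bar>Z z\<bar>)\<^sup>2)" by simp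
        show "(\<bar>sqrt (real n) * (r n z - 1)\<bar> - \<bar>Z z\<bar>)\<^sup>2 \<le> (sqrt (real n) * (r n z - 1) - Z z)\<^sup>2" for z
          by (rule iffD1[OF abs_le_square_iff]) (rule abs_triangle_ineq3)
      qed
      have lim: "(\<lambda>n. \<integral>z. (sqrt (real n) * (r n z - 1) - Z z)\<^sup>2 \<partial>F p) \<longlonglongrightarrow> 0" using rL by (simp add: L2_tendsto_def)
      have "(\<lambda>n. \<integral>z. (\<bar>sqrt (real n) * (r n z - 1)\<bar> - \<bar>Z z\<bar>)\<^sup>2 \<partial>F p) \<longlonglongrightarrow> 0"
        by (rule null_of_norm_le[OF _ lim]) (use le in simp)
      then show ?thesis using rL Zf(1) by (simp add: L2_tendsto_def)
    qed
    have b: "(\<lambda>n. \<integral>z. norm (V n z) * \<bar>sqrt (real n) * (r n z - 1)\<bar> \<partial>F p) \<longlonglongrightarrow> 0"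
      using L2_tendsto_mult[OF VL aL] by simp
    show ?thesis
    proof (rule null_of_norm_le[OF _ b])
      fix n
      show "norm (\<integral>z. V n z * complex_of_real (sqrt (real n) * (r n z - 1)) \<partial>F p) \<le> (\<integral>z. norm (V n z) * \<bar>sqrt (real n) * (r n z - 1)\<bar> \<partial>F p)"
      proof (rule norm_integral_le)
        show "integrable (F p) (\<lambda>z. norm (V n z) * \<bar>sqrt (real n) * (r n z - 1)\<bar>)"
          by (rule integrable_mult_of_squares) (use VL aL in \<open>auto simp: L2_tendsto_def\<close>)
        show "AE z in F p. norm (V n z * complex_of_real (sqrt (real n) * (r n z - 1))) \<le> norm (V n z) * \<bar>sqrt (real n) * (r n z - 1)\<bar>"
          unfolding norm_mult norm_of_real by simp
      qed
    qed
  qed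
  have XZ: "(\<lambda>n. \<integral>z. X z * (sqrt (real n) * (r n z - 1)) \<partial>F p) \<longlonglongrightarrow> (\<integral>z. X z * Z z \<partial>F p)"
    by (rule L2_tendsto_mult[OF L2_tendsto_const[OF Xm X2] rL])
  have Xri: "integrable (F p) (\<lambda>z. X z * (sqrt (real n) * (r n z - 1)))" for n
    by (rule integrable_mult_of_squares[OF Xm _ X2]) (use rL in \<open>auto simp: L2_tendsto_def\<close>)
  have Vri: "integrable (F p) (\<lambda>z. V n z * complex_of_real (sqrt (real n) * (r n z - 1)))" for n
  proof (rule Bochner_Integration.integrable_bound)
    show "integrable (F p) (\<lambda>z. norm (V n z) * (sqrt (real n) * (r n z - 1)))"
      by (rule integrable_mult_of_squares) (use VL rL in \<open>auto simp: L2_tendsto_def\<close>)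
    show "AE z in F p. norm (V n z * complex_of_real (sqrt (real n) * (r n z - 1))) \<le> norm (norm (V n z) * (sqrt (real n) * (r n z - 1)))"
      unfolding norm_mult norm_of_real by (simp add: abs_mult)
  qed measurable
  have Ui: "integrable (F p) (U n)" for n
  proof (rule Bochner_Integration.integrable_bound)
    show "integrable (F p) (\<lambda>z. real n * (2 + \<bar>X z / sqrt (real n)\<bar>))" using X1 by simp
    show "AE z in F p. norm (U n z) \<le> norm (real n * (2 + \<bar>X z / sqrt (real n)\<bar>))"
    proof (rule AE_I2)
      fix z
      have "norm (e n z - 1 - \<i> * (X z / sqrt (real n))) \<le> norm (e n z) + norm (1::complex) + norm (\<i> * (X z / sqrt (real n)))"
        by (rule order_trans[OF norm_triangle_ineq4 add_right_mono[OF norm_triangle_ineq4]])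
      also have "\<dots> = 2 + \<bar>X z / sqrt (real n)\<bar>" unfolding e1 norm_mult norm_of_real by simp
      finally have "real n * norm (e n z - 1 - \<i> * (X z / sqrt (real n))) \<le> real n * (2 + \<bar>X z / sqrt (real n)\<bar>)"
        by (rule mult_left_mono) simp
      moreover have "norm (U n z) = real n * norm (e n z - 1 - \<i> * (X z / sqrt (real n)))"
        by (simp only: U_def norm_mult norm_of_nat)
      moreover have "norm (real n * (2 + \<bar>X z / sqrt (real n)\<bar>)) = real n * (2 + \<bar>X z / sqrt (real n)\<bar>)"
        unfolding real_norm_def by (rule abs_of_nonneg) simp
      ultimately show "norm (U n z) \<le> norm (real n * (2 + \<bar>X z / sqrt (real n)\<bar>))" by (simp only:)
    qed
  qed (unfold U_def, measurable)
  have dec: "of_nat n * ((\<integral>z. e n z * complex_of_real (r n z) \<partial>F p) - 1) =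
     (\<integral>z. U n z \<partial>F p) + (\<integral>z. V n z * complex_of_real (sqrt (real n) * (r n z - 1)) \<partial>F p)
     + \<i> * complex_of_real (\<integral>z. X z * (sqrt (real n) * (r n z - 1)) \<partial>F p) - complex_of_real (real n * excess p (h n))" for n
  proof -
    have X0: "(\<integral>z. X z \<partial>F p) = 0" using g0 by (simp add: X_def)
    have xr: "(\<integral>z. complex_of_real (X z * (sqrt (real n) * (r n z - 1))) \<partial>F p) = complex_of_real (\<integral>z. X z * (sqrt (real n) * (r n z - 1)) \<partial>F p)"
      by (rule integral_complex_of_real)
    have sq: "complex_of_real (sqrt (real n)) * complex_of_real (sqrt (real n)) = of_nat n"
      by (simp flip: of_real_mult)
    have sX: "of_nat n * complex_of_real (X z / sqrt (real n)) = complex_of_real (sqrt (real n) * X z)" for z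
    proof -
      have "real n * (X z / sqrt (real n)) = sqrt (real n) * X z" by (simp add: real_div_sqrt flip: times_divide_eq_left)
      then show ?thesis by (metis of_real_mult of_real_of_nat_eq)
    qed
    \<comment> \<open>Five parts with separate fates: U gives the variance; V times sqrt n (r - 1)
      is a product of a null sequence and a convergent one in L2; X times sqrt n (r - 1) gives the
      covariance; n (r - 1) integrates to the excess; the last is centred.\<close>
    have pw: "of_nat n * (e n z * complex_of_real (r n z) - 1) =
      U n z + V n z * complex_of_real (sqrt (real n) * (r n z - 1)) + \<i> * complex_of_real (X z * (sqrt (real n) * (r n z - 1)))
      + complex_of_real (real n * (r n z - 1)) + \<i> * complex_of_real (sqrt (real n) * X z)" for z
    proof -
      have U_eq: "U n z = of_nat n * (e n z - 1) - \<i> * complex_of_real (sqrt (real n) * X z)"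
        unfolding U_def sX[symmetric] by (simp add: algebra_simps)
      have "V n z * complex_of_real (sqrt (real n) * (r n z - 1)) + \<i> * complex_of_real (X z * (sqrt (real n) * (r n z - 1))) =
         (complex_of_real (sqrt (real n)) * complex_of_real (sqrt (real n))) * ((e n z - 1) * (complex_of_real (r n z) - 1))"
        unfolding V_def by (simp add: algebra_simps)
      then have V_eq: "V n z * complex_of_real (sqrt (real n) * (r n z - 1)) + \<i> * complex_of_real (X z * (sqrt (real n) * (r n z - 1))) =
         of_nat n * ((e n z - 1) * (complex_of_real (r n z) - 1))" unfolding sq .
      have aux: "n * (e * r - 1) = (n * (e - 1) - y) + n * ((e - 1) * (r - 1)) + n * (r - 1) + y" for n e r y :: complex
        by (simp add: algebra_simps)
      have "of_nat n * (e n z * complex_of_real (r n z) - 1) = U n z +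
         (V n z * complex_of_real (sqrt (real n) * (r n z - 1)) + \<i> * complex_of_real (X z * (sqrt (real n) * (r n z - 1))))
         + of_nat n * (complex_of_real (r n z) - 1) + \<i> * complex_of_real (sqrt (real n) * X z)"
        unfolding U_eq V_eq by (rule aux)
      then show ?thesis by (simp only: add.assoc of_real_mult of_real_diff of_real_1 of_real_of_nat_eq)
    qed
    have "of_nat n * ((\<integral>z. e n z * complex_of_real (r n z) \<partial>F p) - 1) = (\<integral>z. of_nat n * (e n z * complex_of_real (r n z) - 1) \<partial>F p)"
      using eri[of n] by (simp add: prob_space)
    also have "\<dots> = (\<integral>z. U n z \<partial>F p) + (\<integral>z. V n z * complex_of_real (sqrt (real n) * (r n z - 1)) \<partial>F p)
        + (\<integral>z. \<i> * complex_of_real (X z * (sqrt (real n) * (r n z - 1))) \<partial>F p)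
        + (\<integral>z. complex_of_real (real n * (r n z - 1)) \<partial>F p) + (\<integral>z. \<i> * complex_of_real (sqrt (real n) * X z) \<partial>F p)"
    proof -
      have i3: "integrable (F p) (\<lambda>z. \<i> * complex_of_real (X z * (sqrt (real n) * (r n z - 1))))"
        by (intro integrable_mult_right integrable_of_real Xri)
      have i4: "integrable (F p) (\<lambda>z. complex_of_real (real n * (r n z - 1)))"
        by (intro integrable_of_real integrable_mult_right Bochner_Integration.integrable_diff ri integrable_const)
      have i5: "integrable (F p) (\<lambda>z. \<i> * complex_of_real (sqrt (real n) * X z))"
        by (intro integrable_of_real integrable_mult_right X1)
      note a1 = Bochner_Integration.integrable_add[OF Ui[of n] Vri[of n]]
      note a2 = Bochner_Integration.integrable_add[OF a1 i3]
      note a3 = Bochner_Integration.integrable_add[OF a2 i4]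
      show ?thesis
        unfolding pw Bochner_Integration.integral_add[OF a3 i5] Bochner_Integration.integral_add[OF a2 i4]
          Bochner_Integration.integral_add[OF a1 i3] Bochner_Integration.integral_add[OF Ui Vri] ..
    qed
    also have "(\<integral>z. complex_of_real (real n * (r n z - 1)) \<partial>F p) = complex_of_real (real n * (- excess p (h n)))"
    proof -
      have "(\<integral>z. r n z \<partial>F p) = 1 - excess p (h n)" unfolding r_def by (rule lr_integral[OF p pn])
      then show ?thesis unfolding integral_complex_of_real using ri[of n] by (simp add: prob_space)
    qed
    also have "(\<integral>z. \<i> * complex_of_real (sqrt (real n) * X z) \<partial>F p) = 0"
      using X0 by (simp add: integral_complex_of_real)
    also have "(\<integral>z. \<i> * complex_of_real (X z * (sqrt (real n) * (r n z - 1))) \<partial>F p) =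
       \<i> * complex_of_real (\<integral>z. X z * (sqrt (real n) * (r n z - 1)) \<partial>F p)"
      unfolding integral_mult_right_zero xr ..
    finally show ?thesis by simp
  qed
  have "(\<lambda>n. of_nat n * ((\<integral>z. e n z * complex_of_real (r n z) \<partial>F p) - 1)) \<longlonglongrightarrow>
     complex_of_real (- (\<integral>z. (X z)\<^sup>2 \<partial>F p) / 2) + 0 + \<i> * complex_of_real (\<integral>z. X z * Z z \<partial>F p) - complex_of_real 0"
    unfolding dec by (intro tendsto_add tendsto_diff tendsto_mult tendsto_const tendsto_of_real U Vr XZ excess_null[OF ls])
  from power_tendsto_exp[OF this] show ?thesis
    unfolding prod by (simp add: X_def Z_def)
qed

end

context utility_model
begin

subsection \<open>Elimination of the residuals\<close>

text \<open>McLeish's trick: the products \<open>\<Prod>\<^sub>j (1 + i c R\<^sub>j / \<surd>n)\<close> have conditional mean \<open>1\<close> given the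
  observations, so no conditional central limit theorem is needed.\<close>

lemma resid_elimination:
  fixes G :: "nat \<Rightarrow> (nat \<Rightarrow> 'x) \<Rightarrow> complex"
  assumes gs: "good_seq p h a"
    and Gm: "\<And>n. G n \<in> borel_measurable (Pi\<^sub>M {..<n} (\<lambda>_. MX))"
    and Gb: "\<And>n x. x \<in> space (Pi\<^sub>M {..<n} (\<lambda>_. MX)) \<Longrightarrow> norm (G n x) \<le> 1"
  shows "(\<lambda>n. (\<integral>w. G n (obs n w) * iexp (\<Sum>j<n. c * resid (p + h n) (w j) / sqrt (real n)) \<partial>iid (F (p + h n)))
      - complex_of_real (exp (- (c\<^sup>2 * resid_var p) / 2)) * (\<integral>w. G n (obs n w) \<partial>iid (F (p + h n)))) \<longlonglongrightarrow> 0"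
proof -
  note ls = good_seqD[OF gs]
  note p = local_seqD(1)[OF ls] and pn = local_seqD(2)[OF ls]
  define M where "M n = F (p + h n)" for n
  define D where "D n z = c * resid (p + h n) z" for n z
  define v where "v = c\<^sup>2 * resid_var p"
  have pM: "prob_space (M n)" for n unfolding M_def by (rule F_prob[OF pn])
  interpret P: prob_space "iid (M n)" for n by (rule prob_space_iid[OF pM])
  have Dm[measurable]: "D n \<in> borel_measurable (M n)" for n
    unfolding D_def[abs_def] M_def using resid_F(1)[OF pn] by measurable
  have D2: "integrable (M n) (\<lambda>z. (D n z)\<^sup>2)" for n
    unfolding D_def M_def power_mult_distrib using resid_F(2)[OF pn] by simp
  have D1: "integrable (M n) (D n)" for n
    unfolding D_def[abs_def] M_def using resid_F(3)[OF pn] by simp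
  have "(\<integral>z. (D n z)\<^sup>2 \<partial>M n) = c\<^sup>2 * resid_var (p + h n)" for n
    by (simp add: D_def M_def power_mult_distrib resid_var_def)
  then have s: "(\<lambda>n. \<integral>z. (D n z)\<^sup>2 \<partial>M n) \<longlonglongrightarrow> v"
    unfolding v_def by (simp only:) (intro tendsto_mult tendsto_const resid_var_tendsto[OF gs])
  have lind: "(\<lambda>n. \<integral>z. (D n z)\<^sup>2 * indicator {z. (D n z)\<^sup>2 > sqrt (real n)} z \<partial>M n) \<longlonglongrightarrow> 0"
  proof (cases "c = 0")
    case True
    then show ?thesis by (simp add: D_def)
  next
    case False
    then have c2: "0 < c\<^sup>2" by simp
    \<comment> \<open>The level for the residual that corresponds to D^2 > sqrt n. Division by c^2
      is the reason for treating c = 0 separately.\<close>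
    define K where "K n = sqrt (real n) / c\<^sup>2" for n :: nat
    have K: "filterlim K at_top sequentially"
      unfolding filterlim_at_top
    proof
      fix Z :: real
      have "\<forall>\<^sub>F n in sequentially. Z * c\<^sup>2 \<le> sqrt (real n)"
        using filterlim_compose[OF sqrt_at_top filterlim_real_sequentially] by (simp add: filterlim_at_top)
      then show "\<forall>\<^sub>F n in sequentially. Z \<le> K n" by eventually_elim (use c2 in \<open>simp add: K_def pos_le_divide_eq\<close>)
    qed
    have "(\<integral>z. (D n z)\<^sup>2 * indicator {z. (D n z)\<^sup>2 > sqrt (real n)} z \<partial>M n) =
        c\<^sup>2 * (\<integral>z. (resid (p + h n) z)\<^sup>2 * indicator {z. K n < (resid (p + h n) z)\<^sup>2} z \<partial>M n)" for n
    proof -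
      have "(D n z)\<^sup>2 > sqrt (real n) \<longleftrightarrow> K n < (resid (p + h n) z)\<^sup>2" for z
        using c2 by (simp add: D_def K_def power_mult_distrib pos_divide_less_eq mult.commute)
      then show ?thesis by (simp add: D_def power_mult_distrib mult.assoc)
    qed
    then show ?thesis
      using tendsto_mult[OF tendsto_const resid_tail[OF ls K], of "c\<^sup>2"] by (simp add: M_def)
  qed
  define E where "E n w = iexp (\<Sum>j<n. D n (w j) / sqrt n)
      - complex_of_real (exp (- v / 2)) * (\<Prod>j<n. 1 + \<i> * (D n (w j) / sqrt n))" for n w
  have E: "(\<lambda>n. \<integral>w. norm (E n w) \<partial>iid (M n)) \<longlonglongrightarrow> 0"
    unfolding E_def by (rule lindeberg_iexp_prod[OF pM Dm D2 s lind])
  have ki: "integrable (M n) (\<lambda>z. 1 + \<i> * (D n z / sqrt n))" for n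
  proof -
    interpret prob_space "M n" by (rule pM)
    show ?thesis by (intro Bochner_Integration.integrable_add integrable_const integrable_mult_right integrable_of_real
        integrable_divide_zero D1 impI)
  qed
  have Gobs: "(\<lambda>w. G n (obs n w)) \<in> borel_measurable (iid (M n))" for n
    unfolding M_def by (rule obs_compose[OF pn Gm])
  have Gobs1: "norm (G n (obs n w)) \<le> 1" if "w \<in> space (iid (M n))" for n w
    using that unfolding M_def by (intro Gb obs_space[OF pn])
  have Dj: "(\<lambda>w. D n (w j)) \<in> borel_measurable (iid (M n))" for n j
    by (rule measurable_compose[OF measurable_iid_component Dm])
  have pi: "integrable (iid (M n)) (\<lambda>w. \<Prod>j<n. 1 + \<i> * (D n (w j) / sqrt n))" for n
    by (rule iid_integral_prod(1)[OF pM[of n], of n "\<lambda>_ z. 1 + \<i> * (D n z / sqrt n)"]) (rule ki)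
  have iem: "(\<lambda>w. iexp (\<Sum>j<n. D n (w j) / sqrt n)) \<in> borel_measurable (iid (M n))" for n
    using Dj by measurable
  have iei: "integrable (iid (M n)) (\<lambda>w. iexp (\<Sum>j<n. D n (w j) / sqrt n))" for n
    by (rule P.integrable_const_bound[of _ 1]) (use iem in auto)
  have Ei: "integrable (iid (M n)) (E n)" for n
    unfolding E_def by (intro Bochner_Integration.integrable_diff iei integrable_mult_right pi)
  have Gint: "integrable (iid (M n)) (\<lambda>w. G n (obs n w) * f w)" if "integrable (iid (M n)) f" for n and f :: "_ \<Rightarrow> complex"
  proof (rule Bochner_Integration.integrable_bound[OF that])
    show "(\<lambda>w. G n (obs n w) * f w) \<in> borel_measurable (iid (M n))"
      by (rule borel_measurable_times[OF Gobs borel_measurable_integrable[OF that]])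
    show "AE w in iid (M n). norm (G n (obs n w) * f w) \<le> norm (f w)"
      by (rule AE_I2) (use mult_right_mono[OF Gobs1 norm_ge_zero] in \<open>simp add: norm_mult\<close>)
  qed
  \<comment> \<open>Residuals integrate to 0 against bounded functions of X, so the weights 1 + i D
    / sqrt n and 1 have the same integrals against such functions, and \<open>iid_transfer\<close>
    with one and the same law removes the product.\<close>
  have tower: "(\<integral>w. G n (obs n w) * (\<Prod>j<n. 1 + \<i> * (D n (w j) / sqrt n)) \<partial>iid (M n)) = (\<integral>w. G n (obs n w) \<partial>iid (M n))" for n
  proof -
    interpret M: prob_space "M n" by (rule pM)
    have sets: "sets (M n) = sets (MX \<Otimes>\<^sub>M MTh)" unfolding M_def by (rule sets_F[OF pn])
    have one: "integrable (M n) (\<lambda>_. 1::complex)" by simp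
    have "(\<integral>w. G n (obs n w) * (\<Prod>j<n. 1 + \<i> * (D n (w j) / sqrt n)) \<partial>iid (M n)) =
        (\<integral>w. G n (obs n w) * (\<Prod>j<n. 1) \<partial>iid (M n))"
    proof (rule iid_transfer[OF pM sets ki pM sets one _ Gm Gb])
      fix H :: "'x \<Rightarrow> complex" and B :: real
      assume H: "H \<in> borel_measurable MX" and HB: "\<And>x. x \<in> space MX \<Longrightarrow> norm (H x) \<le> B"
      have HF: "(\<lambda>z. H (fst z)) \<in> borel_measurable (M n)" unfolding M_def by (rule comp_F[OF pn H])
      have Hb: "norm (H (fst z)) \<le> B" if "z \<in> space (M n)" for z
        using that fst_space[OF pn] HB unfolding M_def by auto
      have Hi: "integrable (M n) (\<lambda>z. H (fst z))"
        by (rule M.integrable_const_bound[of _ B]) (use Hb HF in auto)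
      have HD: "integrable (M n) (\<lambda>z. H (fst z) * (\<i> * (D n z / sqrt n)))"
        "(\<integral>z. H (fst z) * (\<i> * (D n z / sqrt n)) \<partial>M n) = 0"
      proof -
        \<comment> \<open>The orthogonality of residuals is available for real test functions;
          \<open>hh\<close> stands for the real and the imaginary part.\<close>
        have sq: "integrable (M n) (\<lambda>z. (hh (H (fst z)))\<^sup>2)" "(\<lambda>x. hh (H x)) \<in> borel_measurable MX"
          if hh: "hh \<in> borel_measurable borel" "\<And>ww. \<bar>hh ww\<bar> \<le> norm ww" for hh :: "complex \<Rightarrow> real"
        proof -
          show "(\<lambda>x. hh (H x)) \<in> borel_measurable MX" by (rule measurable_compose[OF H hh(1)])
          have hm: "(\<lambda>z. hh (H (fst z))) \<in> borel_measurable (M n)" by (rule measurable_compose[OF HF hh(1)])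
          show "integrable (M n) (\<lambda>z. (hh (H (fst z)))\<^sup>2)"
          proof (rule M.integrable_const_bound[of _ "B\<^sup>2"])
            show "AE z in M n. norm ((hh (H (fst z)))\<^sup>2) \<le> B\<^sup>2"
            proof (rule AE_I2)
              fix z assume z: "z \<in> space (M n)"
              have "\<bar>hh (H (fst z))\<bar> \<le> B" using hh(2)[of "H (fst z)"] Hb[OF z] by linarith
              then have "\<bar>hh (H (fst z))\<bar>\<^sup>2 \<le> B\<^sup>2" by (rule power_mono) simp
              then show "norm ((hh (H (fst z)))\<^sup>2) \<le> B\<^sup>2" by simp
            qed
          qed (rule borel_measurable_power[OF hm])
        qed
        have o: "(\<integral>z. hh (H (fst z)) * D n z \<partial>M n) = 0" "integrable (M n) (\<lambda>z. hh (H (fst z)) * D n z)"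
          if hh: "hh \<in> borel_measurable borel" "\<And>ww. \<bar>hh ww\<bar> \<le> norm ww" for hh :: "complex \<Rightarrow> real"
          using resid_orth[OF pn[of n] sq(2)[OF hh] sq(1)[OF hh, unfolded M_def]]
          unfolding D_def M_def by (simp_all add: mult.left_commute)
        note re = o[of Re, OF _ abs_Re_le_cmod] and im = o[of Im, OF _ abs_Im_le_cmod]
        have dec: "H (fst z) * (\<i> * (D n z / sqrt n)) =
           \<i> * (complex_of_real ((Re (H (fst z)) * D n z) / sqrt n) + \<i> * complex_of_real ((Im (H (fst z)) * D n z) / sqrt n))" for z
          by (subst complex_eq[of "H (fst z)"]) (simp add: algebra_simps add_divide_distrib)
        have i1: "integrable (M n) (\<lambda>z. complex_of_real ((Re (H (fst z)) * D n z) / sqrt n))"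
          and i2: "integrable (M n) (\<lambda>z. \<i> * complex_of_real ((Im (H (fst z)) * D n z) / sqrt n))"
        proof -
          have r1: "integrable (M n) (\<lambda>z. (Re (H (fst z)) * D n z) / sqrt n)"
            and r2: "integrable (M n) (\<lambda>z. (Im (H (fst z)) * D n z) / sqrt n)"
            using re(2) im(2) by simp_all
          show "integrable (M n) (\<lambda>z. complex_of_real ((Re (H (fst z)) * D n z) / sqrt n))"
            by (rule integrable_of_real[OF r1])
          show "integrable (M n) (\<lambda>z. \<i> * complex_of_real ((Im (H (fst z)) * D n z) / sqrt n))"
            by (rule integrable_mult_right[OF integrable_of_real[OF r2]])
        qed
        show "integrable (M n) (\<lambda>z. H (fst z) * (\<i> * (D n z / sqrt n)))"
          unfolding dec by (intro integrable_mult_right Bochner_Integration.integrable_add i1 i2)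
        have "(\<integral>z. (Re (H (fst z)) * D n z) / sqrt n \<partial>M n) = 0" "(\<integral>z. (Im (H (fst z)) * D n z) / sqrt n \<partial>M n) = 0"
          using re(1) im(1) by simp_all
        then have z1: "(\<integral>z. complex_of_real ((Re (H (fst z)) * D n z) / sqrt n) \<partial>M n) = 0"
          and z2: "(\<integral>z. complex_of_real ((Im (H (fst z)) * D n z) / sqrt n) \<partial>M n) = 0"
          by (simp_all only: integral_mult_right_zero integral_complex_of_real of_real_0 mult_zero_right)
        show "(\<integral>z. H (fst z) * (\<i> * (D n z / sqrt n)) \<partial>M n) = 0"
          unfolding dec integral_mult_right_zero Bochner_Integration.integral_add[OF i1 i2] z1 z2 by (simp only: mult_zero_right add_0_right)
      qed
      show "(\<integral>z. H (fst z) * (1 + \<i> * (D n z / sqrt n)) \<partial>M n) = (\<integral>z. H (fst z) * 1 \<partial>M n)"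
        unfolding distrib_left mult_1_right Bochner_Integration.integral_add[OF Hi HD(1)] HD(2) by simp
    qed
    then show ?thesis by simp
  qed
  have le: "norm ((\<integral>w. G n (obs n w) * iexp (\<Sum>j<n. D n (w j) / sqrt n) \<partial>iid (M n))
      - complex_of_real (exp (- v / 2)) * (\<integral>w. G n (obs n w) \<partial>iid (M n))) \<le> (\<integral>w. norm (E n w) \<partial>iid (M n))" for n
  proof -
    note i1 = Gint[OF iei[of n]] and i2 = Gint[OF pi[of n]]
    have "(\<integral>w. G n (obs n w) * E n w \<partial>iid (M n)) =
       (\<integral>w. G n (obs n w) * iexp (\<Sum>j<n. D n (w j) / sqrt n) - complex_of_real (exp (- v / 2)) *
          (G n (obs n w) * (\<Prod>j<n. 1 + \<i> * (D n (w j) / sqrt n))) \<partial>iid (M n))"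
      unfolding E_def right_diff_distrib mult.left_commute[of "complex_of_real (exp (- v / 2))"] ..
    also have "\<dots> = (\<integral>w. G n (obs n w) * iexp (\<Sum>j<n. D n (w j) / sqrt n) \<partial>iid (M n))
      - complex_of_real (exp (- v / 2)) * (\<integral>w. G n (obs n w) \<partial>iid (M n))"
      unfolding Bochner_Integration.integral_diff[OF i1 integrable_mult_right[OF i2]] integral_mult_right_zero tower ..
    finally have e: "(\<integral>w. G n (obs n w) * iexp (\<Sum>j<n. D n (w j) / sqrt n) \<partial>iid (M n))
      - complex_of_real (exp (- v / 2)) * (\<integral>w. G n (obs n w) \<partial>iid (M n)) = (\<integral>w. G n (obs n w) * E n w \<partial>iid (M n))" ..
    show ?thesis unfolding e
    proof (rule norm_integral_le[OF integrable_norm[OF Ei]])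
      show "AE w in iid (M n). norm (G n (obs n w) * E n w) \<le> norm (E n w)"
        by (rule AE_I2) (use mult_right_mono[OF Gobs1 norm_ge_zero] in \<open>simp add: norm_mult\<close>)
    qed
  qed
  from null_of_norm_le[OF le E] show ?thesis unfolding D_def M_def v_def .
qed

section \<open>Characteristic functions of the estimation error under local shifts\<close>

definition stat :: "real ^ 'd \<Rightarrow> (nat \<Rightarrow> (nat \<Rightarrow> 'x) \<Rightarrow> real) \<Rightarrow> nat \<Rightarrow> (nat \<Rightarrow> 'x \<times> 't) \<Rightarrow> real" where
  "stat p S n w = (S n (obs n w) - util_sum u (F p) n w) / sqrt (real n)"

text \<open>The \<open>A\<^sub>n\<close> of the overview. The point p of the centring is independent
  of the law under which the sample is drawn.\<close>

definition centred :: "real ^ 'd \<Rightarrow> (nat \<Rightarrow> (nat \<Rightarrow> 'x) \<Rightarrow> real) \<Rightarrow> nat \<Rightarrow> (nat \<Rightarrow> 'x \<times> 't) \<Rightarrow> real" where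
  "centred p S n w = (S n (obs n w) - (\<Sum>j<n. ubar p (fst (w j)))) / sqrt (real n)"

lemma obs_estimator: "estimator MX S \<Longrightarrow> p \<in> T \<Longrightarrow> (\<lambda>w. S n (obs n w)) \<in> borel_measurable (iid (F p))"
  by (rule obs_compose) (auto simp: estimator_def)

lemma stat_meas:
  assumes S: "estimator MX S" and p: "p \<in> T"
  shows "stat p S n \<in> borel_measurable (iid (F p))"
proof -
  have "(\<lambda>w. \<Sum>j<n. util u (F p) (w j)) \<in> borel_measurable (iid (F p))"
    by (intro borel_measurable_sum iid_comp_F[OF p u_F[OF p]])
  then have "util_sum u (F p) n \<in> borel_measurable (iid (F p))" by (simp add: util_sum_def[abs_def] util_def)
  then show ?thesis unfolding stat_def[abs_def]
    by (intro borel_measurable_divide borel_measurable_diff borel_measurable_const obs_estimator[OF S p])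
qed

lemma centred_meas:
  assumes S: "estimator MX S" and p: "p \<in> T" and p': "p' \<in> T"
  shows "centred p' S n \<in> borel_measurable (iid (F p))"
  unfolding centred_def[abs_def]
  by (intro borel_measurable_divide borel_measurable_diff borel_measurable_sum borel_measurable_const
      obs_estimator[OF S p] iid_comp_F[OF p ubar_F[OF p p']])

text \<open>The estimator cancels. The differences of \<open>ubar\<close>, once centred, have a
  normalised sum whose variance is at most the squared L2 distance of the two versions; their means
  add up to a . \<gamma> by \<open>mean_shift\<close>.\<close>

lemma centred_shift:
  assumes gs: "good_seq p h a"
  shows "oP1 (iid (F p)) (\<lambda>n w. centred (p + h n) S n w - (centred p S n w - a \<bullet> gam p))"
proof -
  note ls = good_seqD[OF gs]
  note p = local_seqD(1)[OF ls] and pn = local_seqD(2)[OF ls]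
  interpret M: prob_space "F p" by (rule F_prob[OF p])
  interpret P: prob_space "iid (F p)" by (rule prob_space_iid[OF F_prob[OF p]])
  define d where "d n z = ubar (p + h n) (fst z) - ubar p (fst z)" for n and z :: "'x \<times> 't"
  define m where "m n = (\<integral>z. d n z \<partial>F p)" for n
  define y where "y n z = d n z - m n" for n z
  have dm[measurable]: "d n \<in> borel_measurable (F p)" for n
    unfolding d_def[abs_def] by (intro borel_measurable_diff ubar_F[OF p pn] ubar_F[OF p p])
  have um: "(\<lambda>z. ubar (p + h n) (fst z)) \<in> borel_measurable (F p)" and u2: "integrable (F p) (\<lambda>z. (ubar (p + h n) (fst z))\<^sup>2)" for n
    using ubar_L2_tendsto[OF gs] by (auto simp: L2_tendsto_def)
  have d2: "integrable (F p) (\<lambda>z. (d n z)\<^sup>2)" for n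
    using integral_square_add_le(1)[OF um borel_measurable_uminus[OF ubar_F[OF p p]] u2] ubar_sq[OF p] by (simp add: d_def)
  have d1: "integrable (F p) (d n)" for n by (rule M.square_integrable_imp_integrable[OF dm d2])
  have ym: "y n \<in> borel_measurable (F p)" and y2: "integrable (F p) (\<lambda>z. (y n z)\<^sup>2)" and y0: "(\<integral>z. y n z \<partial>F p) = 0" for n
    unfolding y_def[abs_def] using d1[of n] d2[of n] by (auto simp: power2_diff m_def M.prob_space)
  have yle: "(\<integral>z. (y n z)\<^sup>2 \<partial>F p) \<le> (\<integral>z. (d n z)\<^sup>2 \<partial>F p)" for n
  proof -
    have "(\<integral>z. (y n z)\<^sup>2 \<partial>F p) = (\<integral>z. (d n z)\<^sup>2 \<partial>F p) - (m n)\<^sup>2"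
      unfolding y_def using d1[of n] d2[of n] by (simp add: power2_diff M.prob_space m_def) (simp add: power2_eq_square)
    then show ?thesis by simp
  qed
  define R where "R n w = (\<Sum>j<n. y n (w j)) / sqrt (real n)" for n :: nat and w
  define e where "e n = sqrt (real n) * m n - a \<bullet> gam p" for n
  have ui: "integrable (F p) (\<lambda>z. ubar (p + h n) (fst z))" "integrable (F p) (\<lambda>z. ubar p (fst z))" for n
    by (rule M.square_integrable_imp_integrable[OF um u2], rule M.square_integrable_imp_integrable[OF ubar_F[OF p p] ubar_sq[OF p]])
  have m: "m n = (\<integral>z. ubar (p + h n) (fst z) \<partial>F p) - mean_util F u p" for n
    unfolding m_def d_def Bochner_Integration.integral_diff[OF ui] ubar_mean[OF p] ..
  have e: "e \<longlonglongrightarrow> 0"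
    unfolding e_def m using mean_shift[OF gs] by (simp add: LIM_zero_iff)
  have Rm: "R n \<in> borel_measurable (iid (F p))" for n
    unfolding R_def[abs_def] by (intro borel_measurable_divide borel_measurable_sum borel_measurable_const iid_comp_F[OF p ym])
  have R2: "integrable (iid (F p)) (\<lambda>w. (R n w)\<^sup>2)" for n
    using iid_L2_sum(1)[OF F_prob[OF p] ym[of n] ym[of n] y2[of n] y2[of n], of n] by (simp add: R_def power_divide power2_eq_square)
  have R2le: "(\<integral>w. (R n w)\<^sup>2 \<partial>iid (F p)) \<le> (\<integral>z. (d n z)\<^sup>2 \<partial>F p)" for n
  proof (cases "n = 0")
    case False
    then have "(\<integral>w. (R n w)\<^sup>2 \<partial>iid (F p)) = (\<integral>z. (y n z)\<^sup>2 \<partial>F p)"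
      using iid_L2_sum(2)[OF F_prob[OF p] ym[of n] ym[of n] y2[of n] y2[of n] y0[of n], of n] by (simp add: R_def power_divide power2_eq_square)
    then show ?thesis using yle[of n] by simp
  qed (simp add: R_def)
  have dl: "(\<lambda>n. \<integral>z. (d n z)\<^sup>2 \<partial>F p) \<longlonglongrightarrow> 0"
    using ubar_L2_tendsto[OF gs] by (simp add: L2_tendsto_def d_def)
  have oP: "oP1 (iid (F p)) (\<lambda>n w. - R n w + - e n)"
  proof (rule oP1_add)
    show "oP1 (iid (F p)) (\<lambda>n w. - R n w)"
    proof (rule oP1_of_L2[OF P.prob_space_axioms])
      show "(\<lambda>n. \<integral>w. (- R n w)\<^sup>2 \<partial>iid (F p)) \<longlonglongrightarrow> 0"
        by (rule null_of_norm_le[OF _ dl]) (use R2le in simp)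
    qed (use Rm R2 in auto)
    show "oP1 (iid (F p)) (\<lambda>n w. - e n)"
    proof (rule oP1_of_L2[OF P.prob_space_axioms])
      show "(\<lambda>n. \<integral>w. (- e n)\<^sup>2 \<partial>iid (F p)) \<longlonglongrightarrow> 0"
        using tendsto_power[OF e, of 2] by (simp add: P.prob_space)
    qed auto
  qed
  show ?thesis
  proof (rule oP1_cong[OF oP], rule eventually_mono[OF eventually_gt_at_top[of 0]], rule ballI)
    fix n :: nat and w :: "nat \<Rightarrow> 'x \<times> 't" assume n: "0 < n"
    have "(\<Sum>j<n. y n (w j)) = (\<Sum>j<n. ubar (p + h n) (fst (w j))) - (\<Sum>j<n. ubar p (fst (w j))) - real n * m n"
      by (simp add: y_def d_def sum_subtractf)
    then have "R n w = ((\<Sum>j<n. ubar (p + h n) (fst (w j))) - (\<Sum>j<n. ubar p (fst (w j)))) / sqrt (real n) - sqrt (real n) * m n"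
      using n by (simp add: R_def diff_divide_distrib real_div_sqrt flip: times_divide_eq_left)
    then show "centred (p + h n) S n w - (centred p S n w - a \<bullet> gam p) = - R n w + - e n"
      by (simp add: centred_def e_def diff_divide_distrib)
  qed
qed

lemma lrprod_sq_bounded:
  assumes ls: "local_seq p h a"
  obtains C where "\<And>n. (\<integral>w. (lrprod p (h n) n w)\<^sup>2 \<partial>iid (F p)) \<le> C"
proof -
  have "Bseq (\<lambda>n. \<integral>w. (lrprod p (h n) n w)\<^sup>2 \<partial>iid (F p))"
    by (rule convergent_imp_Bseq[OF convergentI[OF lrprod_sq_tendsto[OF ls]]])
  then obtain K where "\<And>n. norm (\<integral>w. (lrprod p (h n) n w)\<^sup>2 \<partial>iid (F p)) \<le> K" unfolding Bseq_def by auto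
  then have "(\<integral>w. (lrprod p (h n) n w)\<^sup>2 \<partial>iid (F p)) \<le> K" for n by (metis abs_le_D1 real_norm_def)
  then show ?thesis by (rule that)
qed

text \<open>The order of the replacements matters. The residuals are eliminated under the shifted
  law, where their conditional mean is 0; the exponent is then a function of the observations, to
  which the change of measure applies; and only under the weighted central law is the centring moved
  from p + h to p.\<close>

lemma char_stat:
  assumes gs: "good_seq p h a" and S: "estimator MX S"
  shows "(\<lambda>n. (\<integral>w. iexp (t * stat (p + h n) S n w) \<partial>iid (F (p + h n)))
     - complex_of_real (exp (- (t\<^sup>2 * resid_var p) / 2)) * iexp (- t * (a \<bullet> gam p)) *
       (\<integral>w. iexp (t * centred p S n w) * complex_of_real (lrprod p (h n) n w) \<partial>iid (F p))) \<longlonglongrightarrow> 0"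
proof -
  note ls = good_seqD[OF gs]
  note p = local_seqD(1)[OF ls] and pn = local_seqD(2)[OF ls]
  interpret P: prob_space "iid (F p)" by (rule prob_space_iid[OF F_prob[OF p]])
  define g where "g = a \<bullet> gam p"
  define G where "G n x = iexp (t * ((S n x - (\<Sum>j<n. ubar (p + h n) (x j))) / sqrt (real n)))" for n :: nat and x
  have Gm: "G n \<in> borel_measurable (Pi\<^sub>M {..<n} (\<lambda>_. MX))" for n
  proof -
    have "S n \<in> borel_measurable (Pi\<^sub>M {..<n} (\<lambda>_. MX))" using S by (simp add: estimator_def)
    moreover have "(\<lambda>x. \<Sum>j<n. ubar (p + h n) (x j)) \<in> borel_measurable (Pi\<^sub>M {..<n} (\<lambda>_. MX))"
      by (intro borel_measurable_sum measurable_compose[OF _ ubar_MX[OF pn]] measurable_component_singleton)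
    ultimately have "(\<lambda>x. t * ((S n x - (\<Sum>j<n. ubar (p + h n) (x j))) / sqrt (real n))) \<in> borel_measurable (Pi\<^sub>M {..<n} (\<lambda>_. MX))"
      by (intro borel_measurable_times borel_measurable_divide borel_measurable_diff borel_measurable_const)
    from measurable_compose[OF this, of iexp borel] show ?thesis unfolding G_def by simp
  qed
  have Gb: "norm (G n x) \<le> 1" for n x by (simp add: G_def)
  have Gobs: "G n (obs n w) = iexp (t * centred (p + h n) S n w)" for n w
    by (simp add: G_def centred_def obs_def)
  have st: "iexp (t * stat (p + h n) S n w) = G n (obs n w) * iexp (\<Sum>j<n. (- t) * resid (p + h n) (w j) / sqrt (real n))" for n w
  proof -
    have "util_sum u (F (p + h n)) n w = (\<Sum>j<n. ubar (p + h n) (fst (w j))) + (\<Sum>j<n. resid (p + h n) (w j))"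
      by (simp add: util_sum_def resid_def util_def sum_subtractf)
    then have "stat (p + h n) S n w = centred (p + h n) S n w - (\<Sum>j<n. resid (p + h n) (w j)) / sqrt (real n)"
      by (simp add: stat_def centred_def diff_divide_distrib add_divide_distrib)
    then have "t * stat (p + h n) S n w = t * centred (p + h n) S n w + (\<Sum>j<n. (- t) * resid (p + h n) (w j) / sqrt (real n))"
      by (simp add: right_diff_distrib sum_distrib_left sum_divide_distrib sum_negf)
    then show ?thesis unfolding Gobs by (simp add: distrib_left exp_add)
  qed
  define e where "e = complex_of_real (exp (- (t\<^sup>2 * resid_var p) / 2))"
  have 1: "(\<lambda>n. (\<integral>w. iexp (t * stat (p + h n) S n w) \<partial>iid (F (p + h n))) - e * (\<integral>w. G n (obs n w) \<partial>iid (F (p + h n)))) \<longlonglongrightarrow> 0"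
    unfolding st e_def using resid_elimination[OF gs Gm Gb, of "- t"] by simp
  have 2: "(\<lambda>n. (\<integral>w. G n (obs n w) \<partial>iid (F (p + h n))) - (\<integral>w. G n (obs n w) * complex_of_real (lrprod p (h n) n w) \<partial>iid (F p))) \<longlonglongrightarrow> 0"
    by (rule null_of_norm_le[OF change_of_measure[OF p pn Gm Gb] excess_null[OF ls]])
  obtain C where C: "\<And>n. (\<integral>w. (lrprod p (h n) n w)\<^sup>2 \<partial>iid (F p)) \<le> C" using lrprod_sq_bounded[OF ls] by blast
  have 3: "(\<lambda>n. (\<integral>w. iexp (t * centred (p + h n) S n w) * complex_of_real (lrprod p (h n) n w) \<partial>iid (F p))
      - (\<integral>w. iexp (t * (centred p S n w - g)) * complex_of_real (lrprod p (h n) n w) \<partial>iid (F p))) \<longlonglongrightarrow> 0"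
    unfolding g_def
    by (rule oP1_iexp_weighted[OF P.prob_space_axioms centred_meas[OF S p pn] borel_measurable_diff[OF centred_meas[OF S p p] borel_measurable_const]
        lrprod_meas[OF p pn] lrprod_moments(3)[OF p pn] C centred_shift[OF gs]])
  have sh: "(\<integral>w. iexp (t * (centred p S n w - g)) * complex_of_real (lrprod p (h n) n w) \<partial>iid (F p)) =
     iexp (- t * g) * (\<integral>w. iexp (t * centred p S n w) * complex_of_real (lrprod p (h n) n w) \<partial>iid (F p))" for n
  proof -
    have "iexp (t * (centred p S n w - g)) * complex_of_real (lrprod p (h n) n w) =
       iexp (- t * g) * (iexp (t * centred p S n w) * complex_of_real (lrprod p (h n) n w))" for w
    proof -
      have "t * (centred p S n w - g) = - t * g + t * centred p S n w" by (simp add: algebra_simps)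
      then show ?thesis by (simp only: of_real_add distrib_left exp_add mult.assoc)
    qed
    then show ?thesis by (simp only: integral_mult_right_zero)
  qed
  have "(\<lambda>n. ((\<integral>w. iexp (t * stat (p + h n) S n w) \<partial>iid (F (p + h n))) - e * (\<integral>w. G n (obs n w) \<partial>iid (F (p + h n))))
    + e * ((\<integral>w. G n (obs n w) \<partial>iid (F (p + h n))) - (\<integral>w. G n (obs n w) * complex_of_real (lrprod p (h n) n w) \<partial>iid (F p)))
    + e * ((\<integral>w. iexp (t * centred (p + h n) S n w) * complex_of_real (lrprod p (h n) n w) \<partial>iid (F p))
      - (\<integral>w. iexp (t * (centred p S n w - g)) * complex_of_real (lrprod p (h n) n w) \<partial>iid (F p)))) \<longlonglongrightarrow> 0 + e * 0 + e * 0"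
    by (intro tendsto_add tendsto_mult tendsto_const 1 2 3)
  moreover have "(x - e * y) + e * (y - z) + e * (z - ww) = x - e * ww" for x y z ww by (simp add: algebra_simps)
  ultimately show ?thesis
    unfolding Gobs sh by (simp only: e_def g_def mult.assoc add_0_right mult_zero_right)
qed

end

subsection \<open>Information and regular estimators\<close>

lemma integral_inner_inner:
  fixes X Y :: "'a \<Rightarrow> real ^ 'n"
  assumes i: "\<And>i j. integrable M (\<lambda>z. X z $ i * Y z $ j)"
  shows "(\<integral>z. (a \<bullet> X z) * (b \<bullet> Y z) \<partial>M) = (\<Sum>i\<in>UNIV. \<Sum>j\<in>UNIV. (a $ i * b $ j) * (\<integral>z. X z $ i * Y z $ j \<partial>M))"
proof -
  have "(\<integral>z. (a \<bullet> X z) * (b \<bullet> Y z) \<partial>M) = (\<integral>z. (\<Sum>i\<in>UNIV. \<Sum>j\<in>UNIV. (a $ i * b $ j) * (X z $ i * Y z $ j)) \<partial>M)"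
    by (simp add: inner_vec_def sum_product mult_ac)
  also have "\<dots> = (\<Sum>i\<in>UNIV. \<Sum>j\<in>UNIV. (a $ i * b $ j) * (\<integral>z. X z $ i * Y z $ j \<partial>M))"
    using i
    by (subst Bochner_Integration.integral_sum, intro Bochner_Integration.integrable_sum integrable_mult_right, simp,
        subst Bochner_Integration.integral_sum, intro integrable_mult_right, simp, simp)
  finally show ?thesis .
qed

lemma symmetric_matrix_inner: "transpose A = A \<Longrightarrow> (A *v x) \<bullet> y = x \<bullet> (A *v (y :: real ^ 'n))"
  by (metis dot_lmul_matrix matrix_transpose_mul transpose_matrix_vector)

context utility_model
begin

abbreviation info :: "real ^ 'd \<Rightarrow> real ^ 'd ^ 'd" where
  "info p \<equiv> fisher_info F \<rho> p"

lemma score_mult_integrable: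
  assumes p: "p \<in> T"
  shows "integrable (F p) (\<lambda>z. (a \<bullet> \<rho> p (fst z)) * (b \<bullet> \<rho> p (fst z)))"
  by (rule integrable_mult_of_squares[OF score_F(2)[OF p] score_F(2)[OF p] score_L2(2)[OF p] score_L2(2)[OF p]])

lemma info_component:
  assumes p: "p \<in> T"
  shows "info p $ i $ j = (\<integral>z. \<rho> p (fst z) $ i * \<rho> p (fst z) $ j \<partial>F p)"
  using score_mean[OF p, of "axis i 1"] score_mean[OF p, of "axis j 1"]
  by (simp add: fisher_info_def cov_matrix_def inner_axis')

lemma info_inner:
  assumes p: "p \<in> T"
  shows "a \<bullet> (info p *v b) = (\<integral>z. (a \<bullet> \<rho> p (fst z)) * (b \<bullet> \<rho> p (fst z)) \<partial>F p)"
proof -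
  have i: "integrable (F p) (\<lambda>z. \<rho> p (fst z) $ i * \<rho> p (fst z) $ j)" for i j
    using score_mult_integrable[OF p, of "axis i 1" "axis j 1"] by (simp add: inner_axis')
  show ?thesis unfolding integral_inner_inner[OF i] info_component[OF p, symmetric]
    by (simp add: inner_vec_def matrix_vector_mult_def sum_distrib_left mult_ac)
qed

lemma info_symmetric:
  assumes p: "p \<in> T" shows "transpose (info p) = info p"
  unfolding transpose_def by (simp add: vec_eq_iff info_component[OF p] mult.commute)

lemma info_inverse:
  assumes p: "p \<in> T"
  shows "info p *v (matrix_inv (info p) *v x) = x" "matrix_inv (info p) *v (info p *v x) = x"
    "(matrix_inv (info p) *v x) \<bullet> y = x \<bullet> (matrix_inv (info p) *v y)"
proof -
  have "invertible (info p)"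
    using info_rank[OF p] by (metis full_rank_injective invertible_left_inverse matrix_left_invertible_injective)
  then have i: "info p ** matrix_inv (info p) = mat 1" "matrix_inv (info p) ** info p = mat 1"
    unfolding invertible_def matrix_inv_def by (rule someI_ex[THEN conjunct1], rule someI_ex[THEN conjunct2])
  show 1: "info p *v (matrix_inv (info p) *v x) = x" "matrix_inv (info p) *v (info p *v x) = x" for x
    by (simp_all add: matrix_vector_mul_assoc i)
  have "(matrix_inv (info p) *v x) \<bullet> y = (matrix_inv (info p) *v x) \<bullet> (info p *v (matrix_inv (info p) *v y))"
    by (simp add: 1)
  also have "\<dots> = x \<bullet> (matrix_inv (info p) *v y)"
    by (subst symmetric_matrix_inner[OF info_symmetric[OF p], symmetric]) (simp only: 1)
  finally show "(matrix_inv (info p) *v x) \<bullet> y = x \<bullet> (matrix_inv (info p) *v y)" .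
qed

text \<open>The least favourable direction: the score in this direction represents the functional
  taking a to a . \<gamma>, see \<open>eff_dir_inner\<close>. Its second moment
  \<open>eff_gain\<close> is the quadratic form of the inverse information at \<gamma>.\<close>

definition eff_dir :: "real ^ 'd \<Rightarrow> real ^ 'd" where
  "eff_dir p = matrix_inv (info p) *v gam p"

definition eff_gain :: "real ^ 'd \<Rightarrow> real" where
  "eff_gain p = (\<integral>z. (eff_dir p \<bullet> \<rho> p (fst z))\<^sup>2 \<partial>F p)"

lemma eff_dir_inner:
  assumes p: "p \<in> T"
  shows "(\<integral>z. (eff_dir p \<bullet> \<rho> p (fst z)) * (a \<bullet> \<rho> p (fst z)) \<partial>F p) = a \<bullet> gam p"
proof -
  have "(\<integral>z. (eff_dir p \<bullet> \<rho> p (fst z)) * (a \<bullet> \<rho> p (fst z)) \<partial>F p) = a \<bullet> (info p *v eff_dir p)"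
    unfolding info_inner[OF p] by (simp add: mult.commute)
  then show ?thesis by (simp add: eff_dir_def info_inverse[OF p])
qed

lemma eff_gain:
  assumes p: "p \<in> T"
  shows "eff_gain p = eff_dir p \<bullet> gam p"
  using eff_dir_inner[OF p, of "eff_dir p"] by (simp add: eff_gain_def power2_eq_square)

lemma eff_gain_nonneg: "0 \<le> eff_gain p"
  by (simp add: eff_gain_def)

lemma phi_star_eq: "phi_star F u ubar \<rho> dm p x = ubar p x - mean_util F u p + eff_dir p \<bullet> \<rho> p x"
  by (simp add: phi_star_def eff_dir_def inner_commute)

text \<open>For an estimator that is linear under F p the limits along all local sequences are
  explicit. They depend on a only through the phase, which vanishes exactly when the covariance of g
  with a . \<rho> is a . \<gamma>; this is regularity in terms of influence functions.\<close>

lemma linear_char: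
  fixes g :: "'x \<Rightarrow> real"
  assumes gs: "good_seq p h a" and S: "estimator MX S" and g: "g \<in> borel_measurable MX"
    and g2: "integrable (F p) (\<lambda>z. (g (fst z))\<^sup>2)" and g0: "(\<integral>z. g (fst z) \<partial>F p) = 0"
    and lin: "oP1 (iid (F p)) (\<lambda>n w. centred p S n w - (\<Sum>j<n. g (fst (w j))) / sqrt (real n))"
  shows "(\<lambda>n. \<integral>w. iexp (t * stat (p + h n) S n w) \<partial>iid (F (p + h n))) \<longlonglongrightarrow>
     complex_of_real (exp (- (t\<^sup>2 * (resid_var p + (\<integral>z. (g (fst z))\<^sup>2 \<partial>F p))) / 2)) *
     iexp (t * ((\<integral>z. g (fst z) * (a \<bullet> \<rho> p (fst z)) \<partial>F p) - a \<bullet> gam p))"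
proof -
  note ls = good_seqD[OF gs]
  note p = local_seqD(1)[OF ls] and pn = local_seqD(2)[OF ls]
  interpret P: prob_space "iid (F p)" by (rule prob_space_iid[OF F_prob[OF p]])
  define V where "V = (\<integral>z. (g (fst z))\<^sup>2 \<partial>F p)"
  define I where "I = (\<integral>z. g (fst z) * (a \<bullet> \<rho> p (fst z)) \<partial>F p)"
  define e where "e = complex_of_real (exp (- (t\<^sup>2 * resid_var p) / 2)) * iexp (- t * (a \<bullet> gam p))"
  let ?B = "\<lambda>n w. (\<Sum>j<n. g (fst (w j))) / sqrt (real n)"
  let ?L = "\<lambda>n w. complex_of_real (lrprod p (h n) n w)"
  obtain C where C: "\<And>n. (\<integral>w. (lrprod p (h n) n w)\<^sup>2 \<partial>iid (F p)) \<le> C" using lrprod_sq_bounded[OF ls] by blast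
  have Bm: "?B n \<in> borel_measurable (iid (F p))" for n
    by (intro borel_measurable_divide borel_measurable_sum borel_measurable_const iid_comp_F[OF p comp_F[OF p g]])
  have 1: "(\<lambda>n. (\<integral>w. iexp (t * centred p S n w) * ?L n w \<partial>iid (F p)) - (\<integral>w. iexp (t * ?B n w) * ?L n w \<partial>iid (F p))) \<longlonglongrightarrow> 0"
    by (rule oP1_iexp_weighted[OF P.prob_space_axioms centred_meas[OF S p p] Bm lrprod_meas[OF p pn] lrprod_moments(3)[OF p pn] C lin])
  have 2: "(\<lambda>n. \<integral>w. iexp (t * ?B n w) * ?L n w \<partial>iid (F p)) \<longlonglongrightarrow> exp (complex_of_real (- (t\<^sup>2 * V) / 2) + \<i> * (t * I))"
  proof -
    have m: "(\<lambda>x. t * g x) \<in> borel_measurable MX" using g by measurable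
    have i2: "integrable (F p) (\<lambda>z. (t * g (fst z))\<^sup>2)" using g2 by (simp add: power_mult_distrib)
    have i0: "(\<integral>z. t * g (fst z) \<partial>F p) = 0" using g0 by simp
    have v2: "(\<integral>z. (t * g (fst z))\<^sup>2 \<partial>F p) = t\<^sup>2 * V" by (simp add: power_mult_distrib V_def)
    have v1: "(\<integral>z. t * g (fst z) * (a \<bullet> \<rho> p (fst z)) \<partial>F p) = t * I" unfolding I_def by (simp add: mult.assoc)
    have B: "(\<Sum>j<n. t * g (fst (w j))) / sqrt (real n) = t * ?B n w" for n :: nat and w :: "nat \<Rightarrow> 'x \<times> 't"
      by (simp add: sum_distrib_left)
    show ?thesis using iexp_sum_lrprod_tendsto[OF ls m i2 i0] unfolding v2 v1 B .
  qed
  note L = tendsto_add[OF char_stat[OF gs S, of t, folded e_def] tendsto_mult[OF tendsto_const[of e] tendsto_add[OF 1 2]]]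
  have "e * exp (complex_of_real (- (t\<^sup>2 * V) / 2) + \<i> * (t * I)) =
     complex_of_real (exp (- (t\<^sup>2 * (resid_var p + V)) / 2)) * iexp (t * (I - a \<bullet> gam p))"
  proof -
    have 1: "- (t\<^sup>2 * (resid_var p + V)) / 2 = - (t\<^sup>2 * resid_var p) / 2 + - (t\<^sup>2 * V) / 2"
      by (simp add: field_simps)
    have 2: "t * (I - a \<bullet> gam p) = - t * (a \<bullet> gam p) + t * I" by (simp add: algebra_simps)
    have "complex_of_real (exp (x + y)) = complex_of_real (exp x) * exp (complex_of_real y)"
      and "iexp (x + y) = iexp x * iexp y" for x y
      by (simp_all add: exp_add distrib_left exp_of_real)
    note 3 = this
    show ?thesis unfolding e_def 1 2 3 exp_add[of "complex_of_real (- (t\<^sup>2 * V) / 2)"] by (simp only: mult_ac)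
  qed
  moreover have "(x - e * y) + e * ((y - z) + z) = x" for x y z by (simp add: algebra_simps)
  ultimately show ?thesis using L unfolding V_def I_def by (simp only: add_0_left)
qed

text \<open>a/sqrt n may leave the parameter space for finitely many n, where F is arbitrary.
  Replacing those terms does not affect weak convergence and makes every law a probability law, so
  Levy's theorem applies.\<close>

lemma weak_conv_stat_iff:
  assumes gs: "good_seq p h a" and ev: "\<forall>\<^sub>F n in sequentially. h n = a /\<^sub>R sqrt (real n)"
    and S: "estimator MX S" and L: "real_distribution L"
  shows "weak_conv_m (\<lambda>n. let M = F (p + a /\<^sub>R sqrt (real n))
             in distr (iid M) borel (\<lambda>w. (S n (obs n w) - util_sum u M n w) / sqrt (real n))) L \<longleftrightarrow>
    (\<forall>t. (\<lambda>n. \<integral>w. iexp (t * stat (p + h n) S n w) \<partial>iid (F (p + h n))) \<longlonglongrightarrow> char L t)"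
proof -
  note pn = local_seqD(2)[OF good_seqD[OF gs]]
  let ?N = "\<lambda>n. distr (iid (F (p + h n))) borel (stat (p + h n) S n)"
  have rd: "real_distribution (?N n)" for n
  proof -
    interpret P: prob_space "iid (F (p + h n))" by (rule prob_space_iid[OF F_prob[OF pn]])
    show ?thesis using P.prob_space_distr[OF stat_meas[OF S pn]]
      by (simp add: real_distribution_def real_distribution_axioms_def)
  qed
  have ch: "char (?N n) t = (\<integral>w. iexp (t * stat (p + h n) S n w) \<partial>iid (F (p + h n)))" for n t
    unfolding char_def by (rule integral_distr[OF stat_meas[OF S pn]]) measurable
  have "weak_conv_m (\<lambda>n. let M = F (p + a /\<^sub>R sqrt (real n))
             in distr (iid M) borel (\<lambda>w. (S n (obs n w) - util_sum u M n w) / sqrt (real n))) L \<longleftrightarrow> weak_conv_m ?N L"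
    by (rule weak_conv_m_cong_eventually, rule eventually_mono[OF ev]) (simp add: stat_def[abs_def] Let_def)
  also have "\<dots> \<longleftrightarrow> (\<forall>t. (\<lambda>n. char (?N n) t) \<longlonglongrightarrow> char L t)" by (rule weak_conv_m_iff_char[OF rd L])
  finally show ?thesis unfolding ch .
qed

lemma root_n_seq:
  assumes "p \<in> T"
  obtains h where "good_seq p h a" "\<forall>\<^sub>F n in sequentially. h n = a /\<^sub>R sqrt (real n)"
proof -
  obtain h' where 1: "local_seq p h' a" "\<forall>\<^sub>F n in sequentially. h' n = a /\<^sub>R sqrt (real n)"
    using local_seq_exists[OF assms] by metis
  obtain h where 2: "good_seq p h a" "\<forall>\<^sub>F n in sequentially. h n = h' n"
    using good_seq_of_local_seq[OF 1(1)] by metis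
  from 2(2) 1(2) have "\<forall>\<^sub>F n in sequentially. h n = a /\<^sub>R sqrt (real n)" by eventually_elim simp
  with 2(1) show ?thesis by (rule that)
qed

lemma regular_of_linear:
  fixes g :: "'x \<Rightarrow> real"
  assumes p: "p \<in> T" and S: "estimator MX S" and g: "g \<in> borel_measurable MX"
    and g2: "integrable (F p) (\<lambda>z. (g (fst z))\<^sup>2)" and g0: "(\<integral>z. g (fst z) \<partial>F p) = 0"
    and lin: "oP1 (iid (F p)) (\<lambda>n w. centred p S n w - (\<Sum>j<n. g (fst (w j))) / sqrt (real n))"
    and ga: "\<And>a. (\<integral>z. g (fst z) * (a \<bullet> \<rho> p (fst z)) \<partial>F p) = a \<bullet> gam p"
  shows "regular_limit F u p S (centered_normal (resid_var p + (\<integral>z. (g (fst z))\<^sup>2 \<partial>F p)))"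
proof -
  have nn: "0 \<le> resid_var p + (\<integral>z. (g (fst z))\<^sup>2 \<partial>F p)" using resid_var_nonneg[of p] by simp
  show ?thesis unfolding regular_limit_def
  proof (intro conjI allI centered_normal(1)[OF nn])
    fix a
    obtain h where d: "good_seq p h a" "\<forall>\<^sub>F n in sequentially. h n = a /\<^sub>R sqrt (real n)"
      using root_n_seq[OF p] by metis
    show "weak_conv_m (\<lambda>n. let M = F (p + a /\<^sub>R sqrt (real n))
             in distr (iid M) borel (\<lambda>w. (S n (obs n w) - util_sum u M n w) / sqrt (real n)))
       (centered_normal (resid_var p + (\<integral>z. (g (fst z))\<^sup>2 \<partial>F p)))"
      unfolding weak_conv_stat_iff[OF d S centered_normal(1)[OF nn]] centered_normal(2)[OF nn]
      using linear_char[OF d(1) S g g2 g0 lin] by (simp add: ga)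
  qed
qed

end

subsection \<open>The variance bound\<close>

lemma cos_ge_quadratic: "1 - x\<^sup>2 / 2 \<le> cos (x::real)"
proof -
  have "cos x = 1 - 2 * (sin (x / 2))\<^sup>2" using cos_double_sin[of "x / 2"] by simp
  moreover have "(sin (x / 2))\<^sup>2 \<le> (x / 2)\<^sup>2" by (rule abs_le_square_iff[THEN iffD1]) (rule abs_sin_x_le_abs_x)
  ultimately show ?thesis by (simp add: power_divide)
qed

text \<open>Centring at c multiplies the characteristic function by a phase, so its modulus is at
  least the mean of cos(t (x - c)). The modulus thus sees the variance and not the second
  moment.\<close>

lemma (in real_distribution) cmod_char_ge:
  assumes i: "integrable M (\<lambda>x. (x - c)\<^sup>2)"
  shows "1 - t\<^sup>2 * (\<integral>x. (x - c)\<^sup>2 \<partial>M) / 2 \<le> cmod (char M t)"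
proof -
  have pU: "prob UNIV = 1" using prob_space by simp
  have ii: "integrable M (\<lambda>x. iexp (t * x))" by (rule integrable_iexp) auto
  have "1 - t\<^sup>2 * (\<integral>x. (x - c)\<^sup>2 \<partial>M) / 2 = (\<integral>x. 1 - t\<^sup>2 * (x - c)\<^sup>2 / 2 \<partial>M)"
    using i by (simp add: pU)
  also have "\<dots> \<le> (\<integral>x. Re (iexp (- t * c) * iexp (t * x)) \<partial>M)"
  proof (rule integral_mono)
    show "integrable M (\<lambda>x. 1 - t\<^sup>2 * (x - c)\<^sup>2 / 2)" using i by simp
    show "integrable M (\<lambda>x. Re (iexp (- t * c) * iexp (t * x)))" using ii by (intro integrable_Re integrable_mult_right)
    fix x
    have "iexp (- t * c) * iexp (t * x) = iexp (t * (x - c))" by (simp add: exp_add[symmetric] algebra_simps)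
    then have "Re (iexp (- t * c) * iexp (t * x)) = cos (t * (x - c))" by (simp only: cis_conv_exp[symmetric] cis.sel)
    then show "1 - t\<^sup>2 * (x - c)\<^sup>2 / 2 \<le> Re (iexp (- t * c) * iexp (t * x))"
      using cos_ge_quadratic[of "t * (x - c)"] by (simp only: power_mult_distrib)
  qed
  also have "\<dots> = Re (iexp (- t * c) * char M t)"
    unfolding char_def by (subst integral_mult_right_zero[symmetric]) (intro integral_Re integrable_mult_right ii)
  also have "\<dots> \<le> cmod (iexp (- t * c) * char M t)" by (rule complex_Re_le_cmod)
  also have "\<dots> = cmod (char M t)" by (simp add: norm_mult)
  finally show ?thesis .
qed

text \<open>Only small t matter: with s the variance, 1 - t^2 s \<le> |char|^2, hence (1 - h s)(1 +
  h w) \<le> 1 for h = t^2, and division by h leaves w \<le> s + h s w. Infinite variance is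
  trivial.\<close>

lemma (in real_distribution) ext_variance_ge:
  assumes w: "0 \<le> w" and ch: "\<And>t. (cmod (char M t))\<^sup>2 * (1 + t\<^sup>2 * w) \<le> 1"
  shows "ennreal w \<le> ext_variance M"
proof (cases "ext_variance M < \<infinity>")
  case False
  then show ?thesis by (simp add: not_less top_unique)
next
  case True
  define c where "c = (\<integral>y. y \<partial>M)"
  have i: "integrable M (\<lambda>x. (x - c)\<^sup>2)"
    using True by (intro integrableI_nonneg) (auto simp: ext_variance_def c_def)
  define s where "s = (\<integral>x. (x - c)\<^sup>2 \<partial>M)"
  have s: "ext_variance M = ennreal s"
    unfolding ext_variance_def c_def[symmetric] s_def by (rule nn_integral_eq_integral[OF i]) simp
  have s0: "0 \<le> s" by (simp add: s_def)
  have le: "w \<le> s + h * (s * w)" if h: "0 < h" "h * s \<le> 1" for h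
  proof -
    define t where "t = sqrt h"
    have t2: "t\<^sup>2 = h" using h by (simp add: t_def)
    have "0 \<le> 1 - h * s / 2" using h(2) by simp
    then have "(1 - h * s / 2)\<^sup>2 \<le> (cmod (char M t))\<^sup>2"
      using cmod_char_ge[OF i, of t] by (intro power_mono) (simp_all add: t2 s_def)
    moreover have "1 - h * s \<le> (1 - h * s / 2)\<^sup>2" by (simp add: power2_diff)
    ultimately have "1 - h * s \<le> (cmod (char M t))\<^sup>2" by (rule order_trans[rotated])
    then have "(1 - h * s) * (1 + h * w) \<le> (cmod (char M t))\<^sup>2 * (1 + h * w)"
      by (rule mult_right_mono) (use w h in simp)
    also have "\<dots> \<le> 1" using ch[of t] by (simp add: t2)
    finally have "h * w \<le> h * (s + h * (s * w))" by (simp add: algebra_simps)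
    then show ?thesis using h(1) by simp
  qed
  have "w \<le> s"
  proof (rule field_le_epsilon)
    fix e :: real assume e: "0 < e"
    \<comment> \<open>The first entry ensures h s \<le> 1, the second h s w \<le> e; the added ones
      avoid vanishing denominators.\<close>
    define h where "h = min (1 / (s + 1)) (e / (s * w + 1))"
    have sw: "0 \<le> s * w" using s0 w by simp
    have "0 < h" using s0 sw e by (simp add: h_def)
    moreover have "h * s \<le> 1"
    proof -
      have "h * s \<le> 1 / (s + 1) * s" by (rule mult_right_mono[OF _ s0]) (simp add: h_def)
      also have "\<dots> \<le> 1" using s0 by (simp add: divide_le_eq)
      finally show ?thesis .
    qed
    moreover have "h * (s * w) \<le> e"
    proof -
      have "h * (s * w) \<le> e / (s * w + 1) * (s * w)" by (rule mult_right_mono[OF _ sw]) (simp add: h_def)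
      also have "\<dots> \<le> e" using sw e by (simp add: divide_le_eq)
      finally show ?thesis .
    qed
    ultimately show "w \<le> s + e" using le[of h] by linarith
  qed
  then show ?thesis unfolding s by (rule ennreal_leI)
qed

text \<open>Efficiency is defined by the second moment of the limit while the bound concerns
  variances. Equality leaves no room for a bias: w \<le> w - c^2.\<close>

lemma (in real_distribution) second_moment_attained:
  assumes m: "(\<integral>\<^sup>+x. ennreal (x\<^sup>2) \<partial>M) = ennreal w" and w: "0 \<le> w" and var: "ennreal w \<le> ext_variance M"
  shows "integrable M (\<lambda>x. x\<^sup>2)" "(\<integral>x. x\<^sup>2 \<partial>M) = w" "(\<integral>x. x \<partial>M) = 0"
proof -
  show i2: "integrable M (\<lambda>x. x\<^sup>2)"
    using m by (intro integrableI_nonneg) auto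
  show w': "(\<integral>x. x\<^sup>2 \<partial>M) = w"
    using m w nn_integral_eq_integral[OF i2] by simp
  have i1: "integrable M (\<lambda>x. x)" by (rule square_integrable_imp_integrable[OF _ i2]) simp
  define c where "c = (\<integral>x. x \<partial>M)"
  have i: "integrable M (\<lambda>x. (x - c)\<^sup>2)" using i1 i2 by (simp add: power2_diff)
  have "(\<integral>x. (x - c)\<^sup>2 \<partial>M) = w - c\<^sup>2"
    using i1 i2 by (simp add: power2_diff w' c_def[symmetric] prob_space[simplified]) (simp add: power2_eq_square)
  then have "ext_variance M = ennreal (w - c\<^sup>2)"
    unfolding ext_variance_def c_def[symmetric] using nn_integral_eq_integral[OF i] by simp
  moreover have "0 \<le> w - c\<^sup>2" using \<open>(\<integral>x. (x - c)\<^sup>2 \<partial>M) = w - c\<^sup>2\<close>[symmetric] by simp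
  ultimately have "w \<le> w - c\<^sup>2" using var by simp
  then show "(\<integral>x. x \<partial>M) = 0" unfolding c_def[symmetric] by simp
qed

lemma (in real_distribution) cmod_char_minus_1_le:
  assumes i2: "integrable M (\<lambda>x. x\<^sup>2)" and m: "(\<integral>x. x \<partial>M) = 0"
  shows "cmod (char M t - 1) \<le> t\<^sup>2 * (\<integral>x. x\<^sup>2 \<partial>M) / 2"
proof -
  have i1: "integrable M (\<lambda>x. x)" by (rule square_integrable_imp_integrable[OF _ i2]) simp
  have pU: "prob UNIV = 1" using prob_space by simp
  have ii: "integrable M (\<lambda>x. iexp (t * x))" by (rule integrable_iexp) auto
  have ic: "integrable M (\<lambda>x. \<i> * complex_of_real (t * x))" using i1 by (intro integrable_mult_right integrable_of_real) simp
  have ic1: "integrable M (\<lambda>x. 1 + \<i> * complex_of_real (t * x))"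
    by (intro Bochner_Integration.integrable_add ic integrable_const)
  have "(\<integral>x. \<i> * complex_of_real (t * x) \<partial>M) = 0"
    using m by (simp only: integral_mult_right_zero integral_complex_of_real) simp
  then have z: "(\<integral>x. 1 + \<i> * complex_of_real (t * x) \<partial>M) = 1"
    by (subst Bochner_Integration.integral_add[OF integrable_const ic]) (simp only:, simp add: pU)
  have "char M t - 1 = (\<integral>x. iexp (t * x) - (1 + \<i> * complex_of_real (t * x)) \<partial>M)"
    unfolding char_def by (subst Bochner_Integration.integral_diff[OF ii ic1]) (simp only: z)
  also have "cmod \<dots> \<le> (\<integral>x. t\<^sup>2 * x\<^sup>2 / 2 \<partial>M)"
  proof (rule norm_integral_le)
    show "integrable M (\<lambda>x. t\<^sup>2 * x\<^sup>2 / 2)" using i2 by simp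
    have "norm (iexp (t * x) - (1 + \<i> * complex_of_real (t * x))) \<le> t\<^sup>2 * x\<^sup>2 / 2" for x
      using iexp_approx_first(1)[of "t * x"] by (simp only: power_mult_distrib diff_diff_eq)
    then show "AE x in M. norm (iexp (t * x) - (1 + \<i> * complex_of_real (t * x))) \<le> t\<^sup>2 * x\<^sup>2 / 2" by (rule AE_I2)
  qed
  finally show ?thesis by simp
qed

lemma norm_integral_iexp_le:
  fixes Z :: "'a \<Rightarrow> real"
  assumes P: "prob_space P" and Am: "A \<in> borel_measurable P" and Zm: "Z \<in> borel_measurable P"
    and Z2: "integrable P (\<lambda>w. (Z w)\<^sup>2)"
  shows "integrable P (\<lambda>w. iexp (t * A w) * complex_of_real (Z w))"
    and "norm (\<integral>w. iexp (t * A w) * complex_of_real (Z w) \<partial>P) \<le> sqrt (\<integral>w. (Z w)\<^sup>2 \<partial>P)"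
proof -
  interpret prob_space P by fact
  note [measurable] = Am Zm
  have Z1: "integrable P Z" by (rule square_integrable_imp_integrable[OF Zm Z2])
  have n: "norm (iexp (t * A w) * complex_of_real (Z w)) = \<bar>Z w\<bar>" for w
    by (simp add: norm_mult)
  show "integrable P (\<lambda>w. iexp (t * A w) * complex_of_real (Z w))"
  proof (rule Bochner_Integration.integrable_bound[OF Z1])
    show "AE w in P. norm (iexp (t * A w) * complex_of_real (Z w)) \<le> norm (Z w)"
      unfolding n by simp
  qed measurable
  have "norm (\<integral>w. iexp (t * A w) * complex_of_real (Z w) \<partial>P) \<le> (\<integral>w. \<bar>Z w\<bar> \<partial>P)"
    by (rule norm_integral_le[OF integrable_abs[OF Z1]]) (unfold n, simp)
  also have "\<dots> \<le> sqrt (\<integral>w. (Z w)\<^sup>2 \<partial>P)"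
    using integral_abs_le_L2[OF Zm Z2] by (simp add: prob_space)
  finally show "norm (\<integral>w. iexp (t * A w) * complex_of_real (Z w) \<partial>P) \<le> sqrt (\<integral>w. (Z w)\<^sup>2 \<partial>P)" .
qed

context utility_model
begin

text \<open>The factor contributed by the residuals is divided out. What remains is the limit of the
  characteristic functions of \<open>centred\<close> under F p, and therefore has modulus at most
  1.\<close>

definition tilted_char :: "real ^ 'd \<Rightarrow> real measure \<Rightarrow> real \<Rightarrow> complex" where
  "tilted_char p L t = char L t * complex_of_real (exp (t\<^sup>2 * resid_var p / 2))"

lemma regular_limit_char:
  assumes gs: "good_seq p h a" and ev: "\<forall>\<^sub>F n in sequentially. h n = a /\<^sub>R sqrt (real n)"
    and S: "estimator MX S" and reg: "regular_limit F u p S L"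
  shows "(\<lambda>n. \<integral>w. iexp (t * centred p S n w) * complex_of_real (lrprod p (h n) n w) \<partial>iid (F p))
     \<longlonglongrightarrow> tilted_char p L t * iexp (t * (a \<bullet> gam p))"
proof -
  define e where "e = complex_of_real (exp (- (t\<^sup>2 * resid_var p) / 2)) * iexp (- t * (a \<bullet> gam p))"
  define e' where "e' = complex_of_real (exp (t\<^sup>2 * resid_var p / 2)) * iexp (t * (a \<bullet> gam p))"
  have "e' * e = complex_of_real (exp (t\<^sup>2 * resid_var p / 2) * exp (- (t\<^sup>2 * resid_var p) / 2)) * (iexp (t * (a \<bullet> gam p)) * iexp (- t * (a \<bullet> gam p)))"
    by (simp add: e_def e'_def)
  also have "\<dots> = 1" by (simp only: exp_add[symmetric]) simp
  finally have ee: "e' * e = 1" .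
  have L: "real_distribution L" and ww: "weak_conv_m (\<lambda>n. let M = F (p + a /\<^sub>R sqrt (real n))
             in distr (iid M) borel (\<lambda>w. (S n (obs n w) - util_sum u M n w) / sqrt (real n))) L"
    using reg by (auto simp: regular_limit_def)
  have 1: "(\<lambda>n. \<integral>w. iexp (t * stat (p + h n) S n w) \<partial>iid (F (p + h n))) \<longlonglongrightarrow> char L t"
    using ww unfolding weak_conv_stat_iff[OF gs ev S L] by blast
  note tendsto_mult[OF tendsto_const[of e'] tendsto_diff[OF 1 char_stat[OF gs S, of t, folded e_def]]]
  moreover have "e' * (x - (x - e * y)) = y" for x y
  proof -
    have "e' * (x - (x - e * y)) = e' * e * y" by (simp add: algebra_simps)
    then show ?thesis by (simp add: ee)
  qed
  moreover have "e' * (char L t - 0) = tilted_char p L t * iexp (t * (a \<bullet> gam p))"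
    by (simp add: e'_def tilted_char_def)
  ultimately show ?thesis by (simp only:)
qed

lemma char_expansion:
  assumes ls: "local_seq p h a" and S: "estimator MX S"
  shows "norm ((\<integral>w. iexp (t * centred p S n w) * complex_of_real (lrprod p (h n) n w) \<partial>iid (F p))
      - (\<integral>w. iexp (t * centred p S n w) \<partial>iid (F p))
      - (\<integral>w. iexp (t * centred p S n w) * complex_of_real (scoresum p a n w) \<partial>iid (F p)))
    \<le> sqrt (\<integral>w. (lrprod p (h n) n w - 1 - scoresum p a n w)\<^sup>2 \<partial>iid (F p))"
proof -
  note p = local_seqD(1)[OF ls] and pn = local_seqD(2)[OF ls]
  interpret P: prob_space "iid (F p)" by (rule prob_space_iid[OF F_prob[OF p]])
  note A = centred_meas[OF S p p]
  note Lm = lrprod_meas[OF p pn] and Ym = scoresum_facts(1)[OF p]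
  note i = norm_integral_iexp_le(1)[OF P.prob_space_axioms A]
  have i1: "integrable (iid (F p)) (\<lambda>w. iexp (t * centred p S n w))"
    using i[OF borel_measurable_const, of "1::real" t n] by simp
  note iL = i[OF Lm lrprod_moments(3)[OF p pn], of t n n n]
  note iY = i[OF Ym scoresum_facts(2)[OF p], of t n a n]
  have "(\<integral>w. iexp (t * centred p S n w) * complex_of_real (lrprod p (h n) n w) \<partial>iid (F p))
      - (\<integral>w. iexp (t * centred p S n w) \<partial>iid (F p))
      - (\<integral>w. iexp (t * centred p S n w) * complex_of_real (scoresum p a n w) \<partial>iid (F p)) =
     (\<integral>w. iexp (t * centred p S n w) * complex_of_real (lrprod p (h n) n w - 1 - scoresum p a n w) \<partial>iid (F p))"
    unfolding of_real_diff right_diff_distrib of_real_1 mult_1_right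
      Bochner_Integration.integral_diff[OF Bochner_Integration.integrable_diff[OF iL i1] iY]
      Bochner_Integration.integral_diff[OF iL i1] ..
  also have "norm \<dots> \<le> sqrt (\<integral>w. (lrprod p (h n) n w - 1 - scoresum p a n w)\<^sup>2 \<partial>iid (F p))"
    by (rule norm_integral_iexp_le(2)[OF P.prob_space_axioms A _ lrprod_expansion(1)[OF ls]])
      (intro borel_measurable_diff borel_measurable_const Lm Ym)
  finally show ?thesis .
qed

end

lemma exp_minus_linear_le:
  fixes x :: real assumes "0 \<le> x" "x \<le> 1" shows "exp x - 1 - x \<le> x\<^sup>2"
  using exp_bound[OF assms] by simp

context utility_model
begin

abbreviation cchar :: "real ^ 'd \<Rightarrow> (nat \<Rightarrow> (nat \<Rightarrow> 'x) \<Rightarrow> real) \<Rightarrow> real \<Rightarrow> nat \<Rightarrow> complex" where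
  "cchar p S t n \<equiv> (\<integral>w. iexp (t * centred p S n w) \<partial>iid (F p))"

abbreviation cross :: "real ^ 'd \<Rightarrow> (nat \<Rightarrow> (nat \<Rightarrow> 'x) \<Rightarrow> real) \<Rightarrow> real \<Rightarrow> nat \<Rightarrow> complex" where
  "cross p S t n \<equiv> (\<integral>w. iexp (t * centred p S n w) * complex_of_real (scoresum p (eff_dir p) n w) \<partial>iid (F p))"

lemma scoresum_scale: "scoresum p (s *\<^sub>R b) n w = s * scoresum p b n w"
  by (simp add: scoresum_def sum_distrib_left)

text \<open>The direction a = 0: the error exp m - 1 - m of the expansion vanishes at m = 0, so the
  weight tends to 1 in L2 and may be dropped.\<close>

lemma cchar_limit:
  assumes p: "p \<in> T" and S: "estimator MX S" and reg: "regular_limit F u p S L"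
  shows "cchar p S t \<longlonglongrightarrow> tilted_char p L t"
proof -
  obtain h where d: "good_seq p h 0" "\<forall>\<^sub>F n in sequentially. h n = 0 /\<^sub>R sqrt (real n)"
    using root_n_seq[OF p] by metis
  note ls = good_seqD[OF d(1)]
  have "(\<lambda>n. sqrt (\<integral>w. (lrprod p (h n) n w - 1 - scoresum p 0 n w)\<^sup>2 \<partial>iid (F p))) \<longlonglongrightarrow> sqrt 0"
    by (intro tendsto_real_sqrt) (use lrprod_expansion(2)[OF ls] in simp)
  then have "(\<lambda>n. (\<integral>w. iexp (t * centred p S n w) * complex_of_real (lrprod p (h n) n w) \<partial>iid (F p))
      - cchar p S t n
      - (\<integral>w. iexp (t * centred p S n w) * complex_of_real (scoresum p 0 n w) \<partial>iid (F p))) \<longlonglongrightarrow> 0"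
    by (intro null_of_norm_le[OF char_expansion[OF ls S]]) simp
  moreover have "scoresum p 0 n w = 0" for n w by (simp add: scoresum_def)
  ultimately have "(\<lambda>n. (\<integral>w. iexp (t * centred p S n w) * complex_of_real (lrprod p (h n) n w) \<partial>iid (F p)) - cchar p S t n) \<longlonglongrightarrow> 0"
    by simp
  from tendsto_diff[OF regular_limit_char[OF d S reg, of t] this] show ?thesis by simp
qed

lemma cmod_tilted_char_le:
  assumes p: "p \<in> T" and S: "estimator MX S" and reg: "regular_limit F u p S L"
  shows "cmod (tilted_char p L t) \<le> 1"
proof (rule Lim_norm_ubound[OF _ cchar_limit[OF p S reg]])
  interpret P: prob_space "iid (F p)" by (rule prob_space_iid[OF F_prob[OF p]])
  have "norm (cchar p S t n) \<le> sqrt (\<integral>w. 1\<^sup>2 \<partial>iid (F p))" for n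
    using norm_integral_iexp_le(2)[where Z = "\<lambda>_. 1", OF P.prob_space_axioms centred_meas[OF S p p]]
    by simp
  then show "\<forall>\<^sub>F n in sequentially. cmod (cchar p S t n) \<le> 1" by (simp add: P.prob_space)
qed simp

text \<open>Differentiating the regularity relation along the directions \<open>s b\<close> at \<open>s = 0\<close>.\<close>

lemma cross_limit:
  assumes p: "p \<in> T" and S: "estimator MX S" and reg: "regular_limit F u p S L"
  shows "cross p S t \<longlonglongrightarrow> \<i> * complex_of_real (t * eff_gain p) * tilted_char p L t"
proof -
  define \<beta> where "\<beta> = eff_gain p"
  define b where "b = eff_dir p"
  define \<phi> where "\<phi> = tilted_char p L t"
  have \<beta>: "0 \<le> \<beta>" by (simp add: \<beta>_def eff_gain_nonneg)
  have \<phi>: "cmod \<phi> \<le> 1" unfolding \<phi>_def by (rule cmod_tilted_char_le[OF p S reg])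
  \<comment> \<open>K s^2 covers the L2 remainder s^2 \<beta> and the phase error s^2 (t \<beta>)^2
    / 2, and leaves s^2 for the terms that vanish as n grows.\<close>
  define K where "K = \<beta> + (t * \<beta>)\<^sup>2 / 2 + 1"
  have K: "0 < K" unfolding K_def using \<beta> by (simp add: add_nonneg_pos)
  have main: "\<forall>\<^sub>F n in sequentially. norm (cross p S t n - \<i> * complex_of_real (t * \<beta>) * \<phi>) < K * s"
    if s: "0 < s" "s\<^sup>2 * \<beta> \<le> 1" for s
  proof -
    obtain h where d: "good_seq p h (s *\<^sub>R b)" "\<forall>\<^sub>F n in sequentially. h n = (s *\<^sub>R b) /\<^sub>R sqrt (real n)"
      using root_n_seq[OF p] by metis
    note ls = good_seqD[OF d(1)]
    define X where "X n = (\<integral>w. iexp (t * centred p S n w) * complex_of_real (lrprod p (h n) n w) \<partial>iid (F p))" for n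
    define R where "R n = sqrt (\<integral>w. (lrprod p (h n) n w - 1 - scoresum p (s *\<^sub>R b) n w)\<^sup>2 \<partial>iid (F p))" for n
    define r where "r = sqrt (exp (s\<^sup>2 * \<beta>) - 1 - s\<^sup>2 * \<beta>)"
    have m: "(\<integral>z. (s *\<^sub>R b \<bullet> \<rho> p (fst z))\<^sup>2 \<partial>F p) = s\<^sup>2 * \<beta>"
      by (simp add: \<beta>_def eff_gain_def b_def power_mult_distrib)
    have R: "R \<longlonglongrightarrow> r"
      unfolding R_def r_def using lrprod_expansion(2)[OF ls] unfolding m by (rule tendsto_real_sqrt)
    have "r \<le> sqrt ((s\<^sup>2 * \<beta>)\<^sup>2)"
      unfolding r_def using s \<beta> by (intro real_sqrt_le_mono exp_minus_linear_le) simp_all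
    then have r: "r \<le> s\<^sup>2 * \<beta>" using \<beta> by simp
    have ig: "(s *\<^sub>R b) \<bullet> gam p = s * \<beta>"
      using eff_gain[OF p] by (simp add: b_def \<beta>_def)
    have X: "X \<longlonglongrightarrow> \<phi> * iexp (t * (s * \<beta>))"
      using regular_limit_char[OF d S reg, of t] unfolding X_def \<phi>_def ig .
    have U: "cchar p S t \<longlonglongrightarrow> \<phi>" unfolding \<phi>_def by (rule cchar_limit[OF p S reg])
    have ce: "norm (X n - cchar p S t n - s * cross p S t n) \<le> R n" for n
    proof -
      have "(\<integral>w. iexp (t * centred p S n w) * complex_of_real (scoresum p (s *\<^sub>R b) n w) \<partial>iid (F p)) = s * cross p S t n"
        unfolding scoresum_scale of_real_mult mult.left_commute[of _ "complex_of_real s"] integral_mult_right_zero b_def ..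
      then show ?thesis using char_expansion[OF ls S, of t n] unfolding X_def R_def by simp
    qed
    define E where "E = norm (\<phi> * (iexp (t * (s * \<beta>)) - 1 - \<i> * complex_of_real (t * (s * \<beta>))))"
    have Eq: "norm (iexp (t * (s * \<beta>)) - 1 - \<i> * complex_of_real (t * (s * \<beta>))) \<le> (t * (s * \<beta>))\<^sup>2 / 2"
      by (rule iexp_approx_first(1))
    have "E \<le> 1 * ((t * (s * \<beta>))\<^sup>2 / 2)"
      unfolding E_def norm_mult by (rule mult_mono[OF \<phi> Eq]) simp_all
    also have "\<dots> = s\<^sup>2 * ((t * \<beta>)\<^sup>2 / 2)" by (simp add: power_mult_distrib)
    finally have E: "E \<le> s\<^sup>2 * ((t * \<beta>)\<^sup>2 / 2)" .
    define Q where "Q n = R n + norm (X n - \<phi> * iexp (t * (s * \<beta>))) + norm (cchar p S t n - \<phi>) + E" for n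
    have "Q \<longlonglongrightarrow> r + 0 + 0 + E"
      unfolding Q_def by (intro tendsto_add R tendsto_const tendsto_norm_zero) (use X U LIM_zero in blast)+
    moreover have "r + 0 + 0 + E < s\<^sup>2 * K"
    proof -
      have "s\<^sup>2 * K = s\<^sup>2 * \<beta> + s\<^sup>2 * ((t * \<beta>)\<^sup>2 / 2) + s\<^sup>2" by (simp add: K_def algebra_simps)
      moreover have "0 < s\<^sup>2" using s by simp
      ultimately show ?thesis using r E by linarith
    qed
    ultimately have "\<forall>\<^sub>F n in sequentially. Q n < s\<^sup>2 * K" by (rule order_tendstoD(2))
    then show ?thesis
    proof eventually_elim
      case (elim n)
      let ?I = "iexp (t * (s * \<beta>))" and ?J = "\<i> * complex_of_real (t * (s * \<beta>))"
      \<comment> \<open>All errors are O(s^2) while the quantity sought carries only the factor s;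
        dividing by s leaves an error K s, with s at free disposal.\<close>
      have "s * (cross p S t n - \<i> * complex_of_real (t * \<beta>) * \<phi>) =
         - (X n - cchar p S t n - s * cross p S t n) + (X n - \<phi> * ?I) - (cchar p S t n - \<phi>) + \<phi> * (?I - 1 - ?J)"
        by (simp add: algebra_simps)
      also have "norm \<dots> \<le> Q n"
      proof -
        have "norm (- a + b - c + d) \<le> norm a + norm b + norm c + norm d" for a b c d :: complex
          using norm_triangle_ineq[of "- a + b - c" d] norm_triangle_ineq4[of "- a + b" c] norm_triangle_ineq[of "- a" b] by simp
        from this[of "X n - cchar p S t n - s * cross p S t n" "X n - \<phi> * ?I" "cchar p S t n - \<phi>" "\<phi> * (?I - 1 - ?J)"]
        show ?thesis using ce[of n] unfolding Q_def E_def by linarith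
      qed
      finally have "s * norm (cross p S t n - \<i> * complex_of_real (t * \<beta>) * \<phi>) \<le> Q n"
        using s by (simp add: norm_mult)
      also have "\<dots> < s * (K * s)" using elim by (simp add: power2_eq_square mult_ac)
      finally show ?case using s by simp
    qed
  qed
  show ?thesis
  proof (rule tendstoI)
    fix e :: real assume e: "0 < e"
    \<comment> \<open>The first entry makes K s \<le> e. The second gives s^2 \<beta> \<le> 1, the
      range in which exp x - 1 - x \<le> x^2 is available.\<close>
    define s where "s = min (e / K) (1 / (\<beta> + 1))"
    have s: "0 < s" using e K \<beta> by (simp add: s_def add_nonneg_pos)
    have s1: "s \<le> 1 / (\<beta> + 1)" "1 / (\<beta> + 1) \<le> 1" using \<beta> by (simp_all add: s_def)
    have "s\<^sup>2 * \<beta> \<le> s * \<beta>" using s order_trans[OF s1] \<beta> by (intro mult_right_mono) (simp_all add: power2_eq_square mult_left_le)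
    also have "\<dots> \<le> 1 / (\<beta> + 1) * \<beta>" by (rule mult_right_mono[OF s1(1) \<beta>])
    also have "\<dots> \<le> 1" using \<beta> by (simp add: divide_le_eq)
    finally have "s\<^sup>2 * \<beta> \<le> 1" .
    from main[OF s this] show "\<forall>\<^sub>F n in sequentially. dist (cross p S t n) (\<i> * complex_of_real (t * eff_gain p) * tilted_char p L t) < e"
    proof eventually_elim
      case (elim n)
      have "K * s \<le> K * (e / K)" using K by (intro mult_left_mono) (simp_all add: s_def)
      then show ?case using elim K by (simp add: dist_norm \<beta>_def \<phi>_def)
    qed
  qed
qed

text \<open>The subtracted term is, in the limit, the projection of exp(i t A) to the span of 1 and
  Y: the coefficients come from \<open>cchar_limit\<close> and \<open>cross_limit\<close>. The limit
  of the squared distance is 1 minus the squared norm of the projection, so its sign is a Bessel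
  inequality.\<close>

lemma L2_distance_limit:
  assumes p: "p \<in> T" and S: "estimator MX S" and reg: "regular_limit F u p S L"
  defines "D \<equiv> \<lambda>t n w. iexp (t * centred p S n w)
      - tilted_char p L t * (1 + \<i> * complex_of_real (t * scoresum p (eff_dir p) n w))"
  shows "D t n \<in> borel_measurable (iid (F p))" "integrable (iid (F p)) (\<lambda>w. (cmod (D t n w))\<^sup>2)"
    "(\<lambda>n. \<integral>w. (cmod (D t n w))\<^sup>2 \<partial>iid (F p)) \<longlonglongrightarrow> 1 - (cmod (tilted_char p L t))\<^sup>2 * (1 + t\<^sup>2 * eff_gain p)"
proof -
  interpret P: prob_space "iid (F p)" by (rule prob_space_iid[OF F_prob[OF p]])
  define \<phi> where "\<phi> = tilted_char p L t"
  define Y where "Y n = scoresum p (eff_dir p) n" for n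
  define A where "A n = centred p S n" for n
  have Am: "A n \<in> borel_measurable (iid (F p))" for n unfolding A_def by (rule centred_meas[OF S p p])
  have Ym: "Y n \<in> borel_measurable (iid (F p))" for n unfolding Y_def by (rule scoresum_facts(1)[OF p])
  have Y2: "integrable (iid (F p)) (\<lambda>w. (Y n w)\<^sup>2)" for n unfolding Y_def by (rule scoresum_facts(2)[OF p])
  have D: "D t n w = iexp (t * A n w) - \<phi> * (1 + \<i> * complex_of_real (t * Y n w))" for n w
    by (simp add: D_def A_def Y_def \<phi>_def)
  show "D t n \<in> borel_measurable (iid (F p))"
    unfolding D using Am[of n] Ym[of n] by measurable
  define G where "G n w = cnj \<phi> * (iexp (t * A n w) - \<i> * (t * (iexp (t * A n w) * complex_of_real (Y n w))))" for n w
  have sq: "(cmod (D t n w))\<^sup>2 = 1 - 2 * Re (G n w) + (cmod \<phi>)\<^sup>2 * (1 + t\<^sup>2 * (Y n w)\<^sup>2)" for n w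
  proof -
    have gen: "(cmod (x - y))\<^sup>2 = (cmod x)\<^sup>2 - 2 * Re (cnj y * x) + (cmod y)\<^sup>2" for x y :: complex
      by (simp only: cmod_power2) (simp add: power2_eq_square algebra_simps)
    have "cnj (\<phi> * (1 + \<i> * complex_of_real (t * Y n w))) * iexp (t * A n w) = G n w"
      by (simp add: G_def algebra_simps)
    moreover have "(cmod (\<phi> * (1 + \<i> * complex_of_real (t * Y n w))))\<^sup>2 = (cmod \<phi>)\<^sup>2 * (1 + t\<^sup>2 * (Y n w)\<^sup>2)"
      unfolding norm_mult power_mult_distrib iexp_prod_factor_bound(3) by (simp add: power_mult_distrib)
    ultimately show ?thesis unfolding D gen by simp
  qed
  note i = norm_integral_iexp_le(1)[OF P.prob_space_axioms Am]
  have i1: "integrable (iid (F p)) (\<lambda>w. iexp (t * A n w))" for n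
    using i[OF borel_measurable_const, of "1::real" t n] by simp
  note iY = i[OF Ym Y2, of t]
  have Gi: "integrable (iid (F p)) (G n)" for n
    unfolding G_def by (intro integrable_mult_right Bochner_Integration.integrable_diff i1 iY)
  have ReG: "integrable (iid (F p)) (\<lambda>w. Re (G n w))" for n by (rule integrable_Re[OF Gi])
  show "integrable (iid (F p)) (\<lambda>w. (cmod (D t n w))\<^sup>2)"
    unfolding sq using ReG[of n] Y2[of n] by simp
  have G: "(\<integral>w. G n w \<partial>iid (F p)) = cnj \<phi> * (cchar p S t n - \<i> * (t * cross p S t n))" for n
    unfolding G_def integral_mult_right_zero
      Bochner_Integration.integral_diff[OF i1 integrable_mult_right[OF integrable_mult_right[OF iY]]]
    unfolding integral_mult_right_zero A_def Y_def ..
  define q where "q n = 1 - 2 * Re (cnj \<phi> * (cchar p S t n - \<i> * (t * cross p S t n))) + (cmod \<phi>)\<^sup>2 * (1 + t\<^sup>2 * eff_gain p)" for n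
  have q: "q n = (\<integral>w. (cmod (D t n w))\<^sup>2 \<partial>iid (F p))" if n: "0 < n" for n
  proof -
    have "(\<integral>w. Re (G n w) \<partial>iid (F p)) = Re (cnj \<phi> * (cchar p S t n - \<i> * (t * cross p S t n)))"
      unfolding G[symmetric] by (rule integral_Re[OF Gi])
    moreover have "(\<integral>w. (Y n w)\<^sup>2 \<partial>iid (F p)) = eff_gain p"
      unfolding Y_def eff_gain_def by (rule scoresum_facts(5)[OF p n])
    ultimately show ?thesis unfolding sq q_def using ReG[of n] Y2[of n] by (simp add: P.prob_space)
  qed
  have lim: "q \<longlonglongrightarrow> 1 - 2 * Re (cnj \<phi> * (\<phi> - \<i> * (t * (\<i> * complex_of_real (t * eff_gain p) * \<phi>)))) + (cmod \<phi>)\<^sup>2 * (1 + t\<^sup>2 * eff_gain p)"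
    unfolding q_def \<phi>_def by (intro tendsto_add tendsto_diff tendsto_mult tendsto_const tendsto_Re cchar_limit[OF p S reg] cross_limit[OF p S reg])
  have "Re (cnj \<phi> * (\<phi> - \<i> * (t * (\<i> * complex_of_real (t * eff_gain p) * \<phi>)))) = (cmod \<phi>)\<^sup>2 * (1 + t\<^sup>2 * eff_gain p)"
  proof -
    have "cnj \<phi> * (\<phi> - \<i> * (t * (\<i> * complex_of_real (t * eff_gain p) * \<phi>))) = complex_of_real (1 + t\<^sup>2 * eff_gain p) * (\<phi> * cnj \<phi>)"
      by (simp add: algebra_simps power2_eq_square)
    then show ?thesis by (simp add: complex_mult_cnj cmod_power2 mult.commute)
  qed
  with lim have "q \<longlonglongrightarrow> 1 - (cmod \<phi>)\<^sup>2 * (1 + t\<^sup>2 * eff_gain p)" by (simp only:) simp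
  then show "(\<lambda>n. \<integral>w. (cmod (D t n w))\<^sup>2 \<partial>iid (F p)) \<longlonglongrightarrow> 1 - (cmod (tilted_char p L t))\<^sup>2 * (1 + t\<^sup>2 * eff_gain p)"
    unfolding \<phi>_def[symmetric]
    by (rule Lim_transform_eventually[OF _ eventually_mono[OF eventually_gt_at_top[of 0] q]])
qed

lemma regular_variance_ge:
  assumes p: "p \<in> T" and S: "estimator MX S" and reg: "regular_limit F u p S L"
  shows "ennreal (resid_var p + eff_gain p) \<le> ext_variance L"
proof -
  interpret real_distribution L using reg by (simp add: regular_limit_def)
  show ?thesis
  proof (rule ext_variance_ge)
    show "0 \<le> resid_var p + eff_gain p" using resid_var_nonneg eff_gain_nonneg by (rule add_nonneg_nonneg)
    fix t
    have "0 \<le> 1 - (cmod (tilted_char p L t))\<^sup>2 * (1 + t\<^sup>2 * eff_gain p)"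
      by (rule LIMSEQ_le_const[OF L2_distance_limit(3)[OF assms]]) auto
    then have "(cmod (char L t))\<^sup>2 * ((exp (t\<^sup>2 * resid_var p / 2))\<^sup>2 * (1 + t\<^sup>2 * eff_gain p)) \<le> 1"
      by (simp add: tilted_char_def norm_mult power_mult_distrib mult.assoc)
    \<comment> \<open>The residual factor beats its second-order expansion, exp(t^2 v) \<ge> 1 + t^2
      v, which turns the product of the two contributions into the sum v + \<beta> needed for
      \<open>ext_variance_ge\<close>.\<close>
    moreover have "1 + t\<^sup>2 * (resid_var p + eff_gain p) \<le> (exp (t\<^sup>2 * resid_var p / 2))\<^sup>2 * (1 + t\<^sup>2 * eff_gain p)"
    proof -
      have "1 + t\<^sup>2 * (resid_var p + eff_gain p) \<le> (1 + t\<^sup>2 * resid_var p) * (1 + t\<^sup>2 * eff_gain p)"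
        using resid_var_nonneg[of p] eff_gain_nonneg[of p] by (simp add: algebra_simps)
      also have "\<dots> \<le> exp (t\<^sup>2 * resid_var p) * (1 + t\<^sup>2 * eff_gain p)"
        using eff_gain_nonneg[of p] by (intro mult_right_mono) simp_all
      also have "exp (t\<^sup>2 * resid_var p) = (exp (t\<^sup>2 * resid_var p / 2))\<^sup>2"
        by (simp add: exp_double[symmetric])
      finally show ?thesis .
    qed
    ultimately show "(cmod (char L t))\<^sup>2 * (1 + t\<^sup>2 * (resid_var p + eff_gain p)) \<le> 1"
      by (meson mult_left_mono order_trans zero_le_power2)
  qed
qed

end

subsection \<open>Attainment of the variance bound\<close>

lemma nn_second_moment_centered_normal:
  assumes "0 \<le> v"
  shows "(\<integral>\<^sup>+x. ennreal (x\<^sup>2) \<partial>centered_normal v) = ennreal v"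
  using nn_integral_eq_integral[OF centered_normal(3)[OF assms]] centered_normal(4)[OF assms] by simp

text \<open>The mean c stays unevaluated: the variance v - c^2 is at most v in any case.\<close>

lemma ext_variance_centered_normal_le:
  assumes v: "0 \<le> v"
  shows "ext_variance (centered_normal v) \<le> ennreal v"
proof -
  interpret real_distribution "centered_normal v" by (rule centered_normal(1)[OF v])
  note i2 = centered_normal(3)[OF v]
  have i1: "integrable (centered_normal v) (\<lambda>x. x)" by (rule square_integrable_imp_integrable[OF _ i2]) simp
  define c where "c = (\<integral>x. x \<partial>centered_normal v)"
  have i: "integrable (centered_normal v) (\<lambda>x. (x - c)\<^sup>2)" using i1 i2 by (simp add: power2_diff)
  have "(\<integral>x. (x - c)\<^sup>2 \<partial>centered_normal v) = v - c\<^sup>2"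
    using i1 i2 by (simp add: power2_diff centered_normal(4)[OF v] c_def[symmetric] prob_space[simplified]) (simp add: power2_eq_square)
  then have "ext_variance (centered_normal v) = ennreal (v - c\<^sup>2)"
    unfolding ext_variance_def c_def[symmetric] using nn_integral_eq_integral[OF i] by simp
  then show ?thesis by (simp add: ennreal_leI)
qed

lemma exp_minus_1_le: "exp x - 1 \<le> x * exp (x::real)"
proof -
  have "(1 - x) * exp x \<le> exp (- x) * exp x" using exp_ge_add_one_self[of "- x"] by (intro mult_right_mono) simp_all
  then show ?thesis by (simp add: exp_minus algebra_simps)
qed

context utility_model
begin

text \<open>With second moment exactly w and x = t^2 w, |char|^2 is at least 1 - x and the
  complementary factor at least 1 + x, so their product misses 1 by at most x^2: the second-order
  terms cancel. The other bound is only of second order; t^2 \<le> 1 makes exp(t^2 v / 2) uniform in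
  t.\<close>

lemma tilted_char_bounds:
  assumes L: "real_distribution L" and i2: "integrable L (\<lambda>x. x\<^sup>2)" and m: "(\<integral>x. x \<partial>L) = 0"
    and w: "(\<integral>x. x\<^sup>2 \<partial>L) = resid_var p + eff_gain p" (is "_ = ?w") and t: "t\<^sup>2 \<le> 1"
  shows "1 - (cmod (tilted_char p L t))\<^sup>2 * (1 + t\<^sup>2 * eff_gain p) \<le> (t\<^sup>2 * ?w)\<^sup>2"
    and "cmod (tilted_char p L t - 1) \<le> t\<^sup>2 * (?w * exp (resid_var p / 2))"
proof -
  interpret real_distribution L by fact
  define v \<beta> where "v = resid_var p" and "\<beta> = eff_gain p"
  have v: "0 \<le> v" "0 \<le> \<beta>" by (simp_all add: v_def \<beta>_def resid_var_nonneg eff_gain_nonneg)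
  define x where "x = t\<^sup>2 * ?w"
  have x: "0 \<le> x" using v by (simp add: x_def v_def \<beta>_def)
  define h where "h = cmod (char L t)"
  have "1 - x / 2 \<le> h" using cmod_char_ge[of 0 t] i2 by (simp add: h_def x_def w)
  have h: "1 - x \<le> h\<^sup>2"
  proof (cases "1 \<le> x")
    case False
    then have "(1 - x / 2)\<^sup>2 \<le> h\<^sup>2" using \<open>1 - x / 2 \<le> h\<close> by (intro power_mono) auto
    moreover have "1 - x \<le> (1 - x / 2)\<^sup>2" by (simp add: power2_diff)
    ultimately show ?thesis by (rule order_trans[rotated])
  qed (use zero_le_power2[of h] in linarith)
  have k: "1 + x \<le> (exp (t\<^sup>2 * v / 2))\<^sup>2 * (1 + t\<^sup>2 * \<beta>)"
  proof -
    have "1 + x \<le> (1 + t\<^sup>2 * v) * (1 + t\<^sup>2 * \<beta>)"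
      using v by (simp add: x_def v_def \<beta>_def algebra_simps)
    also have "\<dots> \<le> exp (t\<^sup>2 * v) * (1 + t\<^sup>2 * \<beta>)"
      using v by (intro mult_right_mono) simp_all
    also have "exp (t\<^sup>2 * v) = (exp (t\<^sup>2 * v / 2))\<^sup>2" by (simp add: exp_double[symmetric])
    finally show ?thesis .
  qed
  have "1 - x\<^sup>2 = (1 - x) * (1 + x)" by (simp add: algebra_simps power2_eq_square)
  also have "\<dots> \<le> h\<^sup>2 * (1 + x)" using x by (intro mult_right_mono[OF h]) simp
  also have "\<dots> \<le> h\<^sup>2 * ((exp (t\<^sup>2 * v / 2))\<^sup>2 * (1 + t\<^sup>2 * \<beta>))" by (rule mult_left_mono[OF k]) simp
  finally show "1 - (cmod (tilted_char p L t))\<^sup>2 * (1 + t\<^sup>2 * eff_gain p) \<le> (t\<^sup>2 * ?w)\<^sup>2"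
    by (simp add: tilted_char_def norm_mult power_mult_distrib h_def v_def \<beta>_def x_def mult.assoc)
  define E where "E = exp (t\<^sup>2 * v / 2)"
  have E: "1 \<le> E" "E \<le> exp (v / 2)" "E - 1 \<le> t\<^sup>2 * v / 2 * E"
    using v t exp_minus_1_le[of "t\<^sup>2 * v / 2"] by (auto simp: E_def mult_left_le_one_le)
  have "tilted_char p L t - 1 = (char L t - 1) * complex_of_real E + complex_of_real (E - 1)"
    by (simp add: tilted_char_def E_def v_def algebra_simps)
  also have "cmod \<dots> \<le> cmod ((char L t - 1) * complex_of_real E) + cmod (complex_of_real (E - 1))" by (rule norm_triangle_ineq)
  also have "\<dots> = cmod (char L t - 1) * E + (E - 1)" using E(1) unfolding norm_mult norm_of_real by simp
  also have "\<dots> \<le> t\<^sup>2 * ?w / 2 * E + t\<^sup>2 * v / 2 * E"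
    using cmod_char_minus_1_le[OF i2 m, of t] E by (intro add_mono mult_right_mono) (simp_all add: w)
  also have "\<dots> \<le> t\<^sup>2 * ?w * E"
  proof -
    have "t\<^sup>2 * v * E \<le> t\<^sup>2 * ?w * E" using E(1) v by (intro mult_right_mono mult_left_mono) (simp_all add: v_def \<beta>_def)
    then show ?thesis by (simp add: field_simps)
  qed
  also have "\<dots> \<le> t\<^sup>2 * ?w * exp (v / 2)" using x by (intro mult_left_mono E(2)) (simp add: x_def)
  finally show "cmod (tilted_char p L t - 1) \<le> t\<^sup>2 * (?w * exp (resid_var p / 2))" by (simp add: v_def mult.assoc)
qed

text \<open>If the bound is attained, the limit in \<open>L2_distance_limit\<close> is \<open>O(t\<^sup>4)\<close>, hence
  \<open>E |exp (i t U) - 1| = O(t\<^sup>2)\<close> in the limit for the difference \<open>U\<close> to be shown negligible. As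
  \<open>|z\<^sup>k - 1| \<le> k |z - 1|\<close>, passing from \<open>t\<close> to \<open>t / k\<close> gains a factor \<open>1 / k\<close>, so the limit is \<open>0\<close>.\<close>

lemma efficient_imp_linear:
  assumes p: "p \<in> T" and S: "estimator MX S" and reg: "regular_limit F u p S L"
    and m: "(\<integral>\<^sup>+x. ennreal (x\<^sup>2) \<partial>L) = ennreal (resid_var p + eff_gain p)"
  shows "oP1 (iid (F p)) (\<lambda>n w. centred p S n w - scoresum p (eff_dir p) n w)"
proof -
  interpret P: prob_space "iid (F p)" by (rule prob_space_iid[OF F_prob[OF p]])
  have L: "real_distribution L" using reg by (simp add: regular_limit_def)
  define v \<beta> ww where "v = resid_var p" and "\<beta> = eff_gain p" and "ww = v + \<beta>"
  have v: "0 \<le> v" "0 \<le> \<beta>" "0 \<le> ww" by (simp_all add: v_def \<beta>_def ww_def resid_var_nonneg eff_gain_nonneg)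
  note sm = real_distribution.second_moment_attained[OF L m _ regular_variance_ge[OF p S reg], folded v_def \<beta>_def, folded ww_def, OF v(3)]
  note tb = tilted_char_bounds[OF L sm(1,3), of p, folded v_def \<beta>_def, folded ww_def, OF sm(2)]
  define A where "A n = centred p S n" for n
  define Y where "Y n = scoresum p (eff_dir p) n" for n
  define D where "D t n w = iexp (t * A n w) - tilted_char p L t * (1 + \<i> * complex_of_real (t * Y n w))" for t n w
  note D = L2_distance_limit[OF p S reg, folded A_def Y_def, folded D_def \<beta>_def]
  have Am: "A n \<in> borel_measurable (iid (F p))" for n unfolding A_def by (rule centred_meas[OF S p p])
  have Ym: "Y n \<in> borel_measurable (iid (F p))" for n unfolding Y_def by (rule scoresum_facts(1)[OF p])
  have Y2: "integrable (iid (F p)) (\<lambda>w. (Y n w)\<^sup>2)" for n unfolding Y_def by (rule scoresum_facts(2)[OF p])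
  have Y1: "integrable (iid (F p)) (\<lambda>w. \<bar>Y n w\<bar>)" for n by (rule integrable_abs[OF P.square_integrable_imp_integrable[OF Ym Y2]])
  define U where "U n w = A n w - Y n w" for n w
  have Um: "U n \<in> borel_measurable (iid (F p))" for n unfolding U_def[abs_def] by (rule borel_measurable_diff[OF Am Ym])
  define J where "J t n = (\<integral>w. norm (iexp (t * U n w) - 1) \<partial>iid (F p))" for t n
  have Jm: "(\<lambda>w. norm (iexp (t * U n w) - 1)) \<in> borel_measurable (iid (F p))" for t n
    using Um[of n] by measurable
  have Ji: "integrable (iid (F p)) (\<lambda>w. norm (iexp (t * U n w) - 1))" for t n
    by (rule P.integrable_const_bound[of _ 2 , OF AE_I2 Jm], unfold real_norm_def abs_norm_cancel, rule norm_iexp_diff_le(3))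
  \<comment> \<open>The three summands belong to the L2 distance, to the deviation of
    \<open>tilted_char\<close> from 1, and to the second-order remainder of exp(i t Y).\<close>
  define C where "C = ww + ww * exp (v / 2) * (1 + sqrt \<beta>) + \<beta> / 2"
  have C: "0 \<le> C" using v by (simp add: C_def)
  have small: "\<forall>\<^sub>F n in sequentially. J t n < (C + 1) * t\<^sup>2" if t: "t \<noteq> 0" "t\<^sup>2 \<le> 1" for t
  proof -
    define pp where "pp = cmod (tilted_char p L t - 1)"
    have pp: "pp \<le> t\<^sup>2 * (ww * exp (v / 2))" "0 \<le> pp" unfolding pp_def using tb(2)[OF t(2)] by simp_all
    have t1: "\<bar>t\<bar> \<le> 1" using t(2) by (simp add: abs_square_le_1)
    define I where "I n = (\<integral>w. (cmod (D t n w))\<^sup>2 \<partial>iid (F p))" for n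
    define l where "l = 1 - (cmod (tilted_char p L t))\<^sup>2 * (1 + t\<^sup>2 * \<beta>)"
    have I: "I \<longlonglongrightarrow> l" unfolding I_def l_def by (rule D(3))
    have "sqrt l \<le> sqrt ((t\<^sup>2 * ww)\<^sup>2)" unfolding l_def by (rule real_sqrt_le_mono[OF tb(1)[OF t(2)]])
    then have l: "sqrt l \<le> t\<^sup>2 * ww" using v by simp
    have pw: "norm (iexp (t * U n w) - 1) \<le> cmod (D t n w) + pp * (1 + \<bar>t\<bar> * \<bar>Y n w\<bar>) + t\<^sup>2 * (Y n w)\<^sup>2 / 2" for n w
    proof -
      define z where "z = 1 + \<i> * complex_of_real (t * Y n w)"
      have "iexp (t * A n w) = iexp (t * U n w) * iexp (t * Y n w)"
        unfolding U_def by (simp add: exp_add[symmetric] algebra_simps)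
      then have "iexp (t * A n w) - iexp (t * Y n w) = (iexp (t * U n w) - 1) * iexp (t * Y n w)" by (simp add: algebra_simps)
      then have "norm (iexp (t * U n w) - 1) = norm (iexp (t * A n w) - iexp (t * Y n w))" by (simp add: norm_mult)
      \<comment> \<open>Both exponentials are compared with 1 + i t Y: the first through the
        approximation D, the second by Taylor expansion.\<close>
      also have "iexp (t * A n w) - iexp (t * Y n w) = D t n w + (tilted_char p L t - 1) * z - (iexp (t * Y n w) - 1 - \<i> * complex_of_real (t * Y n w))"
        by (simp add: D_def z_def algebra_simps)
      also have "norm \<dots> \<le> norm (D t n w) + norm ((tilted_char p L t - 1) * z) + norm (iexp (t * Y n w) - 1 - \<i> * complex_of_real (t * Y n w))"
        by (rule order_trans[OF norm_triangle_ineq4 add_right_mono[OF norm_triangle_ineq]])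
      also have "\<dots> \<le> cmod (D t n w) + pp * (1 + \<bar>t\<bar> * \<bar>Y n w\<bar>) + t\<^sup>2 * (Y n w)\<^sup>2 / 2"
      proof (intro add_mono order_refl)
        have "cmod z \<le> 1 + \<bar>t\<bar> * \<bar>Y n w\<bar>"
          unfolding z_def by (rule order_trans[OF norm_triangle_ineq]) (simp add: norm_mult abs_mult)
        then show "norm ((tilted_char p L t - 1) * z) \<le> pp * (1 + \<bar>t\<bar> * \<bar>Y n w\<bar>)"
          unfolding norm_mult pp_def by (rule mult_left_mono) simp
        show "norm (iexp (t * Y n w) - 1 - \<i> * complex_of_real (t * Y n w)) \<le> t\<^sup>2 * (Y n w)\<^sup>2 / 2"
          using iexp_approx_first(1)[of "t * Y n w"] by (simp only: power_mult_distrib)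
      qed
      finally show ?thesis .
    qed
    have Dm: "(\<lambda>w. cmod (D t n w)) \<in> borel_measurable (iid (F p))" for n by (rule measurable_compose[OF D(1) borel_measurable_norm])
    have Di: "integrable (iid (F p)) (\<lambda>w. cmod (D t n w))" for n by (rule P.square_integrable_imp_integrable[OF Dm D(2)])
    have Jle: "J t n \<le> sqrt (I n) + pp * (1 + \<bar>t\<bar> * sqrt \<beta>) + t\<^sup>2 * \<beta> / 2" if n: "0 < n" for n
    proof -
      have b: "(\<integral>w. (Y n w)\<^sup>2 \<partial>iid (F p)) = \<beta>" unfolding Y_def \<beta>_def eff_gain_def by (rule scoresum_facts(5)[OF p n])
      have 1: "(\<integral>w. \<bar>Y n w\<bar> \<partial>iid (F p)) \<le> sqrt \<beta>"
        using P.integral_abs_le_L2[OF Ym[of n] Y2[of n]] b by (simp add: P.prob_space)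
      have 2: "(\<integral>w. cmod (D t n w) \<partial>iid (F p)) \<le> sqrt (I n)"
        using P.integral_abs_le_L2[OF Dm[of n] D(2)] unfolding I_def by (simp add: P.prob_space)
      have "J t n \<le> (\<integral>w. cmod (D t n w) + pp * (1 + \<bar>t\<bar> * \<bar>Y n w\<bar>) + t\<^sup>2 * (Y n w)\<^sup>2 / 2 \<partial>iid (F p))"
        unfolding J_def by (rule integral_mono[OF Ji _ pw]) (use Di[of n] Y1[of n] Y2[of n] in simp)
      also have "\<dots> = (\<integral>w. cmod (D t n w) \<partial>iid (F p)) + pp * (1 + \<bar>t\<bar> * (\<integral>w. \<bar>Y n w\<bar> \<partial>iid (F p))) + t\<^sup>2 * \<beta> / 2"
        using Di[of n] Y1[of n] Y2[of n] by (simp add: b P.prob_space)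
      also have "\<dots> \<le> sqrt (I n) + pp * (1 + \<bar>t\<bar> * sqrt \<beta>) + t\<^sup>2 * \<beta> / 2"
        using 1 2 pp(2) by (intro add_mono mult_left_mono order_refl) simp_all
      finally show ?thesis .
    qed
    have "(\<lambda>n. sqrt (I n) + pp * (1 + \<bar>t\<bar> * sqrt \<beta>) + t\<^sup>2 * \<beta> / 2) \<longlonglongrightarrow> sqrt l + pp * (1 + \<bar>t\<bar> * sqrt \<beta>) + t\<^sup>2 * \<beta> / 2"
      by (intro tendsto_add tendsto_const tendsto_real_sqrt I)
    moreover have "sqrt l + pp * (1 + \<bar>t\<bar> * sqrt \<beta>) + t\<^sup>2 * \<beta> / 2 < (C + 1) * t\<^sup>2"
    proof -
      have "pp * (1 + \<bar>t\<bar> * sqrt \<beta>) \<le> t\<^sup>2 * (ww * exp (v / 2)) * (1 + sqrt \<beta>)"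
        using pp v t1 by (intro mult_mono add_mono) (simp_all add: mult_left_le_one_le)
      moreover have "(C + 1) * t\<^sup>2 = t\<^sup>2 * ww + t\<^sup>2 * (ww * exp (v / 2)) * (1 + sqrt \<beta>) + t\<^sup>2 * \<beta> / 2 + t\<^sup>2"
        by (simp add: C_def field_simps)
      moreover have "0 < t\<^sup>2" using t by simp
      ultimately show ?thesis using l by linarith
    qed
    ultimately have "\<forall>\<^sub>F n in sequentially. sqrt (I n) + pp * (1 + \<bar>t\<bar> * sqrt \<beta>) + t\<^sup>2 * \<beta> / 2 < (C + 1) * t\<^sup>2"
      by (rule order_tendstoD(2))
    with eventually_gt_at_top[of 0] show ?thesis by eventually_elim (use Jle in \<open>rule le_less_trans\<close>)
  qed
  have "J t \<longlonglongrightarrow> 0" for t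
  proof (cases "t = 0")
    case False
    show ?thesis
    proof (rule LIMSEQ_I)
      fix e :: real assume e: "0 < e"
      \<comment> \<open>Large enough for (t / k)^2 \<le> 1, so that the bound for small arguments
        applies at t / k, and for (C + 1) t^2 / k < e after multiplication by k.\<close>
      obtain k :: nat where k: "\<bar>t\<bar> + (C + 1) * t\<^sup>2 / e + 1 < real k" using reals_Archimedean2 by blast
      have "0 \<le> (C + 1) * t\<^sup>2 / e" using C e by simp
      then have k1: "\<bar>t\<bar> < real k" "(C + 1) * t\<^sup>2 / e < real k" "0 < real k" using k by linarith+
      have "(t / real k)\<^sup>2 \<le> 1" using k1 by (simp add: abs_square_le_1 divide_le_eq)
      from small[OF _ this] have "\<forall>\<^sub>F n in sequentially. J (t / real k) n < (C + 1) * (t / real k)\<^sup>2" using False k1(3) by simp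
      then show "\<exists>N. \<forall>n\<ge>N. norm (J t n - 0) < e" unfolding eventually_sequentially[symmetric]
      proof eventually_elim
        case (elim n)
        have "norm (iexp (t * U n w) - 1) \<le> real k * norm (iexp (t / real k * U n w) - 1)" for w
        proof -
          have "iexp (t * U n w) = iexp (t / real k * U n w) ^ k"
            using k1(3) by (simp add: exp_of_nat_mult[symmetric])
          then show ?thesis using norm_power_diff[of "iexp (t / real k * U n w)" 1 k] by simp
        qed
        then have "J t n \<le> (\<integral>w. real k * norm (iexp (t / real k * U n w) - 1) \<partial>iid (F p))"
          unfolding J_def by (rule integral_mono[OF Ji integrable_mult_right[OF Ji]])
        also have "\<dots> = real k * J (t / real k) n" unfolding J_def by (rule integral_mult_right_zero)
        also have "\<dots> < real k * ((C + 1) * (t / real k)\<^sup>2)" by (rule mult_strict_left_mono[OF elim k1(3)])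
        also have "\<dots> = (C + 1) * t\<^sup>2 / real k" using k1(3) by (simp add: power2_eq_square)
        also have "\<dots> < e" using k1 e by (simp add: divide_less_eq mult.commute)
        finally have "J t n < e" .
        moreover have "0 \<le> J t n" by (simp add: J_def)
        ultimately show ?case by simp
      qed
    qed
  next
    case True
    then have "J t = (\<lambda>_. 0)" by (simp add: J_def fun_eq_iff)
    then show ?thesis by simp
  qed
  then have "oP1 (iid (F p)) U" unfolding oP1_iff_iexp[OF P.prob_space_axioms Um] J_def by blast
  then show ?thesis unfolding U_def[abs_def] A_def Y_def .
qed

lemma linear_imp_regular:
  assumes p: "p \<in> T" and S: "estimator MX S"
    and lin: "oP1 (iid (F p)) (\<lambda>n w. centred p S n w - scoresum p (eff_dir p) n w)"
  shows "regular_limit F u p S (centered_normal (resid_var p + eff_gain p))"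
  unfolding eff_gain_def
proof (rule regular_of_linear[OF p S])
  show "(\<lambda>x. eff_dir p \<bullet> \<rho> p x) \<in> borel_measurable MX" using \<rho>_meas[OF p] by measurable
qed (use lin in \<open>simp_all add: score_L2(2)[OF p] score_mean[OF p] eff_dir_inner[OF p] scoresum_def\<close>)

lemma variance_bound_eq:
  assumes p: "p \<in> T"
  shows "variance_bound MX F u p = ennreal (resid_var p + eff_gain p)"
proof (rule antisym)
  have nn: "0 \<le> resid_var p + eff_gain p" using resid_var_nonneg eff_gain_nonneg by (rule add_nonneg_nonneg)
  show "ennreal (resid_var p + eff_gain p) \<le> variance_bound MX F u p"
    unfolding variance_bound_def using regular_variance_ge[OF p] by (intro Inf_greatest) auto
  \<comment> \<open>The bound is attained by a sum in which p itself appears: regularity is required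
    at the one point p, and the estimators in the infimum may depend on it. The coefficient of the
    score is the efficient direction.\<close>
  define S where "S n x = (\<Sum>j<n. ubar p (x j) + eff_dir p \<bullet> \<rho> p (x j))" for n and x :: "nat \<Rightarrow> 'x"
  have m: "(\<lambda>x. ubar p x + eff_dir p \<bullet> \<rho> p x) \<in> borel_measurable MX"
    using \<rho>_meas[OF p] ubar_MX[OF p] by measurable
  have S: "estimator MX S"
    unfolding estimator_def S_def[abs_def]
    by (intro allI borel_measurable_sum measurable_compose[OF _ m] measurable_component_singleton)
  have "centred p S n w - scoresum p (eff_dir p) n w = 0" for n w
    by (simp add: centred_def S_def obs_def sum.distrib scoresum_def)
  then have "oP1 (iid (F p)) (\<lambda>n w. centred p S n w - scoresum p (eff_dir p) n w)"
    by (simp add: oP1_def)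
  note reg = linear_imp_regular[OF p S this]
  have "variance_bound MX F u p \<le> ext_variance (centered_normal (resid_var p + eff_gain p))"
    unfolding variance_bound_def using S reg by (intro Inf_lower) auto
  also have "\<dots> \<le> ennreal (resid_var p + eff_gain p)" by (rule ext_variance_centered_normal_le[OF nn])
  finally show "variance_bound MX F u p \<le> ennreal (resid_var p + eff_gain p)" .
qed

lemma asymp_efficient_iff_oP1:
  assumes p: "p \<in> T" and S: "estimator MX S"
  shows "asymp_efficient MX F u p S \<longleftrightarrow>
    oP1 (iid (F p)) (\<lambda>n w. centred p S n w - scoresum p (eff_dir p) n w)"
proof -
  have nn: "0 \<le> resid_var p + eff_gain p" using resid_var_nonneg eff_gain_nonneg by (rule add_nonneg_nonneg)
  show ?thesis unfolding asymp_efficient_def variance_bound_eq[OF p]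
    using S efficient_imp_linear[OF p S] linear_imp_regular[OF p S] nn_second_moment_centered_normal[OF nn] by blast
qed

text \<open>After multiplication by sqrt n the constant \<open>mean_util\<close> cancels against the
  one in \<open>phi_star\<close>, and the \<open>ubar\<close> part becomes the centring of
  \<open>centred\<close>; only the efficient score remains.\<close>

lemma asymp_linear_phi_star_iff:
  "asymp_linear (F p) (\<lambda>n x. S n x / real n) (mean_util F u p) (phi_star F u ubar \<rho> dm p) \<longleftrightarrow>
    oP1 (iid (F p)) (\<lambda>n w. centred p S n w - scoresum p (eff_dir p) n w)"
proof -
  let ?W = "\<lambda>n w. (S n (obs n w) / real n - (mean_util F u p + (\<Sum>j<n. phi_star F u ubar \<rho> dm p (fst (w j))) /\<^sub>R real n))
      / real n powr (- 1 / 2)"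
  have eq: "?W n w = centred p S n w - scoresum p (eff_dir p) n w" if n: "0 < n" for n w
  proof -
    define q where "q = sqrt (real n)"
    have q: "0 < q" "real n = q * q" using n by (simp_all add: q_def)
    have "real n powr (- 1 / 2) = inverse (real n powr (1 / 2))" using powr_minus[of "real n" "1 / 2"] by simp
    then have pp: "real n powr (- 1 / 2) = inverse q" using n by (simp add: powr_half_sqrt q_def)
    have s: "(\<Sum>j<n. phi_star F u ubar \<rho> dm p (fst (w j))) =
        (\<Sum>j<n. ubar p (fst (w j))) - q * q * mean_util F u p + (\<Sum>j<n. eff_dir p \<bullet> \<rho> p (fst (w j)))"
      by (simp add: phi_star_eq sum.distrib sum_subtractf q(2))
    show ?thesis unfolding pp s centred_def scoresum_def q_def[symmetric] unfolding q(2) using q(1) by (simp add: field_simps)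
  qed
  have "asymp_linear (F p) (\<lambda>n x. S n x / real n) (mean_util F u p) (phi_star F u ubar \<rho> dm p) \<longleftrightarrow> oP1 (iid (F p)) ?W"
    unfolding asymp_linear_def real_norm_def by (rule small_oP_iff_oP1) simp
  also have "\<dots> \<longleftrightarrow> oP1 (iid (F p)) (\<lambda>n w. centred p S n w - scoresum p (eff_dir p) n w)"
    by (rule iffI; erule oP1_cong; rule eventually_mono[OF eventually_gt_at_top[of 0]]; rule ballI; simp only: eq)
  finally show ?thesis .
qed

lemma asymp_efficient_iff:
  assumes "p \<in> T" "estimator MX S"
  shows "asymp_efficient MX F u p S \<longleftrightarrow>
    asymp_linear (F p) (\<lambda>n x. S n x / real n) (mean_util F u p) (phi_star F u ubar \<rho> dm p)"
  unfolding asymp_efficient_iff_oP1[OF assms] asymp_linear_phi_star_iff ..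

subsection \<open>Tangent space\<close>

lemma ubar_centred:
  assumes p: "p \<in> T"
  shows "(\<lambda>z. ubar p (fst z) - mean_util F u p) \<in> borel_measurable (F p)"
    "integrable (F p) (\<lambda>z. (ubar p (fst z) - mean_util F u p)\<^sup>2)"
    "integrable (F p) (\<lambda>z. ubar p (fst z) - mean_util F u p)"
    "(\<integral>z. ubar p (fst z) - mean_util F u p \<partial>F p) = 0"
proof -
  interpret prob_space "F p" by (rule F_prob[OF p])
  note [measurable] = ubar_F[OF p p]
  have i: "integrable (F p) (\<lambda>z. ubar p (fst z))" by (rule square_integrable_imp_integrable[OF ubar_F[OF p p] ubar_sq[OF p]])
  show "(\<lambda>z. ubar p (fst z) - mean_util F u p) \<in> borel_measurable (F p)" by measurable
  show "integrable (F p) (\<lambda>z. (ubar p (fst z) - mean_util F u p)\<^sup>2)"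
    using i ubar_sq[OF p] by (simp add: power2_diff)
  show "integrable (F p) (\<lambda>z. ubar p (fst z) - mean_util F u p)" using i by simp
  show "(\<integral>z. ubar p (fst z) - mean_util F u p \<partial>F p) = 0"
    using i ubar_mean[OF p] by (simp add: prob_space)
qed

lemma influence_fun_phi_star:
  assumes p: "p \<in> T"
  shows "influence_fun MX (F p) (phi_star F u ubar \<rho> dm p)"
proof -
  note c = ubar_centred[OF p] and s = score_F[OF p]
  have "phi_star F u ubar \<rho> dm p \<in> borel_measurable MX"
    unfolding phi_star_eq[abs_def] using ubar_MX[OF p] \<rho>_meas[OF p] by measurable
  moreover have "integrable (F p) (\<lambda>z. (phi_star F u ubar \<rho> dm p (fst z))\<^sup>2)"
    unfolding phi_star_eq by (rule integral_square_add_le(1)[OF c(1) s(2) c(2) score_L2(2)[OF p]])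
  moreover have "(\<integral>z. phi_star F u ubar \<rho> dm p (fst z) \<partial>F p) = 0"
    unfolding phi_star_eq Bochner_Integration.integral_add[OF c(3) s(3)] c(4) score_mean[OF p] by simp
  ultimately show ?thesis by (simp add: influence_fun_def)
qed

lemma mean_directional_derivative:
  assumes p: "p \<in> T"
  shows "((\<lambda>t. (mean_util F u (p + t *\<^sub>R a) - mean_util F u p) / t) \<longlongrightarrow> a \<bullet> dm p) (at_right 0)"
proof -
  have d: "(mean_util F u has_derivative (\<lambda>h. h \<bullet> dm p)) (at (p + 0 *\<^sub>R a))"
    using mean_deriv[OF p] by (simp add: gderiv_def)
  have "((\<lambda>t. p + t *\<^sub>R a) has_derivative (\<lambda>t. t *\<^sub>R a)) (at 0)" by (auto intro!: derivative_eq_intros)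
  from has_derivative_compose[OF this d]
  have "((\<lambda>t. mean_util F u (p + t *\<^sub>R a)) has_field_derivative (a \<bullet> dm p)) (at 0)"
    by (simp add: has_field_derivative_def mult_commute_abs)
  then have "((\<lambda>t. (mean_util F u (p + t *\<^sub>R a) - mean_util F u p) / t) \<longlongrightarrow> a \<bullet> dm p) (at 0)"
    by (simp add: DERIV_def)
  then show ?thesis by (rule tendsto_mono[OF at_le, rotated]) simp
qed

lemma score_span_integral:
  assumes p: "p \<in> T" and g: "g \<in> borel_measurable MX" and ae: "AE z in F p. g (fst z) = b \<bullet> \<rho> p (fst z)"
  shows "(\<integral>z. g (fst z) * (a \<bullet> \<rho> p (fst z)) \<partial>F p) = a \<bullet> (info p *v b)"
    "(\<integral>z. ubar p (fst z) * g (fst z) \<partial>F p) = b \<bullet> (dm p - gam p)"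
    "integrable (F p) (\<lambda>z. ubar p (fst z) * g (fst z))"
proof -
  note [measurable] = score_F(1,2)[OF p] comp_F[OF p g] ubar_F[OF p p]
  have "(\<integral>z. g (fst z) * (a \<bullet> \<rho> p (fst z)) \<partial>F p) = (\<integral>z. (a \<bullet> \<rho> p (fst z)) * (b \<bullet> \<rho> p (fst z)) \<partial>F p)"
    by (rule integral_cong_AE) (measurable, use ae in eventually_elim, simp)
  then show "(\<integral>z. g (fst z) * (a \<bullet> \<rho> p (fst z)) \<partial>F p) = a \<bullet> (info p *v b)" by (simp add: info_inner[OF p])
  have i: "integrable (F p) (\<lambda>z. ubar p (fst z) * (b \<bullet> \<rho> p (fst z)))"
    by (rule integrable_mult_of_squares[OF ubar_F[OF p p] score_F(2)[OF p] ubar_sq[OF p] score_L2(2)[OF p]])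
  have e: "AE z in F p. ubar p (fst z) * g (fst z) = ubar p (fst z) * (b \<bullet> \<rho> p (fst z))" using ae by eventually_elim simp
  have "(\<integral>z. ubar p (fst z) * g (fst z) \<partial>F p) = (\<integral>z. ubar p (fst z) * (b \<bullet> \<rho> p (fst z)) \<partial>F p)"
    by (rule integral_cong_AE[OF _ _ e]) measurable
  then show "(\<integral>z. ubar p (fst z) * g (fst z) \<partial>F p) = b \<bullet> (dm p - gam p)"
    using inner_gamma_vec[OF p, of b] by (simp add: inner_diff_right)
  have "integrable (F p) (\<lambda>z. ubar p (fst z) * g (fst z)) \<longleftrightarrow> integrable (F p) (\<lambda>z. ubar p (fst z) * (b \<bullet> \<rho> p (fst z)))"
    by (rule integrable_cong_AE[OF _ _ e]) measurable
  with i show "integrable (F p) (\<lambda>z. ubar p (fst z) * g (fst z))" by simp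
qed

lemma score_span_meas: "p \<in> T \<Longrightarrow> (\<lambda>x. b \<bullet> \<rho> p x) \<in> borel_measurable MX"
  using \<rho>_meas[of p] by measurable

text \<open>In the coordinate b the pairing with a . \<rho> is a . (info b), so matching all
  directional derivatives is a linear system with the information matrix.\<close>

lemma efficient_influence_fun_iff:
  assumes p: "p \<in> T" and g: "g \<in> borel_measurable MX" and ae: "AE z in F p. g (fst z) = b \<bullet> \<rho> p (fst z)"
  shows "efficient_influence_fun MX (F p) (\<rho> p) (mean_util F u) p g \<longleftrightarrow> info p *v b = dm p"
proof
  assume e: "efficient_influence_fun MX (F p) (\<rho> p) (mean_util F u) p g"
  have h: "a \<bullet> (info p *v b) = a \<bullet> dm p" for a
  proof (rule tendsto_unique[OF _ _ mean_directional_derivative[OF p]])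
    show "((\<lambda>t. (mean_util F u (p + t *\<^sub>R a) - mean_util F u p) / t) \<longlongrightarrow> a \<bullet> (info p *v b)) (at_right 0)"
      using e unfolding efficient_influence_fun_def score_span_integral(1)[OF p g ae] by blast
  qed simp
  show "info p *v b = dm p" by (rule vector_eq_ldot[THEN iffD1, OF allI[OF h]])
next
  assume i: "info p *v b = dm p"
  show "efficient_influence_fun MX (F p) (\<rho> p) (mean_util F u) p g"
    unfolding efficient_influence_fun_def in_tangent_space_def score_span_integral(1)[OF p g ae] i
    by (intro conjI exI[of _ b] allI g ae mean_directional_derivative[OF p])
qed

text \<open>The normal equations for the coordinate b; their right-hand side E ubar \<rho> is dm -
  \<gamma> by the definition of \<gamma>.\<close>

lemma tangent_projection_iff:
  assumes p: "p \<in> T" and pp: "pp \<in> borel_measurable MX" and ae: "AE z in F p. pp (fst z) = b \<bullet> \<rho> p (fst z)"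
  shows "tangent_projection MX (F p) (\<rho> p) (ubar p) pp \<longleftrightarrow> info p *v b = dm p - gam p"
proof -
  have eq: "(\<integral>z. (ubar p (fst z) - pp (fst z)) * g (fst z) \<partial>F p) = a \<bullet> (dm p - gam p) - a \<bullet> (info p *v b)"
    if g: "g \<in> borel_measurable MX" and ag: "AE z in F p. g (fst z) = a \<bullet> \<rho> p (fst z)" for g a
  proof -
    note [measurable] = score_F(1,2)[OF p] comp_F[OF p g] comp_F[OF p pp] ubar_F[OF p p]
    note s = score_span_integral[OF p g ag]
    have "(\<integral>z. (ubar p (fst z) - pp (fst z)) * g (fst z) \<partial>F p) =
       (\<integral>z. ubar p (fst z) * g (fst z) - (a \<bullet> \<rho> p (fst z)) * (b \<bullet> \<rho> p (fst z)) \<partial>F p)"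
      by (rule integral_cong_AE) (measurable, use ae ag in eventually_elim, simp add: algebra_simps)
    also have "\<dots> = a \<bullet> (dm p - gam p) - a \<bullet> (info p *v b)"
      unfolding Bochner_Integration.integral_diff[OF s(3) score_mult_integrable[OF p]] s(2) info_inner[OF p] ..
    finally show ?thesis .
  qed
  show ?thesis
  proof
    assume t: "tangent_projection MX (F p) (\<rho> p) (ubar p) pp"
    have h: "a \<bullet> (info p *v b) = a \<bullet> (dm p - gam p)" for a
    proof -
      have "in_tangent_space MX (F p) (\<rho> p) (\<lambda>x. a \<bullet> \<rho> p x)"
        using score_span_meas[OF p] by (auto simp: in_tangent_space_def)
      then have "(\<integral>z. (ubar p (fst z) - pp (fst z)) * (a \<bullet> \<rho> p (fst z)) \<partial>F p) = 0"
        using t unfolding tangent_projection_def by blast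
      then show ?thesis using eq[OF score_span_meas[OF p], of a] by simp
    qed
    show "info p *v b = dm p - gam p" by (rule vector_eq_ldot[THEN iffD1, OF allI[OF h]])
  next
    assume i: "info p *v b = dm p - gam p"
    show "tangent_projection MX (F p) (\<rho> p) (ubar p) pp"
      unfolding tangent_projection_def
    proof (intro conjI allI impI)
      show "in_tangent_space MX (F p) (\<rho> p) pp" unfolding in_tangent_space_def using pp ae by blast
      fix g assume "in_tangent_space MX (F p) (\<rho> p) g"
      then obtain a where g: "g \<in> borel_measurable MX" "AE z in F p. g (fst z) = a \<bullet> \<rho> p (fst z)"
        by (auto simp: in_tangent_space_def)
      show "(\<integral>z. (ubar p (fst z) - pp (fst z)) * g (fst z) \<partial>F p) = 0" unfolding eq[OF g] i by simp
    qed
  qed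
qed

text \<open>Invertibility of the information solves both linear systems. Their difference has
  right-hand side \<gamma>, so the coordinates of the efficient influence function and of the
  projection differ by \<open>eff_dir\<close>.\<close>

lemma tangent_decomposition:
  assumes p: "p \<in> T"
  shows "\<exists>\<psi>. efficient_influence_fun MX (F p) (\<rho> p) (mean_util F u) p \<psi>"
    "\<exists>pp. tangent_projection MX (F p) (\<rho> p) (ubar p) pp"
    "efficient_influence_fun MX (F p) (\<rho> p) (mean_util F u) p \<psi> \<Longrightarrow> tangent_projection MX (F p) (\<rho> p) (ubar p) pp \<Longrightarrow>
     AE z in F p. phi_star F u ubar \<rho> dm p (fst z) = \<psi> (fst z) + ubar p (fst z) - mean_util F u p - pp (fst z)"
proof -
  have e: "efficient_influence_fun MX (F p) (\<rho> p) (mean_util F u) p (\<lambda>x. (matrix_inv (info p) *v dm p) \<bullet> \<rho> p x)"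
    by (rule efficient_influence_fun_iff[OF p score_span_meas[OF p] AE_I2[OF refl], THEN iffD2]) (rule info_inverse(1)[OF p])
  show "\<exists>\<psi>. efficient_influence_fun MX (F p) (\<rho> p) (mean_util F u) p \<psi>"
    by (rule exI) (rule e)
  have pp: "tangent_projection MX (F p) (\<rho> p) (ubar p) (\<lambda>x. (matrix_inv (info p) *v (dm p - gam p)) \<bullet> \<rho> p x)"
    by (rule tangent_projection_iff[OF p score_span_meas[OF p] AE_I2[OF refl], THEN iffD2]) (rule info_inverse(1)[OF p])
  show "\<exists>pp. tangent_projection MX (F p) (\<rho> p) (ubar p) pp"
    by (rule exI) (rule pp)
  assume e: "efficient_influence_fun MX (F p) (\<rho> p) (mean_util F u) p \<psi>" and pp: "tangent_projection MX (F p) (\<rho> p) (ubar p) pp"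
  obtain b where b: "\<psi> \<in> borel_measurable MX" "AE z in F p. \<psi> (fst z) = b \<bullet> \<rho> p (fst z)"
    using e by (auto simp: efficient_influence_fun_def in_tangent_space_def)
  obtain c where c: "pp \<in> borel_measurable MX" "AE z in F p. pp (fst z) = c \<bullet> \<rho> p (fst z)"
    using pp by (auto simp: tangent_projection_def in_tangent_space_def)
  have "info p *v (b - c) = gam p"
    using e pp efficient_influence_fun_iff[OF p b] tangent_projection_iff[OF p c] by (simp add: matrix_vector_mult_diff_distrib)
  then have ed: "eff_dir p = b - c" using info_inverse(2)[OF p, of "b - c"] by (simp add: eff_dir_def)
  show "AE z in F p. phi_star F u ubar \<rho> dm p (fst z) = \<psi> (fst z) + ubar p (fst z) - mean_util F u p - pp (fst z)"
    using b(2) c(2) unfolding phi_star_eq ed by eventually_elim (simp add: inner_diff_left)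
qed

subsection \<open>The plug-in estimator\<close>

text \<open>A violating sequence of shifts would have a convergent subsequence of \<open>\<surd>n h\<^sub>n\<close>, which extends
  to a full local sequence.\<close>

lemma uniform_mean_shift:
  assumes p: "p \<in> T" and c: "0 < c" and e: "0 < e"
  shows "\<forall>\<^sub>F n in sequentially. \<forall>h. norm h \<le> c / sqrt (real n) \<longrightarrow>
    \<bar>sqrt (real n) * ((\<integral>z. ubar (p + h) (fst z) \<partial>F p) - mean_util F u p) - (sqrt (real n) *\<^sub>R h) \<bullet> gam p\<bar> \<le> e"
proof (rule ccontr)
  define hh where "hh n h = sqrt (real n) * ((\<integral>z. ubar (p + h) (fst z) \<partial>F p) - mean_util F u p) - (sqrt (real n) *\<^sub>R h) \<bullet> gam p"
    for n :: nat and h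
  define bad where "bad n h \<longleftrightarrow> norm h \<le> c / sqrt (real n) \<and> e < \<bar>hh n h\<bar>" for n h
  assume "\<not> ?thesis"
  then have "\<not> (\<forall>\<^sub>F n in sequentially. \<not> (\<exists>h. bad n h))"
    by (simp add: hh_def bad_def not_less)
  then have "infinite {n. \<not> \<not> (\<exists>h. bad n h)}"
    unfolding eventually_cofinite[symmetric] cofinite_eq_sequentially .
  then have "infinite {n. \<exists>h. bad n h}" by simp
  then obtain r :: "nat \<Rightarrow> nat" where r: "strict_mono r" "\<And>k. \<exists>h. bad (r k) h"
    using infinite_enumerate by blast
  define B where "B n = (SOME h. bad n h)" for n
  have B: "bad (r k) (B (r k))" for k unfolding B_def using r(2) by (rule someI_ex)
  have bnd: "norm (sqrt (real (r k)) *\<^sub>R B (r k)) \<le> c" for k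
  proof (cases "r k = 0")
    case False
    then show ?thesis using B[of k] by (simp add: bad_def pos_le_divide_eq mult.commute)
  qed (use c in simp)
  have "bounded (range (\<lambda>k. sqrt (real (r k)) *\<^sub>R B (r k)))"
    unfolding bounded_iff using bnd by blast
  then obtain a and s :: "nat \<Rightarrow> nat" where s: "strict_mono s" "((\<lambda>k. sqrt (real (r k)) *\<^sub>R B (r k)) \<circ> s) \<longlonglongrightarrow> a"
    using bounded_imp_convergent_subsequence by blast
  define q where "q k = r (s k)" for k
  have q: "strict_mono q" unfolding q_def using strict_mono_o[OF r(1) s(1)] by (simp add: comp_def)
  have qa: "(\<lambda>k. sqrt (real (q k)) *\<^sub>R B (q k)) \<longlonglongrightarrow> a" using s(2) by (simp add: q_def comp_def)
  obtain h0 where h0: "local_seq p h0 a" using local_seq_exists[OF p] by metis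
  \<comment> \<open>The violating shifts are kept along the subsequence and the gaps are filled from
    a sequence with the same limiting direction a. Shifts leading outside T are passed over so that
    a local sequence results.\<close>
  define h1 where "h1 n = (if n \<in> range q \<and> p + B n \<in> T then B n else h0 n)" for n
  have "(\<lambda>n. sqrt (real n) *\<^sub>R h1 n) \<longlonglongrightarrow> a"
  proof (rule tendstoI)
    fix \<epsilon> :: real assume \<epsilon>: "0 < \<epsilon>"
    obtain K where K: "\<And>k. K \<le> k \<Longrightarrow> dist (sqrt (real (q k)) *\<^sub>R B (q k)) a < \<epsilon>"
      using tendstoD[OF qa \<epsilon>] by (auto simp: eventually_sequentially)
    have "\<forall>\<^sub>F n in sequentially. dist (sqrt (real n) *\<^sub>R h0 n) a < \<epsilon>"
      by (rule tendstoD[OF local_seqD(3)[OF h0] \<epsilon>])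
    then show "\<forall>\<^sub>F n in sequentially. dist (sqrt (real n) *\<^sub>R h1 n) a < \<epsilon>"
      using eventually_ge_at_top[of "q K"]
    proof eventually_elim
      case (elim n)
      then show ?case
        using K strict_mono_less_eq[OF q, of K] by (auto simp: h1_def)
    qed
  qed
  moreover have "p + h1 n \<in> T" for n using local_seqD(2)[OF h0, of n] by (simp add: h1_def)
  ultimately have "local_seq p h1 a" using p by (simp add: local_seq_def)
  then obtain h where d: "good_seq p h a" "\<forall>\<^sub>F n in sequentially. h n = h1 n"
    using good_seq_of_local_seq by metis
  have "(\<lambda>n. hh n (h n)) \<longlonglongrightarrow> a \<bullet> gam p - a \<bullet> gam p"
    unfolding hh_def by (intro tendsto_diff mean_shift[OF d(1)] tendsto_inner tendsto_const local_seqD(3)[OF good_seqD[OF d(1)]])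
  then have "(\<lambda>n. \<bar>hh n (h n)\<bar>) \<longlonglongrightarrow> 0" by (simp add: tendsto_rabs_zero)
  then have "\<forall>\<^sub>F n in sequentially. \<bar>hh n (h n)\<bar> < e" using e by (rule order_tendstoD)
  with d(2) have "\<forall>\<^sub>F n in sequentially. \<bar>hh n (h1 n)\<bar> < e" by eventually_elim simp
  then have 1: "\<forall>\<^sub>F k in sequentially. \<bar>hh (q k) (h1 (q k))\<bar> < e"
    by (rule eventually_subseq[OF q])
  \<comment> \<open>The violating shifts tend to 0 because sqrt n times them converges; hence they
    are eventually admissible and do occur in \<open>h1\<close>, where the convergence just proved
    contradicts their choice.\<close>
  have "(\<lambda>k. inverse (sqrt (real (q k))) *\<^sub>R (sqrt (real (q k)) *\<^sub>R B (q k))) \<longlonglongrightarrow> 0 *\<^sub>R a"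
  proof (rule tendsto_scaleR[OF _ qa])
    have "(\<lambda>n. inverse (sqrt (real n))) \<longlonglongrightarrow> 0" using inverse_sqrt_tendsto_0[of 1] by simp
    from LIMSEQ_subseq_LIMSEQ[OF this q] show "(\<lambda>k. inverse (sqrt (real (q k)))) \<longlonglongrightarrow> 0" by (simp add: comp_def)
  qed
  moreover have "\<forall>\<^sub>F k in sequentially. inverse (sqrt (real (q k))) *\<^sub>R (sqrt (real (q k)) *\<^sub>R B (q k)) = B (q k)"
    using eventually_gt_at_top[of 0]
  proof eventually_elim
    case (elim k)
    then have "0 < q k" using strict_mono_imp_increasing[OF q, of k] by simp
    then show ?case by simp
  qed
  ultimately have "(\<lambda>k. B (q k)) \<longlonglongrightarrow> 0" by (simp add: tendsto_cong)
  from tendsto_add[OF tendsto_const[of p] this] have "(\<lambda>k. p + B (q k)) \<longlonglongrightarrow> p" by simp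
  from topological_tendstoD[OF this openT p] have "\<forall>\<^sub>F k in sequentially. p + B (q k) \<in> T" .
  with 1 have "\<forall>\<^sub>F k in sequentially. False"
  proof eventually_elim
    case (elim k)
    then have "h1 (q k) = B (q k)" by (simp add: h1_def)
    with elim(1) B[of "s k"] show ?case by (simp add: bad_def q_def)
  qed
  then show False by simp
qed

text \<open>Chebyshev's inequality: the normalised sum has the same second moment K for every n >
  0.\<close>

lemma influence_sum_tight:
  fixes \<kappa> :: "'x \<Rightarrow> real ^ 'd"
  assumes p: "p \<in> T" and \<kappa>: "influence_fun MX (F p) \<kappa>" and \<delta>: "0 < \<delta>"
  obtains c where "0 < c" "\<And>n. 0 < n \<Longrightarrow> outer_measure_of (iid (F p))
    {w \<in> space (iid (F p)). c < norm ((\<Sum>j<n. \<kappa> (fst (w j))) /\<^sub>R sqrt (real n))} \<le> ennreal \<delta>"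
proof -
  interpret M: prob_space "F p" by (rule F_prob[OF p])
  interpret P: prob_space "iid (F p)" by (rule prob_space_iid[OF F_prob[OF p]])
  have km: "(\<lambda>z. \<kappa> (fst z)) \<in> borel_measurable (F p)" and k2: "integrable (F p) (\<lambda>z. (norm (\<kappa> (fst z)))\<^sup>2)"
    and k0: "(\<integral>z. \<kappa> (fst z) \<partial>F p) = 0"
    using \<kappa> comp_F[OF p, of \<kappa>] by (auto simp: influence_fun_def)
  have k1: "integrable (F p) (\<lambda>z. \<kappa> (fst z))"
    using M.square_integrable_imp_integrable[OF measurable_compose[OF km borel_measurable_norm] k2]
    by (simp add: integrable_norm_cancel[OF _ km])
  have im: "(\<lambda>z. \<kappa> (fst z) $ i) \<in> borel_measurable (F p)" for i unfolding cart_eq_inner_axis using km by measurable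
  have i2: "integrable (F p) (\<lambda>z. (\<kappa> (fst z) $ i)\<^sup>2)" for i
  proof (rule Bochner_Integration.integrable_bound[OF k2])
    show "AE z in F p. norm ((\<kappa> (fst z) $ i)\<^sup>2) \<le> norm ((norm (\<kappa> (fst z)))\<^sup>2)"
      by (rule AE_I2) (simp add: abs_le_square_iff[symmetric] component_le_norm_cart)
  qed (rule borel_measurable_power[OF im])
  have i0: "(\<integral>z. \<kappa> (fst z) $ i \<partial>F p) = 0" for i
    unfolding cart_eq_inner_axis using integral_inner_left[of "axis i 1" "F p" "\<lambda>z. \<kappa> (fst z)"] k1 k0 by simp
  define V where "V n w = norm ((\<Sum>j<n. \<kappa> (fst (w j))) /\<^sub>R sqrt (real n))" for n :: nat and w :: "nat \<Rightarrow> 'x \<times> 't"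
  define K where "K = (\<Sum>i\<in>UNIV. \<integral>z. (\<kappa> (fst z) $ i)\<^sup>2 \<partial>F p)"
  have K: "0 \<le> K" unfolding K_def by (simp add: sum_nonneg)
  have V2: "(V n w)\<^sup>2 = (\<Sum>i\<in>UNIV. ((\<Sum>j<n. \<kappa> (fst (w j)) $ i) * (\<Sum>j<n. \<kappa> (fst (w j)) $ i)) / real n)" for n w
    by (simp add: V_def power_mult_distrib power2_norm_eq_inner inner_vec_def power_inverse divide_inverse sum_distrib_left mult_ac)
  note ps = iid_L2_sum[OF F_prob[OF p] im im i2 i2]
  have Vm: "V n \<in> borel_measurable (iid (F p))" for n
  proof -
    have "(\<lambda>w. (\<Sum>j<n. \<kappa> (fst (w j))) /\<^sub>R sqrt (real n)) \<in> borel_measurable (iid (F p))"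
      by (intro borel_measurable_scaleR borel_measurable_const borel_measurable_sum measurable_compose[OF measurable_iid_component km])
    then show ?thesis unfolding V_def by (rule measurable_compose[OF _ borel_measurable_norm])
  qed
  have Vi: "integrable (iid (F p)) (\<lambda>w. (V n w)\<^sup>2)" for n
    unfolding V2 by (intro Bochner_Integration.integrable_sum integrable_divide_zero ps(1))
  have VK: "(\<integral>w. (V n w)\<^sup>2 \<partial>iid (F p)) = K" if n: "0 < n" for n
    unfolding V2 K_def
    by (subst Bochner_Integration.integral_sum, intro integrable_divide_zero ps(1))
      (use n in \<open>simp add: ps(2)[OF i0] power2_eq_square\<close>)
  \<comment> \<open>K / c^2 \<le> \<delta>, and the added 1 keeps c positive when K = 0.\<close>
  define c where "c = sqrt (K / \<delta> + 1)"
  have c2: "c\<^sup>2 = K / \<delta> + 1" using K \<delta> by (simp add: c_def add_nonneg_nonneg)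
  have c: "0 < c" using K \<delta> by (simp add: c_def add_nonneg_pos)
  show ?thesis
  proof
    fix n :: nat assume n: "0 < n"
    note [measurable] = Vm
    have "measure (iid (F p)) {w \<in> space (iid (F p)). c < V n w} \<le> measure (iid (F p)) {w \<in> space (iid (F p)). c \<le> \<bar>V n w\<bar>}"
      by (rule P.finite_measure_mono) auto
    also have "\<dots> \<le> (\<integral>w. (V n w)\<^sup>2 \<partial>iid (F p)) / c\<^sup>2" by (rule P.second_moment_method[OF Vm Vi c])
    also have "\<dots> \<le> \<delta>"
      unfolding VK[OF n] using K \<delta> c2 c by (simp add: divide_le_eq) (simp add: field_simps)
    finally have "emeasure (iid (F p)) {w \<in> space (iid (F p)). c < V n w} \<le> ennreal \<delta>"
      unfolding P.emeasure_eq_measure by (rule ennreal_leI)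
    then show "outer_measure_of (iid (F p))
      {w \<in> space (iid (F p)). c < norm ((\<Sum>j<n. \<kappa> (fst (w j))) /\<^sub>R sqrt (real n))} \<le> ennreal \<delta>"
      unfolding V_def[symmetric] by (subst outer_measure_of_eq) measurable
  qed (rule c)
qed

text \<open>The random shift h = \<tau>hat - \<tau> depends on the sample, so it is inserted
  pathwise into bounds that are uniform over a ball of radius c'/sqrt n. The stochastic part is
  covered by the supremum hypothesis and the deterministic drift by
  \<open>uniform_mean_shift\<close>; the drift is linear in sqrt n h with coefficient
  \<gamma>.\<close>

lemma plug_in_linear:
  fixes \<tau>hat :: "nat \<Rightarrow> (nat \<Rightarrow> 'x) \<Rightarrow> real ^ 'd"
  assumes p: "p \<in> T" and \<kappa>: "influence_fun MX (F p) \<kappa>" and lin: "asymp_linear (F p) \<tau>hat p \<kappa>"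
    and unif: "\<And>c. 0 < c \<Longrightarrow> small_oP (iid (F p))
             (\<lambda>n w. SUP h\<in>{h. norm h \<le> c / sqrt (real n)}.
                ennreal \<bar>\<Sum>j<n. ubar (p + h) (fst (w j)) - ubar p (fst (w j))
                            - ((\<integral>z. ubar (p + h) (fst z) \<partial>F p) - mean_util F u p)\<bar>)
             (\<lambda>n. real n powr (1 / 2))"
  shows "oP1 (iid (F p)) (\<lambda>n w. centred p (plug_in ubar \<tau>hat) n w - (\<Sum>j<n. gam p \<bullet> \<kappa> (fst (w j))) / sqrt (real n))"
proof (rule oP1_tight_cover)
  fix \<epsilon> \<delta> :: real assume \<epsilon>: "0 < \<epsilon>" and \<delta>: "0 < \<delta>"
  let ?P = "iid (F p)"
  have d3: "0 < \<delta> / 3" using \<delta> by simp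
  obtain c where c: "0 < c" "\<And>n. 0 < n \<Longrightarrow> outer_measure_of ?P
    {w \<in> space ?P. c < norm ((\<Sum>j<n. \<kappa> (fst (w j))) /\<^sub>R sqrt (real n))} \<le> ennreal (\<delta> / 3)"
    by (rule influence_sum_tight[OF p \<kappa> d3]) (rule that)
  \<comment> \<open>The bound 1 keeps sqrt n h within c + 1 on the good event; the other entry
    limits the effect of the remainder of \<tau>hat, after pairing with \<gamma>, to
    \<epsilon>/3.\<close>
  define \<eta> where "\<eta> = min 1 (\<epsilon> / (3 * (norm (gam p) + 1)))"
  have \<eta>: "0 < \<eta>" "\<eta> \<le> 1" using \<epsilon> by (simp_all add: \<eta>_def add_nonneg_pos)
  have \<eta>g: "norm (gam p) * \<eta> \<le> \<epsilon> / 3"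
  proof -
    have "norm (gam p) * \<eta> \<le> norm (gam p) * (\<epsilon> / (3 * (norm (gam p) + 1)))"
      by (rule mult_left_mono) (simp_all add: \<eta>_def)
    also have "\<dots> \<le> (norm (gam p) + 1) * (\<epsilon> / (3 * (norm (gam p) + 1)))"
      using \<epsilon> by (intro mult_right_mono) simp_all
    also have "\<dots> = \<epsilon> / 3" using norm_ge_zero[of "gam p"] by (simp add: field_simps add_nonneg_eq_0_iff)
    finally show ?thesis .
  qed
  define c' where "c' = c + 1"
  have c': "0 < c'" using c by (simp add: c'_def)
  define V where "V n w = (\<Sum>j<n. \<kappa> (fst (w j)))" for n :: nat and w :: "nat \<Rightarrow> 'x \<times> 't"
  define r where "r n w = \<tau>hat n (obs n w) - (p + V n w /\<^sub>R real n)" for n and w :: "nat \<Rightarrow> 'x \<times> 't"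
  define s where "s n w h = (\<Sum>j<n. ubar (p + h) (fst (w j)) - ubar p (fst (w j))
                            - ((\<integral>z. ubar (p + h) (fst z) \<partial>F p) - mean_util F u p))" for n :: nat and w :: "nat \<Rightarrow> 'x \<times> 't" and h
  define Z where "Z n w = (SUP h\<in>{h. norm h \<le> c' / sqrt (real n)}. ennreal \<bar>s n w h\<bar>)" for n w
  \<comment> \<open>Three exceptional events: a large influence sum, a large remainder of \<tau>hat,
    and a large supremum. The mass of the first is only small, so the argument runs through
    \<open>oP1_tight_cover\<close>.\<close>
  define A1 where "A1 n = {w \<in> space ?P. c < norm (V n w /\<^sub>R sqrt (real n))}" for n
  define A2 where "A2 n = {w \<in> space ?P. ennreal (norm (r n w)) > ennreal (\<eta> * real n powr (- 1 / 2))}" for n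
  define A3 where "A3 n = {w \<in> space ?P. Z n w > ennreal (\<epsilon> / 3 * real n powr (1 / 2))}" for n
  have e3: "0 < \<epsilon> / 3" using \<epsilon> by simp
  have dn: "0 < ennreal (\<delta> / 3)" using \<delta> by simp
  have "(\<lambda>n. outer_measure_of ?P (A2 n)) \<longlonglongrightarrow> 0"
    using lin \<eta>(1) unfolding asymp_linear_def small_oP_def A2_def r_def V_def by blast
  then have 2: "\<forall>\<^sub>F n in sequentially. outer_measure_of ?P (A2 n) < ennreal (\<delta> / 3)" using dn by (rule order_tendstoD)
  have "(\<lambda>n. outer_measure_of ?P (A3 n)) \<longlonglongrightarrow> 0"
    using unif[OF c'] e3 unfolding small_oP_def A3_def Z_def s_def by blast
  then have 3: "\<forall>\<^sub>F n in sequentially. outer_measure_of ?P (A3 n) < ennreal (\<delta> / 3)" using dn by (rule order_tendstoD)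
  have sub: "A1 n \<subseteq> space ?P" "A2 n \<subseteq> space ?P" "A3 n \<subseteq> space ?P" for n
    by (auto simp: A1_def A2_def A3_def)
  show "\<exists>A. (\<forall>n. A n \<subseteq> space ?P) \<and> (\<forall>\<^sub>F n in sequentially. outer_measure_of ?P (A n) \<le> ennreal \<delta>) \<and>
      (\<forall>\<^sub>F n in sequentially. \<forall>w\<in>space ?P - A n.
        \<bar>centred p (plug_in ubar \<tau>hat) n w - (\<Sum>j<n. gam p \<bullet> \<kappa> (fst (w j))) / sqrt (real n)\<bar> \<le> \<epsilon>)"
  proof (intro exI conjI allI)
    show "A1 n \<union> A2 n \<union> A3 n \<subseteq> space ?P" for n using sub[of n] by blast
    show "\<forall>\<^sub>F n in sequentially. outer_measure_of ?P (A1 n \<union> A2 n \<union> A3 n) \<le> ennreal \<delta>"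
      using 2 3 eventually_gt_at_top[of 0]
    proof eventually_elim
      case (elim n)
      have "outer_measure_of ?P (A1 n \<union> A2 n \<union> A3 n) \<le> outer_measure_of ?P (A1 n \<union> A2 n) + outer_measure_of ?P (A3 n)"
        by (rule outer_measure_of_Un_le) (use sub[of n] in auto)
      also have "\<dots> \<le> (outer_measure_of ?P (A1 n) + outer_measure_of ?P (A2 n)) + outer_measure_of ?P (A3 n)"
        by (intro add_right_mono outer_measure_of_Un_le sub)
      also have "\<dots> \<le> (ennreal (\<delta> / 3) + ennreal (\<delta> / 3)) + ennreal (\<delta> / 3)"
        using c(2)[OF elim(3)] elim(1,2) by (intro add_mono) (auto simp: A1_def V_def)
      also have "\<dots> = ennreal \<delta>" using \<delta> by (simp add: ennreal_plus[symmetric] del: ennreal_plus)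
      finally show ?case .
    qed
    show "\<forall>\<^sub>F n in sequentially. \<forall>w\<in>space ?P - (A1 n \<union> A2 n \<union> A3 n).
        \<bar>centred p (plug_in ubar \<tau>hat) n w - (\<Sum>j<n. gam p \<bullet> \<kappa> (fst (w j))) / sqrt (real n)\<bar> \<le> \<epsilon>"
      using uniform_mean_shift[OF p c' e3] eventually_gt_at_top[of 0]
    proof eventually_elim
      case (elim n)
      show ?case
      proof
        fix w assume ww: "w \<in> space ?P - (A1 n \<union> A2 n \<union> A3 n)"
        define h where "h = \<tau>hat n (obs n w) - p"
        define q where "q = sqrt (real n)"
        have q: "0 < q" "real n = q * q" using elim(2) by (simp_all add: q_def)
        have pw: "real n powr (1 / 2) = q" "real n powr (- 1 / 2) = 1 / q"
          using elim(2) powr_minus[of "real n" "1 / 2"] by (simp_all add: powr_half_sqrt q_def inverse_eq_divide)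
        have D: "h = V n w /\<^sub>R real n + r n w" by (simp add: h_def r_def)
        have qD: "q *\<^sub>R h = V n w /\<^sub>R q + q *\<^sub>R r n w"
          unfolding D using q(1) by (simp add: q(2) scaleR_right_distrib)
        have 1: "norm (V n w /\<^sub>R q) \<le> c" using ww by (auto simp: A1_def q_def)
        have "ennreal (norm (r n w)) \<le> ennreal (\<eta> * (1 / q))"
          using ww unfolding A2_def pw by auto
        then have "norm (r n w) \<le> \<eta> * (1 / q)" using \<eta> q by (simp add: ennreal_le_iff)
        then have 2: "norm (q *\<^sub>R r n w) \<le> \<eta>" using q by (simp add: pos_le_divide_eq mult.commute)
        have "norm (q *\<^sub>R h) \<le> c'"
          unfolding qD c'_def using norm_triangle_ineq[of "V n w /\<^sub>R q" "q *\<^sub>R r n w"] 1 2 \<eta>(2) by linarith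
        then have nD: "norm h \<le> c' / sqrt (real n)"
          using q(1) unfolding q_def[symmetric] by (simp add: pos_le_divide_eq mult.commute)
        have "ennreal \<bar>s n w h\<bar> \<le> Z n w" unfolding Z_def by (rule SUP_upper) (use nD in simp)
        also have "\<dots> \<le> ennreal (\<epsilon> / 3 * q)" using ww unfolding A3_def pw by auto
        finally have "\<bar>s n w h\<bar> \<le> \<epsilon> / 3 * q" using \<epsilon> q by (simp add: ennreal_le_iff)
        then have 3: "\<bar>s n w h / q\<bar> \<le> \<epsilon> / 3" using q by (simp add: abs_divide pos_divide_le_eq)
        define m where "m = (\<integral>z. ubar (p + h) (fst z) \<partial>F p) - mean_util F u p"
        have 4: "\<bar>q * m - (q *\<^sub>R h) \<bullet> gam p\<bar> \<le> \<epsilon> / 3"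
          using elim(1) nD unfolding q_def m_def by blast
        have "\<bar>(q *\<^sub>R r n w) \<bullet> gam p\<bar> \<le> norm (q *\<^sub>R r n w) * norm (gam p)" by (rule Cauchy_Schwarz_ineq2)
        also have "\<dots> \<le> \<eta> * norm (gam p)" by (rule mult_right_mono[OF 2]) simp
        finally have 5: "\<bar>(q *\<^sub>R r n w) \<bullet> gam p\<bar> \<le> \<epsilon> / 3" using \<eta>g by (simp add: mult.commute)
        \<comment> \<open>The summand m removed inside \<open>s\<close> is added back n times and
          divided by sqrt n, hence the factor q of the drift.\<close>
        have "centred p (plug_in ubar \<tau>hat) n w = s n w h / q + q * m"
        proof -
          have "(\<Sum>j<n. ubar (\<tau>hat n (obs n w)) (obs n w j)) = (\<Sum>j<n. ubar (p + h) (fst (w j)))"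
            by (simp add: h_def obs_def)
          moreover have "s n w h = (\<Sum>j<n. ubar (p + h) (fst (w j))) - (\<Sum>j<n. ubar p (fst (w j))) - q * q * m"
            unfolding s_def m_def[symmetric] by (simp add: sum_subtractf q(2))
          ultimately show ?thesis
            unfolding centred_def plug_in_def q_def[symmetric] using q(1) by (simp add: field_simps)
        qed
        moreover have "(\<Sum>j<n. gam p \<bullet> \<kappa> (fst (w j))) / sqrt (real n) = (V n w /\<^sub>R q) \<bullet> gam p"
          unfolding q_def[symmetric] by (simp add: V_def inner_sum_left inner_commute[of "gam p"] divide_inverse mult.commute)
        moreover have "(q *\<^sub>R h) \<bullet> gam p = (V n w /\<^sub>R q) \<bullet> gam p + (q *\<^sub>R r n w) \<bullet> gam p"
          unfolding qD by (rule inner_add_left)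
        ultimately show "\<bar>centred p (plug_in ubar \<tau>hat) n w - (\<Sum>j<n. gam p \<bullet> \<kappa> (fst (w j))) / sqrt (real n)\<bar> \<le> \<epsilon>"
          using 3 4 5 by linarith
      qed
    qed
  qed
qed

text \<open>The direction 0 alone determines the limit law. Since \<open>asymp_efficient\<close>
  speaks of some limit law, uniqueness identifies it with the normal law found for the plug-in
  estimator.\<close>

lemma regular_limit_unique:
  assumes p: "p \<in> T" and S: "estimator MX S" and L: "regular_limit F u p S L" and L': "regular_limit F u p S L'"
  shows "L = L'"
proof -
  obtain h where d: "good_seq p h 0" "\<forall>\<^sub>F n in sequentially. h n = 0 /\<^sub>R sqrt (real n)"
    using root_n_seq[OF p] by metis
  have rd: "real_distribution L" "real_distribution L'" using L L' by (auto simp: regular_limit_def)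
  have "char L t = char L' t" for t
  proof (rule LIMSEQ_unique)
    show "(\<lambda>n. \<integral>w. iexp (t * stat (p + h n) S n w) \<partial>iid (F (p + h n))) \<longlonglongrightarrow> char L t"
      using L weak_conv_stat_iff[OF d S rd(1)] unfolding regular_limit_def by blast
    show "(\<lambda>n. \<integral>w. iexp (t * stat (p + h n) S n w) \<partial>iid (F (p + h n))) \<longlonglongrightarrow> char L' t"
      using L' weak_conv_stat_iff[OF d S rd(2)] unfolding regular_limit_def by blast
  qed
  then show ?thesis by (intro Levy_uniqueness[OF rd]) auto
qed

text \<open>The influence function is g = \<gamma> . \<kappa>. Its projection to the tangent space
  is the efficient score, so by Pythagoras the variance beyond the bound is the squared L2 distance
  between the two; it vanishes exactly when they agree almost surely.\<close>

lemma plug_in_limit: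
  fixes \<tau>hat :: "nat \<Rightarrow> (nat \<Rightarrow> 'x) \<Rightarrow> real ^ 'd"
  assumes p: "p \<in> T" and S: "estimator MX (plug_in ubar \<tau>hat)"
    and \<kappa>: "influence_fun MX (F p) \<kappa>"
    and id: "(\<chi> i j. \<integral>z. \<kappa> (fst z) $ i * \<rho> p (fst z) $ j \<partial>F p) = mat 1"
    and lin: "oP1 (iid (F p)) (\<lambda>n w. centred p (plug_in ubar \<tau>hat) n w - (\<Sum>j<n. gam p \<bullet> \<kappa> (fst (w j))) / sqrt (real n))"
  shows "weak_conv_m
             (\<lambda>n. distr (iid (F p)) borel
                (\<lambda>w. (plug_in ubar \<tau>hat n (obs n w) - util_sum u (F p) n w) / sqrt (real n)))
             (centered_normal
               (prob_space.variance (F p) (\<lambda>z. phi_star F u ubar \<rho> dm p (fst z) - util u (F p) z)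
                + prob_space.variance (F p)
                    (\<lambda>z. (\<kappa> (fst z) - kappa_star F \<rho> p (fst z)) \<bullet> gam p)))" (is ?weak)
    and "asymp_efficient MX F u p (plug_in ubar \<tau>hat) \<longleftrightarrow>
            (AE z in F p. gam p \<bullet> \<kappa> (fst z) = gam p \<bullet> (matrix_inv (info p) *v \<rho> p (fst z)))" (is ?eff)
proof -
  interpret M: prob_space "F p" by (rule F_prob[OF p])
  define v \<beta> b where "v = resid_var p" and "\<beta> = eff_gain p" and "b = eff_dir p"
  define g where "g x = gam p \<bullet> \<kappa> x" for x
  define G where "G = (\<integral>z. (g (fst z))\<^sup>2 \<partial>F p)"
  have kX: "\<kappa> \<in> borel_measurable MX" and k2: "integrable (F p) (\<lambda>z. (norm (\<kappa> (fst z)))\<^sup>2)"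
    and k0: "(\<integral>z. \<kappa> (fst z) \<partial>F p) = 0"
    using \<kappa> by (auto simp: influence_fun_def)
  have km: "(\<lambda>z. \<kappa> (fst z)) \<in> borel_measurable (F p)" by (rule comp_F[OF p kX])
  have k1: "integrable (F p) (\<lambda>z. \<kappa> (fst z))"
    using M.square_integrable_imp_integrable[OF measurable_compose[OF km borel_measurable_norm] k2]
    by (simp add: integrable_norm_cancel[OF _ km])
  have ik2: "integrable (F p) (\<lambda>z. (a \<bullet> \<kappa> (fst z))\<^sup>2)" for a
  proof (rule Bochner_Integration.integrable_bound)
    show "integrable (F p) (\<lambda>z. (norm a)\<^sup>2 * (norm (\<kappa> (fst z)))\<^sup>2)" using k2 by simp
    show "(\<lambda>z. (a \<bullet> \<kappa> (fst z))\<^sup>2) \<in> borel_measurable (F p)" using km by measurable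
    show "AE z in F p. norm ((a \<bullet> \<kappa> (fst z))\<^sup>2) \<le> norm ((norm a)\<^sup>2 * (norm (\<kappa> (fst z)))\<^sup>2)"
    proof (rule AE_I2)
      fix z
      have "\<bar>a \<bullet> \<kappa> (fst z)\<bar>\<^sup>2 \<le> (norm a * norm (\<kappa> (fst z)))\<^sup>2"
        by (rule power_mono[OF Cauchy_Schwarz_ineq2]) simp
      then show "norm ((a \<bullet> \<kappa> (fst z))\<^sup>2) \<le> norm ((norm a)\<^sup>2 * (norm (\<kappa> (fst z)))\<^sup>2)"
        by (simp add: power_mult_distrib)
    qed
  qed
  have ikm: "(\<lambda>z. a \<bullet> \<kappa> (fst z)) \<in> borel_measurable (F p)" for a using km by measurable
  have gX: "g \<in> borel_measurable MX" unfolding g_def[abs_def] using kX by measurable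
  have gm: "(\<lambda>z. g (fst z)) \<in> borel_measurable (F p)" by (rule comp_F[OF p gX])
  have g2: "integrable (F p) (\<lambda>z. (g (fst z))\<^sup>2)" unfolding g_def by (rule ik2)
  have g0: "(\<integral>z. g (fst z) \<partial>F p) = 0" unfolding g_def using k1 k0 by simp
  have kr: "(\<integral>z. \<kappa> (fst z) $ i * \<rho> p (fst z) $ j \<partial>F p) = (if i = j then 1 else 0)" for i j
    using arg_cong[OF id, of "\<lambda>A. A $ i $ j"] by (simp add: mat_def)
  \<comment> \<open>The identity for E \<kappa> \<rho>^t makes the covariance of g with a . \<rho>
    equal to a . \<gamma>, which removes the phase in \<open>linear_char\<close> and gives
    regularity.\<close>
  have ga: "(\<integral>z. g (fst z) * (a \<bullet> \<rho> p (fst z)) \<partial>F p) = a \<bullet> gam p" for a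
  proof -
    have "integrable (F p) (\<lambda>z. \<kappa> (fst z) $ i * \<rho> p (fst z) $ j)" for i j
      using integrable_mult_of_squares[OF ikm score_F(2)[OF p] ik2 score_L2(2)[OF p], of "axis i 1" "axis j 1"]
      by (simp add: inner_axis')
    from integral_inner_inner[OF this, of "gam p" a]
    have "(\<integral>z. g (fst z) * (a \<bullet> \<rho> p (fst z)) \<partial>F p) = (\<Sum>i\<in>UNIV. \<Sum>j\<in>UNIV. (gam p $ i * a $ j) * (if i = j then 1 else 0))"
      unfolding g_def kr .
    also have "\<dots> = a \<bullet> gam p" by (simp add: inner_vec_def if_distrib sum.delta mult.commute cong: if_cong)
    finally show ?thesis .
  qed
  have reg: "regular_limit F u p (plug_in ubar \<tau>hat) (centered_normal (v + G))"
    unfolding v_def G_def by (rule regular_of_linear[OF p S gX g2 g0 _ ga]) (use lin in \<open>simp add: g_def\<close>)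
  have bm: "(\<lambda>z. b \<bullet> \<rho> p (fst z)) \<in> borel_measurable (F p)" by (rule score_F(2)[OF p])
  have b2: "integrable (F p) (\<lambda>z. (b \<bullet> \<rho> p (fst z))\<^sup>2)" by (rule score_L2(2)[OF p])
  have gb: "(\<integral>z. (g (fst z) - b \<bullet> \<rho> p (fst z))\<^sup>2 \<partial>F p) = G - \<beta>" "integrable (F p) (\<lambda>z. (g (fst z) - b \<bullet> \<rho> p (fst z))\<^sup>2)"
  proof -
    note i = integrable_mult_of_squares[OF gm bm g2 b2]
    show "integrable (F p) (\<lambda>z. (g (fst z) - b \<bullet> \<rho> p (fst z))\<^sup>2)"
      unfolding power2_diff mult.assoc using i g2 b2 by simp
    have "(\<integral>z. (g (fst z) - b \<bullet> \<rho> p (fst z))\<^sup>2 \<partial>F p) =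
        G + \<beta> - 2 * (\<integral>z. g (fst z) * (b \<bullet> \<rho> p (fst z)) \<partial>F p)"
      unfolding power2_diff mult.assoc using i g2 b2 by (simp add: G_def \<beta>_def eff_gain_def b_def)
    \<comment> \<open>The covariance of g with the efficient score equals the second moment of that
      score, so the difference is orthogonal to it.\<close>
    also have "(\<integral>z. g (fst z) * (b \<bullet> \<rho> p (fst z)) \<partial>F p) = \<beta>"
      unfolding ga b_def \<beta>_def eff_gain[OF p] ..
    finally show "(\<integral>z. (g (fst z) - b \<bullet> \<rho> p (fst z))\<^sup>2 \<partial>F p) = G - \<beta>" by simp
  qed
  have ks: "gam p \<bullet> (matrix_inv (info p) *v \<rho> p x) = b \<bullet> \<rho> p x" for x
    unfolding b_def eff_dir_def by (simp only: info_inverse(3)[OF p])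
  have V2: "prob_space.variance (F p) (\<lambda>z. (\<kappa> (fst z) - kappa_star F \<rho> p (fst z)) \<bullet> gam p) = G - \<beta>"
  proof -
    have e: "(\<kappa> x - kappa_star F \<rho> p x) \<bullet> gam p = g x - b \<bullet> \<rho> p x" for x
      unfolding kappa_star_def g_def ks[symmetric] inner_commute[of _ "gam p"] inner_diff_right ..
    have "integrable (F p) (\<lambda>z. g (fst z))" by (rule M.square_integrable_imp_integrable[OF gm g2])
    then have "(\<integral>z. g (fst z) - b \<bullet> \<rho> p (fst z) \<partial>F p) = 0"
      using g0 score_F(3)[OF p] score_mean[OF p] by simp
    then show ?thesis unfolding e using gb(1) by simp
  qed
  have V1: "prob_space.variance (F p) (\<lambda>z. phi_star F u ubar \<rho> dm p (fst z) - util u (F p) z) = v + \<beta>"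
  proof -
    \<comment> \<open>\<open>ubar\<close> cancels and leaves the efficient score minus the residual,
      which are orthogonal; the constant - \<open>mean_util\<close> is the mean of the difference
      and drops out of the variance.\<close>
    have e: "phi_star F u ubar \<rho> dm p (fst z) - util u (F p) z = b \<bullet> \<rho> p (fst z) - resid p z - mean_util F u p" for z
      by (simp add: phi_star_eq resid_def b_def)
    have i3: "integrable (F p) (resid p)" by (rule resid_F(3)[OF p])
    have "integrable (F p) (\<lambda>z. 1\<^sup>2 :: real)" by simp
    from resid_orth(1)[OF p _ this] have r0: "(\<integral>z. resid p z \<partial>F p) = 0" by simp
    have m: "(\<integral>z. b \<bullet> \<rho> p (fst z) - resid p z - mean_util F u p \<partial>F p) = - mean_util F u p"
      using score_F(3)[OF p] score_mean[OF p] i3 r0 by (simp add: M.prob_space)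
    note o = resid_orth[OF p score_span_meas[OF p] b2]
    have "(\<integral>z. (b \<bullet> \<rho> p (fst z) - resid p z)\<^sup>2 \<partial>F p) = \<beta> + v"
      unfolding power2_diff mult.assoc using o b2 resid_F(2)[OF p] by (simp add: \<beta>_def v_def eff_gain_def resid_var_def b_def)
    then show ?thesis unfolding e m by simp
  qed
  have nn: "0 \<le> v + G" "0 \<le> v + \<beta>" by (simp_all add: v_def G_def \<beta>_def resid_var_nonneg eff_gain_nonneg)
  have "\<forall>a. weak_conv_m (\<lambda>n. let M = F (p + a /\<^sub>R sqrt (real n))
             in distr (iid M) borel (\<lambda>w. (plug_in ubar \<tau>hat n (obs n w) - util_sum u M n w) / sqrt (real n))) (centered_normal (v + G))"
    using reg unfolding regular_limit_def by blast
  from spec[OF this, of 0] show ?weak unfolding V1 V2 by (simp add: Let_def)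
  have "asymp_efficient MX F u p (plug_in ubar \<tau>hat) \<longleftrightarrow> G = \<beta>"
  proof
    assume "asymp_efficient MX F u p (plug_in ubar \<tau>hat)"
    then obtain L where L: "regular_limit F u p (plug_in ubar \<tau>hat) L" "(\<integral>\<^sup>+x. ennreal (x\<^sup>2) \<partial>L) = ennreal (v + \<beta>)"
      by (auto simp: asymp_efficient_def variance_bound_eq[OF p] v_def \<beta>_def)
    have "ennreal (v + G) = ennreal (v + \<beta>)"
      using L(2) unfolding regular_limit_unique[OF p S L(1) reg] nn_second_moment_centered_normal[OF nn(1)] .
    then show "G = \<beta>" using nn by simp
  next
    assume "G = \<beta>"
    then show "asymp_efficient MX F u p (plug_in ubar \<tau>hat)"
      using S reg nn_second_moment_centered_normal[OF nn(1)]
      by (auto simp: asymp_efficient_def variance_bound_eq[OF p] v_def \<beta>_def)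
  qed
  also have "\<dots> \<longleftrightarrow> (AE z in F p. (g (fst z) - b \<bullet> \<rho> p (fst z))\<^sup>2 = 0)"
    using integral_nonneg_eq_0_iff_AE[OF gb(2)] gb(1) by simp
  finally show ?eff unfolding ks by (simp add: g_def)
qed

end

theorem theorem6p2:
  fixes MX :: "'x measure" and MTh :: "'t measure" and \<nu> :: "'x measure"
    and T :: "(real ^ 'd) set"
    and F :: "real ^ 'd \<Rightarrow> ('x \<times> 't) measure"
    and f :: "real ^ 'd \<Rightarrow> 'x \<Rightarrow> real"
    and \<rho> :: "real ^ 'd \<Rightarrow> 'x \<Rightarrow> real ^ 'd"
    and u :: "'x \<Rightarrow> 't \<Rightarrow> ('x \<times> 't) measure \<Rightarrow> real"
    and ubar :: "real ^ 'd \<Rightarrow> 'x \<Rightarrow> real"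
    and dm :: "real ^ 'd \<Rightarrow> real ^ 'd"
  assumes "open T"
    and "\<And>\<tau>. \<tau> \<in> T \<Longrightarrow> prob_space (F \<tau>)"
    and "\<And>\<tau>. \<tau> \<in> T \<Longrightarrow> sets (F \<tau>) = sets (MX \<Otimes>\<^sub>M MTh)"
    and "sets \<nu> = sets MX"
    and "\<And>\<tau>. \<tau> \<in> T \<Longrightarrow> f \<tau> \<in> borel_measurable MX"
    and "\<And>\<tau> x. \<tau> \<in> T \<Longrightarrow> x \<in> space MX \<Longrightarrow> 0 \<le> f \<tau> x"
    and "\<And>\<tau>. \<tau> \<in> T \<Longrightarrow> distr (F \<tau>) MX fst = density \<nu> (\<lambda>x. ennreal (f \<tau> x))"
    and "\<And>\<tau>. \<tau> \<in> T \<Longrightarrow> \<rho> \<tau> \<in> borel_measurable MX"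
    and "\<And>\<tau>. \<tau> \<in> T \<Longrightarrow> util u (F \<tau>) \<in> borel_measurable (MX \<Otimes>\<^sub>M MTh)"
    and "\<And>\<tau>. \<tau> \<in> T \<Longrightarrow> cond_exp_given_X MX (F \<tau>) (util u (F \<tau>)) (ubar \<tau>)"
    and "\<And>\<tau>. \<tau> \<in> T \<Longrightarrow> quadratic_mean_diff \<nu> f (\<rho> \<tau>) \<tau>"
    and "\<And>\<tau>. \<tau> \<in> T \<Longrightarrow> rank (fisher_info F \<rho> \<tau>) = CARD('d)"
    and "weakly_continuous_on T (\<lambda>\<tau>. distr (F \<tau>) borel (util u (F \<tau>)))"
    and "\<And>\<tau>. \<tau> \<in> T \<Longrightarrow> integrable (F \<tau>) (\<lambda>z. (util u (F \<tau>) z)\<^sup>2)"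
    and "continuous_on T (\<lambda>\<tau>. \<integral>z. (util u (F \<tau>) z)\<^sup>2 \<partial>F \<tau>)"
    and "\<And>\<tau>. \<tau> \<in> T \<Longrightarrow>
          ((\<lambda>\<Delta>. \<integral>\<^sup>+z. ennreal ((ubar (\<tau> + \<Delta>) (fst z) - ubar \<tau> (fst z))\<^sup>2) \<partial>F \<tau>) \<longlongrightarrow> 0) (at 0)"
    and "\<And>\<tau>. \<tau> \<in> T \<Longrightarrow>
          \<exists>\<epsilon>>0. \<exists>B::real. \<forall>\<tau>'\<in>T \<inter> ball \<tau> \<epsilon>. (\<integral>\<^sup>+z. ennreal ((ubar \<tau>' (fst z))\<^sup>2) \<partial>F \<tau>') \<le> ennreal B"
    and "\<And>\<tau>. \<tau> \<in> T \<Longrightarrow> GDERIV (mean_util F u) \<tau> :> dm \<tau>"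
  shows
    "(\<forall>\<tau>\<in>T.
        influence_fun MX (F \<tau>) (phi_star F u ubar \<rho> dm \<tau>) \<and>
        (\<forall>S. estimator MX S \<longrightarrow>
          (asymp_efficient MX F u \<tau> S \<longleftrightarrow>
           asymp_linear (F \<tau>) (\<lambda>n x. S n x / real n) (mean_util F u \<tau>) (phi_star F u ubar \<rho> dm \<tau>))) \<and>
        (\<exists>\<psi>. efficient_influence_fun MX (F \<tau>) (\<rho> \<tau>) (mean_util F u) \<tau> \<psi>) \<and>
        (\<exists>ustar. tangent_projection MX (F \<tau>) (\<rho> \<tau>) (ubar \<tau>) ustar) \<and>
        (\<forall>\<psi> ustar.
          efficient_influence_fun MX (F \<tau>) (\<rho> \<tau>) (mean_util F u) \<tau> \<psi> \<and>
          tangent_projection MX (F \<tau>) (\<rho> \<tau>) (ubar \<tau>) ustar \<longrightarrow>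
          (AE z in F \<tau>. phi_star F u ubar \<rho> dm \<tau> (fst z) =
             \<psi> (fst z) + ubar \<tau> (fst z) - mean_util F u \<tau> - ustar (fst z))))
     \<and>
     (\<forall>(\<tau>hat :: nat \<Rightarrow> (nat \<Rightarrow> 'x) \<Rightarrow> real ^ 'd) (\<kappa> :: real ^ 'd \<Rightarrow> 'x \<Rightarrow> real ^ 'd).
        estimator MX \<tau>hat \<and>
        estimator MX (plug_in ubar \<tau>hat) \<and>
        (\<forall>\<tau>\<in>T. influence_fun MX (F \<tau>) (\<kappa> \<tau>) \<and>
               asymp_linear (F \<tau>) \<tau>hat \<tau> (\<kappa> \<tau>) \<and>
               (\<chi> i j. \<integral>z. \<kappa> \<tau> (fst z) $ i * \<rho> \<tau> (fst z) $ j \<partial>F \<tau>) = mat 1) \<and>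
        (\<forall>\<tau>\<in>T. \<forall>c>0.
           small_oP (iid (F \<tau>))
             (\<lambda>n \<omega>. SUP \<Delta>\<in>{\<Delta>. norm \<Delta> \<le> c / sqrt (real n)}.
                ennreal \<bar>\<Sum>j<n. ubar (\<tau> + \<Delta>) (fst (\<omega> j)) - ubar \<tau> (fst (\<omega> j))
                            - ((\<integral>z. ubar (\<tau> + \<Delta>) (fst z) \<partial>F \<tau>) - mean_util F u \<tau>)\<bar>)
             (\<lambda>n. real n powr (1 / 2)))
        \<longrightarrow>
        (\<forall>\<tau>\<in>T.
           weak_conv_m
             (\<lambda>n. distr (iid (F \<tau>)) borel
                (\<lambda>\<omega>. (plug_in ubar \<tau>hat n (obs n \<omega>) - util_sum u (F \<tau>) n \<omega>) / sqrt (real n)))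
             (centered_normal
               (prob_space.variance (F \<tau>) (\<lambda>z. phi_star F u ubar \<rho> dm \<tau> (fst z) - util u (F \<tau>) z)
                + prob_space.variance (F \<tau>)
                    (\<lambda>z. (\<kappa> \<tau> (fst z) - kappa_star F \<rho> \<tau> (fst z)) \<bullet> gamma_vec F ubar \<rho> dm \<tau>)))
           \<and>
           (asymp_efficient MX F u \<tau> (plug_in ubar \<tau>hat) \<longleftrightarrow>
            (AE z in F \<tau>. gamma_vec F ubar \<rho> dm \<tau> \<bullet> \<kappa> \<tau> (fst z) =
               gamma_vec F ubar \<rho> dm \<tau> \<bullet> (matrix_inv (fisher_info F \<rho> \<tau>) *v \<rho> \<tau> (fst z))))))"
proof -
  note A = assms
  have fin: "(\<integral>\<^sup>+z. ennreal ((ubar \<tau> (fst z))\<^sup>2) \<partial>F \<tau>) < \<infinity>" if \<tau>: "\<tau> \<in> T" for \<tau>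
  proof -
    obtain \<epsilon> B where "0 < \<epsilon>" and b: "\<forall>\<tau>'\<in>T \<inter> ball \<tau> \<epsilon>. (\<integral>\<^sup>+z. ennreal ((ubar \<tau>' (fst z))\<^sup>2) \<partial>F \<tau>') \<le> ennreal B"
      using A(17)[OF \<tau>] by blast
    then have "(\<integral>\<^sup>+z. ennreal ((ubar \<tau> (fst z))\<^sup>2) \<partial>F \<tau>) \<le> ennreal B" using \<tau> by simp
    then show ?thesis by (rule le_less_trans) simp
  qed
  interpret utility_model MX MTh \<nu> T F f \<rho> u ubar dm
    by (intro utility_model.intro dqm_model.intro utility_model_axioms.intro; fact A fin)
  show ?thesis
  proof (intro conjI ballI allI impI)
    fix \<tau> assume \<tau>: "\<tau> \<in> T"
    show "influence_fun MX (F \<tau>) (phi_star F u ubar \<rho> dm \<tau>)" by (rule influence_fun_phi_star[OF \<tau>])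
    show "asymp_efficient MX F u \<tau> S \<longleftrightarrow>
        asymp_linear (F \<tau>) (\<lambda>n x. S n x / real n) (mean_util F u \<tau>) (phi_star F u ubar \<rho> dm \<tau>)"
      if "estimator MX S" for S by (rule asymp_efficient_iff[OF \<tau> that])
    show "\<exists>\<psi>. efficient_influence_fun MX (F \<tau>) (\<rho> \<tau>) (mean_util F u) \<tau> \<psi>"
      and "\<exists>ustar. tangent_projection MX (F \<tau>) (\<rho> \<tau>) (ubar \<tau>) ustar"
      by (rule tangent_decomposition[OF \<tau>])+
    show "AE z in F \<tau>. phi_star F u ubar \<rho> dm \<tau> (fst z) = \<psi> (fst z) + ubar \<tau> (fst z) - mean_util F u \<tau> - ustar (fst z)"
      if "efficient_influence_fun MX (F \<tau>) (\<rho> \<tau>) (mean_util F u) \<tau> \<psi> \<and>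
          tangent_projection MX (F \<tau>) (\<rho> \<tau>) (ubar \<tau>) ustar" for \<psi> ustar
      by (rule tangent_decomposition(3)[OF \<tau> conjunct1[OF that] conjunct2[OF that]])
  next
    fix \<tau>hat :: "nat \<Rightarrow> (nat \<Rightarrow> 'x) \<Rightarrow> real ^ 'd" and \<kappa> :: "real ^ 'd \<Rightarrow> 'x \<Rightarrow> real ^ 'd" and \<tau>
    assume H: "estimator MX \<tau>hat \<and> estimator MX (plug_in ubar \<tau>hat) \<and>
        (\<forall>\<tau>\<in>T. influence_fun MX (F \<tau>) (\<kappa> \<tau>) \<and>
               asymp_linear (F \<tau>) \<tau>hat \<tau> (\<kappa> \<tau>) \<and>
               (\<chi> i j. \<integral>z. \<kappa> \<tau> (fst z) $ i * \<rho> \<tau> (fst z) $ j \<partial>F \<tau>) = mat 1) \<and>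
        (\<forall>\<tau>\<in>T. \<forall>c>0.
           small_oP (iid (F \<tau>))
             (\<lambda>n \<omega>. SUP \<Delta>\<in>{\<Delta>. norm \<Delta> \<le> c / sqrt (real n)}.
                ennreal \<bar>\<Sum>j<n. ubar (\<tau> + \<Delta>) (fst (\<omega> j)) - ubar \<tau> (fst (\<omega> j))
                            - ((\<integral>z. ubar (\<tau> + \<Delta>) (fst z) \<partial>F \<tau>) - mean_util F u \<tau>)\<bar>)
             (\<lambda>n. real n powr (1 / 2)))"
      and \<tau>: "\<tau> \<in> T"
    have S: "estimator MX (plug_in ubar \<tau>hat)" and \<kappa>: "influence_fun MX (F \<tau>) (\<kappa> \<tau>)"
      and al: "asymp_linear (F \<tau>) \<tau>hat \<tau> (\<kappa> \<tau>)"
      and id: "(\<chi> i j. \<integral>z. \<kappa> \<tau> (fst z) $ i * \<rho> \<tau> (fst z) $ j \<partial>F \<tau>) = mat 1"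
      using H \<tau> by blast+
    note lin = plug_in_linear[OF \<tau> \<kappa> al H[THEN conjunct2, THEN conjunct2, THEN conjunct2, THEN bspec, OF \<tau>, rule_format]]
    note lim = plug_in_limit[OF \<tau> S \<kappa> id lin]
    show "weak_conv_m
             (\<lambda>n. distr (iid (F \<tau>)) borel
                (\<lambda>\<omega>. (plug_in ubar \<tau>hat n (obs n \<omega>) - util_sum u (F \<tau>) n \<omega>) / sqrt (real n)))
             (centered_normal
               (prob_space.variance (F \<tau>) (\<lambda>z. phi_star F u ubar \<rho> dm \<tau> (fst z) - util u (F \<tau>) z)
                + prob_space.variance (F \<tau>)
                    (\<lambda>z. (\<kappa> \<tau> (fst z) - kappa_star F \<rho> \<tau> (fst z)) \<bullet> gamma_vec F ubar \<rho> dm \<tau>)))"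
      by (rule lim(1))
    show "asymp_efficient MX F u \<tau> (plug_in ubar \<tau>hat) \<longleftrightarrow>
            (AE z in F \<tau>. gamma_vec F ubar \<rho> dm \<tau> \<bullet> \<kappa> \<tau> (fst z) =
               gamma_vec F ubar \<rho> dm \<tau> \<bullet> (matrix_inv (fisher_info F \<rho> \<tau>) *v \<rho> \<tau> (fst z)))"
      by (rule lim(2))
  qed
qed

end
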